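(* Let $(X,\omega)$ be a compact Hermitian manifold, let $K\subset X$ be a compact subset and let $a\in K$. Then the following are equivalent: (i) $V_K$ is continuous at $a$. (ii) $K$ is locally $L$-regular at $a$. (iii) $K$ is weakly locally $L$-regular at $a$. Consequently, the continuity of $V_K$, the local $L$-regularity of $K$, and the weak local $L$-regularity of $K$ are equivalent to each other.
   Context: $(X,\omega)$ is a compact Hermitian manifold of complex dimension $n$, with no additional assumption on the Hermitian metric $\omega$. Write $d=\partial+\bar\partial$, $d^c=i(\bar\partial-\partial)$. A function $v:X\to\mathbb{R}\cup\{-\infty\}$ is quasi-plurisubharmonic (quasi-psh) if $v\not\equiv-\infty$ and $v$ is locally the sum of a smooth function and a plurisubharmonic function. Set $PSH(X,\omega)=\{v : v \text{ quasi-psh on } X,\ \omega+dd^c v\ge 0\}$. For $E\subset X$, the extremal function is $V_E(x)=\sup\{v(x): v\in PSH(X,\omega),\ v|_E\le 0\}$, $x\in X$ (possibly $+\infty$). On $\mathbb{C}^n$: the Lelong class $\mathcal{L}$ is the set of $u\in PSH(\mathbb{C}^n)$ such that for some constant $c_u$, $u(z)\le\max\{0,\log\|z\|\}+c_u$ for all $z\in\mathbb{C}^n$. For $E\subset\mathbb{C}^n$, $L_E(z)=\sup\{u(z):u\in\mathcal{L},\ u|_E\le 0\}$, $z\in\mathbb{C}^n$. Let $\mathbb{B}(b,r)$ be the open Euclidean ball of center $b$ and radius $r\in(0,\infty]$ and $\bar{\mathbb{B}}(b,r)$ its closure. A set $E\subset\mathbb{C}^n$ is locally $L$-regular at $b\in\bar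 E$ if $L_{E\cap\bar{\mathbb{B}}(b,r)}$ is continuous at $b$ for each $r\in(0,\infty]$. A holomorphic coordinate ball in a complex manifold $Y$ of dimension $n$ centered at $a$ of radius $R\in(0,\infty]$ is a pair $(\Omega,\tau)$ with $\Omega\subset Y$ open, $\tau:\Omega\to\mathbb{B}(\mathbf{0},R)\subset\mathbb{C}^n$ biholomorphic (onto), $\tau(a)=\mathbf{0}$. For $E\subset Y$ and $a\in\bar E$: $E$ is locally $L$-regular at $a$ if for every $R\in(0,\infty]$ and every holomorphic coordinate ball $(\Omega,\tau)$ in $Y$ centered at $a$ of radius $R$, the set $\tau(E\cap\Omega)$ is locally $L$-regular at $\mathbf{0}$; $E$ is weakly locally $L$-regular at $a$ if for some $R\in(0,\infty]$ and some holomorphic coordinate ball $(\Omega,\tau)$ in $Y$ centered at $a$ of radius $R$, the set $\tau(E\cap\Omega)$ is locally $L$-regular at $\mathbf{0}$. $E$ is locally $L$-regular (resp. weakly locally $L$-regular) if it is so at every point of $\bar E$. Continuity of $V_K$ without mention of a point means continuity on $X$. *)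

theory Defs
  imports "HOL-Analysis.Analysis"
begin

section \<open>Holomorphic, smooth and plurisubharmonic functions on open subsets of \<open>\<complex>\<^sup>n\<close>\<close>

definition holomorphic_map_on :: "(complex^'n) set \<Rightarrow> (complex^'n \<Rightarrow> complex^'m) \<Rightarrow> bool" where
  "holomorphic_map_on W f \<longleftrightarrow>
     (\<forall>z\<in>W. \<exists>f'. (f has_derivative f') (at z) \<and> (\<forall>c w. f' (c *s w) = c *s f' w))"

primrec Ck_on :: "nat \<Rightarrow> 'v::real_normed_vector set \<Rightarrow> ('v \<Rightarrow> real) \<Rightarrow> bool" where
  "Ck_on 0 W f \<longleftrightarrow> continuous_on W f"
| "Ck_on (Suc k) W f \<longleftrightarrow>
     (\<exists>f'. (\<forall>x\<in>W. (f has_derivative f' x) (at x)) \<and> (\<forall>v. Ck_on k W (\<lambda>x. f' x v)))"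

definition smooth_on :: "'v::real_normed_vector set \<Rightarrow> ('v \<Rightarrow> real) \<Rightarrow> bool" where
  "smooth_on W f \<longleftrightarrow> (\<forall>k. Ck_on k W f)"

definition usc_on :: "'a::topological_space set \<Rightarrow> ('a \<Rightarrow> ereal) \<Rightarrow> bool" where
  "usc_on W u \<longleftrightarrow> (\<forall>x\<in>W. \<forall>c. u x < c \<longrightarrow> (\<forall>\<^sub>F y in at x within W. u y < c))"

text \<open>The mean over the circle \<open>{z + e\<^bsup>it\<^esup> w}\<close> of an extended-valued function. It is only used for
  functions that are bounded above on the circle, so the first integral is finite and the
  difference is a well-defined element of \<open>[-\<infinity>, \<infinity>)\<close>.\<close>

definition circle_mean :: "(complex^'n \<Rightarrow> ereal) \<Rightarrow> complex^'n \<Rightarrow> complex^'n \<Rightarrow> ereal" where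
  "circle_mean u z w =
     (enn2ereal (\<integral>\<^sup>+t\<in>{0..2*pi}. e2ennreal (u (z + cis t *s w)) \<partial>lborel)
      - enn2ereal (\<integral>\<^sup>+t\<in>{0..2*pi}. e2ennreal (- u (z + cis t *s w)) \<partial>lborel)) / ereal (2*pi)"

text \<open>The constant \<open>-\<infinity>\<close> is not counted as plurisubharmonic on any connected component. Admitting it
  would not change either of the extremal functions defined below.\<close>

definition psh_on :: "(complex^'n) set \<Rightarrow> (complex^'n \<Rightarrow> ereal) \<Rightarrow> bool" where
  "psh_on W u \<longleftrightarrow>
     (\<forall>z\<in>W. u z < \<infinity>) \<and>
     usc_on W u \<and>
     (\<forall>z w. (\<forall>\<zeta>. cmod \<zeta> \<le> 1 \<longrightarrow> z + \<zeta> *s w \<in> W) \<longrightarrow> u z \<le> circle_mean u z w) \<and>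
     (\<forall>C\<in>components W. \<exists>z\<in>C. u z \<noteq> -\<infinity>)"


section \<open>The Lelong class and local \<open>L\<close>-regularity in \<open>\<complex>\<^sup>n\<close>\<close>

definition lelong_class :: "(complex^'n \<Rightarrow> ereal) set" where
  "lelong_class = {u. psh_on UNIV u \<and> (\<exists>c::real. \<forall>z. u z \<le> ereal (max 0 (ln (norm z)) + c))}"

definition L_extremal :: "(complex^'n) set \<Rightarrow> complex^'n \<Rightarrow> ereal" where
  "L_extremal E z = (SUP u\<in>{u\<in>lelong_class. \<forall>x\<in>E. u x \<le> 0}. u z)"

definition ext_ball :: "'v::metric_space \<Rightarrow> ereal \<Rightarrow> 'v set" where
  "ext_ball b r = {z. ereal (dist b z) < r}"

definition locally_L_regular_Cn_at :: "(complex^'n) set \<Rightarrow> complex^'n \<Rightarrow> bool" where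
  "locally_L_regular_Cn_at E b \<longleftrightarrow>
     (\<forall>r::ereal. 0 < r \<longrightarrow> isCont (L_extremal (E \<inter> closure (ext_ball b r))) b)"


section \<open>Complex manifolds\<close>

text \<open>A manifold is a Hausdorff second countable type with a holomorphic atlas, which need not be
  maximal; \<open>n\<close> is the cardinality of the index type \<open>'n\<close>.\<close>

type_synonym ('a, 'n) chart = "'a set \<times> ('a \<Rightarrow> complex^'n)"

definition topological_chart :: "('a::topological_space, 'n::finite) chart \<Rightarrow> bool" where
  "topological_chart = (\<lambda>(U, \<phi>).
     open U \<and> open (\<phi> ` U) \<and> homeomorphism U (\<phi> ` U) \<phi> (inv_into U \<phi>))"

definition holomorphically_compatible ::
    "('a::topological_space, 'n::finite) chart \<Rightarrow> ('a, 'n) chart \<Rightarrow> bool" where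
  "holomorphically_compatible = (\<lambda>(U, \<phi>) (V, \<psi>).
     holomorphic_map_on (\<phi> ` (U \<inter> V)) (\<psi> \<circ> inv_into U \<phi>) \<and>
     holomorphic_map_on (\<psi> ` (U \<inter> V)) (\<phi> \<circ> inv_into V \<psi>))"

definition complex_atlas ::
    "('a::{t2_space,second_countable_topology}, 'n::finite) chart set \<Rightarrow> bool" where
  "complex_atlas \<A> \<longleftrightarrow>
     (\<Union>(U, \<phi>)\<in>\<A>. U) = UNIV \<and>
     (\<forall>c\<in>\<A>. topological_chart c) \<and>
     (\<forall>c\<in>\<A>. \<forall>c'\<in>\<A>. holomorphically_compatible c c')"

text \<open>Biholomorphy of \<open>\<tau>\<close> is expressed by compatibility with the charts of the atlas.\<close>

definition coordinate_ball ::
    "('a::{t2_space,second_countable_topology}, 'n::finite) chart set \<Rightarrow> 'a \<Rightarrow> ereal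
      \<Rightarrow> 'a set \<Rightarrow> ('a \<Rightarrow> complex^'n) \<Rightarrow> bool" where
  "coordinate_ball \<A> a R \<Omega> \<tau> \<longleftrightarrow>
     0 < R \<and> a \<in> \<Omega> \<and> \<tau> a = 0 \<and> \<tau> ` \<Omega> = ext_ball 0 R \<and>
     topological_chart (\<Omega>, \<tau>) \<and> (\<forall>c\<in>\<A>. holomorphically_compatible c (\<Omega>, \<tau>))"

definition locally_L_regular_at ::
    "('a::{t2_space,second_countable_topology}, 'n::finite) chart set \<Rightarrow> 'a set \<Rightarrow> 'a \<Rightarrow> bool" where
  "locally_L_regular_at \<A> E a \<longleftrightarrow>
     (\<forall>R \<Omega> \<tau>. coordinate_ball \<A> a R \<Omega> \<tau> \<longrightarrow> locally_L_regular_Cn_at (\<tau> ` (E \<inter> \<Omega>)) 0)"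

definition weakly_locally_L_regular_at ::
    "('a::{t2_space,second_countable_topology}, 'n::finite) chart set \<Rightarrow> 'a set \<Rightarrow> 'a \<Rightarrow> bool" where
  "weakly_locally_L_regular_at \<A> E a \<longleftrightarrow>
     (\<exists>R \<Omega> \<tau>. coordinate_ball \<A> a R \<Omega> \<tau> \<and> locally_L_regular_Cn_at (\<tau> ` (E \<inter> \<Omega>)) 0)"

definition locally_L_regular ::
    "('a::{t2_space,second_countable_topology}, 'n::finite) chart set \<Rightarrow> 'a set \<Rightarrow> bool" where
  "locally_L_regular \<A> E \<longleftrightarrow> (\<forall>a\<in>closure E. locally_L_regular_at \<A> E a)"

definition weakly_locally_L_regular ::
    "('a::{t2_space,second_countable_topology}, 'n::finite) chart set \<Rightarrow> 'a set \<Rightarrow> bool" where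
  "weakly_locally_L_regular \<A> E \<longleftrightarrow> (\<forall>a\<in>closure E. weakly_locally_L_regular_at \<A> E a)"


section \<open>Hermitian metrics\<close>

text \<open>A real 2-form is given in each chart \<open>(U, \<phi>)\<close> of the atlas by its values
  \<open>\<omega> (U, \<phi>) z u w\<close> at \<open>z \<in> \<phi> ` U\<close> on pairs of coordinate tangent vectors, subject to the usual
  transformation law. A Hermitian metric is identified with its fundamental form, that is, a smooth
  real form of type \<open>(1,1)\<close> (invariant under multiplication by \<open>\<i>\<close>) with \<open>\<omega>(w, \<i>w) > 0\<close> for
  \<open>w \<noteq> 0\<close>.\<close>

type_synonym ('a, 'n) two_form =
  "('a, 'n) chart \<Rightarrow> complex^'n \<Rightarrow> complex^'n \<Rightarrow> complex^'n \<Rightarrow> real"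

definition hermitian_metric ::
    "('a::{t2_space,second_countable_topology}, 'n::finite) chart set \<Rightarrow> ('a, 'n) two_form \<Rightarrow> bool" where
  "hermitian_metric \<A> \<omega> \<longleftrightarrow>
     (\<forall>(U, \<phi>)\<in>\<A>.
        (\<forall>z\<in>\<phi> ` U. bilinear (\<omega> (U, \<phi>) z) \<and>
           (\<forall>u w. \<omega> (U, \<phi>) z w u = - \<omega> (U, \<phi>) z u w) \<and>
           (\<forall>u w. \<omega> (U, \<phi>) z (\<i> *s u) (\<i> *s w) = \<omega> (U, \<phi>) z u w) \<and>
           (\<forall>w. w \<noteq> 0 \<longrightarrow> 0 < \<omega> (U, \<phi>) z w (\<i> *s w))) \<and>
        (\<forall>u w. smooth_on (\<phi> ` U) (\<lambda>z. \<omega> (U, \<phi>) z u w))) \<and>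
     (\<forall>(U, \<phi>)\<in>\<A>. \<forall>(V, \<psi>)\<in>\<A>. \<forall>x\<in>U \<inter> V. \<forall>u w.
        \<omega> (U, \<phi>) (\<phi> x) u w =
        \<omega> (V, \<psi>) (\<psi> x) (frechet_derivative (\<psi> \<circ> inv_into U \<phi>) (at (\<phi> x)) u)
                       (frechet_derivative (\<psi> \<circ> inv_into U \<phi>) (at (\<phi> x)) w))"


section \<open>The operator \<open>dd\<^sup>c\<close> on smooth functions\<close>

definition del :: "(complex^'n \<Rightarrow> real) \<Rightarrow> complex^'n \<Rightarrow> complex^'n \<Rightarrow> complex" where
  "del f z w = (complex_of_real (frechet_derivative f (at z) w)
                - \<i> * complex_of_real (frechet_derivative f (at z) (\<i> *s w))) / 2"

definition delbar :: "(complex^'n \<Rightarrow> real) \<Rightarrow> complex^'n \<Rightarrow> complex^'n \<Rightarrow> complex" where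
  "delbar f z w = (complex_of_real (frechet_derivative f (at z) w)
                   + \<i> * complex_of_real (frechet_derivative f (at z) (\<i> *s w))) / 2"

text \<open>The complex number below is real, because \<open>f\<close> is.\<close>

definition dc :: "(complex^'n \<Rightarrow> real) \<Rightarrow> complex^'n \<Rightarrow> complex^'n \<Rightarrow> real" where
  "dc f z w = Re (\<i> * (delbar f z w - del f z w))"

text \<open>The exterior derivative of a 1-form, evaluated on constant vector fields \<open>u\<close> and \<open>w\<close>.\<close>

definition ext_d :: "(complex^'n \<Rightarrow> complex^'n \<Rightarrow> real) \<Rightarrow> complex^'n \<Rightarrow> complex^'n \<Rightarrow> complex^'n \<Rightarrow> real"
  where
  "ext_d \<alpha> z u w =
     frechet_derivative (\<lambda>y. \<alpha> y w) (at z) u - frechet_derivative (\<lambda>y. \<alpha> y u) (at z) w"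

definition ddc :: "(complex^'n \<Rightarrow> real) \<Rightarrow> complex^'n \<Rightarrow> complex^'n \<Rightarrow> complex^'n \<Rightarrow> real" where
  "ddc f = ext_d (dc f)"


section \<open>\<open>\<omega>\<close>-plurisubharmonic functions and their extremal function\<close>

definition quasi_psh ::
    "('a::{t2_space,second_countable_topology}, 'n::finite) chart set \<Rightarrow> ('a \<Rightarrow> ereal) \<Rightarrow> bool" where
  "quasi_psh \<A> v \<longleftrightarrow>
     (\<exists>x. v x \<noteq> -\<infinity>) \<and>
     (\<forall>x. \<exists>(U, \<phi>)\<in>\<A>. x \<in> U \<and>
        (\<exists>W f u. open W \<and> \<phi> x \<in> W \<and> W \<subseteq> \<phi> ` U \<and> smooth_on W f \<and> psh_on W u \<and>
                 (\<forall>z\<in>W. v (inv_into U \<phi> z) = ereal (f z) + u z)))"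

definition nonneg_test_function :: "'v::real_normed_vector set \<Rightarrow> ('v \<Rightarrow> real) \<Rightarrow> bool" where
  "nonneg_test_function W \<eta> \<longleftrightarrow>
     smooth_on UNIV \<eta> \<and> (\<forall>z. 0 \<le> \<eta> z) \<and>
     compact (closure {z. \<eta> z \<noteq> 0}) \<and> closure {z. \<eta> z \<noteq> 0} \<subseteq> W"

text \<open>Positivity of the current \<open>T = \<omega> + dd\<^sup>c v\<close> of bidegree \<open>(1,1)\<close>: in every chart and for every
  \<open>w \<in> \<complex>\<^sup>n\<close> the distribution \<open>T(w, \<i>w)\<close> is nonnegative, where the derivatives in \<open>dd\<^sup>c v\<close> are
  transferred to the test function. (The pairings with \<open>\<eta>\<close> are, up to positive constants, the
  pairings of \<open>T\<close> with \<open>\<eta> \<i>\<alpha>\<^sub>1 \<and> \<alpha>\<^sub>1\<^sup>* \<and> \<dots> \<and> \<i>\<alpha>\<^bsub>n-1\<^esub> \<and> \<alpha>\<^bsub>n-1\<^esub>\<^sup>*\<close>, where \<open>\<alpha>\<^sub>j\<close> are linearly independent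
  constant \<open>(1,0)\<close>-forms annihilating \<open>w\<close> and \<open>\<alpha>\<^sub>j\<^sup>*\<close> are their conjugates.) A quasi-psh function
  is locally integrable, so \<open>v = -\<infinity>\<close> occurs only on a null set and \<^const>\<open>real_of_ereal\<close> is
  harmless.\<close>

definition omega_psh ::
    "('a::{t2_space,second_countable_topology}, 'n::finite) chart set \<Rightarrow> ('a, 'n) two_form
      \<Rightarrow> ('a \<Rightarrow> ereal) set" where
  "omega_psh \<A> \<omega> = {v. quasi_psh \<A> v \<and>
     (\<forall>(U, \<phi>)\<in>\<A>. \<forall>w \<eta>. nonneg_test_function (\<phi> ` U) \<eta> \<longrightarrow>
        0 \<le> (LINT z:\<phi> ` U|lborel. \<omega> (U, \<phi>) z w (\<i> *s w) * \<eta> z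
                 + real_of_ereal (v (inv_into U \<phi> z)) * ddc \<eta> z w (\<i> *s w)))}"

definition V_extremal ::
    "('a::{t2_space,second_countable_topology}, 'n::finite) chart set \<Rightarrow> ('a, 'n) two_form
      \<Rightarrow> 'a set \<Rightarrow> 'a \<Rightarrow> ereal" where
  "V_extremal \<A> \<omega> E x = (SUP v\<in>{v\<in>omega_psh \<A> \<omega>. \<forall>y\<in>E. v y \<le> 0}. v x)"

end

theory Submission
  imports Defs "HOL-Complex_Analysis.Cauchy_Integral_Formula"
begin

text \<open>
  Write \<open>\<omega> + dd\<^sup>cv \<ge> 0\<close> as a sub-mean value inequality at each point along each complex direction. In this
  form the condition passes to coordinates, where \<open>\<omega>\<close> lies between two multiples of the Euclidean form,
  and it can be glued by maxima.

  If \<open>\<tau>(K \<inter> \<Omega>)\<close> is locally \<open>L\<close>-regular at \<open>0\<close>, take \<open>v \<ge> 0\<close> in \<open>PSH(X, \<omega>)\<close> with \<open>v \<le> 0\<close> on \<open>K\<close>. In a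
  coordinate ball, \<open>v + C(|z|\<^sup>2 - r\<^sup>2)\<close> is plurisubharmonic and nonpositive on \<open>K \<inter> B(0, r)\<close>, so after gluing
  with a multiple of \<open>log |z|\<close> it is dominated by a multiple of the function \<open>L\<close> of \<open>K \<inter> B(0, r)\<close>. The
  multiple is uniform in \<open>v\<close> by a Harnack type estimate on the connected component of the point. As \<open>r\<close> is
  arbitrary, \<open>V\<^sub>K\<close> is small near the point. Conversely, if \<open>V\<^sub>K\<close> is continuous at \<open>a\<close> and \<open>u \<in> \<L>\<close> is
  nonpositive on \<open>K\<close> near \<open>a\<close>, a small multiple of \<open>u\<close> minus \<open>\<epsilon>|z|\<^sup>2\<close> extends to a competitor for \<open>V\<^sub>K\<close>.

  Continuity of \<open>V\<^sub>K\<close> at the points of \<open>K\<close> propagates to \<open>X\<close>: the upper regularization of \<open>V\<^sub>K\<close> is still a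
  competitor, and comparison with translates in charts gives lower semicontinuity. On components that miss
  \<open>K\<close>, \<open>V\<^sub>K\<close> is identically \<open>\<infinity>\<close>.
\<close>

text \<open>The form \<open>\<omega>\<close> need not be closed, so it has no local potential: a
  function with \<omega> + dd^c v \<ge> 0 becomes plurisubharmonic only after adding C|z|^2 in a
  small ball, and every step has to absorb this error. Competitors are replaced by their positive
  parts, which are real-valued and, by compactness, bounded; circle means are then ordinary
  integrals. Distributions occur only where this class is matched with \<open>omega_psh\<close>. The
  link is the expansion of circle means: the mean of radius r exceeds the centre value by r^2/4
  times dd^c(w, iw), up to o(r^2). This is the origin of the factor r^2/4, and since dd^c|z|^2 (w,
  iw) = 4|w|^2, also of the constants C0/4 and c0/4. In both directions of the equivalence the size
  M of a competitor has no bound at the outset. Each time an estimate M \<le> const + M/2 is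
  produced, and M absorbs its own half; the estimate is carried to the maximum point by the Harnack
  argument in one direction and by logarithmic growth in the other.\<close>

section \<open>Upper semicontinuous real functions\<close>

text \<open>Relatively open sublevel sets serve spheres and open sets alike; on open sets
  \<open>usc_openD\<close> and \<open>usc_openI\<close> give the filter form.\<close>

definition usc :: "'a::topological_space set \<Rightarrow> ('a \<Rightarrow> real) \<Rightarrow> bool" where
  "usc S f \<longleftrightarrow> (\<forall>c. openin (top_of_set S) {x\<in>S. f x < c})"

lemma usc_subset: "usc S f \<Longrightarrow> T \<subseteq> S \<Longrightarrow> usc T f"
  unfolding usc_def
proof (intro allI)
  fix c assume a: "\<forall>c. openin (top_of_set S) {x\<in>S. f x < c}" "T \<subseteq> S"
  obtain A where "open A" "{x\<in>S. f x < c} = S \<inter> A" using a(1) unfolding openin_open by blast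
  then have "openin (top_of_set T) (T \<inter> {x\<in>S. f x < c})"
    using a(2) unfolding openin_open by blast
  moreover have "T \<inter> {x\<in>S. f x < c} = {x\<in>T. f x < c}" using a by auto
  ultimately show "openin (top_of_set T) {x\<in>T. f x < c}" by simp
qed

lemma usc_cong: "usc S f \<Longrightarrow> (\<And>x. x \<in> S \<Longrightarrow> f x = g x) \<Longrightarrow> usc S g"
proof -
  assume a: "usc S f" "\<And>x. x \<in> S \<Longrightarrow> f x = g x"
  have "{x\<in>S. g x < c} = {x\<in>S. f x < c}" for c using a(2) by auto
  then show ?thesis using a(1) by (simp add: usc_def)
qed

lemma usc_compose:
  assumes "usc S f" "continuous_on T g" "g ` T \<subseteq> S"
  shows "usc T (\<lambda>x. f (g x))"
  unfolding usc_def
proof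
  fix c
  have "g \<in> T \<rightarrow> S" using assms(3) by auto
  moreover have "openin (top_of_set S) {x\<in>S. f x < c}" using assms(1) by (simp add: usc_def)
  ultimately have "openin (top_of_set T) (T \<inter> g -` {x\<in>S. f x < c})"
    by (rule continuous_openin_preimage[OF assms(2)])
  moreover have "T \<inter> g -` {x\<in>S. f x < c} = {x\<in>T. f (g x) < c}" using assms by auto
  ultimately show "openin (top_of_set T) {x\<in>T. f (g x) < c}" by simp
qed

lemma usc_max: "usc S f \<Longrightarrow> usc S g \<Longrightarrow> usc S (\<lambda>x. max (f x) (g x))"
proof -
  assume a: "usc S f" "usc S g"
  have "{x\<in>S. max (f x) (g x) < c} = {x\<in>S. f x < c} \<inter> {x\<in>S. g x < c}" for c by auto
  then show ?thesis using a by (simp add: usc_def openin_Int)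
qed

lemma usc_openD:
  assumes "usc S f" "open S" "x \<in> S" "f x < c"
  shows "\<forall>\<^sub>F y in nhds x. y \<in> S \<and> f y < c"
proof -
  have "openin (top_of_set S) {x\<in>S. f x < c}" using assms by (auto simp: usc_def)
  then have "open {x\<in>S. f x < c}" using assms(2) openin_open_eq by blast
  then show ?thesis unfolding eventually_nhds using assms(3,4)
    by (intro exI[of _ "{x\<in>S. f x < c}"]) auto
qed

lemma usc_openI:
  assumes "open S" "\<And>x c. x \<in> S \<Longrightarrow> f x < c \<Longrightarrow> \<forall>\<^sub>F y in nhds x. f y < c"
  shows "usc S f"
  unfolding usc_def
proof
  fix c
  have "open {x\<in>S. f x < c}"
    unfolding open_subopen[of "{x\<in>S. f x < c}"]
  proof
    fix x assume x: "x \<in> {x\<in>S. f x < c}"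
    then obtain A where "open A" "x \<in> A" "\<forall>y\<in>A. f y < c"
      using assms(2)[of x c] by (auto simp: eventually_nhds)
    then show "\<exists>T. open T \<and> x \<in> T \<and> T \<subseteq> {x\<in>S. f x < c}"
      using x assms(1) by (intro exI[of _ "A \<inter> S"]) auto
  qed
  then show "openin (top_of_set S) {x\<in>S. f x < c}"
    by (subst openin_open_eq[OF assms(1)]) auto
qed

lemma continuous_imp_usc: "continuous_on S f \<Longrightarrow> usc S f"
proof -
  assume a: "continuous_on S f"
  have "openin (top_of_set S) (S \<inter> f -` {..<c})" for c using a by (intro continuous_openin_preimage_gen) auto
  moreover have "S \<inter> f -` {..<c} = {x\<in>S. f x < c}" for c by auto
  ultimately show ?thesis by (simp add: usc_def)
qed

lemma usc_add_continuous:
  assumes "usc S f" "continuous_on S g" "open S"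
  shows "usc S (\<lambda>x. f x + g x)"
proof (rule usc_openI[OF assms(3)])
  fix x c assume x: "x \<in> S" "f x + g x < c"
  define d where "d = (c - (f x + g x)) / 2"
  have d: "d > 0" using x by (simp add: d_def)
  have "\<forall>\<^sub>F y in nhds x. f y < f x + d" using usc_openD[OF assms(1,3) x(1), of "f x + d"] d
    by (simp add: eventually_conj_iff)
  moreover have "\<forall>\<^sub>F y in nhds x. y \<in> S \<and> g y < g x + d"
    using usc_openD[OF continuous_imp_usc[OF assms(2)] assms(3) x(1), of "g x + d"] d by simp
  ultimately show "\<forall>\<^sub>F y in nhds x. f y + g y < c"
    by eventually_elim (simp add: d_def field_simps)
qed

lemma usc_cmult:
  assumes "usc S f" "0 < (c::real)"
  shows "usc S (\<lambda>x. c * f x)"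
proof -
  have "{x\<in>S. c * f x < d} = {x\<in>S. f x < d / c}" for d using assms(2) by (auto simp: field_simps)
  then show ?thesis using assms by (simp add: usc_def)
qed

text \<open>Without a maximum the sets {f < f y} would cover S; in a finite subcover the index y
  with the largest f y lies in none of the chosen sets.\<close>

lemma usc_attains_max:
  assumes "usc S f" "compact S" "S \<noteq> {}"
  shows "\<exists>x\<in>S. \<forall>y\<in>S. f y \<le> f x"
proof (rule ccontr)
  assume "\<not> ?thesis"
  then have n: "\<forall>x\<in>S. \<exists>y\<in>S. f x < f y" by force
  have "\<forall>y\<in>S. \<exists>T. open T \<and> {x\<in>S. f x < f y} = S \<inter> T"
    using assms(1) unfolding usc_def openin_open by blast
  then obtain T where T: "\<And>y. y \<in> S \<Longrightarrow> open (T y)" "\<And>y. y \<in> S \<Longrightarrow> {x\<in>S. f x < f y} = S \<inter> T y" by metis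
  have "S \<subseteq> (\<Union>y\<in>S. T y)" using n T(2) by blast
  then obtain F where F: "F \<subseteq> S" "finite F" "S \<subseteq> (\<Union>y\<in>F. T y)"
    using compactE_image[OF assms(2), of S T] T(1) by metis
  have "F \<noteq> {}" using F(3) assms(3) by auto
  obtain y where y: "y \<in> F" "\<forall>z\<in>F. f z \<le> f y"
  proof -
    have "Max (f ` F) \<in> f ` F" using F(2) \<open>F \<noteq> {}\<close> by (intro Max_in) auto
    then obtain y where "y \<in> F" "Max (f ` F) = f y" by blast
    then show ?thesis using F(2) that[of y] Max_ge[of "f ` F"] by auto
  qed
  then obtain z where "z \<in> F" "y \<in> T z" using F by blast
  then have "f y < f z" using T(2)[of z] F y by blast
  then show False using y \<open>z \<in> F\<close> by force
qed

lemma usc_borel_measurable: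
  assumes "usc S f" "S \<in> sets borel"
  shows "f \<in> borel_measurable (restrict_space borel S)"
proof (subst borel_measurable_iff_less, intro allI)
  fix a
  have "openin (top_of_set S) {x\<in>S. f x < a}" using assms(1) by (simp add: usc_def)
  then obtain T where "open T" "{x\<in>S. f x < a} = S \<inter> T"
    unfolding openin_open by blast
  then show "{w \<in> space (restrict_space borel S). f w < a} \<in> sets (restrict_space borel S)"
    using assms(2) by (auto simp: sets_restrict_space space_restrict_space)
qed

section \<open>Circle means\<close>

text \<open>Functions live on the parameter plane. A mean of \<open>u\<close> along a straight or
  curved disc \<open>\<gamma>\<close> is
  \<open>cmean (\<lambda>\<zeta>. u (\<gamma> \<zeta>)) r\<close>, and a change of coordinates only
  alters \<open>\<gamma>\<close>.\<close>

definition cmean :: "(complex \<Rightarrow> real) \<Rightarrow> real \<Rightarrow> real" where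
  "cmean f r = (LINT t:{0..2*pi}|lborel. f (of_real r * cis t)) / (2*pi)"

definition cint :: "(complex \<Rightarrow> real) \<Rightarrow> real \<Rightarrow> bool" where
  "cint f r \<longleftrightarrow> set_integrable lborel {0..2*pi} (\<lambda>t. f (of_real r * cis t))"

lemma norm_circle [simp]: "0 \<le> r \<Longrightarrow> cmod (of_real r * cis t) = r"
  by (simp add: norm_mult)

lemma continuous_circle: "continuous_on A (\<lambda>t. of_real r * cis t)"
  by (intro continuous_intros)

lemma usc_cint:
  assumes "usc (sphere 0 r) f" "\<And>z. cmod z = r \<Longrightarrow> m \<le> f z" "0 \<le> r"
  shows "cint f r"
proof -
  have u: "usc {0..2*pi} (\<lambda>t. f (of_real r * cis t))"
    by (rule usc_compose[OF assms(1) continuous_circle]) (use assms(3) in auto)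
  then have "(\<lambda>t. f (of_real r * cis t)) \<in> borel_measurable (restrict_space borel {0..2*pi})"
    by (intro usc_borel_measurable) auto
  then have "(\<lambda>t. indicator {0..2*pi} t *\<^sub>R f (of_real r * cis t)) \<in> borel_measurable borel"
    by (subst (asm) borel_measurable_restrict_space_iff) auto
  then have m1: "(\<lambda>t. indicator {0..2*pi} t *\<^sub>R f (of_real r * cis t)) \<in> borel_measurable lborel" by simp
  obtain M where M: "\<And>t. t \<in> {0..2*pi} \<Longrightarrow> f (of_real r * cis t) \<le> M"
    using usc_attains_max[OF u] by fastforce
  show ?thesis unfolding cint_def set_integrable_def
  proof (rule Bochner_Integration.integrable_bound[OF _ m1])
    show "integrable lborel (\<lambda>t::real. indicator {0..2*pi} t *\<^sub>R max \<bar>M\<bar> \<bar>m\<bar>)"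
      by (auto intro!: integrable_real_indicator integrable_mult_left)
    show "AE t in lborel. norm (indicator {0..2*pi} t *\<^sub>R f (of_real r * cis t))
            \<le> norm (indicator {0..2*pi} t *\<^sub>R max \<bar>M\<bar> \<bar>m\<bar>)"
    proof (rule AE_I2)
      fix t :: real
      show "norm (indicator {0..2*pi} t *\<^sub>R f (of_real r * cis t)) \<le> norm (indicator {0..2*pi} t *\<^sub>R max \<bar>M\<bar> \<bar>m\<bar>)"
        using M[of t] assms(2)[of "of_real r * cis t"] assms(3) by (auto simp: indicator_def)
    qed
  qed
qed

lemma continuous_cint: "continuous_on (sphere 0 r) f \<Longrightarrow> 0 \<le> r \<Longrightarrow> cint f r"
proof -
  assume a: "continuous_on (sphere 0 r) f" "0 \<le> r"
  have "compact (f ` sphere 0 r)" using a by (intro compact_continuous_image) auto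
  then have "bounded (f ` sphere 0 r)" by (rule compact_imp_bounded)
  then obtain B where "\<forall>x\<in>sphere 0 r. \<bar>f x\<bar> \<le> B" by (auto simp: bounded_iff)
  then have "-B \<le> f z" if "cmod z = r" for z using that by (metis abs_le_D2 dist_0_norm mem_sphere minus_le_iff)
  then show ?thesis using usc_cint[OF continuous_imp_usc[OF a(1)]] a(2) by blast
qed

lemma cmean_mono:
  assumes "cint f r" "cint g r" "\<And>z. cmod z = r \<Longrightarrow> f z \<le> g z" "0 \<le> r"
  shows "cmean f r \<le> cmean g r"
  unfolding cmean_def
  by (intro divide_right_mono set_integral_mono) (use assms in \<open>auto simp: cint_def\<close>)

lemma cmean_cong:
  assumes "\<And>z. cmod z = r \<Longrightarrow> f z = g z" "0 \<le> r"
  shows "cmean f r = cmean g r"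
proof -
  have "f (of_real r * cis t) = g (of_real r * cis t)" for t using assms by simp
  then show ?thesis by (simp add: cmean_def)
qed

lemma cint_add: "cint f r \<Longrightarrow> cint g r \<Longrightarrow> cint (\<lambda>z. f z + g z) r"
  unfolding cint_def by (rule set_integral_add)

lemma cmean_add: "cint f r \<Longrightarrow> cint g r \<Longrightarrow> cmean (\<lambda>z. f z + g z) r = cmean f r + cmean g r"
  unfolding cint_def cmean_def by (simp add: set_integral_add add_divide_distrib)

lemma cint_cmult: "cint f r \<Longrightarrow> cint (\<lambda>z. c * f z) r"
  unfolding cint_def by simp

lemma cmean_cmult: "cmean (\<lambda>z. c * f z) r = c * cmean f r"
  unfolding cmean_def by simp

lemma cint_const: "cint (\<lambda>z. c) r"
  unfolding cint_def set_integrable_def by (auto intro!: integrable_mult_left integrable_real_indicator)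

lemma cmean_const [simp]: "cmean (\<lambda>z. c) r = c"
  unfolding cmean_def set_lebesgue_integral_def by simp

lemma cint_diff: "cint f r \<Longrightarrow> cint g r \<Longrightarrow> cint (\<lambda>z. f z - g z) r"
  unfolding cint_def by (rule set_integral_diff)

lemma cmean_diff: "cint f r \<Longrightarrow> cint g r \<Longrightarrow> cmean (\<lambda>z. f z - g z) r = cmean f r - cmean g r"
  unfolding cint_def cmean_def by (simp add: set_integral_diff diff_divide_distrib)

lemma cmean_scale: "cmean (\<lambda>z. f (of_real s * z)) r = cmean f (s * r)"
  unfolding cmean_def by (simp add: mult.assoc)

text \<open>Cauchy's integral formula at the centre: on the circle the kernel 1/z cancels the
  velocity of the parametrisation up to the factor i.\<close>

lemma cmean_holomorphic:
  assumes "F holomorphic_on ball 0 \<rho>" "0 < r" "r < \<rho>"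
  shows "cmean (\<lambda>z. Re (F z)) r = Re (F 0)"
proof -
  have c: "continuous_on (cball 0 r) F"
    using assms by (intro holomorphic_on_imp_continuous_on holomorphic_on_subset[OF assms(1)]) auto
  have "((\<lambda>u. F u / (u - 0)) has_contour_integral (2 * of_real pi * \<i> * F 0)) (circlepath 0 r)"
    using assms by (intro Cauchy_integral_circlepath c) (auto intro!: holomorphic_on_subset[OF assms(1)])
  then have "((\<lambda>t. F (of_real r * cis t) / (of_real r * cis t) * of_real r * \<i> * cis t) has_integral (2 * of_real pi * \<i> * F 0)) {0..2*pi}"
    unfolding circlepath_def by (subst (asm) has_contour_integral_part_circlepath_iff) simp_all
  then have "((\<lambda>t. \<i> * F (of_real r * cis t)) has_integral (2 * of_real pi * \<i> * F 0)) {0..2*pi}"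
    by (rule has_integral_eq[rotated]) (use assms in \<open>auto simp: field_simps\<close>)
  from has_integral_mult_right[OF this, of "-\<i>"]
  have "((\<lambda>t. F (of_real r * cis t)) has_integral (2 * of_real pi * F 0)) {0..2*pi}"
    by (simp add: algebra_simps)
  from has_integral_linear[OF this bounded_linear_Re]
  have h: "((\<lambda>t. Re (F (of_real r * cis t))) has_integral (2 * pi * Re (F 0))) {0..2*pi}"
    by (simp add: o_def)
  have "continuous_on {0..2*pi} (\<lambda>t. Re (F (of_real r * cis t)))"
    using assms by (intro continuous_intros continuous_on_compose2[OF c]) auto
  then have "set_integrable lborel {0..2*pi} (\<lambda>t. Re (F (of_real r * cis t)))"
    by (rule borel_integrable_atLeastAtMost')
  then have "(LINT t:{0..2*pi}|lborel. Re (F (of_real r * cis t))) = 2 * pi * Re (F 0)"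
    using set_borel_integral_eq_integral(2) h by (metis integral_unique)
  then show ?thesis by (simp add: cmean_def)
qed

section \<open>Harmonic majorants\<close>

text \<open>Complex polynomials, used through their real parts: on the unit circle these are the
  trigonometric polynomials, and inside they are harmonic, with mean equal to the value at
  0.\<close>

inductive trig_poly :: "(complex \<Rightarrow> complex) \<Rightarrow> bool" where
  monom: "trig_poly (\<lambda>z. c * z ^ n)"
| add: "trig_poly p \<Longrightarrow> trig_poly q \<Longrightarrow> trig_poly (\<lambda>z. p z + q z)"

lemma trig_poly_holomorphic: "trig_poly p \<Longrightarrow> p holomorphic_on UNIV"
  by (induction rule: trig_poly.induct) (auto intro!: holomorphic_intros)

lemma Re_mult_Re: "Re a * Re b = (Re (a * b) + Re (a * cnj b)) / 2"
  by simp

text \<open>2 Re a Re b = Re (ab) + Re (a cnj b), and on the unit circle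
  \<open>cnj z ^ n * z ^ m\<close> is the monomial \<open>z ^ (m - n)\<close>. The subtraction of
  exponents is why n \<le> m is arranged by symmetry.\<close>

lemma trig_poly_mult_monom:
  "\<exists>r. trig_poly r \<and> (\<forall>z. cmod z = 1 \<longrightarrow> Re (c * z ^ n) * Re (d * z ^ m) = Re (r z))"
proof (induction n m arbitrary: c d rule: linorder_wlog)
  case (le n m)
  have "trig_poly (\<lambda>z. (c * d / 2) * z ^ (n + m) + (cnj c * d / 2) * z ^ (m - n))"
    by (intro trig_poly.intros)
  moreover have "Re (c * z ^ n) * Re (d * z ^ m) = Re ((c * d / 2) * z ^ (n + m) + (cnj c * d / 2) * z ^ (m - n))"
    if z: "cmod z = 1" for z
  proof -
    have e: "cnj z ^ n * z ^ m = z ^ (m - n)"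
    proof -
      have "z ^ m = z ^ n * z ^ (m - n)" using le by (simp flip: power_add)
      then have "cnj z ^ n * z ^ m = (cnj z * z) ^ n * z ^ (m - n)" by (simp add: power_mult_distrib)
      also have "cnj z * z = 1" using z by (simp add: complex_norm_square[symmetric] mult.commute)
      finally show ?thesis by simp
    qed
    have "Re (c * z ^ n) * Re (d * z ^ m) = (Re (d * z ^ m * (c * z ^ n)) + Re (d * z ^ m * cnj (c * z ^ n))) / 2"
      using Re_mult_Re[of "d * z ^ m" "c * z ^ n"] by (simp add: mult.commute)
    also have "d * z ^ m * cnj (c * z ^ n) = cnj c * d * (cnj z ^ n * z ^ m)" by simp
    also have "\<dots> = cnj c * d * z ^ (m - n)" by (simp only: e)
    also have "d * z ^ m * (c * z ^ n) = c * d * z ^ (n + m)" by (simp add: power_add)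
    finally show ?thesis by (simp add: add_divide_distrib)
  qed
  ultimately show ?case by blast
next
  case (sym n m)
  show ?case using sym[of d c] by (metis mult.commute)
qed

lemma trig_poly_mult:
  assumes "trig_poly p" "trig_poly q"
  shows "\<exists>r. trig_poly r \<and> (\<forall>z. cmod z = 1 \<longrightarrow> Re (p z) * Re (q z) = Re (r z))"
  using assms(1)
proof induction
  case (monom c n)
  show ?case using assms(2)
  proof induction
    case (monom d m)
    show ?case by (rule trig_poly_mult_monom)
  next
    case (add q1 q2)
    then obtain r1 r2 where "trig_poly r1" "trig_poly r2"
      "\<forall>z. cmod z = 1 \<longrightarrow> Re (c * z ^ n) * Re (q1 z) = Re (r1 z)" "\<forall>z. cmod z = 1 \<longrightarrow> Re (c * z ^ n) * Re (q2 z) = Re (r2 z)" by blast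
    then show ?case
      by (intro exI[of _ "\<lambda>z. r1 z + r2 z"]) (auto intro: trig_poly.intros simp: distrib_left simp del: times_complex.sel)
  qed
next
  case (add p1 p2)
  then obtain r1 r2 where "trig_poly r1" "trig_poly r2"
    "\<forall>z. cmod z = 1 \<longrightarrow> Re (p1 z) * Re (q z) = Re (r1 z)" "\<forall>z. cmod z = 1 \<longrightarrow> Re (p2 z) * Re (q z) = Re (r2 z)" by blast
  then show ?case
    by (intro exI[of _ "\<lambda>z. r1 z + r2 z"]) (auto intro: trig_poly.intros simp: distrib_right)
qed

lemma real_polynomial_function_eq_trig_poly:
  "real_polynomial_function g \<Longrightarrow> \<exists>p. trig_poly p \<and> (\<forall>z. cmod z = 1 \<longrightarrow> g z = Re (p z))"
proof (induction rule: real_polynomial_function.induct)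
  case (linear f)
  have l: "linear f" using linear bounded_linear.linear by blast
  \<comment> \<open>A real-linear f is z \<mapsto> Re (c z) with c = f 1 - i f(i).\<close>
  have "f z = Re (Complex (f 1) (- f \<i>) * z ^ 1)" for z
  proof -
    have "f z = f (Re z *\<^sub>R 1 + Im z *\<^sub>R \<i>)" by (metis complex_eq mult.commute scaleR_conv_of_real mult.right_neutral)
    also have "\<dots> = Re z * f 1 + Im z * f \<i>" by (simp only: linear_add[OF l] linear_scale[OF l] real_scaleR_def)
    finally show ?thesis by simp
  qed
  then show ?case using trig_poly.monom by blast
next
  case (const c)
  show ?case by (rule exI[of _ "\<lambda>z. of_real c * z ^ 0"]) (auto intro: trig_poly.monom[of "of_real c" 0, simplified])
next
  case (add f g)
  then obtain p q where "trig_poly p" "trig_poly q" "\<forall>z. cmod z = 1 \<longrightarrow> f z = Re (p z)" "\<forall>z. cmod z = 1 \<longrightarrow> g z = Re (q z)" by blast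
  then show ?case by (intro exI[of _ "\<lambda>z. p z + q z"]) (auto intro: trig_poly.intros)
next
  case (mult f g)
  then obtain p q where "trig_poly p" "trig_poly q" "\<forall>z. cmod z = 1 \<longrightarrow> f z = Re (p z)" "\<forall>z. cmod z = 1 \<longrightarrow> g z = Re (q z)" by blast
  then show ?case using trig_poly_mult[of p q] by metis
qed

text \<open>Stone-Weierstrass takes the place of the Poisson integral: continuous boundary values
  are approximated by real parts of entire functions.\<close>

lemma continuous_circle_approx:
  fixes f :: "complex \<Rightarrow> real"
  assumes "continuous_on (sphere 0 s) f" "0 < s" "0 < e"
  obtains p where "p holomorphic_on UNIV" "\<And>z. cmod z = s \<Longrightarrow> \<bar>f z - Re (p z)\<bar> < e"
proof -
  have "continuous_on (sphere 0 1) (\<lambda>z. f (of_real s * z))"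
    using assms by (intro continuous_on_compose2[OF assms(1)] continuous_intros) (auto simp: norm_mult)
  then obtain g where g: "real_polynomial_function g" "\<And>z. z \<in> sphere 0 1 \<Longrightarrow> \<bar>f (of_real s * z) - g z\<bar> < e"
    using Stone_Weierstrass_real_polynomial_function[of "sphere 0 1" _ e] assms(3) compact_sphere by metis
  obtain p where p: "trig_poly p" "\<forall>z. cmod z = 1 \<longrightarrow> g z = Re (p z)"
    using real_polynomial_function_eq_trig_poly[OF g(1)] by blast
  show ?thesis
  proof
    show "(\<lambda>z. p (z / of_real s)) holomorphic_on UNIV"
      by (rule holomorphic_on_compose_gen[of _ _ p UNIV, unfolded o_def])
         (use assms trig_poly_holomorphic[OF p(1)] in \<open>auto intro!: holomorphic_intros\<close>)
    show "\<bar>f z - Re (p (z / of_real s))\<bar> < e" if "cmod z = s" for z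
      using g(2)[of "z / of_real s"] p(2) that assms by (auto simp: norm_divide)
  qed
qed

text \<open>The sup-convolutions x \<mapsto> sup over y of f y - k|x - y| are k-Lipschitz, dominate
  f, and tend to f because f is upper semicontinuous; dominated convergence carries this to the
  means.\<close>

lemma usc_approx_continuous:
  fixes f :: "complex \<Rightarrow> real"
  assumes u: "usc (sphere 0 s) f" and m: "\<And>z. cmod z = s \<Longrightarrow> m \<le> f z" and s: "0 < s" and c: "cmean f s < c"
  obtains g where "continuous_on (sphere 0 s) g" "\<And>z. cmod z = s \<Longrightarrow> f z \<le> g z" "cmean g s < c"
proof -
  define S where "S = sphere (0::complex) s"
  have uS: "usc S f" using u by (simp add: S_def)
  have S: "S \<noteq> {}" "compact S" using s by (auto simp: S_def)
  obtain M where M: "\<And>z. z \<in> S \<Longrightarrow> f z \<le> M" using usc_attains_max[OF uS S(2,1)] by blast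
  have mM: "m \<le> f z" if "z \<in> S" for z using m that by (auto simp: S_def)
  define F where "F k x = (SUP y\<in>S. f y - real k * norm (x - y))" for k :: nat and x
  have bdd: "bdd_above ((\<lambda>y. f y - real k * norm (x - y)) ` S)" for k x
  proof (rule bdd_aboveI2)
    fix y assume "y \<in> S"
    then show "f y - real k * norm (x - y) \<le> M" using M[of y] by (smt (verit) mult_nonneg_nonneg norm_ge_zero of_nat_0_le_iff)
  qed
  have F_ge: "f x \<le> F k x" if "x \<in> S" for k x
    unfolding F_def using cSUP_upper[OF that bdd[of k x]] by simp
  have F_le: "F k x \<le> M" for k x
    unfolding F_def
  proof (rule cSUP_least[OF S(1)])
    fix y assume "y \<in> S"
    then show "f y - real k * norm (x - y) \<le> M" using M[of y] by (smt (verit) mult_nonneg_nonneg norm_ge_zero of_nat_0_le_iff)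
  qed
  have F_lip: "F k x \<le> F k x' + real k * norm (x - x')" for k x x'
    unfolding F_def[of k x]
  proof (rule cSUP_least[OF S(1)])
    fix y assume y: "y \<in> S"
    have "f y - real k * norm (x' - y) \<le> F k x'" unfolding F_def by (rule cSUP_upper[OF y bdd])
    moreover have "norm (x' - y) \<le> norm (x - y) + norm (x - x')" by norm
    then have "real k * norm (x' - y) \<le> real k * norm (x - y) + real k * norm (x - x')"
      by (simp add: distrib_left[symmetric] mult_left_mono)
    ultimately show "f y - real k * norm (x - y) \<le> F k x' + real k * norm (x - x')" by linarith
  qed
  have F_cont: "continuous_on UNIV (F k)" for k
  proof -
    have "\<bar>F k x - F k x'\<bar> \<le> real k * norm (x - x')" for x x'
      using F_lip[of k x x'] F_lip[of k x' x] by (simp add: norm_minus_commute abs_le_iff)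
    then have "(real k)-lipschitz_on UNIV (F k)"
      by (intro lipschitz_onI) (auto simp: dist_norm)
    then show ?thesis by (rule lipschitz_on_continuous_on)
  qed
  have F_lim: "(\<lambda>k. F k x) \<longlonglongrightarrow> f x" if x: "x \<in> S" for x
  proof (rule order_tendstoI)
    fix a assume "a < f x"
    then show "\<forall>\<^sub>F k in sequentially. a < F k x"
      using F_ge[OF x] by (intro always_eventually allI) (meson less_le_trans)
  next
    fix a assume a: "f x < a"
    define b where "b = (a + f x) / 2"
    have b: "f x < b" "b < a" using a by (auto simp: b_def)
    obtain T where T: "open T" "{y\<in>S. f y < b} = S \<inter> T"
      using uS unfolding usc_def openin_open by blast
    then have "x \<in> T" using x b by blast
    then obtain d where d: "d > 0" "ball x d \<subseteq> T" using T(1) open_contains_ball by blast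
    \<comment> \<open>Points at distance at least d pay a penalty exceeding M - b, so only points
      with f y < b can raise the supremum above b.\<close>
    obtain K :: nat where K: "(M - b) / d < real K" using reals_Archimedean2 by blast
    have "F k x < a" if "k \<ge> K" for k
    proof -
      have "F k x \<le> b" unfolding F_def
      proof (rule cSUP_least[OF S(1)])
        fix y assume y: "y \<in> S"
        show "f y - real k * norm (x - y) \<le> b"
        proof (cases "norm (x - y) < d")
          case True
          then have "y \<in> T" using d by (auto simp: dist_norm)
          then have "f y < b" using T y by blast
          then show ?thesis by (smt (verit) mult_nonneg_nonneg norm_ge_zero of_nat_0_le_iff)
        next
          case False
          have "M - b < real K * d" using K d by (simp add: field_simps)
          also have "\<dots> \<le> real k * norm (x - y)" using False that d by (intro mult_mono) auto
          finally show ?thesis using M[OF y] by linarith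
        qed
      qed
      then show ?thesis using b by simp
    qed
    then show "\<forall>\<^sub>F k in sequentially. F k x < a" using eventually_sequentially by blast
  qed
  have fi: "cint f s" using usc_cint[OF u m] s by simp
  have Fi: "cint (F k) s" for k using s continuous_on_subset[OF F_cont] by (intro continuous_cint) auto
  have "(\<lambda>k. LINT t|lborel. indicator {0..2*pi} t *\<^sub>R F k (of_real s * cis t)) \<longlonglongrightarrow>
        (LINT t|lborel. indicator {0..2*pi} t *\<^sub>R f (of_real s * cis t))"
  proof (rule integral_dominated_convergence)
    show "(\<lambda>t. indicator {0..2*pi} t *\<^sub>R f (of_real s * cis t)) \<in> borel_measurable lborel"
      using fi by (auto simp: cint_def set_integrable_def)
    show "(\<lambda>t. indicator {0..2*pi} t *\<^sub>R F k (of_real s * cis t)) \<in> borel_measurable lborel" for k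
      using Fi[of k] by (auto simp: cint_def set_integrable_def)
    show "integrable lborel (\<lambda>t::real. indicator {0..2*pi} t *\<^sub>R max \<bar>M\<bar> \<bar>m\<bar>)"
      by (auto intro!: integrable_real_indicator integrable_mult_left)
    show "AE t in lborel. (\<lambda>k. indicator {0..2*pi} t *\<^sub>R F k (of_real s * cis t)) \<longlonglongrightarrow> indicator {0..2*pi} t *\<^sub>R f (of_real s * cis t)"
      using s by (intro AE_I2 tendsto_scaleR tendsto_const F_lim) (auto simp: S_def)
    show "AE t in lborel. norm (indicator {0..2*pi} t *\<^sub>R F k (of_real s * cis t)) \<le> indicator {0..2*pi} t *\<^sub>R max \<bar>M\<bar> \<bar>m\<bar>" for k
    proof (rule AE_I2)
      fix t
      have "of_real s * cis t \<in> S" using s by (simp add: S_def)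
      then have "m \<le> F k (of_real s * cis t)" "F k (of_real s * cis t) \<le> M"
        using mM F_ge F_le order_trans by blast+
      then show "norm (indicator {0..2*pi} t *\<^sub>R F k (of_real s * cis t)) \<le> indicator {0..2*pi} t *\<^sub>R max \<bar>M\<bar> \<bar>m\<bar>"
        by (auto simp: indicator_def)
    qed
  qed
  then have "(\<lambda>k. cmean (F k) s) \<longlonglongrightarrow> cmean f s"
    unfolding cmean_def set_lebesgue_integral_def by (intro tendsto_divide tendsto_const) auto
  then have "\<forall>\<^sub>F k in sequentially. cmean (F k) s < c" using c by (rule order_tendstoD)
  then obtain k where "cmean (F k) s < c" using eventually_happens by force
  then show ?thesis using that[of "F k"] F_ge continuous_on_subset[OF F_cont subset_UNIV] by (auto simp: S_def)
qed

text \<open>Strictness on the circle is the point: being an open condition, it persists on a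
  neighbourhood of the circle, which is exploited in \<open>usc_tube\<close>.\<close>

lemma harmonic_majorant:
  fixes f :: "complex \<Rightarrow> real"
  assumes u: "usc (sphere 0 s) f" and m: "\<And>z. cmod z = s \<Longrightarrow> m \<le> f z" and s: "0 < s" and c: "cmean f s < c"
  obtains p where "p holomorphic_on UNIV" "\<And>z. cmod z = s \<Longrightarrow> f z < Re (p z)" "Re (p 0) < c"
proof -
  obtain g where g: "continuous_on (sphere 0 s) g" "\<And>z. cmod z = s \<Longrightarrow> f z \<le> g z" "cmean g s < c"
    using usc_approx_continuous[OF assms] by blast
  \<comment> \<open>One third pays for the approximation, one for the shift by e that makes the
    majorant strict, and one remains as a gap.\<close>
  define e where "e = (c - cmean g s) / 3"
  have e: "e > 0" using g by (simp add: e_def)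
  obtain p where p: "p holomorphic_on UNIV" "\<And>z. cmod z = s \<Longrightarrow> \<bar>g z - Re (p z)\<bar> < e"
    using continuous_circle_approx[OF g(1) s e] by blast
  show ?thesis
  proof
    show "(\<lambda>z. p z + of_real e) holomorphic_on UNIV" using p by (intro holomorphic_intros)
    show "f z < Re (p z + of_real e)" if "cmod z = s" for z using p(2)[OF that] g(2)[OF that] by simp
    have "cint (\<lambda>z. Re (p z)) s" using s
      by (intro continuous_cint continuous_intros holomorphic_on_imp_continuous_on holomorphic_on_subset[OF p(1)]) auto
    moreover have "cint (\<lambda>z. g z + e) s" using s g(1) by (intro continuous_cint continuous_intros) auto
    moreover have "Re (p z) \<le> g z + e" if "cmod z = s" for z using p(2)[OF that] by linarith
    ultimately have "cmean (\<lambda>z. Re (p z)) s \<le> cmean (\<lambda>z. g z + e) s" using s by (intro cmean_mono) auto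
    also have "\<dots> = cmean g s + e" using s g(1) by (subst cmean_add) (auto intro!: continuous_cint cint_const)
    finally have "Re (p 0) \<le> cmean g s + e"
      using cmean_holomorphic[of p "s + 1" s] s p(1) holomorphic_on_subset by (metis less_add_one subset_UNIV)
    then show "Re (p 0 + of_real e) < c" using e by (simp add: e_def field_simps)
  qed
qed

section \<open>Holomorphic discs\<close>

lemma norm_smult_cart: "norm (c *s (w::complex^'n)) = cmod c * norm w"
  by (simp add: norm_vec_def norm_mult L2_set_right_distrib)

lemma norm_cart_power2: "(norm (w::complex^'n))\<^sup>2 = (\<Sum>i\<in>UNIV. (cmod (w $ i))\<^sup>2)"
  by (simp add: norm_vec_def L2_set_def sum_nonneg)

lemma bounded_linear_smult_left: "bounded_linear (\<lambda>h::complex. h *s (w::complex^'n))"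
  by (rule bounded_linear_intro[where K="norm w"]) (auto simp: norm_smult_cart vec_eq_iff algebra_simps)

lemma continuous_on_smult [continuous_intros]:
  fixes g :: "'a::t2_space \<Rightarrow> complex^'n"
  assumes "continuous_on S f" "continuous_on S g"
  shows "continuous_on S (\<lambda>x. f x *s g x)"
  unfolding vector_scalar_mult_def
  using assms by (intro continuous_on_vec_lambda continuous_intros) auto

section \<open>Discs with a prescribed 1-jet and the pointwise condition \<open>asub\<close>\<close>

text \<open>A derivative of the form \<open>\<lambda>h. h *s d\<close> is complex linear, so
  \<open>\<gamma>\<close> is holomorphic near 0. Only its 1-jet at 0 is fixed, because a change of
  coordinates bends straight discs.\<close>

definition disc_at :: "(complex \<Rightarrow> complex^'n) \<Rightarrow> complex^'n \<Rightarrow> complex^'n \<Rightarrow> bool" where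
  "disc_at \<gamma> z w \<longleftrightarrow> \<gamma> 0 = z \<and> (\<gamma> has_derivative (\<lambda>h. h *s w)) (at 0) \<and>
     (\<exists>\<rho>>0. \<forall>\<zeta>\<in>ball 0 \<rho>. \<exists>d. (\<gamma> has_derivative (\<lambda>h. h *s d)) (at \<zeta>))"

text \<open>A pointwise form of \<open>dd\<^sup>cu(w, \<i>w) \<ge> -q\<close> at \<open>z\<close>. Only one disc with the prescribed 1-jet and only
  arbitrarily small radii are asked for, so that the condition is invariant under biholomorphic maps and is
  inherited by every function that touches \<open>u\<close> from above at \<open>z\<close>.\<close>

definition asub :: "(complex^'n \<Rightarrow> real) \<Rightarrow> complex^'n \<Rightarrow> complex^'n \<Rightarrow> real \<Rightarrow> bool" where
  "asub u z w q \<longleftrightarrow> (\<forall>e>0. \<exists>\<gamma>. disc_at \<gamma> z w \<and>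
     (\<exists>\<^sub>F r in at_right 0. u z \<le> cmean (\<lambda>\<zeta>. u (\<gamma> \<zeta>)) r + r\<^sup>2 / 4 * (q + e)))"

lemma disc_at_linear: "disc_at (\<lambda>\<zeta>. z + \<zeta> *s w) z w"
proof -
  have d: "((\<lambda>\<zeta>. z + \<zeta> *s w) has_derivative (\<lambda>h. h *s w)) (at \<zeta>)" for \<zeta>
    using has_derivative_add[OF has_derivative_const bounded_linear.has_derivative[OF bounded_linear_smult_left has_derivative_ident]]
    by simp
  have "\<exists>d. ((\<lambda>\<zeta>. z + \<zeta> *s w) has_derivative (\<lambda>h. h *s d)) (at \<zeta>)" for \<zeta> using d by blast
  then show ?thesis unfolding disc_at_def using d by (auto intro: gt_ex)
qed

lemma disc_component_derivative:
  assumes "(\<gamma> has_derivative (\<lambda>h. h *s d)) (at \<zeta>)"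
  shows "((\<lambda>\<zeta>. \<gamma> \<zeta> $ i) has_field_derivative d $ i) (at \<zeta>)"
proof -
  have "(\<lambda>h. h * d $ i) = (*) (d $ i)" by (auto simp: mult.commute)
  then show ?thesis
    using bounded_linear.has_derivative[OF bounded_linear_vec_nth assms, of i]
    by (simp add: has_field_derivative_def)
qed

lemma disc_at_holomorphic:
  assumes "disc_at \<gamma> z w"
  obtains \<rho> where "\<rho> > 0" "\<And>i. (\<lambda>\<zeta>. \<gamma> \<zeta> $ i) holomorphic_on ball 0 \<rho>" "continuous_on (ball 0 \<rho>) \<gamma>"
proof -
  obtain \<rho> where r: "\<rho> > 0" "\<forall>\<zeta>\<in>ball 0 \<rho>. \<exists>d. (\<gamma> has_derivative (\<lambda>h. h *s d)) (at \<zeta>)"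
    using assms by (auto simp: disc_at_def)
  show ?thesis
  proof
    show "(\<lambda>\<zeta>. \<gamma> \<zeta> $ i) holomorphic_on ball 0 \<rho>" for i
      unfolding holomorphic_on_def field_differentiable_def
      using r(2) disc_component_derivative has_field_derivative_at_within by blast
    show "continuous_on (ball 0 \<rho>) \<gamma>"
      using r(2) has_derivative_continuous continuous_at_imp_continuous_on by blast
  qed (use r in auto)
qed

text \<open>The pairs (\<zeta>, x) with u x < g \<zeta> form an open set that contains the compact
  set of pairs (\<zeta>, z + \<zeta>w), |\<zeta>| = s, hence also a neighbourhood of uniform
  width.\<close>

lemma usc_tube:
  fixes u :: "complex^'n \<Rightarrow> real"
  assumes W: "open W" "usc W u" and g: "continuous_on UNIV g"
    and lt: "\<And>\<zeta>. cmod \<zeta> = s \<Longrightarrow> z + \<zeta> *s w \<in> W \<and> u (z + \<zeta> *s w) < g \<zeta>"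
  obtains \<sigma> where "\<sigma> > 0" "\<And>\<zeta> x. cmod \<zeta> = s \<Longrightarrow> norm (x - (z + \<zeta> *s w)) \<le> \<sigma> \<Longrightarrow> x \<in> W \<and> u x < g \<zeta>"
proof -
  define T where "T = {p \<in> (UNIV \<times> W). u (snd p) + - g (fst p) < 0}"
  have "usc (UNIV \<times> W) (\<lambda>p. u (snd p) + - g (fst p))"
    by (intro usc_add_continuous usc_compose[OF W(2)] continuous_intros continuous_on_compose2[OF g])
       (auto intro: open_Times W)
  then have "openin (top_of_set (UNIV \<times> W)) T" unfolding usc_def T_def by (rule spec)
  then have T: "open T" using W(1) by (simp add: openin_open_eq open_Times)
  define A where "A = (\<lambda>\<zeta>. (\<zeta>, z + \<zeta> *s w)) ` sphere 0 s"
  have "compact A" unfolding A_def by (intro compact_continuous_image continuous_intros) auto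
  moreover have "A \<subseteq> T" using lt by (auto simp: A_def T_def)
  ultimately obtain e where e: "e > 0" "(\<Union>x\<in>A. cball x e) \<subseteq> T"
    using T compact_subset_open_imp_cball_epsilon_subset by metis
  show ?thesis
  proof
    fix \<zeta> x assume a: "cmod \<zeta> = s" "norm (x - (z + \<zeta> *s w)) \<le> e"
    have "(\<zeta>, x) \<in> cball (\<zeta>, z + \<zeta> *s w) e"
      using a by (simp add: dist_Pair_Pair dist_norm norm_minus_commute)
    moreover have "(\<zeta>, z + \<zeta> *s w) \<in> A" using a(1) by (auto simp: A_def)
    ultimately have "(\<zeta>, x) \<in> T" using e(2) by blast
    then show "x \<in> W \<and> u x < g \<zeta>" by (auto simp: T_def)
  qed (use e in auto)
qed

lemma cint_disc:
  fixes u :: "complex^'n \<Rightarrow> real"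
  assumes "usc W u" "\<And>x. x \<in> W \<Longrightarrow> m \<le> u x" "0 \<le> r" "continuous_on (sphere 0 r) \<gamma>" "\<And>\<zeta>. cmod \<zeta> = r \<Longrightarrow> \<gamma> \<zeta> \<in> W"
  shows "cint (\<lambda>\<zeta>. u (\<gamma> \<zeta>)) r"
  by (rule usc_cint[where m=m]) (use assms in \<open>auto intro!: usc_compose[OF assms(1)]\<close>)

text \<open>If the conclusion failed, a harmonic majorant on the circle, penalised transversally, would be
  touched from above by \<open>u\<close> at an interior point, against the hypothesis at that point.\<close>

lemma disc_submean:
  fixes u :: "complex^'n \<Rightarrow> real"
  assumes W: "open W" "usc W u" and m: "\<And>x. x \<in> W \<Longrightarrow> m \<le> u x" and q: "0 \<le> q"
    and A: "\<And>x. x \<in> W \<Longrightarrow> asub u x w q"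
    and s: "0 < s" and D: "\<And>\<zeta>. cmod \<zeta> \<le> s \<Longrightarrow> z + \<zeta> *s w \<in> W"
  shows "u z \<le> cmean (\<lambda>\<zeta>. u (z + \<zeta> *s w)) s + s\<^sup>2 / 4 * q"
proof (cases "w = 0")
  case True
  then show ?thesis using q by simp
next
  case w: False
  show ?thesis
  proof (rule ccontr)
    assume n: "\<not> ?thesis"
    define c where "c = cmean (\<lambda>\<zeta>. u (z + \<zeta> *s w)) s"
    \<comment> \<open>The excess equals s^2 e; a quarter of it is spent on raising q to q + e, and
      the inequality stays strict.\<close>
    define e where "e = (u z - c - s\<^sup>2 / 4 * q) / s\<^sup>2"
    have e: "e > 0" using n s by (auto simp: e_def c_def)
    have ce: "c < u z - s\<^sup>2 / 4 * (q + e)"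
    proof -
      have "u z - c - s\<^sup>2 / 4 * q = s\<^sup>2 * e" using s by (simp add: e_def)
      moreover have "s\<^sup>2 * e > 0" using s e by simp
      ultimately show ?thesis by (simp add: algebra_simps)
    qed
    have uS: "usc (sphere 0 s) (\<lambda>\<zeta>. u (z + \<zeta> *s w))"
      by (rule usc_compose[OF W(2)]) (use D in \<open>auto intro!: continuous_intros\<close>)
    obtain p where p: "p holomorphic_on UNIV" "\<And>\<zeta>. cmod \<zeta> = s \<Longrightarrow> u (z + \<zeta> *s w) < Re (p \<zeta>)"
      "Re (p 0) < u z - s\<^sup>2 / 4 * (q + e)"
      using harmonic_majorant[OF uS, of m] m D s ce unfolding c_def by (metis order_refl)
    have pc: "continuous_on UNIV p" using p(1) by (rule holomorphic_on_imp_continuous_on)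
    define W2 where "W2 = (\<Sum>i\<in>UNIV. w $ i * cnj (w $ i))"
    have W2: "W2 = of_real ((norm w)\<^sup>2)"
      by (simp add: W2_def norm_vec_def L2_set_def sum_nonneg complex_norm_square[symmetric])
    have W20: "W2 \<noteq> 0" using w W2 by simp
    \<comment> \<open>\<open>lam\<close> is the orthogonal projection onto the line of w, in
      multiples of w, and \<open>pr\<close> is the complementary part. Both are complex linear, so
      the function P below is pluriharmonic up to its two squared norms.\<close>
    define lam where "lam x = (\<Sum>i\<in>UNIV. x $ i * cnj (w $ i)) / W2" for x :: "complex^'n"
    define pr where "pr x = x - lam x *s w" for x :: "complex^'n"
    have lam_add: "lam (x + y) = lam x + lam y" for x y
      by (simp add: lam_def sum.distrib distrib_right add_divide_distrib)
    have lam_sm: "lam (h *s x) = h * lam x" for h x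
      by (simp add: lam_def sum_distrib_left mult.assoc)
    have lam_w: "lam w = 1" using W20 by (simp add: lam_def W2_def)
    have lam_lin: "linear lam"
    proof (rule linearI)
      show "lam (r *\<^sub>R x) = r *\<^sub>R lam x" for r x
      proof -
        have "r *\<^sub>R x = of_real r *s x" by (simp add: vec_eq_iff scaleR_conv_of_real[of _ "_::complex"])
        then show ?thesis by (simp add: lam_sm scaleR_conv_of_real)
      qed
    qed (rule lam_add)
    have lam_bl: "bounded_linear lam" using lam_lin linear_conv_bounded_linear by blast
    have pr_bl: "bounded_linear pr"
      unfolding pr_def
      by (intro bounded_linear_sub bounded_linear_ident bounded_linear_compose[OF bounded_linear_smult_left lam_bl])
    have lam_diff: "lam (x - y) = lam x - lam y" for x y by (rule linear_diff[OF lam_lin])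
    have pr_diff: "pr (x - y) = pr x - pr y" for x y by (rule linear_diff[OF bounded_linear.linear[OF pr_bl]])
    have pr_w: "pr (h *s w) = 0" for h by (simp add: pr_def lam_sm lam_w)
    have lam_cont: "continuous_on S (\<lambda>x. lam (f x))" if "continuous_on S f" for S f
      using bounded_linear.continuous_on[OF lam_bl that] .
    have pr_cont: "continuous_on S (\<lambda>x. pr (f x))" if "continuous_on S f" for S f
      using bounded_linear.continuous_on[OF pr_bl that] .
    have lam_pr: "x = lam x *s w + pr x" for x by (simp add: pr_def)
    have lam0: "lam 0 = 0" "pr 0 = 0" by (simp_all add: pr_def lam_def)
    obtain \<sigma>1 where \<sigma>1: "\<sigma>1 > 0" "\<And>\<zeta> x. cmod \<zeta> = s \<Longrightarrow> norm (x - (z + \<zeta> *s w)) \<le> \<sigma>1 \<Longrightarrow> x \<in> W \<and> u x < Re (p \<zeta>)"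
      using usc_tube[OF W, of "\<lambda>\<zeta>. Re (p \<zeta>)" s z w] p(2) D pc by (auto intro!: continuous_intros)
    have "compact ((\<lambda>\<zeta>. z + \<zeta> *s w) ` cball 0 s)" by (intro compact_continuous_image continuous_intros) auto
    moreover have "(\<lambda>\<zeta>. z + \<zeta> *s w) ` cball 0 s \<subseteq> W" using D by auto
    ultimately obtain \<sigma>2 where \<sigma>2: "\<sigma>2 > 0" "(\<Union>x\<in>(\<lambda>\<zeta>. z + \<zeta> *s w) ` cball 0 s. cball x \<sigma>2) \<subseteq> W"
      using W(1) compact_subset_open_imp_cball_epsilon_subset by metis
    define \<sigma> where "\<sigma> = min \<sigma>1 \<sigma>2"
    have \<sigma>: "\<sigma> > 0" using \<sigma>1 \<sigma>2 by (simp add: \<sigma>_def)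
    \<comment> \<open>A compact tube around the disc. Over the circle the harmonic majorant controls
      u; on the lateral boundary the penalty N does.\<close>
    define C where "C = {x. cmod (lam (x - z)) \<le> s \<and> norm (pr (x - z)) \<le> \<sigma>}"
    have xdec: "x - (z + lam (x - z) *s w) = pr (x - z)" for x by (simp add: pr_def algebra_simps)
    have CW: "C \<subseteq> W"
    proof
      fix x assume x: "x \<in> C"
      then have "x \<in> cball (z + lam (x - z) *s w) \<sigma>2"
        using xdec[of x] by (auto simp: C_def \<sigma>_def dist_norm norm_minus_commute)
      moreover have "lam (x - z) \<in> cball 0 s" using x by (simp add: C_def)
      ultimately show "x \<in> W" using \<sigma>2(2) by blast
    qed
    have zC: "z \<in> C" using s \<sigma> by (simp add: C_def lam0)
    have "closed C" unfolding C_def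
      by (intro closed_Collect_conj closed_Collect_le continuous_intros lam_cont pr_cont)
    moreover have "bounded C"
    proof (rule boundedI)
      fix x assume x: "x \<in> C"
      have "x = z + lam (x - z) *s w + pr (x - z)" using xdec[of x] by (simp add: algebra_simps)
      then have "norm x \<le> norm z + norm (lam (x - z) *s w) + norm (pr (x - z))"
        by (metis norm_triangle_le norm_triangle_ineq add_right_mono)
      also have "\<dots> \<le> norm z + s * norm w + \<sigma>"
        using x by (auto simp: C_def norm_smult_cart intro!: add_mono mult_right_mono)
      finally show "norm x \<le> norm z + s * norm w + \<sigma>" .
    qed
    ultimately have Cc: "compact C" by (simp add: compact_eq_bounded_closed)
    have uC: "usc C u" using usc_subset[OF W(2) CW] .
    obtain M where M: "\<And>x. x \<in> C \<Longrightarrow> u x \<le> M" using usc_attains_max[OF uC Cc] zC by blast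
    have "compact ((\<lambda>\<zeta>. Re (p \<zeta>)) ` cball 0 s)"
      by (intro compact_continuous_image continuous_intros continuous_on_subset[OF pc]) auto
    then obtain B where B: "\<And>\<zeta>. cmod \<zeta> \<le> s \<Longrightarrow> \<bar>Re (p \<zeta>)\<bar> \<le> B"
      using compact_imp_bounded by (fastforce simp: bounded_iff)
    \<comment> \<open>As 4Q = q + e, the term -Q|lam|^2 contributes -(q + e) to dd^c P(w, iw), which
      is more than u is allowed to lose.\<close>
    define Q where "Q = (q + e) / 4"
    have Q: "Q > 0" using q e by (simp add: Q_def)
    have Q4: "4 * Q = q + e" by (simp add: Q_def)
    \<comment> \<open>On the lateral boundary, where |pr| = \<sigma>, the penalty exceeds the
      maximum of u plus the size of Re p.\<close>
    define N where "N = (\<bar>M\<bar> + B + 1) / \<sigma>\<^sup>2"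
    have N: "N \<ge> 0" using B[of 0] s \<sigma> by (simp add: N_def)
    have N\<sigma>: "N * \<sigma>\<^sup>2 = \<bar>M\<bar> + B + 1" using \<sigma> by (simp add: N_def)
    define P where "P x = Re (p (lam (x - z))) - Q * (cmod (lam (x - z)))\<^sup>2 + N * (norm (pr (x - z)))\<^sup>2" for x
    define \<Psi> where "\<Psi> x = u x - P x" for x
    have Pc: "continuous_on UNIV P" unfolding P_def
      by (intro continuous_intros continuous_on_compose2[OF pc] lam_cont pr_cont) auto
    have "usc W (\<lambda>x. u x + - P x)"
      by (intro usc_add_continuous W continuous_intros continuous_on_subset[OF Pc]) auto
    then have "usc W \<Psi>" by (rule usc_cong) (simp add: \<Psi>_def)
    then have u\<Psi>: "usc C \<Psi>" using CW by (rule usc_subset)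
    obtain x0 where x0: "x0 \<in> C" "\<And>x. x \<in> C \<Longrightarrow> \<Psi> x \<le> \<Psi> x0"
      using usc_attains_max[OF u\<Psi> Cc] zC by blast
    have \<Psi>z: "\<Psi> z > Q * s\<^sup>2" using p(3) by (simp add: \<Psi>_def P_def lam0 Q_def algebra_simps)
    have Qb: "Q * (cmod (lam (x - z)))\<^sup>2 \<le> Q * s\<^sup>2" if "x \<in> C" for x
      using that Q by (auto simp: C_def intro!: mult_left_mono power_mono)
    have lt1: "cmod (lam (x0 - z)) < s"
    proof (rule ccontr)
      assume "\<not> ?thesis"
      then have eq: "cmod (lam (x0 - z)) = s" using x0(1) by (simp add: C_def)
      have "norm (x0 - (z + lam (x0 - z) *s w)) \<le> \<sigma>1"
        using x0(1) xdec[of x0] by (simp add: C_def \<sigma>_def)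
      from \<sigma>1(2)[OF eq this] have "u x0 < Re (p (lam (x0 - z)))" by simp
      moreover have "N * (norm (pr (x0 - z)))\<^sup>2 \<ge> 0" using N by simp
      ultimately have "\<Psi> x0 \<le> Q * s\<^sup>2" using Qb[OF x0(1)] by (simp add: \<Psi>_def P_def)
      then show False using \<Psi>z x0(2)[OF zC] by simp
    qed
    have lt2: "norm (pr (x0 - z)) < \<sigma>"
    proof (rule ccontr)
      assume "\<not> ?thesis"
      then have eq: "norm (pr (x0 - z)) = \<sigma>" using x0(1) by (simp add: C_def)
      have "\<bar>Re (p (lam (x0 - z)))\<bar> \<le> B" using x0(1) by (intro B) (simp add: C_def)
      then have "\<Psi> x0 \<le> Q * s\<^sup>2" using Qb[OF x0(1)] M[OF x0(1)] N\<sigma> by (simp add: \<Psi>_def P_def eq)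
      then show False using \<Psi>z x0(2)[OF zC] by simp
    qed
    define O' where "O' = {x. cmod (lam (x - z)) < s \<and> norm (pr (x - z)) < \<sigma>}"
    have O': "open O'" "x0 \<in> O'" "O' \<subseteq> C" unfolding O'_def C_def using lt1 lt2
      by (auto intro!: open_Collect_conj open_Collect_less continuous_intros lam_cont pr_cont)
    define a b where "a = lam (x0 - z)" and "b = pr (x0 - z)"
    \<comment> \<open>Admissible relative deviation of the disc from its tangent line. The error it
      causes in P is at most r^2 e/32, below the gain r^2 e/8 of the final comparison.\<close>
    define \<epsilon> where "\<epsilon> = min 1 (e / (32 * (2 * Q + N + 1)))"
    have \<epsilon>: "\<epsilon> > 0" "\<epsilon> \<le> 1" using e Q N by (auto simp: \<epsilon>_def)
    have \<epsilon>2: "\<epsilon> * (2 * Q + N) \<le> e / 32"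
    proof -
      have "\<epsilon> * (2 * Q + N) \<le> \<epsilon> * (2 * Q + N + 1)" using \<epsilon> by (intro mult_left_mono) auto
      also have "\<dots> \<le> e / (32 * (2 * Q + N + 1)) * (2 * Q + N + 1)"
        using Q N by (intro mult_right_mono) (auto simp: \<epsilon>_def)
      also have "\<dots> = e / 32" using Q N by (simp add: field_simps)
      finally show ?thesis .
    qed
    have x0W: "x0 \<in> W" using x0 CW by auto
    obtain \<gamma> where \<gamma>: "disc_at \<gamma> x0 w" "\<exists>\<^sub>F r in at_right 0. u x0 \<le> cmean (\<lambda>\<zeta>. u (\<gamma> \<zeta>)) r + r\<^sup>2 / 4 * (q + e / 2)"
      using A[OF x0W, unfolded asub_def, rule_format, of "e / 2"] e by auto
    obtain \<rho> where \<rho>: "\<rho> > 0" "\<And>i. (\<lambda>\<zeta>. \<gamma> \<zeta> $ i) holomorphic_on ball 0 \<rho>" "continuous_on (ball 0 \<rho>) \<gamma>"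
      using disc_at_holomorphic[OF \<gamma>(1)] by blast
    have \<gamma>0: "\<gamma> 0 = x0" using \<gamma>(1) by (simp add: disc_at_def)
    define g where "g \<zeta> = lam (\<gamma> \<zeta> - x0)" for \<zeta>
    define k where "k \<zeta> = pr (\<gamma> \<zeta> - x0)" for \<zeta>
    have g_hol: "g holomorphic_on ball 0 \<rho>" unfolding g_def lam_def
      using W20 by (auto intro!: holomorphic_intros \<rho>(2))
    have k_hol: "(\<lambda>\<zeta>. k \<zeta> $ i) holomorphic_on ball 0 \<rho>" for i
    proof -
      have "(\<lambda>\<zeta>. k \<zeta> $ i) = (\<lambda>\<zeta>. \<gamma> \<zeta> $ i - x0 $ i - g \<zeta> * w $ i)" by (auto simp: k_def pr_def g_def)
      then show ?thesis using g_hol \<rho>(2) by (auto intro!: holomorphic_intros)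
    qed
    \<comment> \<open>F collects the holomorphic part of P along \<open>\<gamma>\<close>. Besides a
      constant there remain Q|g|^2 and N|k|^2, where |g - \<zeta>| and |k| are at most \<epsilon>r
      on the circle.\<close>
    define F where "F \<zeta> = p (a + g \<zeta>) - of_real (2 * Q) * (cnj a * g \<zeta>) + of_real (2 * N) * (\<Sum>i\<in>UNIV. cnj (b $ i) * k \<zeta> $ i)" for \<zeta>
    have F_hol: "F holomorphic_on ball 0 \<rho>" unfolding F_def
      by (intro holomorphic_intros g_hol k_hol holomorphic_on_compose_gen[OF _ p(1), unfolded o_def]) auto
    define c0 where "c0 = - Q * (cmod a)\<^sup>2 + N * (norm b)\<^sup>2"
    have cm2: "(cmod (a + y))\<^sup>2 = (cmod a)\<^sup>2 + 2 * Re (cnj a * y) + (cmod y)\<^sup>2" for a y :: complex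
      unfolding cmod_power2 by (simp add: power2_eq_square algebra_simps)
    have nm2: "(norm (b + y))\<^sup>2 = (norm b)\<^sup>2 + 2 * (\<Sum>i\<in>UNIV. Re (cnj (b $ i) * y $ i)) + (norm y)\<^sup>2" for b y :: "complex^'n"
      by (simp add: norm_cart_power2 cm2 sum.distrib sum_distrib_left del: times_complex.sel)
    have PF: "P (\<gamma> \<zeta>) = Re (F \<zeta>) + c0 - Q * (cmod (g \<zeta>))\<^sup>2 + N * (norm (k \<zeta>))\<^sup>2" for \<zeta>
    proof -
      have "lam (\<gamma> \<zeta> - z) = a + g \<zeta>" by (simp add: a_def g_def lam_diff)
      moreover have "pr (\<gamma> \<zeta> - z) = b + k \<zeta>" by (simp add: b_def k_def pr_diff)
      ultimately show ?thesis
        by (simp add: P_def F_def c0_def cm2 nm2 algebra_simps del: times_complex.sel)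
           (simp add: algebra_simps)
    qed
    have gk0: "g 0 = 0" "k 0 = 0" by (simp_all add: g_def k_def \<gamma>0 lam0)
    have Px0: "P x0 = Re (F 0) + c0" using PF[of 0] by (simp add: \<gamma>0 gk0)
    obtain L1 where L1: "\<And>x. norm (lam x) \<le> norm x * L1" using bounded_linear.bounded[OF lam_bl] by blast
    obtain L2 where L2: "\<And>x. norm (pr x) \<le> norm x * L2" using bounded_linear.bounded[OF pr_bl] by blast
    define L where "L = \<bar>L1\<bar> + \<bar>L2\<bar> + 1"
    have "L > 0" by (simp add: L_def)
    have lamL: "cmod (lam x) \<le> L * norm x" for x
    proof -
      have "norm x * L1 \<le> norm x * L" by (intro mult_left_mono) (auto simp: L_def)
      then show ?thesis using L1[of x] by (simp add: mult.commute)
    qed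
    have prL: "norm (pr x) \<le> L * norm x" for x
    proof -
      have "norm x * L2 \<le> norm x * L" by (intro mult_left_mono) (auto simp: L_def)
      then show ?thesis using L2[of x] by (simp add: mult.commute)
    qed
    have "(\<gamma> has_derivative (\<lambda>h. h *s w)) (at 0)" using \<gamma>(1) by (simp add: disc_at_def)
    then have "\<exists>d>0. \<forall>y. norm (y - 0) < d \<longrightarrow> norm (\<gamma> y - \<gamma> 0 - (y - 0) *s w) \<le> (\<epsilon> / L) * norm (y - 0)"
      unfolding has_derivative_at_alt using \<epsilon> \<open>L > 0\<close> by (metis divide_pos_pos)
    then obtain d where d: "d > 0" "\<And>y. norm y < d \<Longrightarrow> norm (\<gamma> y - x0 - y *s w) \<le> (\<epsilon> / L) * norm y"
      by (auto simp: \<gamma>0)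
    have "isCont \<gamma> 0" using \<rho>(1,3) by (simp add: continuous_on_eq_continuous_at)
    then have "\<forall>\<^sub>F y in at 0. \<gamma> y \<in> O'" using O' \<gamma>0 by (metis isCont_def topological_tendstoD)
    then obtain d2 where d2: "d2 > 0" "\<And>y. y \<noteq> 0 \<Longrightarrow> norm y < d2 \<Longrightarrow> \<gamma> y \<in> O'"
      unfolding eventually_at by (auto simp: dist_norm)
    define d3 where "d3 = min \<rho> (min d d2)"
    have d3: "d3 > 0" using \<rho> d d2 by (simp add: d3_def)
    have "\<forall>\<^sub>F r in at_right (0::real). r < d3 \<and> 0 < r"
      using d3 by (simp add: eventually_at_right_less eventually_at_right_field) (metis)
    from frequently_eventually_conj[OF \<gamma>(2) this]
    obtain r where r: "r < d3" "0 < r" "u x0 \<le> cmean (\<lambda>\<zeta>. u (\<gamma> \<zeta>)) r + r\<^sup>2 / 4 * (q + e / 2)"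
      by (auto dest: frequently_ex)
    have rr: "r < \<rho>" "r < d" "r < d2" using r by (auto simp: d3_def)
    have \<gamma>c: "continuous_on (sphere 0 r) \<gamma>" by (rule continuous_on_subset[OF \<rho>(3)]) (use rr in auto)
    have \<gamma>O: "\<gamma> \<zeta> \<in> O'" if "cmod \<zeta> = r" for \<zeta> using d2(2)[of \<zeta>] that rr r by auto
    \<comment> \<open>Upper bound for u - Re F on the circle: maximality of x0 gives u \<le> P + u
      x0 - P x0, and there |g|^2 \<ge> (1 - 2\<epsilon>)r^2 and |k|^2 \<le> \<epsilon>r^2.\<close>
    define K where "K = c0 + u x0 - P x0 - Q * ((1 - 2 * \<epsilon>) * r\<^sup>2) + N * (\<epsilon> * r\<^sup>2)"
    have ub: "u (\<gamma> \<zeta>) \<le> Re (F \<zeta>) + K" if \<zeta>: "cmod \<zeta> = r" for \<zeta>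
    proof -
      have dd: "norm (\<gamma> \<zeta> - x0 - \<zeta> *s w) \<le> (\<epsilon> / L) * r" using d(2)[of \<zeta>] \<zeta> rr by simp
      have "g \<zeta> - \<zeta> = lam (\<gamma> \<zeta> - x0 - \<zeta> *s w)" by (simp add: g_def lam_diff lam_sm lam_w)
      then have "cmod (g \<zeta> - \<zeta>) \<le> L * ((\<epsilon> / L) * r)" using lamL dd \<open>L > 0\<close> by (metis mult_left_mono less_imp_le order_trans)
      then have g1: "cmod (g \<zeta> - \<zeta>) \<le> \<epsilon> * r" using \<open>L > 0\<close> by simp
      have "k \<zeta> = pr (\<gamma> \<zeta> - x0 - \<zeta> *s w)" by (simp add: k_def pr_diff pr_w)
      then have "norm (k \<zeta>) \<le> L * ((\<epsilon> / L) * r)" using prL dd \<open>L > 0\<close> by (metis mult_left_mono less_imp_le order_trans)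
      then have k1: "norm (k \<zeta>) \<le> \<epsilon> * r" using \<open>L > 0\<close> by simp
      have "cmod (g \<zeta>) \<ge> r - \<epsilon> * r" using g1 \<zeta> norm_triangle_ineq2[of \<zeta> "\<zeta> - g \<zeta>"] by (simp add: norm_minus_commute)
      then have "(cmod (g \<zeta>))\<^sup>2 \<ge> (r - \<epsilon> * r)\<^sup>2" using \<epsilon> r by (intro power_mono) (auto simp: algebra_simps)
      moreover have "(r - \<epsilon> * r)\<^sup>2 = (1 - 2 * \<epsilon>) * r\<^sup>2 + (\<epsilon> * r)\<^sup>2" by (simp add: power2_eq_square algebra_simps)
      ultimately have "(cmod (g \<zeta>))\<^sup>2 \<ge> (1 - 2 * \<epsilon>) * r\<^sup>2" using zero_le_power2[of "\<epsilon> * r"] by linarith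
      then have g2: "Q * (cmod (g \<zeta>))\<^sup>2 \<ge> Q * ((1 - 2 * \<epsilon>) * r\<^sup>2)" using Q by (intro mult_left_mono) auto
      have "(norm (k \<zeta>))\<^sup>2 \<le> (\<epsilon> * r)\<^sup>2" using k1 by (intro power_mono) auto
      also have "\<dots> \<le> \<epsilon> * r\<^sup>2"
      proof -
        have "\<epsilon> * \<epsilon> \<le> \<epsilon> * 1" using \<epsilon> by (intro mult_left_mono) auto
        then have "\<epsilon> * \<epsilon> * r\<^sup>2 \<le> \<epsilon> * r\<^sup>2" by (intro mult_right_mono) auto
        then show ?thesis by (simp add: power2_eq_square algebra_simps)
      qed
      finally have k2: "N * (norm (k \<zeta>))\<^sup>2 \<le> N * (\<epsilon> * r\<^sup>2)" using N by (intro mult_left_mono) auto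
      have "\<Psi> (\<gamma> \<zeta>) \<le> \<Psi> x0" using x0(2) \<gamma>O[OF \<zeta>] O' by blast
      then show ?thesis using g2 k2 PF[of \<zeta>] by (simp add: \<Psi>_def K_def)
    qed
    have ci: "cint (\<lambda>\<zeta>. u (\<gamma> \<zeta>)) r"
      by (rule cint_disc[OF W(2) m _ \<gamma>c]) (use \<gamma>O O' CW r in auto)
    have "continuous_on (sphere 0 r) F"
      by (intro holomorphic_on_imp_continuous_on holomorphic_on_subset[OF F_hol]) (use rr in auto)
    then have ciF: "cint (\<lambda>\<zeta>. Re (F \<zeta>)) r" using r by (intro continuous_cint continuous_intros) auto
    have "cmean (\<lambda>\<zeta>. u (\<gamma> \<zeta>)) r \<le> cmean (\<lambda>\<zeta>. Re (F \<zeta>) + K) r"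
      using r ub by (intro cmean_mono ci cint_add ciF cint_const) auto
    also have "\<dots> = Re (F 0) + K"
      using cmean_holomorphic[OF F_hol r(2) rr(1)] by (simp add: cmean_add[OF ciF cint_const])
    finally have "u x0 \<le> Re (F 0) + K + r\<^sup>2 / 4 * (q + e / 2)" using r(3) by simp
    then have "0 \<le> - Q * ((1 - 2 * \<epsilon>) * r\<^sup>2) + N * (\<epsilon> * r\<^sup>2) + r\<^sup>2 / 4 * (4 * Q - e / 2)"
    proof -
      have "q + e / 2 = 4 * Q - e / 2" using Q4 by simp
      then show ?thesis using \<open>u x0 \<le> Re (F 0) + K + r\<^sup>2 / 4 * (q + e / 2)\<close> by (simp only: K_def Px0)
    qed
    also have "\<dots> = r\<^sup>2 * (\<epsilon> * (2 * Q + N) - e / 8)" by (simp add: algebra_simps)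
    finally have "0 \<le> \<epsilon> * (2 * Q + N) - e / 8" using r by (simp add: zero_le_mult_iff)
    then show False using \<epsilon>2 e by simp
  qed
qed

section \<open>Stability of \<open>asub\<close> under touching, coordinate changes and small
  shifts\<close>

lemma asub_mono:
  assumes "asub u z w q" "q \<le> q'"
  shows "asub u z w q'"
  unfolding asub_def
proof (intro allI impI)
  fix e :: real assume e: "e > 0"
  obtain \<gamma> where \<gamma>: "disc_at \<gamma> z w" "\<exists>\<^sub>F r in at_right 0. u z \<le> cmean (\<lambda>\<zeta>. u (\<gamma> \<zeta>)) r + r\<^sup>2 / 4 * (q + e)"
    using assms(1) e unfolding asub_def by blast
  have "u z \<le> cmean (\<lambda>\<zeta>. u (\<gamma> \<zeta>)) r + r\<^sup>2 / 4 * (q' + e)"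
    if "u z \<le> cmean (\<lambda>\<zeta>. u (\<gamma> \<zeta>)) r + r\<^sup>2 / 4 * (q + e)" for r
  proof -
    have "r\<^sup>2 / 4 * (q + e) \<le> r\<^sup>2 / 4 * (q' + e)" using assms(2) by (intro mult_left_mono) auto
    then show ?thesis using that by linarith
  qed
  then show "\<exists>\<gamma>. disc_at \<gamma> z w \<and> (\<exists>\<^sub>F r in at_right 0. u z \<le> cmean (\<lambda>\<zeta>. u (\<gamma> \<zeta>)) r + r\<^sup>2 / 4 * (q' + e))"
    using \<gamma> by (meson frequently_elim1)
qed

lemma disc_at_eventually:
  assumes "disc_at \<gamma> z w" "open A" "z \<in> A"
  shows "\<exists>d>0. continuous_on (ball 0 d) \<gamma> \<and> \<gamma> ` ball 0 d \<subseteq> A"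
proof -
  obtain \<rho> where \<rho>: "\<rho> > 0" "continuous_on (ball 0 \<rho>) \<gamma>"
    using disc_at_holomorphic[OF assms(1)] by metis
  have "openin (top_of_set (ball 0 \<rho>)) (ball 0 \<rho> \<inter> \<gamma> -` A)"
    using \<rho>(2) assms(2) continuous_openin_preimage_gen by blast
  then have "open (ball 0 \<rho> \<inter> \<gamma> -` A)" by (simp add: openin_open_eq)
  moreover have "0 \<in> ball 0 \<rho> \<inter> \<gamma> -` A" using \<rho> assms by (auto simp: disc_at_def)
  ultimately obtain d where "d > 0" "ball 0 d \<subseteq> ball 0 \<rho> \<inter> \<gamma> -` A" using open_contains_ball by blast
  then show ?thesis using \<rho>(2) continuous_on_subset by (metis image_subset_iff_subset_vimage le_inf_iff)
qed

lemma eventually_at_right_0_less: "0 < d \<Longrightarrow> \<forall>\<^sub>F r in at_right (0::real). 0 < r \<and> r < d"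
  by (auto simp: eventually_at_right_field)

text \<open>At z the two values agree, and the circle means of v are no smaller, so the discs of u
  serve v. Maxima are glued this way: at each point one of the glued functions touches from
  below.\<close>

lemma asub_touch:
  fixes u v :: "complex^'n \<Rightarrow> real"
  assumes u: "asub u z w q" and A: "open A" "z \<in> A" "usc A u" "usc A v"
    and uv: "\<And>x. x \<in> A \<Longrightarrow> m \<le> u x" "\<And>x. x \<in> A \<Longrightarrow> u x \<le> v x" "v z \<le> u z"
  shows "asub v z w q"
  unfolding asub_def
proof (intro allI impI)
  fix e :: real assume e: "e > 0"
  obtain \<gamma> where \<gamma>: "disc_at \<gamma> z w" "\<exists>\<^sub>F r in at_right 0. u z \<le> cmean (\<lambda>\<zeta>. u (\<gamma> \<zeta>)) r + r\<^sup>2 / 4 * (q + e)"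
    using assms(1) e unfolding asub_def by blast
  obtain d where d: "d > 0" "continuous_on (ball 0 d) \<gamma>" "\<gamma> ` ball 0 d \<subseteq> A"
    using disc_at_eventually[OF \<gamma>(1) A(1,2)] by blast
  have *: "v z \<le> cmean (\<lambda>\<zeta>. v (\<gamma> \<zeta>)) r + r\<^sup>2 / 4 * (q + e)"
    if r: "0 < r \<and> r < d" "u z \<le> cmean (\<lambda>\<zeta>. u (\<gamma> \<zeta>)) r + r\<^sup>2 / 4 * (q + e)" for r
  proof -
    have c: "continuous_on (sphere 0 r) \<gamma>" by (rule continuous_on_subset[OF d(2)]) (use r in auto)
    have i: "\<gamma> \<zeta> \<in> A" if "cmod \<zeta> = r" for \<zeta> using d(3) r that by (auto simp: image_subset_iff)
    have "cmean (\<lambda>\<zeta>. u (\<gamma> \<zeta>)) r \<le> cmean (\<lambda>\<zeta>. v (\<gamma> \<zeta>)) r"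
      using i r uv A by (intro cmean_mono cint_disc[OF A(3) uv(1) _ c] cint_disc[OF A(4) _ _ c, of m]) (auto intro: order_trans)
    then show ?thesis using r uv(3) by linarith
  qed
  have "\<exists>\<^sub>F r in at_right 0. v z \<le> cmean (\<lambda>\<zeta>. v (\<gamma> \<zeta>)) r + r\<^sup>2 / 4 * (q + e)"
    using frequently_eventually_conj[OF \<gamma>(2) eventually_at_right_0_less[OF d(1)]]
    by (rule frequently_elim1) (use * in auto)
  then show "\<exists>\<gamma>. disc_at \<gamma> z w \<and> (\<exists>\<^sub>F r in at_right 0. v z \<le> cmean (\<lambda>\<zeta>. v (\<gamma> \<zeta>)) r + r\<^sup>2 / 4 * (q + e))"
    using \<gamma>(1) by blast
qed

text \<open>Composition with F sends a disc with 1-jet (z, w) to one with 1-jet (F z, f' w), and the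
  circle means along the two discs are the same numbers.\<close>

lemma asub_transport:
  fixes F :: "complex^'n \<Rightarrow> complex^'m"
  assumes u: "asub u z w q" and A: "open A" "z \<in> A" and F: "holomorphic_map_on A F"
    and f': "(F has_derivative f') (at z)" and uv: "\<And>x. x \<in> A \<Longrightarrow> v (F x) = u x"
  shows "asub v (F z) (f' w) q"
  unfolding asub_def
proof (intro allI impI)
  fix e :: real assume e: "e > 0"
  obtain \<gamma> where \<gamma>: "disc_at \<gamma> z w" "\<exists>\<^sub>F r in at_right 0. u z \<le> cmean (\<lambda>\<zeta>. u (\<gamma> \<zeta>)) r + r\<^sup>2 / 4 * (q + e)"
    using assms(1) e unfolding asub_def by blast
  obtain d where d: "d > 0" "continuous_on (ball 0 d) \<gamma>" "\<gamma> ` ball 0 d \<subseteq> A"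
    using disc_at_eventually[OF \<gamma>(1) A] by blast
  have lin: "f' (c *s y) = c *s f' y" for c y
  proof -
    obtain f'' where "(F has_derivative f'') (at z)" "\<forall>c w. f'' (c *s w) = c *s f'' w"
      using F A(2) by (auto simp: holomorphic_map_on_def)
    then show ?thesis using f' has_derivative_unique by blast
  qed
  obtain \<rho> where \<rho>: "\<rho> > 0" "\<forall>\<zeta>\<in>ball 0 \<rho>. \<exists>d. (\<gamma> has_derivative (\<lambda>h. h *s d)) (at \<zeta>)"
    using \<gamma>(1) by (auto simp: disc_at_def)
  have \<gamma>0: "\<gamma> 0 = z" "(\<gamma> has_derivative (\<lambda>h. h *s w)) (at 0)" using \<gamma>(1) by (auto simp: disc_at_def)
  have "((\<lambda>\<zeta>. F (\<gamma> \<zeta>)) has_derivative (\<lambda>h. f' (h *s w))) (at 0)"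
    by (rule has_derivative_compose[OF \<gamma>0(2)]) (simp add: \<gamma>0 f')
  moreover have "\<exists>d. ((\<lambda>\<zeta>. F (\<gamma> \<zeta>)) has_derivative (\<lambda>h. h *s d)) (at \<zeta>)" if "\<zeta> \<in> ball 0 (min \<rho> d)" for \<zeta>
  proof -
    have "\<zeta> \<in> ball 0 \<rho>" using that by simp
    with \<rho>(2) obtain c where c: "(\<gamma> has_derivative (\<lambda>h. h *s c)) (at \<zeta>)" by blast
    have "\<gamma> \<zeta> \<in> A" using d(3) that by (auto simp: image_subset_iff)
    then obtain g' where g': "(F has_derivative g') (at (\<gamma> \<zeta>))" "\<forall>c w. g' (c *s w) = c *s g' w"
      using F by (auto simp: holomorphic_map_on_def)
    have "((\<lambda>\<zeta>. F (\<gamma> \<zeta>)) has_derivative (\<lambda>h. g' (h *s c))) (at \<zeta>)"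
      by (rule has_derivative_compose[OF c g'(1)])
    then show ?thesis using g'(2) by auto
  qed
  ultimately have D: "disc_at (\<lambda>\<zeta>. F (\<gamma> \<zeta>)) (F z) (f' w)"
    unfolding disc_at_def using \<gamma>0 lin \<rho>(1) d(1) by (auto intro!: exI[of _ "min \<rho> d"])
  have *: "v (F z) \<le> cmean (\<lambda>\<zeta>. v (F (\<gamma> \<zeta>))) r + r\<^sup>2 / 4 * (q + e)"
    if r: "0 < r \<and> r < d" "u z \<le> cmean (\<lambda>\<zeta>. u (\<gamma> \<zeta>)) r + r\<^sup>2 / 4 * (q + e)" for r
  proof -
    have "cmean (\<lambda>\<zeta>. v (F (\<gamma> \<zeta>))) r = cmean (\<lambda>\<zeta>. u (\<gamma> \<zeta>)) r"
      by (rule cmean_cong) (use r d(3) uv in \<open>auto simp: image_subset_iff\<close>)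
    then show ?thesis using r uv[OF A(2)] by simp
  qed
  have "\<exists>\<^sub>F r in at_right 0. v (F z) \<le> cmean (\<lambda>\<zeta>. v (F (\<gamma> \<zeta>))) r + r\<^sup>2 / 4 * (q + e)"
    using frequently_eventually_conj[OF \<gamma>(2) eventually_at_right_0_less[OF d(1)]]
    by (rule frequently_elim1) (use * in auto)
  then show "\<exists>\<gamma>. disc_at \<gamma> (F z) (f' w) \<and> (\<exists>\<^sub>F r in at_right 0. v (F z) \<le> cmean (\<lambda>\<zeta>. v (\<gamma> \<zeta>)) r + r\<^sup>2 / 4 * (q + e))"
    using D by blast
qed

lemma asub_linearI:
  assumes "\<And>e. e > 0 \<Longrightarrow> \<forall>\<^sub>F r in at_right 0. u z \<le> cmean (\<lambda>\<zeta>. u (z + \<zeta> *s w)) r + r\<^sup>2 / 4 * (q + e)"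
  shows "asub u z w q"
  unfolding asub_def
  using assms disc_at_linear[of z w] by (meson eventually_frequently trivial_limit_at_right_real)

lemma disc_in_ball:
  fixes z :: "complex^'n"
  assumes "dist z c + s * norm w < R" "cmod \<zeta> \<le> s"
  shows "z + \<zeta> *s w \<in> ball c R"
proof -
  have "norm (z + \<zeta> *s w - c) \<le> norm (z - c) + norm (\<zeta> *s w)"
    by (metis add_diff_eq add.commute norm_triangle_ineq diff_add_eq)
  also have "\<dots> \<le> dist z c + s * norm w" using assms(2) by (simp add: norm_smult_cart dist_norm mult_right_mono)
  finally show ?thesis using assms(1) by (simp add: dist_norm norm_minus_commute)
qed

text \<open>The radius does not depend on \<open>u\<close>.\<close>

lemma disc_submean_uniform:
  fixes W :: "(complex^'n) set"
  assumes W: "open W" "z0 \<in> W" and h: "continuous_on W h" "\<And>x. x \<in> W \<Longrightarrow> 0 \<le> h x" and e: "0 < e"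
  obtains \<rho> where "\<rho> > 0" "ball z0 (2 * \<rho>) \<subseteq> W"
    "\<And>u m z s. usc W u \<Longrightarrow> (\<And>x. x \<in> W \<Longrightarrow> m \<le> u x) \<Longrightarrow> (\<And>x. x \<in> W \<Longrightarrow> asub u x w (h x)) \<Longrightarrow>
       dist z z0 < \<rho> \<Longrightarrow> 0 < s \<Longrightarrow> s * norm w < \<rho> \<Longrightarrow>
       u z \<le> cmean (\<lambda>\<zeta>. u (z + \<zeta> *s w)) s + s\<^sup>2 / 4 * (h z0 + e)"
proof -
  have "usc W h" using continuous_imp_usc h(1) by blast
  then have "\<forall>\<^sub>F x in nhds z0. x \<in> W \<and> h x < h z0 + e" using W e by (intro usc_openD) auto
  then obtain d where d: "d > 0" "\<And>x. dist x z0 < d \<Longrightarrow> x \<in> W \<and> h x < h z0 + e"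
    by (auto simp: eventually_nhds_metric)
  show ?thesis
  proof
    show "d / 2 > 0" using d by simp
    show s: "ball z0 (2 * (d / 2)) \<subseteq> W" using d by (auto simp: dist_commute)
    fix u m z s
    assume a: "usc W u" "\<And>x. x \<in> W \<Longrightarrow> m \<le> u x" "\<And>x. x \<in> W \<Longrightarrow> asub u x w (h x)"
       "dist z z0 < d / 2" "0 < s" "s * norm w < d / 2"
    show "u z \<le> cmean (\<lambda>\<zeta>. u (z + \<zeta> *s w)) s + s\<^sup>2 / 4 * (h z0 + e)"
    proof (rule disc_submean[where W = "ball z0 d" and m = m])
      show "usc (ball z0 d) u" using a(1) s by (intro usc_subset[OF a(1)]) auto
      show "0 \<le> h z0 + e" using h(2) W e by (simp add: add_nonneg_nonneg less_imp_le)
      show "m \<le> u x" if "x \<in> ball z0 d" for x using that a(2) d by (simp add: dist_commute)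
      show "asub u x w (h z0 + e)" if "x \<in> ball z0 d" for x
        using that d(2)[of x] by (intro asub_mono[OF a(3)]) (auto simp: dist_commute)
      show "z + \<zeta> *s w \<in> ball z0 d" if "cmod \<zeta> \<le> s" for \<zeta>
        by (rule disc_in_ball[OF _ that]) (use a in auto)
    qed (use a in auto)
  qed
qed

lemma eventually_disc_ball:
  fixes z :: "complex^'n"
  assumes "open W" "z \<in> W"
  obtains d where "d > 0" "\<And>r \<zeta>. 0 < r \<Longrightarrow> r < d \<Longrightarrow> cmod \<zeta> \<le> r \<Longrightarrow> z + \<zeta> *s w \<in> W"
proof -
  obtain d where d: "d > 0" "\<gamma> ` ball 0 d \<subseteq> W" if "\<gamma> = (\<lambda>\<zeta>. z + \<zeta> *s w)" for \<gamma>
    using disc_at_eventually[OF disc_at_linear assms] by metis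
  show ?thesis using d by (intro that[of d]) (auto simp: image_subset_iff)
qed

text \<open>A harmonic majorant of u on one circle majorises u on a tube around it. Hence a strict
  bound for the mean passes to functions whose values on the circle are at most values of u nearby,
  such as mollifications or restrictions to shifted circles.\<close>

lemma cmean_tube:
  fixes u :: "complex^'n \<Rightarrow> real"
  assumes W: "open W" "usc W u" "\<And>x. x \<in> W \<Longrightarrow> m \<le> u x" "0 < s" "\<And>\<zeta>. cmod \<zeta> = s \<Longrightarrow> z + \<zeta> *s w \<in> W"
    and c: "cmean (\<lambda>\<zeta>. u (z + \<zeta> *s w)) s < c"
  shows "\<exists>\<sigma>>0. (\<forall>\<zeta> x. cmod \<zeta> = s \<longrightarrow> norm (x - (z + \<zeta> *s w)) \<le> \<sigma> \<longrightarrow> x \<in> W) \<and>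
    (\<forall>f. cint f s \<longrightarrow> (\<forall>\<zeta>. cmod \<zeta> = s \<longrightarrow> (\<exists>x. norm (x - (z + \<zeta> *s w)) \<le> \<sigma> \<and> f \<zeta> \<le> u x)) \<longrightarrow> cmean f s < c)"
proof -
  have uS: "usc (sphere 0 s) (\<lambda>\<zeta>. u (z + \<zeta> *s w))"
    by (rule usc_compose[OF W(2)]) (use W in \<open>auto intro!: continuous_intros\<close>)
  have um: "m \<le> u (z + \<zeta> *s w)" if "cmod \<zeta> = s" for \<zeta> using W that by auto
  obtain p where p: "p holomorphic_on UNIV" "\<And>\<zeta>. cmod \<zeta> = s \<Longrightarrow> u (z + \<zeta> *s w) < Re (p \<zeta>)" "Re (p 0) < c"
    using harmonic_majorant[OF uS um W(4) c] by blast
  have pc: "continuous_on UNIV p" using p(1) by (rule holomorphic_on_imp_continuous_on)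
  obtain \<sigma> where \<sigma>: "\<sigma> > 0" "\<And>\<zeta> x. cmod \<zeta> = s \<Longrightarrow> norm (x - (z + \<zeta> *s w)) \<le> \<sigma> \<Longrightarrow> x \<in> W \<and> u x < Re (p \<zeta>)"
    using usc_tube[OF W(1,2), of "\<lambda>\<zeta>. Re (p \<zeta>)" s z w] p(2) W(5) pc by (auto intro!: continuous_intros)
  show ?thesis
  proof (intro exI[of _ \<sigma>] conjI allI impI)
    fix f assume f: "cint f s" "\<forall>\<zeta>. cmod \<zeta> = s \<longrightarrow> (\<exists>x. norm (x - (z + \<zeta> *s w)) \<le> \<sigma> \<and> f \<zeta> \<le> u x)"
    have "cint (\<lambda>\<zeta>. Re (p \<zeta>)) s" using W(4)
      by (intro continuous_cint continuous_intros continuous_on_subset[OF pc]) auto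
    moreover have "f \<zeta> \<le> Re (p \<zeta>)" if "cmod \<zeta> = s" for \<zeta>
      using f(2) that \<sigma>(2)[OF that] by force
    ultimately have "cmean f s \<le> cmean (\<lambda>\<zeta>. Re (p \<zeta>)) s" using W(4) f(1) by (intro cmean_mono) auto
    also have "\<dots> = Re (p 0)"
      by (rule cmean_holomorphic[of p "s + 1"]) (use p(1) W(4) in \<open>auto intro: holomorphic_on_subset\<close>)
    finally show "cmean f s < c" using p(3) by simp
  qed (use \<sigma> in auto)
qed

section \<open>Quadratic and logarithmic model functions\<close>

lemma norm_add_smult_power2:
  fixes b w :: "complex^'n"
  shows "(norm (b + \<zeta> *s w))\<^sup>2 = (norm b)\<^sup>2 + 2 * Re (\<zeta> * (\<Sum>i\<in>UNIV. cnj (b $ i) * w $ i)) + (cmod \<zeta>)\<^sup>2 * (norm w)\<^sup>2"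
proof -
  have cm2: "(cmod (a + y))\<^sup>2 = (cmod a)\<^sup>2 + 2 * Re (cnj a * y) + (cmod y)\<^sup>2" for a y :: complex
    unfolding cmod_power2 by (simp add: power2_eq_square algebra_simps)
  have "(norm (b + \<zeta> *s w))\<^sup>2 = (\<Sum>i\<in>UNIV. (cmod (b $ i))\<^sup>2 + 2 * Re (\<zeta> * (cnj (b $ i) * w $ i)) + (cmod \<zeta>)\<^sup>2 * (cmod (w $ i))\<^sup>2)"
    unfolding norm_cart_power2
    by (intro sum.cong refl) (simp add: cm2 norm_mult power_mult_distrib mult.left_commute del: times_complex.sel)
  also have "\<dots> = (norm b)\<^sup>2 + 2 * Re (\<zeta> * (\<Sum>i\<in>UNIV. cnj (b $ i) * w $ i)) + (cmod \<zeta>)\<^sup>2 * (norm w)\<^sup>2"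
    by (simp add: sum.distrib norm_cart_power2 sum_distrib_left del: times_complex.sel)
  finally show ?thesis .
qed

text \<open>The cross term is the real part of a linear holomorphic function and has mean
  zero.\<close>

lemma cmean_norm_power2:
  fixes z c w :: "complex^'n"
  assumes "0 < r"
  shows "cmean (\<lambda>\<zeta>. (norm (z + \<zeta> *s w - c))\<^sup>2) r = (norm (z - c))\<^sup>2 + r\<^sup>2 * (norm w)\<^sup>2"
proof -
  define F where "F \<zeta> = of_real ((norm (z - c))\<^sup>2 + r\<^sup>2 * (norm w)\<^sup>2) + 2 * \<zeta> * (\<Sum>i\<in>UNIV. cnj ((z - c) $ i) * w $ i)" for \<zeta>
  have "cmean (\<lambda>\<zeta>. (norm (z + \<zeta> *s w - c))\<^sup>2) r = cmean (\<lambda>\<zeta>. Re (F \<zeta>)) r"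
  proof (rule cmean_cong)
    fix \<zeta> assume "cmod \<zeta> = r"
    moreover have "z + \<zeta> *s w - c = (z - c) + \<zeta> *s w" by simp
    ultimately show "(norm (z + \<zeta> *s w - c))\<^sup>2 = Re (F \<zeta>)"
      by (simp only: norm_add_smult_power2) (simp add: F_def algebra_simps)
  qed (use assms in auto)
  also have "\<dots> = Re (F 0)"
    by (rule cmean_holomorphic[of F "r + 1"]) (use assms in \<open>auto simp: F_def[abs_def] intro!: holomorphic_intros\<close>)
  finally show ?thesis by (simp add: F_def)
qed

text \<open>dd^c|x|^2 (w, iw) = 4|w|^2. The discs that \<open>asub\<close> provides for u may be
  curved, where the mean of the quadratic term is not explicit; therefore
  \<open>disc_submean\<close> first supplies the inequality for u on straight discs.\<close>

lemma asub_affine_quadratic: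
  fixes u :: "complex^'n \<Rightarrow> real"
  assumes W: "open W" "usc W u" "\<And>x. x \<in> W \<Longrightarrow> m \<le> u x" "z \<in> W" "\<And>x. x \<in> W \<Longrightarrow> asub u x w q" "0 \<le> q"
    and a: "0 < a"
  shows "asub (\<lambda>x. a * u x + b + C * (norm (x - c))\<^sup>2) z w (a * q - 4 * C * (norm w)\<^sup>2)"
proof (rule asub_linearI)
  fix e :: real assume e: "e > 0"
  obtain d where d: "d > 0" "\<And>r \<zeta>. 0 < r \<Longrightarrow> r < d \<Longrightarrow> cmod \<zeta> \<le> r \<Longrightarrow> z + \<zeta> *s w \<in> W"
    using eventually_disc_ball[OF W(1,4)] by metis
  show "\<forall>\<^sub>F r in at_right 0. a * u z + b + C * (norm (z - c))\<^sup>2 \<le>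
      cmean (\<lambda>\<zeta>. a * u (z + \<zeta> *s w) + b + C * (norm (z + \<zeta> *s w - c))\<^sup>2) r + r\<^sup>2 / 4 * (a * q - 4 * C * (norm w)\<^sup>2 + e)"
    using eventually_at_right_0_less[OF d(1)]
  proof eventually_elim
    case (elim r)
    have ci: "cint (\<lambda>\<zeta>. u (z + \<zeta> *s w)) r"
      by (rule cint_disc[OF W(2,3)]) (use d elim in \<open>auto intro!: continuous_intros\<close>)
    have ciq: "cint (\<lambda>\<zeta>. (norm (z + \<zeta> *s w - c))\<^sup>2) r"
      using elim by (intro continuous_cint continuous_intros) auto
    have "u z \<le> cmean (\<lambda>\<zeta>. u (z + \<zeta> *s w)) r + r\<^sup>2 / 4 * q"
      using d elim by (intro disc_submean[OF W(1,2,3,6,5)]) auto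
    then have "a * u z \<le> a * (cmean (\<lambda>\<zeta>. u (z + \<zeta> *s w)) r + r\<^sup>2 / 4 * q)" using a by (intro mult_left_mono) auto
    moreover have "cmean (\<lambda>\<zeta>. a * u (z + \<zeta> *s w) + b + C * (norm (z + \<zeta> *s w - c))\<^sup>2) r =
        a * cmean (\<lambda>\<zeta>. u (z + \<zeta> *s w)) r + b + C * ((norm (z - c))\<^sup>2 + r\<^sup>2 * (norm w)\<^sup>2)"
      using elim by (simp add: cmean_add cint_add cint_cmult ci ciq cint_const cmean_cmult cmean_norm_power2)
    moreover have "r\<^sup>2 / 4 * e \<ge> 0" using e by simp
    ultimately show ?case by (simp add: algebra_simps add_divide_distrib)
  qed
qed

text \<open>On the disc the integrand is the real part of Ln (1 + \<zeta>\<beta>/\<alpha>) plus a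
  constant, holomorphic because 1 + \<zeta>\<beta>/\<alpha> has positive real part there.\<close>

lemma cmean_ln:
  assumes "\<alpha> \<noteq> 0" "0 < r" "r * cmod \<beta> < cmod \<alpha>"
  shows "cmean (\<lambda>\<zeta>. ln (cmod (\<alpha> + \<zeta> * \<beta>))) r = ln (cmod \<alpha>)"
proof (cases "\<beta> = 0")
  case False
  define \<rho> where "\<rho> = cmod \<alpha> / cmod \<beta>"
  have r: "r < \<rho>" using assms False by (simp add: \<rho>_def field_simps)
  define F where "F \<zeta> = Ln (1 + \<zeta> * (\<beta> / \<alpha>)) + of_real (ln (cmod \<alpha>))" for \<zeta>
  have pos: "0 < Re (1 + \<zeta> * (\<beta> / \<alpha>))" if "cmod \<zeta> < \<rho>" for \<zeta>
  proof -
    have "cmod (\<zeta> * (\<beta> / \<alpha>)) < 1" using that assms False by (simp add: \<rho>_def norm_mult norm_divide field_simps)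
    then have "\<bar>Re (\<zeta> * (\<beta> / \<alpha>))\<bar> < 1" using abs_Re_le_cmod[of "\<zeta> * (\<beta> / \<alpha>)"] by linarith
    then show ?thesis by (simp del: times_complex.sel)
  qed
  have "F holomorphic_on ball 0 \<rho>"
    unfolding F_def by (intro holomorphic_intros) (use pos complex_nonpos_Reals_iff in force)
  then have "cmean (\<lambda>\<zeta>. Re (F \<zeta>)) r = Re (F 0)" using assms r by (intro cmean_holomorphic) auto
  moreover have "Re (F \<zeta>) = ln (cmod (\<alpha> + \<zeta> * \<beta>))" if "cmod \<zeta> < \<rho>" for \<zeta>
  proof -
    have nz: "1 + \<zeta> * (\<beta> / \<alpha>) \<noteq> 0" using pos[OF that] by (metis less_irrefl zero_complex.sel(1))
    have "\<alpha> + \<zeta> * \<beta> = (1 + \<zeta> * (\<beta> / \<alpha>)) * \<alpha>" using assms by (simp add: field_simps)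
    then have "ln (cmod (\<alpha> + \<zeta> * \<beta>)) = ln (cmod (1 + \<zeta> * (\<beta> / \<alpha>))) + ln (cmod \<alpha>)"
      using nz assms by (simp only: norm_mult) (simp add: ln_mult)
    then show ?thesis using nz by (simp add: F_def Re_Ln)
  qed
  moreover have "cmean (\<lambda>\<zeta>. Re (F \<zeta>)) r = cmean (\<lambda>\<zeta>. ln (cmod (\<alpha> + \<zeta> * \<beta>))) r"
    using calculation(2) r assms by (intro cmean_cong) auto
  moreover have "\<rho> > 0" using r assms by simp
  ultimately show ?thesis by (metis mult_zero_left add.right_neutral norm_zero)
qed simp

lemma norm_sum_cnj_le:
  fixes x y :: "complex^'n"
  shows "cmod (\<Sum>i\<in>UNIV. x $ i * cnj (y $ i)) \<le> norm x * norm y"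
proof -
  have "cmod (\<Sum>i\<in>UNIV. x $ i * cnj (y $ i)) \<le> (\<Sum>i\<in>UNIV. cmod (x $ i) * cmod (y $ i))"
    by (rule order_trans[OF norm_sum]) (simp add: norm_mult)
  also have "\<dots> \<le> norm x * norm y" unfolding norm_vec_def
    using L2_set_mult_ineq[of "\<lambda>i. cmod (x $ i)" "\<lambda>i. cmod (y $ i)" UNIV] by simp
  finally show ?thesis .
qed

text \<open>By Cauchy-Schwarz, the inner product with z/|z| bounds |z + \<zeta>w| from below by
  |\<alpha> + \<zeta>\<beta>|, with equality at \<zeta> = 0, and the logarithm of this lower bound
  has its centre value as mean.\<close>

lemma ln_norm_submean:
  fixes z w :: "complex^'n"
  assumes z: "z \<noteq> 0" and r: "0 < r" "r * norm w < norm z"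
  shows "ln (norm z) \<le> cmean (\<lambda>\<zeta>. ln (norm (z + \<zeta> *s w))) r"
proof -
  define \<alpha> \<beta> where "\<alpha> = complex_of_real (norm z)" and "\<beta> = (\<Sum>i\<in>UNIV. w $ i * cnj (z $ i)) / norm z"
  have nz: "norm z > 0" using z by simp
  have \<beta>: "cmod \<beta> \<le> norm w" using norm_sum_cnj_le[of w z] nz by (simp add: \<beta>_def norm_divide field_simps)
  have small: "r * cmod \<beta> < cmod \<alpha>"
  proof -
    have "r * cmod \<beta> \<le> r * norm w" using \<beta> r by (intro mult_left_mono) auto
    moreover have "cmod \<alpha> = norm z" by (simp add: \<alpha>_def)
    ultimately show ?thesis using r by linarith
  qed
  have zz: "(\<Sum>i\<in>UNIV. z $ i * cnj (z $ i)) = of_real ((norm z)\<^sup>2)"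
    by (simp add: norm_cart_power2 complex_norm_square[symmetric])
  have le: "cmod (\<alpha> + \<zeta> * \<beta>) \<le> norm (z + \<zeta> *s w)" for \<zeta>
  proof -
    have "(\<Sum>i\<in>UNIV. (z + \<zeta> *s w) $ i * cnj (z $ i)) = of_real (norm z) * (\<alpha> + \<zeta> * \<beta>)"
      using nz zz by (simp add: \<alpha>_def \<beta>_def distrib_right sum.distrib sum_distrib_left mult.assoc power2_eq_square field_simps)
    then have "norm z * cmod (\<alpha> + \<zeta> * \<beta>) \<le> norm (z + \<zeta> *s w) * norm z"
      using norm_sum_cnj_le[of "z + \<zeta> *s w" z] by (simp add: norm_mult)
    then show ?thesis using nz by (simp add: mult.commute)
  qed
  have pos: "cmod (\<alpha> + \<zeta> * \<beta>) > 0" if "cmod \<zeta> = r" for \<zeta>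
  proof -
    have "cmod \<alpha> \<le> cmod (\<alpha> + \<zeta> * \<beta>) + cmod (\<zeta> * \<beta>)" by (metis add_diff_cancel_right' norm_triangle_ineq4)
    moreover have "cmod (\<zeta> * \<beta>) = r * cmod \<beta>" using that by (simp add: norm_mult)
    ultimately show ?thesis using small by linarith
  qed
  have pos2: "norm (z + \<zeta> *s w) > 0" if "cmod \<zeta> = r" for \<zeta> using pos[OF that] le[of \<zeta>] by linarith
  have "ln (norm z) = cmean (\<lambda>\<zeta>. ln (cmod (\<alpha> + \<zeta> * \<beta>))) r"
    using cmean_ln[of \<alpha> r \<beta>] nz r small by (simp add: \<alpha>_def)
  also have "\<dots> \<le> cmean (\<lambda>\<zeta>. ln (norm (z + \<zeta> *s w))) r"
  proof (rule cmean_mono)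
    show "cint (\<lambda>\<zeta>. ln (cmod (\<alpha> + \<zeta> * \<beta>))) r"
      using pos r by (intro continuous_cint continuous_intros) force+
    show "cint (\<lambda>\<zeta>. ln (norm (z + \<zeta> *s w))) r"
      using pos2 r by (intro continuous_cint continuous_intros) force+
    show "ln (cmod (\<alpha> + \<zeta> * \<beta>)) \<le> ln (norm (z + \<zeta> *s w))" if "cmod \<zeta> = r" for \<zeta>
      using pos[OF that] le[of \<zeta>] ln_mono by blast
  qed (use r in auto)
  finally show ?thesis .
qed

text \<open>Comparison with the multiple of the logarithm that takes the values A and B on the two
  spheres. Adding e|x - c|^2 makes the comparison strict, and an interior maximum is excluded along
  the complex line through c, where ln |x - c| is harmonic.\<close>

lemma three_circles:
  fixes u :: "complex^'n \<Rightarrow> real"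
  assumes W: "open W" "usc W u" "\<And>x. x \<in> W \<Longrightarrow> m \<le> u x" "\<And>x w. x \<in> W \<Longrightarrow> asub u x w 0"
    and R: "0 < s" "s < R" "cball c R \<subseteq> W"
    and A: "\<And>x. norm (x - c) = s \<Longrightarrow> u x \<le> A" and B: "\<And>x. norm (x - c) = R \<Longrightarrow> u x \<le> B"
    and x: "s \<le> norm (x - c)" "norm (x - c) \<le> R"
  shows "u x \<le> A + (B - A) * (ln (norm (x - c) / s) / ln (R / s))"
proof -
  define S where "S = {x. s \<le> norm (x - c) \<and> norm (x - c) \<le> R}"
  have lR: "ln (R / s) > 0" using R by simp
  define \<beta> where "\<beta> = (B - A) / ln (R / s)"
  have SW: "S \<subseteq> W" using R by (auto simp: S_def dist_norm norm_minus_commute subset_iff)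
  have "closed S" unfolding S_def by (intro closed_Collect_conj closed_Collect_le continuous_intros)
  moreover have "S \<subseteq> cball c R" by (auto simp: S_def dist_norm norm_minus_commute)
  ultimately have Sc: "compact S" using compact_Int_closed[of "cball c R" S] by (simp add: Int_absorb1)
  have xS: "x \<in> S" using x by (simp add: S_def)
  have main: "u x - \<beta> * ln (norm (x - c)) \<le> A - \<beta> * ln s + e * R\<^sup>2" if e: "e > 0" for e
  proof -
    define \<Psi> where "\<Psi> x = u x - \<beta> * ln (norm (x - c)) + e * (norm (x - c))\<^sup>2" for x
    define W' where "W' = W - {c}"
    have W': "open W'" using W(1) by (auto simp: W'_def)
    have "usc W' (\<lambda>x. u x + (e * (norm (x - c))\<^sup>2 - \<beta> * ln (norm (x - c))))"
      by (intro usc_add_continuous usc_subset[OF W(2)] W' continuous_intros) (auto simp: W'_def)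
    then have "usc W' \<Psi>" by (rule usc_cong) (simp add: \<Psi>_def)
    moreover have "S \<subseteq> W'" using SW R by (auto simp: S_def W'_def)
    ultimately have "usc S \<Psi>" by (rule usc_subset)
    then obtain x0 where x0: "x0 \<in> S" "\<And>y. y \<in> S \<Longrightarrow> \<Psi> y \<le> \<Psi> x0"
      using usc_attains_max[OF _ Sc] xS by blast
    have "norm (x0 - c) = s \<or> norm (x0 - c) = R"
    proof (rule ccontr)
      assume "\<not> ?thesis"
      then have i: "s < norm (x0 - c)" "norm (x0 - c) < R" using x0(1) by (auto simp: S_def)
      \<comment> \<open>The radial direction: x0 + \<zeta>w - c = (1 + \<zeta>)w, so the logarithm
        of its norm is ln |1 + \<zeta>| plus a constant.\<close>
      define w where "w = x0 - c"
      have w: "norm w > 0" using i(1) R(1) unfolding w_def by linarith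
      define O' where "O' = {x. s < norm (x - c) \<and> norm (x - c) < R}"
      have "open O'" unfolding O'_def by (intro open_Collect_conj open_Collect_less continuous_intros)
      moreover have "x0 \<in> O'" using i by (simp add: O'_def)
      ultimately obtain d where d: "d > 0" "\<And>r \<zeta>. 0 < r \<Longrightarrow> r < d \<Longrightarrow> cmod \<zeta> \<le> r \<Longrightarrow> x0 + \<zeta> *s w \<in> O'"
        using eventually_disc_ball[of O' x0 w] by metis
      \<comment> \<open>A radius below 1 keeps 1 + \<zeta> away from 0.\<close>
      define r where "r = min (d / 2) (1 / 2)"
      have r: "0 < r" "r < d" "r < 1" using d by (auto simp: r_def)
      have rO: "x0 + \<zeta> *s w \<in> O'" if "cmod \<zeta> \<le> r" for \<zeta> using d(2) r that by blast
      have OS: "O' \<subseteq> S" by (auto simp: O'_def S_def)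
      have "u x0 \<le> cmean (\<lambda>\<zeta>. u (x0 + \<zeta> *s w)) r + r\<^sup>2 / 4 * 0"
        by (rule disc_submean[OF W(1,2,3) _ W(4)]) (use r rO OS SW in auto)
      also have "cmean (\<lambda>\<zeta>. u (x0 + \<zeta> *s w)) r \<le>
          cmean (\<lambda>\<zeta>. (\<Psi> x0 + \<beta> * ln (cmod (1 + \<zeta> * 1) )) + (\<beta> * ln (norm w) + (- e) * (norm (x0 + \<zeta> *s w - c))\<^sup>2)) r"
      proof (rule cmean_mono)
        show "cint (\<lambda>\<zeta>. u (x0 + \<zeta> *s w)) r"
          by (rule cint_disc[OF W(2,3)]) (use r rO OS SW in \<open>auto intro!: continuous_intros\<close>)
        have nz: "cmod (1 + \<zeta> * 1) \<noteq> 0" if "cmod \<zeta> = r" for \<zeta>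
          using that r by (metis add_eq_0_iff mult.right_neutral norm_eq_zero norm_minus_cancel norm_one less_irrefl)
        then show "cint (\<lambda>\<zeta>. (\<Psi> x0 + \<beta> * ln (cmod (1 + \<zeta> * 1) )) + (\<beta> * ln (norm w) + (- e) * (norm (x0 + \<zeta> *s w - c))\<^sup>2)) r"
          using r by (intro continuous_cint continuous_intros) auto
        fix \<zeta> assume \<zeta>: "cmod \<zeta> = r"
        have "x0 + \<zeta> *s w - c = (1 + \<zeta>) *s w" by (simp add: w_def vec_eq_iff algebra_simps)
        then have nn: "norm (x0 + \<zeta> *s w - c) = cmod (1 + \<zeta>) * norm w" by (simp only: norm_smult_cart)
        have "ln (norm (x0 + \<zeta> *s w - c)) = ln (cmod (1 + \<zeta>)) + ln (norm w)"
          unfolding nn using nz[OF \<zeta>] w by (subst ln_mult) auto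
        moreover have "\<Psi> (x0 + \<zeta> *s w) \<le> \<Psi> x0" using x0(2) rO[of \<zeta>] OS \<zeta> by auto
        ultimately show "u (x0 + \<zeta> *s w) \<le> (\<Psi> x0 + \<beta> * ln (cmod (1 + \<zeta> * 1) )) + (\<beta> * ln (norm w) + (- e) * (norm (x0 + \<zeta> *s w - c))\<^sup>2)"
          by (simp add: \<Psi>_def algebra_simps)
      qed (use r in auto)
      also have "\<dots> = \<Psi> x0 + \<beta> * ln (norm w) - e * ((norm w)\<^sup>2 + r\<^sup>2 * (norm w)\<^sup>2)"
      proof -
        have c1: "cint (\<lambda>\<zeta>. ln (cmod (1 + \<zeta> * 1))) r"
        proof -
          have nz: "cmod (1 + \<zeta> * 1) \<noteq> 0" if "cmod \<zeta> = r" for \<zeta>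
            using that r by (metis add_eq_0_iff mult.right_neutral norm_eq_zero norm_minus_cancel norm_one less_irrefl)
          then show ?thesis using r by (intro continuous_cint continuous_intros) auto
        qed
        have c2: "cint (\<lambda>\<zeta>. (norm (x0 + \<zeta> *s w - c))\<^sup>2) r" using r by (intro continuous_cint continuous_intros) auto
        have l0: "cmean (\<lambda>\<zeta>. ln (cmod (1 + \<zeta> * 1))) r = 0" using cmean_ln[of 1 r 1] r by simp
        have "cmean (\<lambda>\<zeta>. (\<Psi> x0 + \<beta> * ln (cmod (1 + \<zeta> * 1) )) + (\<beta> * ln (norm w) + (- e) * (norm (x0 + \<zeta> *s w - c))\<^sup>2)) r
          = (\<Psi> x0 + \<beta> * cmean (\<lambda>\<zeta>. ln (cmod (1 + \<zeta> * 1))) r) + (\<beta> * ln (norm w) + (- e) * cmean (\<lambda>\<zeta>. (norm (x0 + \<zeta> *s w - c))\<^sup>2) r)"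
          by (simp only: cmean_add cint_add cint_cmult c1 c2 cint_const cmean_cmult cmean_const)
        then show ?thesis by (simp only: l0 cmean_norm_power2[OF r(1)]) (simp add: w_def)
      qed
      finally have "e * (r\<^sup>2 * (norm w)\<^sup>2) \<le> 0" by (simp add: \<Psi>_def w_def algebra_simps)
      then show False using e r w by (simp add: mult_le_0_iff)
    qed
    then have "\<Psi> x0 \<le> A - \<beta> * ln s + e * R\<^sup>2"
    proof
      assume eq: "norm (x0 - c) = s"
      have "e * s\<^sup>2 \<le> e * R\<^sup>2" using e R by (intro mult_left_mono power_mono) auto
      then show ?thesis using A[OF eq] eq by (simp add: \<Psi>_def)
    next
      assume eq: "norm (x0 - c) = R"
      have "\<beta> * ln R = B - A + \<beta> * ln s" using lR R by (simp add: \<beta>_def ln_div field_simps)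
      then show ?thesis using B[OF eq] eq by (simp add: \<Psi>_def)
    qed
    moreover have "0 \<le> e * (norm (x - c))\<^sup>2" using e by simp
    ultimately show ?thesis using x0(2)[OF xS] by (simp add: \<Psi>_def)
  qed
  have "u x - \<beta> * ln (norm (x - c)) \<le> A - \<beta> * ln s"
  proof (rule field_le_epsilon)
    fix e :: real assume "e > 0"
    then have "u x - \<beta> * ln (norm (x - c)) \<le> A - \<beta> * ln s + (e / R\<^sup>2) * R\<^sup>2" using R by (intro main) auto
    then show "u x - \<beta> * ln (norm (x - c)) \<le> A - \<beta> * ln s + e" using R by simp
  qed
  then have "u x \<le> A + \<beta> * ln (norm (x - c) / s)" 
  proof -
    have "norm (x - c) > 0" using R x by linarith
    then have e: "ln (norm (x - c) / s) = ln (norm (x - c)) - ln s" using R by (simp add: ln_div)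
    show ?thesis using \<open>u x - \<beta> * ln (norm (x - c)) \<le> A - \<beta> * ln s\<close> unfolding e right_diff_distrib by linarith
  qed
  then show ?thesis by (simp add: \<beta>_def)
qed

section \<open>Plurisubharmonic functions and the Lelong class\<close>

lemma nn_integral_circle:
  assumes "cint f r" "\<And>\<zeta>. cmod \<zeta> = r \<Longrightarrow> 0 \<le> f \<zeta>" "0 \<le> r"
  shows "(\<integral>\<^sup>+t\<in>{0..2*pi}. ennreal (f (of_real r * cis t)) \<partial>lborel) = ennreal (2 * pi * cmean f r)"
proof -
  have i: "integrable lborel (\<lambda>t. indicator {0..2*pi} t *\<^sub>R f (of_real r * cis t))"
    using assms(1) by (simp add: cint_def set_integrable_def)
  have "(\<integral>\<^sup>+t\<in>{0..2*pi}. ennreal (f (of_real r * cis t)) \<partial>lborel)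
      = (\<integral>\<^sup>+t. ennreal (indicator {0..2*pi} t *\<^sub>R f (of_real r * cis t)) \<partial>lborel)"
    by (intro nn_integral_cong) (auto simp: indicator_def)
  also have "\<dots> = ennreal (LINT t|lborel. indicator {0..2*pi} t *\<^sub>R f (of_real r * cis t))"
    by (rule nn_integral_eq_integral[OF i]) (use assms in \<open>auto simp: indicator_def\<close>)
  finally show ?thesis by (simp add: cmean_def set_lebesgue_integral_def)
qed

lemma cmean_nonneg: "cint f r \<Longrightarrow> (\<And>\<zeta>. cmod \<zeta> = r \<Longrightarrow> 0 \<le> f \<zeta>) \<Longrightarrow> 0 \<le> r \<Longrightarrow> 0 \<le> cmean f r"
  using cmean_mono[of "\<lambda>_. 0" r f] cint_const[of 0 r] by simp

text \<open>For u \<ge> 0 the subtracted integral in \<open>circle_mean\<close> is 0, and the mean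
  is the real number \<open>cmean\<close>. All radii are covered by the unit circle because w is
  arbitrary.\<close>

lemma psh_on_ereal:
  fixes u :: "complex^'n \<Rightarrow> real"
  assumes W: "open W" "usc W u" "\<And>x. x \<in> W \<Longrightarrow> 0 \<le> u x" "\<And>x w. x \<in> W \<Longrightarrow> asub u x w 0"
  shows "psh_on W (\<lambda>z. ereal (u z))"
  unfolding psh_on_def
proof (intro conjI ballI allI impI)
  show "usc_on W (\<lambda>z. ereal (u z))"
    unfolding usc_on_def
  proof (intro ballI allI impI)
    fix x c assume x: "x \<in> W" "ereal (u x) < c"
    show "\<forall>\<^sub>F y in at x within W. ereal (u y) < c"
    proof (cases c)
      case (real c')
      then have "\<forall>\<^sub>F y in nhds x. y \<in> W \<and> u y < c'" using x by (intro usc_openD[OF W(2,1)]) auto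
      then have "\<forall>\<^sub>F y in at x within W. y \<in> W \<and> u y < c'"
        by (metis (mono_tags, lifting) eventually_at_topological eventually_nhds)
      then show ?thesis by eventually_elim (simp add: real)
    qed (use x in auto)
  qed
next
  fix z w assume d: "\<forall>\<zeta>. cmod \<zeta> \<le> 1 \<longrightarrow> z + \<zeta> *s w \<in> W"
  define f where "f \<zeta> = u (z + \<zeta> *s w)" for \<zeta>
  have ci: "cint f 1" unfolding f_def
    by (rule cint_disc[OF W(2,3)]) (use d in \<open>auto intro!: continuous_intros\<close>)
  have nn: "0 \<le> f \<zeta>" if "cmod \<zeta> = 1" for \<zeta> using that d W(3) by (simp add: f_def)
  have "u z \<le> cmean f 1 + 1\<^sup>2 / 4 * 0"
    unfolding f_def by (rule disc_submean[OF W(1,2,3) _ W(4)]) (use d in auto)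
  moreover have "circle_mean (\<lambda>z. ereal (u z)) z w = ereal (cmean f 1)"
  proof -
    have "(\<integral>\<^sup>+t\<in>{0..2*pi}. e2ennreal (ereal (u (z + cis t *s w))) \<partial>lborel) = ennreal (2 * pi * cmean f 1)"
      using nn_integral_circle[OF ci nn] by (simp add: e2ennreal_ereal f_def[abs_def])
    moreover have "e2ennreal (- ereal (u (z + cis t *s w))) = 0" for t
      using nn[of "cis t"] by (simp add: f_def e2ennreal_ereal ennreal_neg)
    moreover have "0 \<le> cmean f 1" using cmean_nonneg[OF ci nn] by simp
    ultimately show ?thesis by (simp add: circle_mean_def enn2ereal_ennreal zero_ennreal.rep_eq)
  qed
  ultimately show "ereal (u z) \<le> circle_mean (\<lambda>z. ereal (u z)) z w" by simp
next
  fix C assume "C \<in> components W"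
  then show "\<exists>z\<in>C. ereal (u z) \<noteq> - \<infinity>" using in_components_nonempty by fastforce
qed auto

section \<open>Positive parts of plurisubharmonic functions\<close>

text \<open>\<open>max (u x) 0\<close> is finite as soon as u x < \<infinity>, so
  \<open>real_of_ereal\<close> loses nothing there, and the values -\<infinity> disappear.\<close>

definition pos_part :: "('a \<Rightarrow> ereal) \<Rightarrow> 'a \<Rightarrow> real" where
  "pos_part u x = real_of_ereal (max (u x) 0)"

lemma pos_part_nonneg: "0 \<le> pos_part u x"
  by (simp add: pos_part_def real_of_ereal_pos)

lemma ereal_pos_part: "u x < \<infinity> \<Longrightarrow> ereal (pos_part u x) = max (u x) 0"
  by (cases "u x") (auto simp: pos_part_def max_def)

lemma pos_part_le: "u x < \<infinity> \<Longrightarrow> max (u x) 0 \<le> ereal c \<Longrightarrow> pos_part u x \<le> c"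
  by (metis ereal_pos_part ereal_less_eq(3))

lemma pos_part_usc:
  assumes "open W" "usc_on W u" "\<And>x. x \<in> W \<Longrightarrow> u x < \<infinity>"
  shows "usc W (pos_part u)"
proof (rule usc_openI[OF assms(1)])
  fix x c assume x: "x \<in> W" "pos_part u x < c"
  then have c: "0 < c" using pos_part_nonneg[of u x] by linarith
  have "max (u x) 0 < ereal c" using x ereal_pos_part[of u x] assms(3) by (metis less_ereal.simps(1))
  then have "u x < ereal c" by simp
  then have "\<forall>\<^sub>F y in at x within W. u y < ereal c" using assms(2) x by (auto simp: usc_on_def)
  then have "\<forall>\<^sub>F y in at x. u y < ereal c" by (simp only: at_within_open[OF x(1) assms(1)])
  then have ev: "\<forall>\<^sub>F y in nhds x. u y < ereal c"
    using \<open>u x < ereal c\<close> by (simp add: eventually_nhds_conv_at)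
  have "\<forall>\<^sub>F y in nhds x. y \<in> W" by (rule eventually_nhds_in_open[OF assms(1) x(1)])
  with ev show "\<forall>\<^sub>F y in nhds x. pos_part u y < c"
  proof eventually_elim
    case (elim y)
    then have "ereal (pos_part u y) < ereal c" using ereal_pos_part[of u y] assms(3)[of y] c by simp
    then show ?case by simp
  qed
qed

text \<open>The first integral in \<open>circle_mean\<close> is that of the positive part, and the
  subtracted one can only lower the result. The mean of the positive part is also nonnegative, so it
  dominates max (u z) 0.\<close>

lemma psh_on_pos_part:
  fixes u :: "complex^'n \<Rightarrow> ereal"
  assumes "psh_on W u" "open W"
  shows "usc W (pos_part u)" "\<And>z. z \<in> W \<Longrightarrow> asub (pos_part u) z w 0"
proof -
  have fin: "\<And>x. x \<in> W \<Longrightarrow> u x < \<infinity>" and "usc_on W u" using assms by (auto simp: psh_on_def)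
  then show us: "usc W (pos_part u)" using assms(2) pos_part_usc by blast
  have sub: "pos_part u z \<le> cmean (\<lambda>\<zeta>. pos_part u (z + \<zeta> *s w)) 1" if d: "\<forall>\<zeta>. cmod \<zeta> \<le> 1 \<longrightarrow> z + \<zeta> *s w \<in> W" for z w
  proof -
    define f where "f \<zeta> = pos_part u (z + \<zeta> *s w)" for \<zeta>
    have ci: "cint f 1" unfolding f_def
      by (rule cint_disc[OF us, of 0]) (use d pos_part_nonneg in \<open>auto intro!: continuous_intros\<close>)
    have nn: "0 \<le> f \<zeta>" for \<zeta> by (simp add: f_def pos_part_nonneg)
    have c0: "0 \<le> cmean f 1" using cmean_nonneg[OF ci nn] by simp
    have "z \<in> W" using d[rule_format, of 0] by simp
    have e: "e2ennreal (u x) = ennreal (pos_part u x)" if "x \<in> W" for x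
      using fin[OF that] by (cases "u x") (auto simp: pos_part_def e2ennreal_ereal max_def ennreal_neg e2ennreal_neg)
    have "(\<integral>\<^sup>+t\<in>{0..2*pi}. e2ennreal (u (z + cis t *s w)) \<partial>lborel) = (\<integral>\<^sup>+t\<in>{0..2*pi}. ennreal (f (of_real 1 * cis t)) \<partial>lborel)"
      by (intro nn_integral_cong) (use d in \<open>auto simp: f_def e\<close>)
    also have "\<dots> = ennreal (2 * pi * cmean f 1)" by (rule nn_integral_circle[OF ci nn]) auto
    finally have P: "enn2ereal (\<integral>\<^sup>+t\<in>{0..2*pi}. e2ennreal (u (z + cis t *s w)) \<partial>lborel) = ereal (2 * pi * cmean f 1)"
      using c0 by (simp add: enn2ereal_ennreal)
    have "u z \<le> circle_mean u z w" using assms(1) d by (auto simp: psh_on_def)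
    also have "\<dots> \<le> ereal (2 * pi * cmean f 1) / ereal (2 * pi)"
      unfolding circle_mean_def P
    proof (rule ereal_divide_right_mono)
      show "ereal (2 * pi * cmean f 1) - enn2ereal N \<le> ereal (2 * pi * cmean f 1)" for N
        by (cases "enn2ereal N") (use enn2ereal_nonneg[of N] in auto)
    qed simp
    also have "\<dots> = ereal (cmean f 1)" by simp
    finally have "max (u z) 0 \<le> ereal (cmean f 1)" using c0 by simp
    then show ?thesis unfolding f_def[abs_def] by (rule pos_part_le[of u, OF fin[OF \<open>z \<in> W\<close>]])
  qed
  show "asub (pos_part u) z w 0" if z: "z \<in> W" for z
  proof (rule asub_linearI)
    fix e :: real assume e: "e > 0"
    obtain d where d: "d > 0" "\<And>r \<zeta>. 0 < r \<Longrightarrow> r < d \<Longrightarrow> cmod \<zeta> \<le> r \<Longrightarrow> z + \<zeta> *s w \<in> W"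
      using eventually_disc_ball[OF assms(2) z] by metis
    show "\<forall>\<^sub>F r in at_right 0. pos_part u z \<le> cmean (\<lambda>\<zeta>. pos_part u (z + \<zeta> *s w)) r + r\<^sup>2 / 4 * (0 + e)"
      using eventually_at_right_0_less[OF d(1)]
    proof eventually_elim
      case (elim r)
      \<comment> \<open>Circles of radius r in direction w are unit circles in direction r
        w.\<close>
      have eq: "\<zeta> *s (complex_of_real r *s w) = (of_real r * \<zeta>) *s w" for \<zeta>
        by (simp add: vec_eq_iff mult_ac)
      have "pos_part u z \<le> cmean (\<lambda>\<zeta>. pos_part u (z + \<zeta> *s (complex_of_real r *s w))) 1"
      proof (rule sub, intro allI impI)
        fix \<zeta> assume "cmod \<zeta> \<le> 1"
        then have "cmod (of_real r * \<zeta>) \<le> r" using elim by (simp add: norm_mult mult_left_le)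
        then show "z + \<zeta> *s (complex_of_real r *s w) \<in> W" unfolding eq using d(2) elim by blast
      qed
      also have "\<dots> = cmean (\<lambda>\<zeta>. pos_part u (z + \<zeta> *s w)) r"
        unfolding eq using cmean_scale[of "\<lambda>\<zeta>. pos_part u (z + \<zeta> *s w)" r 1] by simp
      moreover have "0 \<le> r\<^sup>2 / 4 * (0 + e)" using e by simp
      ultimately show ?case by linarith
    qed
  qed
qed

section \<open>The Lelong class\<close>

lemma asub_const: "0 \<le> q \<Longrightarrow> asub (\<lambda>_. c) z w q"
  by (rule asub_linearI) (auto intro!: always_eventually)

lemma zero_in_lelong_class: "(\<lambda>_. 0) \<in> lelong_class"
proof -
  have "psh_on UNIV (\<lambda>_::complex^'n. ereal 0)"
    by (rule psh_on_ereal) (auto intro: asub_const continuous_imp_usc)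
  then show ?thesis unfolding lelong_class_def by (auto simp: zero_ereal_def intro!: exI[of _ 0])
qed

lemma L_extremal_nonneg: "0 \<le> L_extremal E z"
  unfolding L_extremal_def by (rule SUP_upper2[of "\<lambda>_. 0"]) (auto simp: zero_in_lelong_class)

lemma L_extremal_zero: "z \<in> E \<Longrightarrow> L_extremal E z = 0"
  by (rule antisym[OF _ L_extremal_nonneg]) (auto simp: L_extremal_def intro!: SUP_least)

lemma L_extremal_antimono: "E \<subseteq> E' \<Longrightarrow> L_extremal E' z \<le> L_extremal E z"
  unfolding L_extremal_def by (rule SUP_subset_mono) auto

lemma lelong_class_real:
  fixes u :: "complex^'n \<Rightarrow> real"
  assumes "usc UNIV u" "\<And>x. 0 \<le> u x" "\<And>x w. asub u x w 0" "\<And>z. u z \<le> max 0 (ln (norm z)) + c"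
  shows "(\<lambda>z. ereal (u z)) \<in> lelong_class"
  unfolding lelong_class_def using psh_on_ereal[of UNIV u] assms by auto

text \<open>A Bernstein-Walsh inequality: three circles between s and R, then R \<rightarrow>
  \<infinity>. The slope (ln R + |c| - A) / ln (R/s) tends to 1, so the individual constant of u
  disappears and the bound is uniform over the class.\<close>

lemma lelong_class_growth:
  fixes u :: "complex^'n \<Rightarrow> ereal"
  assumes u: "u \<in> lelong_class" and s: "0 < s" and A: "\<And>x. norm x = s \<Longrightarrow> pos_part u x \<le> A"
    and x: "s \<le> norm x"
  shows "pos_part u x \<le> A + ln (norm x / s)"
proof -
  obtain c where p: "psh_on UNIV u" and c: "\<And>z. u z \<le> ereal (max 0 (ln (norm z)) + c)"
    using u by (auto simp: lelong_class_def)
  have fin: "u z < \<infinity>" for z using p by (auto simp: psh_on_def)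
  define L where "L = ln (norm x / s)"
  have bound: "pos_part u x \<le> A + (1 + (\<bar>c\<bar> - A + ln s) / (ln R - ln s)) * L"
    if R: "R > norm x" "R > s" "R > 1" for R
  proof -
    have "pos_part u x \<le> A + (ln R + \<bar>c\<bar> - A) * (ln (norm (x - 0) / s) / ln (R / s))"
    proof (rule three_circles[where W = UNIV and m = 0])
      show "usc UNIV (pos_part u)" "\<And>x w. asub (pos_part u) x w 0" using psh_on_pos_part[OF p] by auto
      fix y :: "complex^'n" assume y: "norm (y - 0) = R"
      have "max (u y) 0 \<le> ereal (ln R + \<bar>c\<bar>)"
        using c[of y] y R by (auto intro: order_trans)
      then show "pos_part u y \<le> ln R + \<bar>c\<bar>" by (rule pos_part_le[of u, OF fin])
    qed (use s R A x pos_part_nonneg in auto)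
    also have "\<dots> = A + (1 + (\<bar>c\<bar> - A + ln s) / (ln R - ln s)) * L"
    proof -
      define D k where "D = ln R - ln s" and "k = \<bar>c\<bar> - A + ln s"
      have e: "ln (R / s) = D" "D > 0" "ln R + \<bar>c\<bar> - A = D + k" using R s by (auto simp: ln_div D_def k_def)
      have "(D + k) * (L / D) = (1 + k / D) * L" using e(2) by (simp add: field_simps)
      then show ?thesis by (simp add: L_def e(1,3) flip: D_def k_def)
    qed
    finally show ?thesis .
  qed
  have lim: "filterlim (\<lambda>R. ln R - ln s) at_top at_top"
    using filterlim_tendsto_add_at_top[OF tendsto_const[of "- ln s"] ln_at_top] by simp
  have "((\<lambda>R. A + (1 + (\<bar>c\<bar> - A + ln s) / (ln R - ln s)) * L) \<longlongrightarrow> A + (1 + 0) * L) at_top"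
    using lim by (intro tendsto_intros tendsto_divide_0[OF tendsto_const] filterlim_at_top_imp_at_infinity)
  moreover have "\<forall>\<^sub>F R in at_top. pos_part u x \<le> A + (1 + (\<bar>c\<bar> - A + ln s) / (ln R - ln s)) * L"
    using eventually_gt_at_top[of "norm x"] eventually_gt_at_top[of s] eventually_gt_at_top[of "1::real"]
    by eventually_elim (rule bound)
  ultimately have "pos_part u x \<le> A + (1 + 0) * L"
    by (rule tendsto_lowerbound) simp
  then show ?thesis by (simp add: L_def)
qed

lemma asub_ln_norm:
  fixes z w :: "complex^'n"
  assumes "z \<noteq> 0" "0 < A"
  shows "asub (\<lambda>x. A * (ln (norm x) - b)) z w 0"
proof (rule asub_linearI)
  fix e :: real assume e: "e > 0"
  obtain d where d: "d > 0" "d * norm w < norm z"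
  proof (cases "w = 0")
    case True then show ?thesis using that[of 1] assms by simp
  next
    case False
    then show ?thesis using that[of "norm z / (2 * norm w)"] assms by simp
  qed
  show "\<forall>\<^sub>F r in at_right 0. A * (ln (norm z) - b) \<le> cmean (\<lambda>\<zeta>. A * (ln (norm (z + \<zeta> *s w)) - b)) r + r\<^sup>2 / 4 * (0 + e)"
    using eventually_at_right_0_less[OF d(1)]
  proof eventually_elim
    case (elim r)
    have rw: "r * norm w < norm z" using d elim mult_right_mono[of r d "norm w"] by auto
    have nz: "norm (z + \<zeta> *s w) > 0" if "cmod \<zeta> = r" for \<zeta>
    proof -
      have "norm z \<le> norm (z + \<zeta> *s w) + norm (\<zeta> *s w)" by (metis add_diff_cancel_right' norm_triangle_ineq4)
      then show ?thesis using rw that unfolding norm_smult_cart that by linarith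
    qed
    have ci: "cint (\<lambda>\<zeta>. ln (norm (z + \<zeta> *s w))) r"
      using nz elim by (intro continuous_cint continuous_intros) force+
    have "cmean (\<lambda>\<zeta>. A * (ln (norm (z + \<zeta> *s w)) - b)) r = A * (cmean (\<lambda>\<zeta>. ln (norm (z + \<zeta> *s w))) r - b)"
      by (simp only: cmean_cmult cmean_diff[OF ci cint_const] cmean_const)
    moreover have "A * (ln (norm z) - b) \<le> A * (cmean (\<lambda>\<zeta>. ln (norm (z + \<zeta> *s w))) r - b)"
      using ln_norm_submean[OF assms(1) _ rw] elim assms by (intro mult_left_mono diff_right_mono) auto
    moreover have "0 \<le> r\<^sup>2 / 4 * (0 + e)" using e by simp
    ultimately show ?case by linarith
  qed
qed

text \<open>u is continued by h = A ln (|x|/r1). The choice of A gives h > M from radius r2 on, so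
  the maximum equals h there and extends to the whole space; for |x| \<le> r1, h vanishes and u is
  unchanged. Division by A normalises the growth to that of the Lelong class.\<close>

lemma le_L_extremal_by_gluing:
  fixes u :: "complex^'n \<Rightarrow> real"
  assumes r: "0 < r1" "r1 < r2" "r2 < r0"
    and u: "usc (ball 0 r0) u" "\<And>x. norm x < r0 \<Longrightarrow> 0 \<le> u x" "\<And>x. norm x < r0 \<Longrightarrow> u x \<le> M" "\<And>x w. norm x < r0 \<Longrightarrow> asub u x w 0"
    and E: "\<And>x. x \<in> E \<Longrightarrow> norm x \<le> r1 \<and> u x \<le> 0"
    and z: "norm z \<le> r1"
  shows "ereal (u z) \<le> ereal ((M + 1) / ln (r2 / r1)) * L_extremal E z"
proof -
  define A where "A = (M + 1) / ln (r2 / r1)"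
  have M: "M \<ge> 0" using u(2,3)[of 0] r by (metis less_trans norm_zero order_trans)
  have l: "ln (r2 / r1) > 0" using r by simp
  have A: "A > 0" using M l by (simp add: A_def)
  define h where "h x = A * ln (max (norm x) r1 / r1)" for x :: "complex^'n"
  define v where "v x = (if norm x < r0 then max (u x) (h x) else h x)" for x
  have h0: "h x \<ge> 0" for x using A r by (simp add: h_def)
  have h_le: "norm x \<le> r1 \<Longrightarrow> h x = 0" for x using r by (simp add: h_def)
  have h_eq: "r1 \<le> norm x \<Longrightarrow> h x = A * (ln (norm x) - ln r1)" for x
  proof -
    assume "r1 \<le> norm x"
    moreover from this have "0 < norm x" using r by linarith
    ultimately show ?thesis using r by (simp add: h_def max_absorb1 ln_div)
  qed
  have h_cont: "continuous_on UNIV h" unfolding h_def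
    using r by (intro continuous_intros) (auto simp: max_def)
  have h_big: "h x > M" if "r2 \<le> norm x" for x
  proof -
    have "M < A * ln (r2 / r1)" using l by (simp add: A_def)
    also have "\<dots> \<le> h x" unfolding h_def using that r A by (intro mult_left_mono ln_mono) (auto simp: max_def divide_right_mono)
    finally show ?thesis .
  qed
  have v_h: "v x = h x" if "r2 < norm x" for x
    using h_big[of x] u(3)[of x] that by (auto simp: v_def max_def)
  have vh: "h x \<le> v x" for x by (simp add: v_def)
  have v0: "v x \<ge> 0" for x using vh[of x] h0[of x] by linarith
  have o: "open (ball (0::complex^'n) r0)" "open {x::complex^'n. r2 < norm x}" "open {x::complex^'n. r1 < norm x}"
    by (auto intro!: open_Collect_less continuous_intros)
  have us1: "usc (ball 0 r0) v"
    by (rule usc_cong[OF usc_max[OF u(1) continuous_imp_usc[OF continuous_on_subset[OF h_cont]]]]) (auto simp: v_def)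
  have us2: "usc {x. r2 < norm x} v"
    by (rule usc_cong[OF continuous_imp_usc[OF continuous_on_subset[OF h_cont]]]) (auto simp: v_h)
  have us: "usc UNIV v"
  proof (rule usc_openI)
    fix x c assume "v x < c"
    consider "x \<in> ball 0 r0" | "x \<in> {x. r2 < norm x}" using r by force
    then show "\<forall>\<^sub>F y in nhds x. v y < c"
    proof cases
      case 1 then show ?thesis using usc_openD[OF us1 o(1) _ \<open>v x < c\<close>] by (simp add: eventually_conj_iff)
    next
      case 2 then show ?thesis using usc_openD[OF us2 o(2) _ \<open>v x < c\<close>] by (simp add: eventually_conj_iff)
    qed
  qed simp
  have as: "asub v x w 0" for x w
  \<comment> \<open>Where u is at least h, u touches v from below. Elsewhere v = h and |x| > r1,
    since h = 0 \<le> u on the smaller ball, and the pure logarithm touches.\<close>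
  proof (cases "norm x < r0 \<and> h x \<le> u x")
    case True
    show ?thesis
      by (rule asub_touch[OF u(4) o(1) _ u(1) us1, where m = 0]) (use True u(2) in \<open>auto simp: v_def\<close>)
  next
    case False
    then have vx: "v x = h x" "norm x < r0 \<Longrightarrow> u x < h x" by (auto simp: v_def)
    have rx: "r1 < norm x"
    proof (rule ccontr)
      assume "\<not> r1 < norm x"
      then show False using False h_le[of x] u(2)[of x] r by auto
    qed
    have c: "continuous_on {x. r1 < norm x} (\<lambda>x. A * (ln (norm x) - ln r1))"
      using r by (intro continuous_intros) auto
    show ?thesis
    proof (rule asub_touch[OF asub_ln_norm[OF _ A, where b = "ln r1"] o(3), where m = 0])
      show "0 \<le> A * (ln (norm y) - ln r1)" if "y \<in> {x. r1 < norm x}" for y :: "complex^'n" using that h_eq[of y] h0[of y] by simp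
      show "A * (ln (norm y) - ln r1) \<le> v y" if "y \<in> {x. r1 < norm x}" for y using that h_eq[of y] vh[of y] by simp
    qed (use rx r c vx h_eq[of x] in \<open>auto intro: continuous_imp_usc usc_subset[OF us]\<close>)
  qed
  define f where "f x = (1 / A) * v x" for x
  have "(\<lambda>x. ereal (f x)) \<in> lelong_class"
  proof (rule lelong_class_real)
    show "usc UNIV f" unfolding f_def using A by (intro usc_cmult us) auto
    show "0 \<le> f x" for x using A v0 by (simp add: f_def)
    show "asub f x w 0" for x w
    proof -
      have "asub (\<lambda>x. (1 / A) * v x + 0 + 0 * (norm (x - 0))\<^sup>2) x w ((1 / A) * 0 - 4 * 0 * (norm w)\<^sup>2)"
        by (rule asub_affine_quadratic[of UNIV _ 0]) (use A us as v0 in auto)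
      then show ?thesis by (simp add: f_def[abs_def])
    qed
    have r00: "0 < r0" using r by linarith
    show "f x \<le> max 0 (ln (norm x)) + (M / A + \<bar>ln r1\<bar>)" for x
    proof -
      have "h x \<le> A * (max 0 (ln (norm x)) + \<bar>ln r1\<bar>)"
      proof (cases "norm x \<le> r1")
        case True then show ?thesis using h_le A by simp
      next
        case False then show ?thesis using A by (subst h_eq) (auto intro!: mult_left_mono)
      qed
      moreover have "v x \<le> h x + M" using u(3)[of x] h0[of x] M by (auto simp: v_def)
      ultimately have "v x \<le> A * (max 0 (ln (norm x)) + \<bar>ln r1\<bar>) + M" by linarith
      then have "(1 / A) * v x \<le> (1 / A) * (A * (max 0 (ln (norm x)) + \<bar>ln r1\<bar>) + M)" using A by (intro mult_left_mono) auto
      also have "\<dots> = max 0 (ln (norm x)) + (M / A + \<bar>ln r1\<bar>)" using A by (simp add: field_simps)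
      finally show ?thesis by (simp add: f_def)
    qed
  qed
  moreover have "ereal (f x) \<le> 0" if "x \<in> E" for x
  proof -
    have "v x = u x" using E[OF that] h_le[of x] u(2)[of x] r by (auto simp: v_def)
    then show ?thesis using E[OF that] A by (simp add: f_def divide_nonpos_pos)
  qed
  ultimately have "ereal (f z) \<le> L_extremal E z"
    unfolding L_extremal_def by (intro SUP_upper2[of "\<lambda>x. ereal (f x)"]) auto
  then have "ereal A * ereal (f z) \<le> ereal A * L_extremal E z" using A by (intro ereal_mult_left_mono) auto
  moreover have "A * f z = u z"
    using z h_le[of z] u(2)[of z] r A by (auto simp: f_def v_def)
  ultimately show ?thesis by (simp add: A_def)
qed

section \<open>Smooth functions\<close>

lemma Ck_on_SucD: "Ck_on (Suc k) W f \<Longrightarrow> Ck_on k W f"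
proof (induction k arbitrary: f)
  case 0
  then obtain f' where "\<forall>x\<in>W. (f has_derivative f' x) (at x)" unfolding Ck_on.simps(2) by blast
  then have "\<forall>x\<in>W. isCont f x" by (metis has_derivative_continuous)
  then show ?case unfolding Ck_on.simps(1) by (rule continuous_at_imp_continuous_on)
next
  case (Suc k)
  from Suc.prems obtain f' where "\<forall>x\<in>W. (f has_derivative f' x) (at x)" "\<forall>v. Ck_on (Suc k) W (\<lambda>x. f' x v)"
    unfolding Ck_on.simps(2)[of "Suc k"] by blast
  then show ?case unfolding Ck_on.simps(2)[of k] by (intro exI[of _ f'] conjI allI) (simp_all add: Suc.IH)
qed

lemma Ck_on_const: "Ck_on k W (\<lambda>_. c)"
proof (induction k arbitrary: c)
  case (Suc k)
  then show ?case by (auto intro!: exI[of _ "\<lambda>_ _. 0"])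
qed auto

lemma Ck_on_add: "Ck_on k W f \<Longrightarrow> Ck_on k W g \<Longrightarrow> Ck_on k W (\<lambda>x. f x + g x)"
proof (induction k arbitrary: f g)
  case 0
  then show ?case by (auto intro: continuous_on_add)
next
  case (Suc k)
  from Suc.prems obtain f' g' where f: "\<forall>x\<in>W. (f has_derivative f' x) (at x)" "\<forall>v. Ck_on k W (\<lambda>x. f' x v)"
    and g: "\<forall>x\<in>W. (g has_derivative g' x) (at x)" "\<forall>v. Ck_on k W (\<lambda>x. g' x v)" by auto
  show ?case unfolding Ck_on.simps(2)
    by (rule exI[of _ "\<lambda>x v. f' x v + g' x v"]) (use f g Suc.IH in \<open>auto intro: has_derivative_add\<close>)
qed

lemma Ck_on_mult: "Ck_on k W f \<Longrightarrow> Ck_on k W g \<Longrightarrow> Ck_on k W (\<lambda>x. f x * g x)"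
proof (induction k arbitrary: f g)
  case 0
  then show ?case by (auto intro: continuous_on_mult)
next
  case (Suc k)
  from Suc.prems obtain f' g' where f: "\<forall>x\<in>W. (f has_derivative f' x) (at x)" "\<forall>v. Ck_on k W (\<lambda>x. f' x v)"
    and g: "\<forall>x\<in>W. (g has_derivative g' x) (at x)" "\<forall>v. Ck_on k W (\<lambda>x. g' x v)" by auto
  have "Ck_on k W f" "Ck_on k W g" using Suc.prems Ck_on_SucD by blast+
  then show ?case unfolding Ck_on.simps(2)
    by (intro exI[of _ "\<lambda>x v. f x * g' x v + f' x v * g x"])
       (use f g Suc.IH in \<open>auto intro: has_derivative_mult Ck_on_add\<close>)
qed

lemma Ck_on_linear: "bounded_linear f \<Longrightarrow> Ck_on k W f"
proof (cases k)
  case 0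
  then show "bounded_linear f \<Longrightarrow> ?thesis" by (auto intro: linear_continuous_on)
next
  case (Suc j)
  assume "bounded_linear f"
  then show ?thesis unfolding Suc Ck_on.simps(2)
    by (intro exI[of _ "\<lambda>x. f"]) (auto intro: Ck_on_const bounded_linear_imp_has_derivative)
qed

lemma Ck_on_norm_power2:
  fixes c :: "'v::real_inner"
  shows "Ck_on k W (\<lambda>x. (norm (x - c))\<^sup>2)"
proof -
  have eq: "(\<lambda>x. (norm (x - c))\<^sup>2) = (\<lambda>x. (x - c) \<bullet> (x - c))" by (simp add: dot_square_norm)
  have l: "bounded_linear (\<lambda>x::'v. x \<bullet> v)" for v by (rule bounded_linear_inner_left)
  show ?thesis
  proof (cases k)
    case 0
    then show ?thesis by (auto intro!: continuous_intros)
  next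
    case (Suc j)
    have "((\<lambda>x. (x - c) \<bullet> (x - c)) has_derivative (\<lambda>h. 2 * (h \<bullet> (x - c)))) (at x)" for x
      by (auto intro!: derivative_eq_intros simp: inner_commute)
    moreover have "Ck_on j W (\<lambda>x. 2 * (v \<bullet> (x - c)))" for v
    proof -
      have "(\<lambda>x. 2 * (v \<bullet> (x - c))) = (\<lambda>x. 2 * (x \<bullet> v + - (c \<bullet> v)))" by (auto simp: inner_diff inner_commute)
      then show ?thesis by (simp only:) (intro Ck_on_mult Ck_on_add Ck_on_const Ck_on_linear[OF l])
    qed
    ultimately show ?thesis unfolding Suc eq Ck_on.simps(2)
      by (intro exI[of _ "\<lambda>x h. 2 * (h \<bullet> (x - c))"]) auto
  qed
qed

section \<open>A flat function and smooth bumps\<close>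

text \<open>The powers of t in the denominator make the family closed under differentiation, so
  smoothness follows by one induction for all j.\<close>

definition flat_exp :: "nat \<Rightarrow> real \<Rightarrow> real" where
  "flat_exp j t = (if 0 < t then exp (- 1 / t) / t ^ j else 0)"

lemma flat_exp_tendsto_0: "(flat_exp j \<longlongrightarrow> 0) (at 0)"
proof -
  have "(flat_exp j \<longlongrightarrow> 0) (at_left 0)"
    by (rule tendsto_eventually) (auto simp: eventually_at_left_field flat_exp_def intro!: exI[of _ "-1"])
  moreover have "((\<lambda>t. (inverse t) ^ j / exp (inverse t)) \<longlongrightarrow> 0) (at_right (0::real))"
    by (rule filterlim_compose[OF tendsto_power_div_exp_0 filterlim_inverse_at_top_right])
  then have "(flat_exp j \<longlongrightarrow> 0) (at_right 0)"
    by (rule Lim_transform_eventually)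
       (auto simp: eventually_at_right_field flat_exp_def exp_minus field_simps intro!: exI[of _ 1])
  ultimately show ?thesis by (simp add: filterlim_split_at)
qed

lemma flat_exp_derivative:
  "(flat_exp j has_real_derivative (- real j * flat_exp (j + 1) t + flat_exp (j + 2) t)) (at t)"
proof -
  consider "t > 0" | "t < 0" | "t = 0" by linarith
  then show ?thesis
  proof cases
    case 1
    have "((\<lambda>t. exp (- 1 / t) * inverse t ^ j) has_real_derivative (- real j * flat_exp (j + 1) t + flat_exp (j + 2) t)) (at t)"
    proof (cases j)
      case 0
      then show ?thesis using 1 by (auto intro!: derivative_eq_intros simp: flat_exp_def power2_eq_square)
    next
      case (Suc i)
      show ?thesis unfolding Suc
        by (rule derivative_eq_intros refl | use 1 in \<open>simp add: flat_exp_def field_simps\<close>)+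
    qed
    moreover have "\<forall>\<^sub>F s in nhds t. s \<in> {0<..}" using 1 by (intro eventually_nhds_in_open) auto
    then have ev: "\<forall>\<^sub>F s in nhds t. flat_exp j s = exp (- 1 / s) * inverse s ^ j"
      by eventually_elim (simp add: flat_exp_def field_simps)
    ultimately show ?thesis using DERIV_cong_ev[OF refl ev refl] by blast
  next
    case 2
    have "\<forall>\<^sub>F s in nhds t. s \<in> {..<0}" using 2 by (intro eventually_nhds_in_open) auto
    then have ev: "\<forall>\<^sub>F s in nhds t. flat_exp j s = 0" by eventually_elim (simp add: flat_exp_def)
    have "(flat_exp j has_real_derivative 0) (at t)" using DERIV_cong_ev[OF refl ev refl] DERIV_const by blast
    then show ?thesis using 2 by (simp add: flat_exp_def)
  next
    case 3
    \<comment> \<open>The difference quotient at 0 is again a member of the family, and it tends to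
      0.\<close>
    have "(\<lambda>h. (flat_exp j (0 + h) - flat_exp j 0) / h) = flat_exp (j + 1)"
      by (auto simp: flat_exp_def field_simps)
    then have "(flat_exp j has_real_derivative 0) (at 0)"
      using flat_exp_tendsto_0[of "j + 1"] by (simp add: DERIV_def)
    then show ?thesis using 3 by (simp add: flat_exp_def)
  qed
qed

lemma flat_exp_continuous: "continuous_on A (flat_exp j)"
  using flat_exp_derivative by (meson DERIV_continuous continuous_at_imp_continuous_on)

lemma Ck_on_flat_exp:
  assumes "\<And>k. Ck_on k W s"
  shows "Ck_on k W (\<lambda>x. flat_exp j (s x))"
proof (induction k arbitrary: j)
  case 0
  have "continuous_on W s" using assms[of 0] by simp
  then show ?case by (auto intro: continuous_on_compose2[OF flat_exp_continuous[of UNIV]])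
next
  case (Suc k)
  obtain s' where s': "\<forall>x\<in>W. (s has_derivative s' x) (at x)" "\<forall>v. Ck_on k W (\<lambda>x. s' x v)"
    using assms[of "Suc k"] by auto
  have "((\<lambda>x. flat_exp j (s x)) has_derivative (\<lambda>h. (- real j * flat_exp (j + 1) (s x) + flat_exp (j + 2) (s x)) * s' x h)) (at x)"
    if "x \<in> W" for x
    using has_derivative_compose[of s "s' x" x UNIV "flat_exp j"] s'(1) that flat_exp_derivative[of j "s x"]
    by (simp add: has_field_derivative_def)
  moreover have "Ck_on k W (\<lambda>x. (- real j * flat_exp (j + 1) (s x) + flat_exp (j + 2) (s x)) * s' x v)" for v
    using Suc s'(2) by (intro Ck_on_mult Ck_on_add Ck_on_const) auto
  ultimately show ?case unfolding Ck_on.simps(2)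
    by (intro exI[of _ "\<lambda>x v. (- real j * flat_exp (j + 1) (s x) + flat_exp (j + 2) (s x)) * s' x v"]) auto
qed

lemma smooth_on_imp_continuous_on: "smooth_on W f \<Longrightarrow> continuous_on W f"
  unfolding smooth_on_def by (metis Ck_on.simps(1))

lemma smooth_on_bump: "smooth_on W (\<lambda>y::'v::real_inner. C * flat_exp 0 (\<epsilon>\<^sup>2 - (norm (y - z))\<^sup>2))"
  unfolding smooth_on_def
proof
  fix k
  have "Ck_on k W (\<lambda>y::'v. \<epsilon>\<^sup>2 + (- 1) * (norm (y - z))\<^sup>2)" for k
    by (intro Ck_on_add Ck_on_mult Ck_on_const Ck_on_norm_power2)
  then have "Ck_on k W (\<lambda>y::'v. \<epsilon>\<^sup>2 - (norm (y - z))\<^sup>2)" for k by simp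
  then show "Ck_on k W (\<lambda>y::'v. C * flat_exp 0 (\<epsilon>\<^sup>2 - (norm (y - z))\<^sup>2))"
    by (intro Ck_on_mult Ck_on_const Ck_on_flat_exp)
qed

section \<open>The second order expansion of circle means\<close>

lemma cart_ii_mult: "\<i> *s (\<i> *s (w::complex^'n)) = - w"
  by (simp add: vec_eq_iff)

text \<open>dd^c \<eta>(w, iw) is the Laplacian of \<zeta> \<mapsto> \<eta>(z + \<zeta>w): the sum
  of the second derivatives in the real directions w and iw.\<close>

lemma smooth_second_derivatives:
  fixes \<eta> :: "complex^'n \<Rightarrow> real"
  assumes "smooth_on UNIV \<eta>"
  obtains f' D where "\<And>x. (\<eta> has_derivative f' x) (at x)" "\<And>v x. ((\<lambda>x. f' x v) has_derivative D v x) (at x)"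
    "\<And>v u. continuous_on UNIV (\<lambda>x. D v x u)" "\<And>z w. ddc \<eta> z w (\<i> *s w) = D w z w + D (\<i> *s w) z (\<i> *s w)"
proof -
  have "Ck_on (Suc (Suc 0)) UNIV \<eta>" using assms unfolding smooth_on_def by blast
  then obtain f' where f': "\<And>x. (\<eta> has_derivative f' x) (at x)" "\<And>v. Ck_on (Suc 0) UNIV (\<lambda>x. f' x v)"
    unfolding Ck_on.simps(2)[of "Suc 0"] by blast
  have "\<forall>v. \<exists>D. (\<forall>x. ((\<lambda>x. f' x v) has_derivative D x) (at x)) \<and> (\<forall>u. continuous_on UNIV (\<lambda>x. D x u))"
    using f'(2) by simp
  then obtain D where D: "\<And>v x. ((\<lambda>x. f' x v) has_derivative D v x) (at x)" "\<And>v u. continuous_on UNIV (\<lambda>x. D v x u)"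
    by metis
  have fd: "frechet_derivative \<eta> (at x) = f' x" for x using f'(1) frechet_derivative_at by metis
  have fdD: "frechet_derivative (\<lambda>x. f' x v) (at x) = D v x" for v x using D(1) frechet_derivative_at by metis
  have lin: "linear (f' x)" for x using f'(1) has_derivative_linear by blast
  \<comment> \<open>d^c is minus the differential composed with multiplication by i.\<close>
  have dc: "dc \<eta> y w = - f' y (\<i> *s w)" for y w
    by (simp add: dc_def del_def delbar_def fd)
  have dc2: "dc \<eta> y (\<i> *s w) = f' y w" for y w
    by (simp add: dc cart_ii_mult linear_neg[OF lin])
  have "frechet_derivative (\<lambda>y. - f' y (\<i> *s w)) (at z) (\<i> *s w) = - D (\<i> *s w) z (\<i> *s w)" for z w
    using frechet_derivative_at[OF has_derivative_minus[OF D(1)[of "\<i> *s w" z]]] by metis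
  then have "ddc \<eta> z w (\<i> *s w) = D w z w + D (\<i> *s w) z (\<i> *s w)" for z w
    unfolding ddc_def ext_d_def dc2 by (simp add: dc fdD)
  then show ?thesis using that f'(1) D by blast
qed

lemma ddc_eq_0_outside:
  fixes \<eta> :: "complex^'n \<Rightarrow> real"
  assumes "open A" "\<And>x. x \<in> A \<Longrightarrow> \<eta> x = 0" "z \<in> A"
  shows "ddc \<eta> z u w = 0"
proof -
  have d0: "(\<eta> has_derivative (\<lambda>_. 0)) (at x)" if "x \<in> A" for x
    by (rule has_derivative_transform_within_open[OF has_derivative_const[of 0] assms(1) that]) (simp add: assms(2))
  have fd: "frechet_derivative \<eta> (at x) = (\<lambda>_. 0)" if "x \<in> A" for x using frechet_derivative_at[OF d0[OF that]] by simp
  have dc0: "dc \<eta> x v = 0" if "x \<in> A" for x v by (simp add: dc_def del_def delbar_def fd[OF that])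
  have "((\<lambda>y. dc \<eta> y v) has_derivative (\<lambda>_. 0)) (at z)" for v
    by (rule has_derivative_transform_within_open[OF has_derivative_const[of 0] assms(1,3)]) (simp add: dc0)
  from frechet_derivative_at[OF this] have "frechet_derivative (\<lambda>y. dc \<eta> y v) (at z) = (\<lambda>_. 0)" for v by simp
  then show ?thesis by (simp add: ddc_def ext_d_def)
qed

lemma smult_eq_real: "\<zeta> *s (w::complex^'n) = Re \<zeta> *\<^sub>R w + Im \<zeta> *\<^sub>R (\<i> *s w)"
  by (simp add: vec_eq_iff complex_eq_iff)

text \<open>Second order Taylor expansion with an error uniform in x. The quadratic part splits into
  r^2/4 times the Laplacian and the real part of a multiple of \<zeta>^2, whose mean
  vanishes.\<close>

lemma cmean_expansion:
  fixes \<eta> :: "complex^'n \<Rightarrow> real"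
  assumes \<eta>: "smooth_on UNIV \<eta>" and R: "\<And>x. R < norm x \<Longrightarrow> \<eta> x = 0" and e: "0 < e"
  obtains r0 where "0 < r0"
    "\<And>r x. 0 < r \<Longrightarrow> r < r0 \<Longrightarrow> \<bar>cmean (\<lambda>\<zeta>. \<eta> (x + \<zeta> *s w)) r - \<eta> x - r\<^sup>2 / 4 * ddc \<eta> x w (\<i> *s w)\<bar> \<le> e * r\<^sup>2"
proof -
  obtain f' D where f': "\<And>x. (\<eta> has_derivative f' x) (at x)" and D: "\<And>v x. ((\<lambda>x. f' x v) has_derivative D v x) (at x)"
    and Dc: "\<And>v u. continuous_on UNIV (\<lambda>x. D v x u)" and dd: "\<And>z w. ddc \<eta> z w (\<i> *s w) = D w z w + D (\<i> *s w) z (\<i> *s w)"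
    using smooth_second_derivatives[OF \<eta>] by metis
  have \<eta>c: "continuous_on UNIV \<eta>" using smooth_on_imp_continuous_on[OF \<eta>] .
  define w' where "w' = \<i> *s w"
  have "\<exists>d>0. \<forall>x\<in>cball 0 (R + 2). \<forall>y\<in>cball 0 (R + 2). dist y x < d \<longrightarrow> dist (D v y u) (D v x u) < e / 2" for v u
  proof -
    have "uniformly_continuous_on (cball 0 (R + 2)) (\<lambda>x. D v x u)"
      by (rule compact_uniformly_continuous[OF continuous_on_subset[OF Dc]]) auto
    then show ?thesis using e unfolding uniformly_continuous_on_def by (metis half_gt_zero)
  qed
  then obtain d where d: "\<And>v u. d v u > 0"
    "\<And>v u x y. x \<in> cball 0 (R + 2) \<Longrightarrow> y \<in> cball 0 (R + 2) \<Longrightarrow> dist y x < d v u \<Longrightarrow> dist (D v y u) (D v x u) < e / 2" by metis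
  \<comment> \<open>The bound 1 separates two cases: for |x| > R + 1 the circle misses the support,
    otherwise the disc stays in the ball of radius R + 2, where the second derivatives are uniformly
    continuous.\<close>
  define \<delta> where "\<delta> = min 1 (min (min (d w w) (d w w')) (min (d w' w) (d w' w')))"
  have \<delta>: "\<delta> > 0" using d by (simp add: \<delta>_def)
  define r0 where "r0 = \<delta> / (norm w + 1)"
  have nw: "norm w + 1 > 0" by (simp add: add_nonneg_pos)
  show ?thesis
  proof
    show "0 < r0" using \<delta> nw by (simp add: r0_def)
    fix r x assume r: "0 < r" "r < r0"
    have rw: "r * norm w < \<delta>"
    proof -
      have "r * norm w \<le> r * (norm w + 1)" using r by (intro mult_left_mono) auto
      also have "\<dots> < \<delta>" using r nw by (simp add: r0_def field_simps)
      finally show ?thesis .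
    qed
    have ci: "cint (\<lambda>\<zeta>. \<eta> (x + \<zeta> *s w)) r"
      using r by (intro continuous_cint continuous_on_compose2[OF \<eta>c] continuous_intros) auto
    show "\<bar>cmean (\<lambda>\<zeta>. \<eta> (x + \<zeta> *s w)) r - \<eta> x - r\<^sup>2 / 4 * ddc \<eta> x w (\<i> *s w)\<bar> \<le> e * r\<^sup>2"
    proof (cases "norm x \<le> R + 1")
      case False
      have "\<eta> (x + \<zeta> *s w) = 0" if "cmod \<zeta> = r" for \<zeta>
      proof (rule R)
        have "norm x \<le> norm (x + \<zeta> *s w) + norm (\<zeta> *s w)" by (metis add_diff_cancel_right' norm_triangle_ineq4)
        then show "R < norm (x + \<zeta> *s w)" using False rw that unfolding norm_smult_cart by (simp add: \<delta>_def)
      qed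
      then have "cmean (\<lambda>\<zeta>. \<eta> (x + \<zeta> *s w)) r = cmean (\<lambda>_. 0) r" using r by (intro cmean_cong) auto
      moreover have "ddc \<eta> x w (\<i> *s w) = 0"
        by (rule ddc_eq_0_outside[of "{x. R < norm x}"]) (use R False in \<open>auto intro!: open_Collect_less continuous_intros\<close>)
      ultimately show ?thesis using R[of x] False e by simp
    next
      case True
      define A B C where "A = D w x w" and "B = D w' x w'" and "C = D w x w' + D w' x w"
      \<comment> \<open>On the circle, Re(\<zeta>)^2 and Im(\<zeta>)^2 are (r^2 + t)/2 and (r^2 -
        t)/2 with t = Re (\<zeta>^2); this gives the constant and the coefficient of
        \<zeta>^2.\<close>
      define F where "F \<zeta> = of_real (\<eta> x + r\<^sup>2 / 4 * (A + B)) + Complex (f' x w) (- f' x w') * \<zeta> + Complex ((A - B) / 4) (- C / 4) * \<zeta>\<^sup>2" for \<zeta>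
      have close: "\<bar>\<eta> (x + \<zeta> *s w) - Re (F \<zeta>)\<bar> \<le> e * r\<^sup>2" if \<zeta>: "cmod \<zeta> = r" for \<zeta>
      proof -
        define a b where "a = Re \<zeta>" and "b = Im \<zeta>"
        have ab: "a\<^sup>2 + b\<^sup>2 = r\<^sup>2" using \<zeta> by (simp add: a_def b_def cmod_power2[symmetric])
        have v: "\<zeta> *s w = a *\<^sub>R w + b *\<^sub>R w'" by (simp add: a_def b_def w'_def smult_eq_real[of \<zeta>])
        define Q where "Q y = a * (a * D w y w + b * D w y w') + b * (a * D w' y w + b * D w' y w')" for y
        define \<phi> where "\<phi> m s = (if m = (0::nat) then \<eta> (x + s *\<^sub>R (\<zeta> *s w)) else if m = 1 then f' (x + s *\<^sub>R (\<zeta> *s w)) (\<zeta> *s w)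
            else Q (x + s *\<^sub>R (\<zeta> *s w)))" for m s
        have linD: "linear (D u y)" for u y using D has_derivative_linear by blast
        have linf: "linear (f' y)" for y using f' has_derivative_linear by blast
        have line: "((\<lambda>s. x + s *\<^sub>R (\<zeta> *s w)) has_derivative (\<lambda>h. h *\<^sub>R (\<zeta> *s w))) (at s)" for s :: real
          by (auto intro!: derivative_eq_intros)
        have fv: "f' y (\<zeta> *s w) = a * f' y w + b * f' y w'" for y
          by (simp add: v linear_add[OF linf] linear_scale[OF linf])
        have d1: "DERIV (\<phi> 0) s :> \<phi> (Suc 0) s" for s
        proof -
          have "((\<lambda>s. \<eta> (x + s *\<^sub>R (\<zeta> *s w))) has_derivative (\<lambda>h. f' (x + s *\<^sub>R (\<zeta> *s w)) (h *\<^sub>R (\<zeta> *s w)))) (at s)"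
            by (rule has_derivative_compose[OF line f'])
          then show ?thesis by (simp add: \<phi>_def[abs_def] has_field_derivative_def linear_scale[OF linf] mult.commute[of _ "f' _ _"] mult_commute_abs)
        qed
        have d2: "DERIV (\<phi> (Suc 0)) s :> \<phi> (Suc (Suc 0)) s" for s
        proof -
          have "((\<lambda>y. a * f' y w + b * f' y w') has_derivative (\<lambda>h. a * D w y h + b * D w' y h)) (at y)" for y
            by (intro derivative_intros D)
          then have "((\<lambda>y. f' y (\<zeta> *s w)) has_derivative (\<lambda>h. a * D w y h + b * D w' y h)) (at y)" for y
            by (simp add: fv)
          from has_derivative_compose[OF line this]
          have "((\<lambda>s. f' (x + s *\<^sub>R (\<zeta> *s w)) (\<zeta> *s w)) has_derivative
              (\<lambda>h. a * D w (x + s *\<^sub>R (\<zeta> *s w)) (h *\<^sub>R (\<zeta> *s w)) + b * D w' (x + s *\<^sub>R (\<zeta> *s w)) (h *\<^sub>R (\<zeta> *s w)))) (at s)" .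
          moreover have "(\<lambda>h. a * D w y (h *\<^sub>R (\<zeta> *s w)) + b * D w' y (h *\<^sub>R (\<zeta> *s w))) = (*) (Q y)" for y
            by (auto simp: Q_def v linear_add[OF linD] linear_scale[OF linD] algebra_simps)
          ultimately show ?thesis by (simp add: \<phi>_def[abs_def] has_field_derivative_def)
        qed
        have "\<exists>t>0. t < 1 \<and> \<phi> 0 1 = (\<Sum>m<2. \<phi> m 0 / fact m * 1 ^ m) + \<phi> 2 t / fact 2 * 1 ^ 2"
        proof (rule Maclaurin)
          show "\<forall>m t. m < 2 \<and> 0 \<le> t \<and> t \<le> 1 \<longrightarrow> DERIV (\<phi> m) t :> \<phi> (Suc m) t"
            using d1 d2 by (auto simp: less_2_cases_iff)
        qed auto
        then obtain \<theta> where \<theta>: "0 < \<theta>" "\<theta> < 1" "\<phi> 0 1 = \<phi> 0 0 + \<phi> 1 0 + \<phi> 2 \<theta> / 2"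
          by (auto simp: numeral_2_eq_2)
        define y where "y = x + \<theta> *\<^sub>R (\<zeta> *s w)"
        have yx: "dist y x \<le> r * norm w"
          using \<theta> \<zeta> r by (simp add: y_def dist_norm norm_smult_cart mult_left_le_one_le)
        have yB: "y \<in> cball 0 (R + 2)" "x \<in> cball 0 (R + 2)"
          using True yx rw norm_triangle_sub[of y x] by (auto simp: \<delta>_def dist_norm)
        have Dd: "\<bar>D v y u - D v x u\<bar> \<le> e / 2" if "v \<in> {w, w'}" "u \<in> {w, w'}" for v u
        proof -
          have "dist y x < d v u" using yx rw that by (auto simp: \<delta>_def)
          then show ?thesis using d(2)[OF yB(2,1)] by (force simp: dist_real_def)
        qed
        \<comment> \<open>Four terms of size at most r^2 e/2; the Taylor factor 1/2 brings the total
          to e r^2.\<close>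
        have "\<bar>Q y - Q x\<bar> \<le> 2 * e * r\<^sup>2"
        proof -
          have ar: "\<bar>a\<bar> \<le> r" "\<bar>b\<bar> \<le> r" using \<zeta> abs_Re_le_cmod abs_Im_le_cmod by (auto simp: a_def b_def)
          have m: "\<bar>p * q * k\<bar> \<le> r\<^sup>2 * (e / 2)" if "\<bar>p\<bar> \<le> r" "\<bar>q\<bar> \<le> r" "\<bar>k\<bar> \<le> e / 2" for p q k
          proof -
            have "\<bar>p\<bar> * \<bar>q\<bar> * \<bar>k\<bar> \<le> r * r * (e / 2)" using that r by (intro mult_mono) auto
            then show ?thesis by (simp add: abs_mult power2_eq_square)
          qed
          have "Q y - Q x = a * a * (D w y w - D w x w) + a * b * (D w y w' - D w x w')
              + a * b * (D w' y w - D w' x w) + b * b * (D w' y w' - D w' x w')"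
            by (simp add: Q_def algebra_simps)
          moreover have "\<bar>a * a * (D w y w - D w x w)\<bar> \<le> r\<^sup>2 * (e / 2)" "\<bar>a * b * (D w y w' - D w x w')\<bar> \<le> r\<^sup>2 * (e / 2)"
            "\<bar>a * b * (D w' y w - D w' x w)\<bar> \<le> r\<^sup>2 * (e / 2)" "\<bar>b * b * (D w' y w' - D w' x w')\<bar> \<le> r\<^sup>2 * (e / 2)"
            by (intro m ar Dd; simp)+
          ultimately have "\<bar>Q y - Q x\<bar> \<le> 4 * (r\<^sup>2 * (e / 2))" by linarith
          then show ?thesis by (simp add: mult_ac)
        qed
        moreover have "\<phi> 0 0 + \<phi> 1 0 + Q x / 2 = Re (F \<zeta>)"
        proof -
          have "Q x / 2 = r\<^sup>2 / 4 * (A + B) + (A - B) / 4 * (a\<^sup>2 - b\<^sup>2) + C / 4 * (2 * a * b)"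
          proof -
            have "2 * Q x = r\<^sup>2 * (A + B) + (A - B) * (a\<^sup>2 - b\<^sup>2) + C * (2 * a * b)"
              unfolding ab[symmetric] Q_def A_def B_def C_def by (simp add: power2_eq_square algebra_simps)
            moreover have "r\<^sup>2 / 4 * (A + B) = r\<^sup>2 * (A + B) / 4" "(A - B) / 4 * (a\<^sup>2 - b\<^sup>2) = (A - B) * (a\<^sup>2 - b\<^sup>2) / 4"
              "C / 4 * (2 * a * b) = C * (2 * a * b) / 4" by simp_all
            ultimately show ?thesis by linarith
          qed
          moreover have "Re (F \<zeta>) = \<eta> x + r\<^sup>2 / 4 * (A + B) + (f' x w * a + f' x w' * b) + (A - B) / 4 * (a\<^sup>2 - b\<^sup>2) + C / 4 * (2 * a * b)"
            by (simp add: F_def a_def b_def power2_eq_square)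
          ultimately show ?thesis by (simp add: \<phi>_def fv mult.commute)
        qed
        moreover have "\<eta> (x + \<zeta> *s w) = \<phi> 0 0 + \<phi> 1 0 + Q y / 2" using \<theta>(3) by (simp add: \<phi>_def y_def)
        ultimately show ?thesis by linarith
      qed
      have Fh: "F holomorphic_on ball 0 (r + 1)" unfolding F_def by (intro holomorphic_intros)
      have ciF: "cint (\<lambda>\<zeta>. Re (F \<zeta>)) r" using r unfolding F_def by (intro continuous_cint continuous_intros) auto
      have mF: "cmean (\<lambda>\<zeta>. Re (F \<zeta>)) r = \<eta> x + r\<^sup>2 / 4 * (A + B)"
        using cmean_holomorphic[OF Fh] r by (simp add: F_def)
      have "cmean (\<lambda>\<zeta>. \<eta> (x + \<zeta> *s w)) r \<le> cmean (\<lambda>\<zeta>. Re (F \<zeta>) + e * r\<^sup>2) r"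
        using close r by (intro cmean_mono ci cint_add ciF cint_const) (auto simp: abs_le_iff algebra_simps)
      moreover have "cmean (\<lambda>\<zeta>. Re (F \<zeta>) - e * r\<^sup>2) r \<le> cmean (\<lambda>\<zeta>. \<eta> (x + \<zeta> *s w)) r"
        using close r by (intro cmean_mono ci cint_diff ciF cint_const) (auto simp: abs_le_iff algebra_simps)
      ultimately show ?thesis
        by (simp add: cmean_add[OF ciF cint_const] cmean_diff[OF ciF cint_const] mF dd A_def B_def w'_def)
    qed
  qed
qed

section \<open>Integration\<close>

lemma nn_integral_lborel_shift:
  fixes f :: "'a::euclidean_space \<Rightarrow> ennreal"
  assumes "f \<in> borel_measurable borel"
  shows "(\<integral>\<^sup>+x. f (x + c) \<partial>lborel) = (\<integral>\<^sup>+x. f x \<partial>lborel)"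
proof -
  have "(\<integral>\<^sup>+x. f x \<partial>lborel) = (\<integral>\<^sup>+x. f x \<partial>(distr lborel borel ((+) c)))" by (simp add: lborel_distr_plus)
  also have "\<dots> = (\<integral>\<^sup>+x. f (c + x) \<partial>lborel)" using assms by (subst nn_integral_distr) auto
  finally show ?thesis by (simp add: add.commute)
qed

lemma integral_lborel_shift:
  fixes f :: "'a::euclidean_space \<Rightarrow> real"
  assumes "f \<in> borel_measurable borel"
  shows "(LINT x|lborel. f (x + c)) = (LINT x|lborel. f x)"
proof -
  have "(LINT x|lborel. f x) = (LINT x|distr lborel borel ((+) c). f x)" by (simp add: lborel_distr_plus)
  also have "\<dots> = (LINT x|lborel. f (c + x))" using assms by (subst integral_distr) auto
  finally show ?thesis by (simp add: add.commute)
qed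

lemma borel_measurable_smult_pair [measurable]:
  "(\<lambda>p. fst p *s snd p :: complex^'n) \<in> borel_measurable (borel \<Otimes>\<^sub>M borel)"
  unfolding borel_prod by (intro borel_measurable_continuous_onI continuous_intros)

lemma borel_measurable_smult [measurable (raw)]:
  assumes "f \<in> borel_measurable M" "g \<in> borel_measurable M"
  shows "(\<lambda>x. f x *s g x :: complex^'n) \<in> borel_measurable M"
  using measurable_compose[OF measurable_Pair[OF assms] borel_measurable_smult_pair] by simp

lemma borel_measurable_cis [measurable]: "cis \<in> borel_measurable borel"
  by (intro borel_measurable_continuous_onI continuous_intros)

text \<open>Comparing the integrals of \<open>f (cis t *s x) * indicator B (y - cis t *s x)\<close> over \<open>x\<close> and \<open>y\<close>,
  \<open>B\<close> the unit ball, in both orders of integration.\<close>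

lemma nn_integral_lborel_cis:
  fixes f :: "complex^'n \<Rightarrow> ennreal"
  assumes [measurable]: "f \<in> borel_measurable borel"
  shows "(\<integral>\<^sup>+x. f (cis t *s x) \<partial>lborel) = (\<integral>\<^sup>+x. f x \<partial>lborel)"
proof -
  define b where "b = (indicator (ball 0 1) :: complex^'n \<Rightarrow> ennreal)"
  have bm[measurable]: "b \<in> borel_measurable borel" unfolding b_def by (intro borel_measurable_indicator) simp
  define m where "m = (\<integral>\<^sup>+y. b y \<partial>lborel)"
  have m: "m \<noteq> 0" "m \<noteq> \<infinity>"
  proof -
    have "m = emeasure lborel (ball (0::complex^'n) 1)" by (simp add: m_def b_def)
    then show "m \<noteq> 0" "m \<noteq> \<infinity>" 
      using emeasure_bounded_finite[of "ball (0::complex^'n) 1"] content_ball_pos[of 1 "0::complex^'n"]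
      by (auto simp: measure_def top.not_eq_extremum)
  qed
  have nrm: "norm (cis t *s x) = norm x" for x :: "complex^'n" by (simp add: norm_smult_cart)
  have inv: "cis t *s (x + cis (- t) *s y) = cis t *s x + y" for x y :: "complex^'n"
    by (simp add: vec_eq_iff distrib_left mult.assoc[symmetric] cis_mult)
  have "(\<integral>\<^sup>+x. (\<integral>\<^sup>+y. f (cis t *s x) * b (y - cis t *s x) \<partial>lborel) \<partial>lborel) = (\<integral>\<^sup>+x. f (cis t *s x) \<partial>lborel) * m"
  proof -
    have "(\<integral>\<^sup>+y. b (y - c) \<partial>lborel) = m" for c
      using nn_integral_lborel_shift[OF bm, of "- c"] by (simp add: m_def)
    then show ?thesis by (simp add: nn_integral_cmult nn_integral_multc)
  qed
  moreover have "(\<integral>\<^sup>+x. (\<integral>\<^sup>+y. f (cis t *s x) * b (y - cis t *s x) \<partial>lborel) \<partial>lborel)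
      = (\<integral>\<^sup>+y. (\<integral>\<^sup>+x. f (cis t *s x) * b (y - cis t *s x) \<partial>lborel) \<partial>lborel)"
    by (rule lborel_pair.Fubini') measurable
  \<comment> \<open>The unit ball is invariant under rotations and reflection, so after the shift
    the factor b no longer depends on y.\<close>
  moreover have "(\<integral>\<^sup>+x. f (cis t *s x) * b (y - cis t *s x) \<partial>lborel) = (\<integral>\<^sup>+x. f (cis t *s x + y) * b x \<partial>lborel)" for y
  proof -
    have "(\<integral>\<^sup>+x. f (cis t *s x) * b (y - cis t *s x) \<partial>lborel) = (\<integral>\<^sup>+x. f (cis t *s (x + cis (- t) *s y)) * b (y - cis t *s (x + cis (- t) *s y)) \<partial>lborel)"
      by (rule nn_integral_lborel_shift[symmetric]) measurable
    also have "\<dots> = (\<integral>\<^sup>+x. f (cis t *s x + y) * b x \<partial>lborel)"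
      unfolding inv by (intro nn_integral_cong arg_cong2[of _ _ _ _ "(*)"] refl) (simp add: b_def indicator_def nrm)
    finally show ?thesis .
  qed
  moreover have "(\<integral>\<^sup>+y. (\<integral>\<^sup>+x. f (cis t *s x + y) * b x \<partial>lborel) \<partial>lborel) = (\<integral>\<^sup>+x. (\<integral>\<^sup>+y. f (cis t *s x + y) * b x \<partial>lborel) \<partial>lborel)"
    by (rule lborel_pair.Fubini') measurable
  moreover have "(\<integral>\<^sup>+x. (\<integral>\<^sup>+y. f (cis t *s x + y) * b x \<partial>lborel) \<partial>lborel) = (\<integral>\<^sup>+x. f x \<partial>lborel) * m"
  proof -
    have "(\<integral>\<^sup>+y. f (c + y) \<partial>lborel) = (\<integral>\<^sup>+x. f x \<partial>lborel)" for c
      using nn_integral_lborel_shift[OF assms, of c] by (simp add: add.commute)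
    then show ?thesis by (simp add: nn_integral_cmult nn_integral_multc m_def)
  qed
  ultimately have "(\<integral>\<^sup>+x. f (cis t *s x) \<partial>lborel) * m = (\<integral>\<^sup>+x. f x \<partial>lborel) * m" by simp
  then show ?thesis using m by (metis ennreal_mult_divide_eq infinity_ennreal_def)
qed

lemma cmean_integral_swap:
  fixes g \<eta> :: "complex^'n \<Rightarrow> real"
  assumes g: "integrable lborel g" and \<eta>[measurable]: "\<eta> \<in> borel_measurable borel" and C: "\<And>x. \<bar>\<eta> x\<bar> \<le> C"
  shows "cmean (\<lambda>\<zeta>. LINT y|lborel. g y * \<eta> (y + \<zeta> *s w)) r = (LINT y|lborel. g y * cmean (\<lambda>\<zeta>. \<eta> (y + \<zeta> *s w)) r)"
proof -
  have [measurable]: "g \<in> borel_measurable borel" using borel_measurable_integrable[OF g] by simp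
  define I where "I = (indicator {0..2*pi} :: real \<Rightarrow> real)"
  have Im[measurable]: "I \<in> borel_measurable borel" by (simp add: I_def)
  have Ii: "integrable lborel I" by (auto simp: I_def intro!: integrable_real_indicator)
  have C0: "0 \<le> C" using C[of 0] by linarith
  have "integrable (lborel \<Otimes>\<^sub>M lborel) (\<lambda>(t, y). I t * \<bar>g y\<bar>)"
  proof (rule lborel_pair.Fubini_integrable)
    show "(\<lambda>(t, y). I t * \<bar>g y\<bar>) \<in> borel_measurable (lborel \<Otimes>\<^sub>M lborel)" by measurable
    have "(\<lambda>t. LINT y|lborel. norm (case (t, y) of (t, y) \<Rightarrow> I t * \<bar>g y\<bar>)) = (\<lambda>t. I t * (LINT y|lborel. \<bar>g y\<bar>))"
      by (auto simp: I_def abs_mult)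
    then show "integrable lborel (\<lambda>t. LINT y|lborel. norm (case (t, y) of (t, y) \<Rightarrow> I t * \<bar>g y\<bar>))" using Ii by simp
    show "AE t in lborel. integrable lborel (\<lambda>y. case (t, y) of (t, y) \<Rightarrow> I t * \<bar>g y\<bar>)" using g by simp
  qed
  then have "integrable (lborel \<Otimes>\<^sub>M lborel) (\<lambda>p. C * (case p of (t, y) \<Rightarrow> I t * \<bar>g y\<bar>))" by (rule integrable_mult_right)
  then have int: "integrable (lborel \<Otimes>\<^sub>M lborel) (\<lambda>(t, y). I t * (g y * \<eta> (y + (of_real r * cis t) *s w)))"
  proof (rule Bochner_Integration.integrable_bound)
    show "(\<lambda>(t, y). I t * (g y * \<eta> (y + (of_real r * cis t) *s w))) \<in> borel_measurable (lborel \<Otimes>\<^sub>M lborel)" by measurable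
    show "AE p in lborel \<Otimes>\<^sub>M lborel. norm (case p of (t, y) \<Rightarrow> I t * (g y * \<eta> (y + (of_real r * cis t) *s w))) \<le> norm (C * (case p of (t, y) \<Rightarrow> I t * \<bar>g y\<bar>))"
    proof (rule AE_I2, clarify)
      fix t y
      have "\<bar>I t * g y\<bar> * \<bar>\<eta> (y + (of_real r * cis t) *s w)\<bar> \<le> \<bar>I t * g y\<bar> * C" using C by (intro mult_left_mono) auto
      then show "norm (I t * (g y * \<eta> (y + (of_real r * cis t) *s w))) \<le> norm (C * (I t * \<bar>g y\<bar>))"
        using C0 by (simp add: abs_mult mult_ac)
    qed
  qed
  have "(LINT t|lborel. (LINT y|lborel. I t * (g y * \<eta> (y + (of_real r * cis t) *s w)))) =
        (LINT y|lborel. (LINT t|lborel. I t * (g y * \<eta> (y + (of_real r * cis t) *s w))))"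
    using lborel_pair.Fubini_integral[OF int] by simp
  moreover have "(LINT t|lborel. I t * (g y * \<eta> (y + (of_real r * cis t) *s w))) = g y * (LINT t|lborel. I t * \<eta> (y + (of_real r * cis t) *s w))" for y
  proof -
    have "(\<lambda>t. I t * (g y * \<eta> (y + (of_real r * cis t) *s w))) = (\<lambda>t. g y * (I t * \<eta> (y + (of_real r * cis t) *s w)))"
      by (simp add: mult_ac)
    then show ?thesis by (simp only: integral_mult_right_zero)
  qed
  ultimately show ?thesis
    by (simp add: cmean_def set_lebesgue_integral_def I_def mult.assoc)
qed

section \<open>Local integrability and the sub-mean value property for radial kernels\<close>

text \<open>With the value \<infinity> off W the sublevel sets stay open, which gives Borel
  measurability on the whole space; in integrands
  \<open>e2ennreal (ereal M - ext_infinity W u y)\<close> this value contributes 0.\<close>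

definition ext_infinity :: "(complex^'n) set \<Rightarrow> (complex^'n \<Rightarrow> ereal) \<Rightarrow> complex^'n \<Rightarrow> ereal" where
  "ext_infinity W u x = (if x \<in> W then u x else \<infinity>)"

lemma ext_infinity_measurable:
  assumes "open W" "usc_on W u"
  shows "ext_infinity W u \<in> borel_measurable borel"
proof (rule borel_measurableI_less)
  fix c :: ereal
  have eq: "{x. ext_infinity W u x < c} = {x\<in>W. u x < c}" by (auto simp: ext_infinity_def)
  have "open {x\<in>W. u x < c}"
    unfolding open_subopen[of "{x\<in>W. u x < c}"]
  proof
    fix x assume x: "x \<in> {x\<in>W. u x < c}"
    then have "\<forall>\<^sub>F y in at x within W. u y < c" using assms(2) by (auto simp: usc_on_def)
    then have "\<forall>\<^sub>F y in at x. u y < c" using x assms(1) by (simp only: at_within_open[OF _ assms(1)] mem_Collect_eq)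
    then have "\<forall>\<^sub>F y in nhds x. u y < c" using x by (simp add: eventually_nhds_conv_at)
    then obtain A where "open A" "x \<in> A" "\<forall>y\<in>A. u y < c" by (auto simp: eventually_nhds)
    then show "\<exists>T. open T \<and> x \<in> T \<and> T \<subseteq> {x\<in>W. u x < c}"
      using x assms(1) by (intro exI[of _ "A \<inter> W"]) auto
  qed
  then show "{x \<in> space borel. ext_infinity W u x < c} \<in> sets borel" by (simp add: eq)
qed

text \<open>The sub-mean inequality rewritten for M - u \<ge> 0 as a single integral with values in
  [0, \<infinity>], to which Tonelli's theorem can be applied. If u z = -\<infinity>, the right side
  is infinite.\<close>

lemma psh_circle_bound:
  fixes u :: "complex^'n \<Rightarrow> ereal"
  assumes u: "psh_on W u" "open W" and d: "\<And>\<zeta>. cmod \<zeta> \<le> 1 \<Longrightarrow> z + \<zeta> *s w \<in> W"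
    and M: "0 \<le> M" "\<And>\<zeta>. cmod \<zeta> = 1 \<Longrightarrow> u (z + \<zeta> *s w) \<le> ereal M"
  shows "(\<integral>\<^sup>+t\<in>{0..2*pi}. e2ennreal (ereal M - u (z + cis t *s w)) \<partial>lborel) \<le> ennreal (2 * pi) * e2ennreal (ereal M - u z)"
proof (cases "u z = -\<infinity>")
  case True
  have "e2ennreal \<infinity> = \<infinity>" by simp
  then have "ennreal (2 * pi) * e2ennreal (ereal M - u z) = \<infinity>"
    using True by (simp add: ennreal_mult_top infinity_ennreal_def)
  then show ?thesis by simp
next
  case False
  have us: "usc_on W u" using u by (simp add: psh_on_def)
  have zW: "z \<in> W" using d[of 0] by simp
  define U where "U t = ext_infinity W u (z + cis t *s w)" for t
  have [measurable]: "ext_infinity W u \<in> borel_measurable borel" using ext_infinity_measurable[OF u(2) us] .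
  have [measurable]: "U \<in> borel_measurable borel" unfolding U_def by measurable
  have Uu: "U t = u (z + cis t *s w)" for t using d[of "cis t"] by (simp add: U_def ext_infinity_def)
  have UM: "U t \<le> ereal M" for t using M(2)[of "cis t"] by (simp add: Uu)
  obtain a where a: "u z = ereal a" using False u(1) zW by (cases "u z") (auto simp: psh_on_def)
  define P N I where "P = (\<integral>\<^sup>+t\<in>{0..2*pi}. e2ennreal (U t) \<partial>lborel)" and "N = (\<integral>\<^sup>+t\<in>{0..2*pi}. e2ennreal (- U t) \<partial>lborel)"
    and "I = (\<integral>\<^sup>+t\<in>{0..2*pi}. e2ennreal (ereal M - U t) \<partial>lborel)"
  \<comment> \<open>(M - x) + x^+ = M + x^-, also for x = -\<infinity>. Integrated, this turns the
    difference of integrals in \<open>circle_mean\<close> into one integral.\<close>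
  have pw: "e2ennreal (ereal M - x) + e2ennreal x = ennreal M + e2ennreal (- x)" if "x \<le> ereal M" for x
  proof (cases x)
    case (real y)
    show ?thesis
    proof (cases "y \<ge> 0")
      case True
      then show ?thesis using that M real by (simp add: e2ennreal_ereal ennreal_plus[symmetric] ennreal_neg del: ennreal_plus)
    next
      case False
      then show ?thesis using that M real by (simp add: e2ennreal_ereal ennreal_plus[symmetric] ennreal_neg del: ennreal_plus)
    qed
  next
    case MInf
    have "e2ennreal \<infinity> = \<infinity>" by simp
    then show ?thesis using MInf by (simp add: infinity_ennreal_def e2ennreal_neg)
  qed (use that in auto)
  have "I + P = (\<integral>\<^sup>+t. (e2ennreal (ereal M - U t) + e2ennreal (U t)) * indicator {0..2*pi} t \<partial>lborel)"
    unfolding I_def P_def by (subst nn_integral_add[symmetric]) (auto simp: distrib_right)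
  also have "\<dots> = (\<integral>\<^sup>+t. (ennreal M + e2ennreal (- U t)) * indicator {0..2*pi} t \<partial>lborel)" by (simp only: pw[OF UM])
  also have "\<dots> = (\<integral>\<^sup>+t. ennreal M * indicator {0..2*pi} t \<partial>lborel) + N"
    unfolding N_def by (subst nn_integral_add[symmetric]) (auto simp: distrib_right)
  also have "(\<integral>\<^sup>+t. ennreal M * indicator {0..2*pi} t \<partial>lborel) = ennreal (2 * pi * M)"
    using M by (simp add: nn_integral_cmult_indicator ennreal_mult[symmetric] mult.commute)
  finally have IP: "I + P = ennreal (2 * pi * M) + N" .
  have "P \<le> (\<integral>\<^sup>+t. ennreal M * indicator {0..2*pi} t \<partial>lborel)"
    unfolding P_def using e2ennreal_mono[OF UM] by (intro nn_integral_mono) (auto simp: indicator_def e2ennreal_ereal)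
  also have "\<dots> = ennreal (2 * pi * M)"
    using M by (simp add: nn_integral_cmult_indicator ennreal_mult[symmetric] mult.commute)
  finally have Pf: "P < \<infinity>" by (simp add: order.strict_trans1[OF _ ennreal_less_top])
  then obtain p where p: "P = ennreal p" "0 \<le> p" by (cases P) auto
  have "u z \<le> circle_mean u z w" using u d by (auto simp: psh_on_def)
  also have "circle_mean u z w = (enn2ereal P - enn2ereal N) / ereal (2 * pi)"
    by (simp add: circle_mean_def P_def N_def Uu)
  finally have az: "ereal a \<le> (ereal p - enn2ereal N) / ereal (2 * pi)" using p by (simp add: a enn2ereal_ennreal)
  have "N \<noteq> \<infinity>"
  proof
    assume "N = \<infinity>"
    then have "enn2ereal N = \<infinity>" by (simp add: infinity_ennreal_def)
    then show False using az by simp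
  qed
  then obtain n where n: "N = ennreal n" "0 \<le> n" by (cases N) auto
  have an: "a \<le> (p - n) / (2 * pi)" using az n by (simp add: enn2ereal_ennreal)
  have "I \<noteq> \<infinity>"
  proof
    assume "I = \<infinity>"
    then have "ennreal (2 * pi * M) + N = top" using IP by (simp add: infinity_ennreal_def)
    then show False using n by (simp add: ennreal_add_eq_top)
  qed
  then obtain i where i: "I = ennreal i" "0 \<le> i" by (cases I) auto
  have "ennreal (i + p) = ennreal (2 * pi * M + n)" using IP i n p M by simp
  then have "i + p = 2 * pi * M + n" using i n p M by (subst (asm) ennreal_inj) auto
  moreover have "2 * pi * a \<le> p - n" using an by (simp add: field_simps)
  ultimately have "i \<le> 2 * pi * (M - a)" by (simp add: algebra_simps)
  moreover from this have "0 \<le> 2 * pi * (M - a)" using i by linarith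
  then have "0 \<le> M - a" using pi_gt_zero by (auto simp: zero_le_mult_iff simp del: pi_gt_zero)
  ultimately have "I \<le> ennreal (2 * pi) * ennreal (M - a)" using i by (simp add: ennreal_mult[symmetric] ennreal_leI)
  then show ?thesis by (simp add: I_def Uu a e2ennreal_ereal)
qed

text \<open>In place of polar coordinates, the integral is averaged over the rotations
  \<open>cis t\<close>, under which k and Lebesgue measure are invariant; each x then contributes
  the circle about z through z + x. Indicators of balls as k give local integrability, mollifiers
  the sub-mean property of convolutions.\<close>

lemma psh_kernel_bound:
  fixes u :: "complex^'n \<Rightarrow> ereal"
  assumes u: "psh_on W u" "open W" and z: "cball z R \<subseteq> W" and M: "0 \<le> M" "\<And>x. x \<in> cball z R \<Longrightarrow> u x \<le> ereal M"
    and k[measurable]: "k \<in> borel_measurable borel" and krot: "\<And>t x. k (cis t *s x) = k x" and k0: "\<And>x. R < norm x \<Longrightarrow> k x = 0"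
  shows "(\<integral>\<^sup>+y. k (y - z) * e2ennreal (ereal M - ext_infinity W u y) \<partial>lborel)
           \<le> e2ennreal (ereal M - u z) * (\<integral>\<^sup>+x. k x \<partial>lborel)"
proof -
  have us: "usc_on W u" using u by (simp add: psh_on_def)
  define G where "G x = e2ennreal (ereal M - ext_infinity W u (z + x))" for x
  have [measurable]: "ext_infinity W u \<in> borel_measurable borel" using ext_infinity_measurable[OF u(2) us] .
  have [measurable]: "G \<in> borel_measurable borel" unfolding G_def by measurable
  define L where "L = (\<integral>\<^sup>+x. k x * G x \<partial>lborel)"
  have L_eq: "(\<integral>\<^sup>+y. k (y - z) * e2ennreal (ereal M - ext_infinity W u y) \<partial>lborel) = L"
    using nn_integral_lborel_shift[of "\<lambda>y. k (y - z) * e2ennreal (ereal M - ext_infinity W u y)" z]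
    by (simp add: L_def G_def add.commute)
  have "L = (\<integral>\<^sup>+x. k x * G (cis t *s x) \<partial>lborel)" for t
    using nn_integral_lborel_cis[of "\<lambda>x. k x * G x" t] by (simp add: L_def krot)
  then have "ennreal (2 * pi) * L = (\<integral>\<^sup>+t. (\<integral>\<^sup>+x. k x * G (cis t *s x) \<partial>lborel) * indicator {0..2*pi} t \<partial>lborel)"
  proof -
    assume a: "\<And>t. L = (\<integral>\<^sup>+x. k x * G (cis t *s x) \<partial>lborel)"
    have "(\<integral>\<^sup>+t. (\<integral>\<^sup>+x. k x * G (cis t *s x) \<partial>lborel) * indicator {0..2*pi} t \<partial>lborel) = (\<integral>\<^sup>+t. L * indicator {0..2*pi} t \<partial>lborel)"
      by (simp add: a[symmetric])
    also have "\<dots> = ennreal (2 * pi) * L" by (simp add: nn_integral_cmult_indicator mult.commute)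
    finally show ?thesis by simp
  qed
  also have "\<dots> = (\<integral>\<^sup>+t. (\<integral>\<^sup>+x. k x * G (cis t *s x) * indicator {0..2*pi} t \<partial>lborel) \<partial>lborel)"
    by (intro nn_integral_cong nn_integral_multc[symmetric]) measurable
  also have "\<dots> = (\<integral>\<^sup>+x. (\<integral>\<^sup>+t. k x * G (cis t *s x) * indicator {0..2*pi} t \<partial>lborel) \<partial>lborel)"
    by (rule lborel_pair.Fubini') measurable
  also have "\<dots> \<le> (\<integral>\<^sup>+x. ennreal (2 * pi) * e2ennreal (ereal M - u z) * k x \<partial>lborel)"
  proof (rule nn_integral_mono)
    fix x
    have "(\<integral>\<^sup>+t. k x * G (cis t *s x) * indicator {0..2*pi} t \<partial>lborel) = k x * (\<integral>\<^sup>+t\<in>{0..2*pi}. G (cis t *s x) \<partial>lborel)"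
      by (subst nn_integral_cmult[symmetric]) (auto simp: mult.assoc)
    also have "\<dots> \<le> k x * (ennreal (2 * pi) * e2ennreal (ereal M - u z))"
    proof (cases "norm x \<le> R")
      case True
      have inb: "z + \<zeta> *s x \<in> cball z R" if "cmod \<zeta> \<le> 1" for \<zeta>
        using True that mult_mono[of "cmod \<zeta>" 1 "norm x" R] by (simp add: dist_norm norm_smult_cart)
      have "(\<integral>\<^sup>+t\<in>{0..2*pi}. G (cis t *s x) \<partial>lborel) = (\<integral>\<^sup>+t\<in>{0..2*pi}. e2ennreal (ereal M - u (z + cis t *s x)) \<partial>lborel)"
        using inb z by (intro nn_integral_cong) (auto simp: G_def ext_infinity_def subset_iff)
      also have "\<dots> \<le> ennreal (2 * pi) * e2ennreal (ereal M - u z)"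
        using inb z M by (intro psh_circle_bound[OF u]) auto
      finally show ?thesis by (rule mult_left_mono) simp
    qed (simp add: k0)
    finally show "(\<integral>\<^sup>+t. k x * G (cis t *s x) * indicator {0..2*pi} t \<partial>lborel) \<le> ennreal (2 * pi) * e2ennreal (ereal M - u z) * k x"
      by (simp add: mult_ac)
  qed
  also have "\<dots> = ennreal (2 * pi) * (e2ennreal (ereal M - u z) * (\<integral>\<^sup>+x. k x \<partial>lborel))"
    by (simp add: nn_integral_cmult mult.assoc)
  finally have "ennreal (2 * pi) * L \<le> ennreal (2 * pi) * (e2ennreal (ereal M - u z) * (\<integral>\<^sup>+x. k x \<partial>lborel))" .
  then have "(L * ennreal (2 * pi)) / ennreal (2 * pi) \<le> (e2ennreal (ereal M - u z) * (\<integral>\<^sup>+x. k x \<partial>lborel)) * ennreal (2 * pi) / ennreal (2 * pi)"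
    by (intro divide_right_mono_ennreal) (simp add: mult.commute)
  then have "L \<le> e2ennreal (ereal M - u z) * (\<integral>\<^sup>+x. k x \<partial>lborel)"
    by (subst (asm) (1 2) ennreal_mult_divide_eq) auto
  then show ?thesis by (simp add: L_eq)
qed

section \<open>Positivity of currents and asymptotic sub-mean values\<close>

lemma ddc_continuous: "smooth_on UNIV \<eta> \<Longrightarrow> continuous_on UNIV (\<lambda>z. ddc \<eta> z w (\<i> *s w))"
  by (rule smooth_second_derivatives[of \<eta>]) (auto intro!: continuous_on_add)

lemma continuous_compact_support_bounded:
  fixes f :: "complex^'n \<Rightarrow> real"
  assumes "continuous_on UNIV f" "\<And>x. R < norm x \<Longrightarrow> f x = 0"
  obtains C where "0 \<le> C" "\<And>x. \<bar>f x\<bar> \<le> C"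
proof -
  have "compact (f ` cball 0 R)" using assms(1) by (intro compact_continuous_image) (auto intro: continuous_on_subset)
  then obtain B where B: "\<And>x. x \<in> cball 0 R \<Longrightarrow> \<bar>f x\<bar> \<le> B"
    using compact_imp_bounded by (fastforce simp: bounded_iff)
  have "\<bar>f x\<bar> \<le> \<bar>B\<bar>" for x
    using B[of x] assms(2)[of x] by (cases "norm x \<le> R") auto
  then show ?thesis using that[of "\<bar>B\<bar>"] by simp
qed

lemma integrable_bounded_support:
  fixes f :: "complex^'n \<Rightarrow> real"
  assumes [measurable]: "f \<in> borel_measurable borel" and "\<And>x. \<bar>f x\<bar> \<le> C" "\<And>x. R < norm x \<Longrightarrow> f x = 0"
  shows "integrable lborel f"
proof (rule Bochner_Integration.integrable_bound)
  show "integrable lborel (\<lambda>x::complex^'n. C * indicator (cball 0 R) x)"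
    by (intro integrable_mult_right integrable_real_indicator) (auto intro!: emeasure_bounded_finite[unfolded infinity_ennreal_def])
  show "AE x in lborel. norm (f x) \<le> norm (C * indicator (cball 0 R) x)"
  proof (rule AE_I2)
    fix x :: "complex^'n"
    show "norm (f x) \<le> norm (C * indicator (cball 0 R) x)"
      using assms(2)[of x] assms(3)[of x] by (cases "norm x \<le> R") auto
  qed
qed simp

lemma integrable_mult_bounded_support:
  fixes f g :: "complex^'n \<Rightarrow> real"
  assumes [measurable]: "f \<in> borel_measurable borel" "g \<in> borel_measurable borel"
    and b: "\<And>x. \<bar>f x\<bar> \<le> C" "\<And>x. \<bar>g x\<bar> \<le> B" and z: "\<And>x. R < norm x \<Longrightarrow> f x = 0"
  shows "integrable lborel (\<lambda>x. f x * g x)"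
proof (rule integrable_bounded_support[where C = "C * B" and R = R])
  show "\<bar>f x * g x\<bar> \<le> C * B" for x
    unfolding abs_mult using b[of x] by (intro mult_mono) auto
qed (use z in auto)

lemma cint_bounded:
  assumes [measurable]: "f \<in> borel_measurable borel" and "\<And>\<zeta>. \<bar>f \<zeta>\<bar> \<le> C"
  shows "cint f r"
  unfolding cint_def set_integrable_def
proof (rule Bochner_Integration.integrable_bound)
  show "integrable lborel (\<lambda>t. C * indicator {0..2*pi} t)"
    by (intro integrable_mult_right integrable_real_indicator) auto
  show "AE t in lborel. norm (indicator {0..2*pi} t *\<^sub>R f (of_real r * cis t)) \<le> norm (C * indicator {0..2*pi} t)"
    using assms(2)[of "of_real r * cis _"] by (intro AE_I2) (auto simp: indicator_def intro: order_trans[OF _ abs_ge_self])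
qed measurable

lemma cmean_bounded:
  assumes "f \<in> borel_measurable borel" "\<And>\<zeta>. \<bar>f \<zeta>\<bar> \<le> C" "0 \<le> r"
  shows "\<bar>cmean f r\<bar> \<le> C"
proof -
  have ci: "cint f r" using cint_bounded assms by blast
  have b: "f \<zeta> \<le> C" "- C \<le> f \<zeta>" for \<zeta> using assms(2)[of \<zeta>] by auto
  have "cmean f r \<le> cmean (\<lambda>_. C) r" "cmean (\<lambda>_. - C) r \<le> cmean f r"
    using assms(3) b by (intro cmean_mono ci cint_const; simp)+
  then show ?thesis by simp
qed

lemma cmean_measurable [measurable (raw)]:
  fixes g :: "complex^'n \<Rightarrow> real"
  assumes [measurable]: "g \<in> borel_measurable borel"
  shows "(\<lambda>y. cmean (\<lambda>\<zeta>. g (y + \<zeta> *s w)) r) \<in> borel_measurable borel"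
proof -
  have "(\<lambda>y. LINT t|lborel. indicator {0..2*pi} t *\<^sub>R g (y + (of_real r * cis t) *s w)) \<in> borel_measurable (borel :: (complex^'n) measure)"
    by (rule lborel.borel_measurable_lebesgue_integral) measurable
  then show ?thesis by (simp add: cmean_def set_lebesgue_integral_def)
qed

lemma borel_measurable_extend_zero:
  fixes f :: "complex^'n \<Rightarrow> real"
  assumes "usc D f" "open D"
  shows "(\<lambda>x. if x \<in> D then f x else 0) \<in> borel_measurable borel"
proof -
  have "f \<in> borel_measurable (restrict_space borel D)" using assms by (intro usc_borel_measurable) auto
  then have "(\<lambda>x. indicator D x *\<^sub>R f x) \<in> borel_measurable borel"
    using assms(2) by (subst (asm) borel_measurable_restrict_space_iff) auto
  moreover have "(\<lambda>x. indicator D x *\<^sub>R f x) = (\<lambda>x. if x \<in> D then f x else 0)" by (auto simp: indicator_def)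
  ultimately show ?thesis by simp
qed

lemma integral_product_shift:
  fixes f g :: "complex^'n \<Rightarrow> real"
  assumes [measurable]: "f \<in> borel_measurable borel" "g \<in> borel_measurable borel"
  shows "(LINT y|lborel. g y * f (y + c)) = (LINT y|lborel. f y * g (y - c))"
  using integral_lborel_shift[of "\<lambda>y. f y * g (y - c)" c] by (simp add: mult.commute)

lemma test_function_support:
  assumes "nonneg_test_function D (\<eta> :: complex^'n \<Rightarrow> real)"
  obtains S R where "compact S" "S \<subseteq> D" "\<And>x. x \<in> S \<Longrightarrow> norm x \<le> R" "\<And>x. x \<notin> S \<Longrightarrow> \<eta> x = 0"
    "\<And>x w v. x \<notin> S \<Longrightarrow> ddc \<eta> x w v = 0" "smooth_on UNIV \<eta>" "\<And>x. 0 \<le> \<eta> x"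
proof -
  define S where "S = closure {z. \<eta> z \<noteq> 0}"
  have S: "compact S" "S \<subseteq> D" using assms by (auto simp: nonneg_test_function_def S_def)
  then obtain R where R: "\<And>x. x \<in> S \<Longrightarrow> norm x \<le> R" using compact_imp_bounded[OF S(1)] by (auto simp: bounded_iff)
  have z: "\<eta> x = 0" if "x \<notin> S" for x using that closure_subset[of "{z. \<eta> z \<noteq> 0}"] by (auto simp: S_def)
  have "open (- S)" by (auto simp: S_def)
  then have "ddc \<eta> x w v = 0" if "x \<notin> S" for x w v using z that by (intro ddc_eq_0_outside[of "- S"]) auto
  then show ?thesis using that[OF S R z] assms by (auto simp: nonneg_test_function_def)
qed

text \<open>For small r, pairing G with r^2/4 dd^c \<eta> is close to pairing it with the circle
  mean of \<eta> minus \<eta>. Fubini and a translation move the mean onto G, where the sub-mean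
  inequality yields at least -r^2/4 times the pairing of h + \<delta> with \<eta>. Division by r^2/4
  and \<delta> \<rightarrow> 0 give the claim.\<close>

lemma current_positive:
  fixes G :: "complex^'n \<Rightarrow> real"
  assumes D: "open D" and G: "usc D G" "\<And>x. x \<in> D \<Longrightarrow> m \<le> G x" "\<And>x. x \<in> D \<Longrightarrow> G x \<le> M"
    and as: "\<And>z w. z \<in> D \<Longrightarrow> asub G z w (h z w)"
    and h: "\<And>w. continuous_on D (\<lambda>z. h z w)" "\<And>z w. z \<in> D \<Longrightarrow> 0 \<le> h z w" "\<And>z w. z \<in> D \<Longrightarrow> h z (- w) = h z w"
    and \<eta>: "nonneg_test_function D \<eta>"
  shows "0 \<le> (LINT z:D|lborel. h z w * \<eta> z + G z * ddc \<eta> z w (\<i> *s w))"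
proof -
  obtain S R where S: "compact S" "S \<subseteq> D" "\<And>x. x \<in> S \<Longrightarrow> norm x \<le> R" "\<And>x. x \<notin> S \<Longrightarrow> \<eta> x = 0"
    "\<And>x w v. x \<notin> S \<Longrightarrow> ddc \<eta> x w v = 0" and sm: "smooth_on UNIV \<eta>" and \<eta>0: "\<And>x. 0 \<le> \<eta> x"
    using test_function_support[OF \<eta>] by blast
  \<comment> \<open>A bounded neighbourhood of the support: cutting G off outside it leaves an
    integrable function, and the small discs used below stay inside.\<close>
  define W where "W = D \<inter> ball 0 (R + 2)"
  have W: "open W" "S \<subseteq> W" "W \<subseteq> D" using D S by (force simp: W_def)+
  have \<eta>c: "continuous_on UNIV \<eta>" using sm by (rule smooth_on_imp_continuous_on)
  define H where "H x = (if x \<in> W then h x w else 0)" for x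
  define g where "g x = (if x \<in> W then G x else 0)" for x
  define dd where "dd z = ddc \<eta> z w (\<i> *s w)" for z
  have ddc: "continuous_on UNIV dd" unfolding dd_def by (rule ddc_continuous[OF sm])
  have [measurable]: "\<eta> \<in> borel_measurable borel" "dd \<in> borel_measurable borel"
    using \<eta>c ddc by (auto intro: borel_measurable_continuous_onI)
  have [measurable]: "H \<in> borel_measurable borel" unfolding H_def
    by (rule borel_measurable_extend_zero[OF _ W(1)]) (use h W in \<open>auto intro: continuous_imp_usc continuous_on_subset\<close>)
  have [measurable]: "g \<in> borel_measurable borel" unfolding g_def
    by (rule borel_measurable_extend_zero[OF _ W(1)]) (use G W in \<open>auto intro: usc_subset\<close>)
  define B where "B = max \<bar>m\<bar> \<bar>M\<bar>"
  have gB: "\<bar>g x\<bar> \<le> B" for x using G(2,3)[of x] W by (auto simp: g_def B_def)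
  have gR: "g x = 0" if "R + 2 < norm x" for x using that by (simp add: g_def W_def)
  have gint: "integrable lborel g" by (rule integrable_bounded_support[of _ B "R + 2"]) (use gB in \<open>auto simp: g_def W_def\<close>)
  have \<eta>R: "\<eta> x = 0" "dd x = 0" if "R < norm x" for x using S(3)[of x] S(4,5)[of x] that by (auto simp: dd_def)
  obtain C where C: "0 \<le> C" "\<And>x. \<bar>\<eta> x\<bar> \<le> C" using continuous_compact_support_bounded[OF \<eta>c \<eta>R(1)] by blast
  obtain C2 where C2: "0 \<le> C2" "\<And>x. \<bar>dd x\<bar> \<le> C2" using continuous_compact_support_bounded[OF ddc \<eta>R(2)] by blast
  have \<eta>int: "integrable lborel \<eta>" by (rule integrable_bounded_support[of _ C R]) (use C \<eta>R in auto)
  have "compact ((\<lambda>z. h z w) ` S)" by (rule compact_continuous_image[OF continuous_on_subset[OF h(1) S(2)] S(1)])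
  then obtain Ch where Ch: "\<And>x. x \<in> S \<Longrightarrow> \<bar>h x w\<bar> \<le> Ch" using compact_imp_bounded by (fastforce simp: bounded_iff)
  have H\<eta>int: "integrable lborel (\<lambda>x. H x * \<eta> x)"
  proof (rule integrable_bounded_support[of _ "\<bar>Ch\<bar> * C" R])
    show "\<bar>H x * \<eta> x\<bar> \<le> \<bar>Ch\<bar> * C" for x
    proof (cases "x \<in> S")
      case True
      then have "\<bar>H x\<bar> \<le> \<bar>Ch\<bar>" using Ch[OF True] by (auto simp: H_def)
      then show ?thesis using C by (simp add: abs_mult mult_mono)
    qed (use S C in auto)
  qed (use \<eta>R in auto)
  have gddint: "integrable lborel (\<lambda>x. g x * dd x)"
    by (rule integrable_mult_bounded_support[OF _ _ gB C2(2) gR]) auto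
  have claim: "0 \<le> (LINT x|lborel. H x * \<eta> x) + (LINT x|lborel. g x * dd x) + \<delta> * ((LINT x|lborel. \<eta> x) + 4 * (LINT x|lborel. \<bar>g x\<bar>))"
    if \<delta>: "\<delta> > 0" for \<delta>
  proof -
    obtain r0 where r0: "0 < r0" "\<And>r x. 0 < r \<Longrightarrow> r < r0 \<Longrightarrow> \<bar>cmean (\<lambda>\<zeta>. \<eta> (x + \<zeta> *s w)) r - \<eta> x - r\<^sup>2 / 4 * dd x\<bar> \<le> \<delta> * r\<^sup>2"
      using cmean_expansion[OF sm \<eta>R(1) \<delta>] unfolding dd_def by blast
    \<comment> \<open>Translation turns w into -w, so the inequality is wanted in direction -w;
      evenness of h in w returns to the original direction.\<close>
    have "\<exists>d>0. \<forall>y r. dist y z0 < d \<longrightarrow> 0 < r \<longrightarrow> r * norm w < d \<longrightarrow>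
        G y \<le> cmean (\<lambda>\<zeta>. g (y + \<zeta> *s (- w))) r + r\<^sup>2 / 4 * (h y w + \<delta>)" if z0: "z0 \<in> S" for z0
    proof -
      have z0W: "z0 \<in> W" using z0 W by auto
      have GW: "usc W G" using usc_subset[OF G(1) W(3)] .
      have GmW: "m \<le> G x" if "x \<in> W" for x using G(2) W(3) that by blast
      have asW: "asub G x (- w) (h x (- w))" if "x \<in> W" for x using as W(3) that by blast
      have hc: "continuous_on W (\<lambda>x. h x (- w))" using continuous_on_subset[OF h(1) W(3)] .
      have hp: "0 \<le> h x (- w)" if "x \<in> W" for x using h(2) W(3) that by blast
      obtain \<rho> where \<rho>: "\<rho> > 0" "ball z0 (2 * \<rho>) \<subseteq> W"
        "\<And>u m z s. usc W u \<Longrightarrow> (\<And>x. x \<in> W \<Longrightarrow> m \<le> u x) \<Longrightarrow> (\<And>x. x \<in> W \<Longrightarrow> asub u x (- w) (h x (- w))) \<Longrightarrow>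
       dist z z0 < \<rho> \<Longrightarrow> 0 < s \<Longrightarrow> s * norm (- w) < \<rho> \<Longrightarrow>
       u z \<le> cmean (\<lambda>\<zeta>. u (z + \<zeta> *s (- w))) s + s\<^sup>2 / 4 * (h z0 (- w) + \<delta> / 2)"
        using disc_submean_uniform[OF W(1) z0W hc hp half_gt_zero[OF \<delta>], where w = "- w"] by blast
      have "continuous_on W (\<lambda>z. - h z w)" using h(1) W(3) by (intro continuous_intros) (rule continuous_on_subset)
      then have "usc W (\<lambda>z. - h z w)" by (rule continuous_imp_usc)
      then have "\<forall>\<^sub>F y in nhds z0. y \<in> W \<and> - h y w < - h z0 w + \<delta> / 2" using W z0W \<delta> by (intro usc_openD) auto
      then obtain d where d: "d > 0" "\<And>y. dist y z0 < d \<Longrightarrow> - h y w < - h z0 w + \<delta> / 2"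
        by (auto simp: eventually_nhds_metric)
      show ?thesis
      proof (intro exI conjI allI impI)
        show "0 < min \<rho> d" using \<rho> d by simp
        fix y r assume a: "dist y z0 < min \<rho> d" "0 < r" "r * norm w < min \<rho> d"
        have inW: "y + \<zeta> *s (- w) \<in> W" if "cmod \<zeta> = r" for \<zeta>
          by (rule subsetD[OF \<rho>(2)], rule disc_in_ball[of _ _ r]) (use a that in auto)
        have "G y \<le> cmean (\<lambda>\<zeta>. G (y + \<zeta> *s (- w))) r + r\<^sup>2 / 4 * (h z0 (- w) + \<delta> / 2)"
          by (rule \<rho>(3)[OF GW GmW asW]) (use a in auto)
        also have "cmean (\<lambda>\<zeta>. G (y + \<zeta> *s (- w))) r = cmean (\<lambda>\<zeta>. g (y + \<zeta> *s (- w))) r"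
          using inW a by (intro cmean_cong) (auto simp: g_def)
        also have "r\<^sup>2 / 4 * (h z0 (- w) + \<delta> / 2) \<le> r\<^sup>2 / 4 * (h y w + \<delta>)"
          using d(2)[of y] a h(3)[of z0 w] z0W W by (intro mult_left_mono) auto
        finally show "G y \<le> cmean (\<lambda>\<zeta>. g (y + \<zeta> *s (- w))) r + r\<^sup>2 / 4 * (h y w + \<delta>)" by simp
      qed
    qed
    then obtain d where d: "\<And>z0. z0 \<in> S \<Longrightarrow> d z0 > 0" "\<And>z0 y r. z0 \<in> S \<Longrightarrow> dist y z0 < d z0 \<Longrightarrow> 0 < r \<Longrightarrow> r * norm w < d z0 \<Longrightarrow>
        G y \<le> cmean (\<lambda>\<zeta>. g (y + \<zeta> *s (- w))) r + r\<^sup>2 / 4 * (h y w + \<delta>)" by metis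
    \<comment> \<open>Compactness of the support makes the admissible radius r uniform.\<close>
    have "S \<subseteq> (\<Union>z0\<in>S. ball z0 (d z0))" using d(1) by force
    then obtain T where T: "T \<subseteq> S" "finite T" "S \<subseteq> (\<Union>z0\<in>T. ball z0 (d z0))"
      using compactE_image[OF S(1), of S "\<lambda>z0. ball z0 (d z0)"] by auto
    define r1 where "r1 = Min (insert 1 (d ` T)) / (norm w + 1)"
    have nw: "norm w + 1 > 0" by (simp add: add_nonneg_pos)
    have "Min (insert 1 (d ` T)) > 0" using T d(1) by (subst Min_gr_iff) auto
    then have r1: "r1 > 0" using nw unfolding r1_def by (rule divide_pos_pos)
    have sub: "G y \<le> cmean (\<lambda>\<zeta>. g (y + \<zeta> *s (- w))) r + r\<^sup>2 / 4 * (h y w + \<delta>)" if "y \<in> S" "0 < r" "r < r1" for y r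
    proof -
      obtain z0 where z0: "z0 \<in> T" "dist y z0 < d z0" using T(3) \<open>y \<in> S\<close> by (auto simp: dist_commute)
      have "r * norm w \<le> r * (norm w + 1)" using that by (intro mult_left_mono) auto
      also have "\<dots> < Min (insert 1 (d ` T))" using that nw by (simp add: r1_def field_simps)
      also have "\<dots> \<le> d z0" using z0 T by (intro Min_le) auto
      finally show ?thesis using d(2)[of z0 y r] z0 T that by auto
    qed
    define r where "r = min r0 r1 / 2"
    have r: "0 < r" "r < r0" "r < r1" using r0(1) r1 by (auto simp: r_def)
    have g_eta: "(LINT y|lborel. g y * cmean (\<lambda>\<zeta>. \<eta> (y + \<zeta> *s w)) r) = (LINT y|lborel. \<eta> y * cmean (\<lambda>\<zeta>. g (y + \<zeta> *s (- w))) r)"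
    proof -
      have "(LINT y|lborel. g y * cmean (\<lambda>\<zeta>. \<eta> (y + \<zeta> *s w)) r) = cmean (\<lambda>\<zeta>. LINT y|lborel. g y * \<eta> (y + \<zeta> *s w)) r"
        by (rule cmean_integral_swap[symmetric, OF gint _ C(2)]) simp
      also have "\<dots> = cmean (\<lambda>\<zeta>. LINT y|lborel. \<eta> y * g (y + \<zeta> *s (- w))) r"
      proof -
        have "(LINT y|lborel. g y * \<eta> (y + \<zeta> *s w)) = (LINT y|lborel. \<eta> y * g (y + \<zeta> *s (- w)))" for \<zeta>
          by (subst integral_product_shift) simp_all
        then show ?thesis by simp
      qed
      also have "\<dots> = (LINT y|lborel. \<eta> y * cmean (\<lambda>\<zeta>. g (y + \<zeta> *s (- w))) r)"
        by (rule cmean_integral_swap[OF \<eta>int _ gB]) simp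
      finally show ?thesis .
    qed
    have cm\<eta>: "\<bar>cmean (\<lambda>\<zeta>. \<eta> (y + \<zeta> *s w)) r\<bar> \<le> C" for y
      by (rule cmean_bounded) (use C r in auto)
    have cmg: "\<bar>cmean (\<lambda>\<zeta>. g (y + \<zeta> *s (- w))) r\<bar> \<le> B" for y
      by (rule cmean_bounded) (use gB r in auto)
    have i1: "integrable lborel (\<lambda>y. g y * cmean (\<lambda>\<zeta>. \<eta> (y + \<zeta> *s w)) r)"
      by (rule integrable_mult_bounded_support[OF _ cmean_measurable gB cm\<eta> gR]) auto
    have i2: "integrable lborel (\<lambda>y. \<eta> y * cmean (\<lambda>\<zeta>. g (y + \<zeta> *s (- w))) r)"
      by (rule integrable_mult_bounded_support[OF _ cmean_measurable C(2) cmg \<eta>R(1)]) auto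
    have i3: "integrable lborel (\<lambda>y. g y * \<eta> y)"
      by (rule integrable_mult_bounded_support[OF _ _ gB C(2) gR]) auto
    have "(LINT y|lborel. g y * cmean (\<lambda>\<zeta>. \<eta> (y + \<zeta> *s w)) r) \<le> (LINT y|lborel. g y * \<eta> y + r\<^sup>2 / 4 * (g y * dd y) + \<delta> * r\<^sup>2 * \<bar>g y\<bar>)"
    proof (rule integral_mono)
      show "integrable lborel (\<lambda>y. g y * \<eta> y + r\<^sup>2 / 4 * (g y * dd y) + \<delta> * r\<^sup>2 * \<bar>g y\<bar>)"
        using i3 gddint gint by (intro Bochner_Integration.integrable_add integrable_mult_right) auto
      fix y
      have "g y * (cmean (\<lambda>\<zeta>. \<eta> (y + \<zeta> *s w)) r - \<eta> y - r\<^sup>2 / 4 * dd y) \<le> \<bar>g y\<bar> * (\<delta> * r\<^sup>2)"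
        by (rule order_trans[OF abs_ge_self], simp only: abs_mult) (rule mult_left_mono[OF r0(2)[OF r(1,2)] abs_ge_zero])
      then show "g y * cmean (\<lambda>\<zeta>. \<eta> (y + \<zeta> *s w)) r \<le> g y * \<eta> y + r\<^sup>2 / 4 * (g y * dd y) + \<delta> * r\<^sup>2 * \<bar>g y\<bar>"
        by (simp add: algebra_simps)
    qed (rule i1)
    also have "\<dots> = (LINT y|lborel. g y * \<eta> y) + r\<^sup>2 / 4 * (LINT y|lborel. g y * dd y) + \<delta> * r\<^sup>2 * (LINT y|lborel. \<bar>g y\<bar>)"
      using i3 gddint gint by (simp add: Bochner_Integration.integral_add)
    finally have up: "(LINT y|lborel. \<eta> y * cmean (\<lambda>\<zeta>. g (y + \<zeta> *s (- w))) r) \<le> (LINT y|lborel. g y * \<eta> y) + r\<^sup>2 / 4 * (LINT y|lborel. g y * dd y) + \<delta> * r\<^sup>2 * (LINT y|lborel. \<bar>g y\<bar>)"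
      by (simp add: g_eta)
    have "(LINT y|lborel. g y * \<eta> y) \<le> (LINT y|lborel. \<eta> y * cmean (\<lambda>\<zeta>. g (y + \<zeta> *s (- w))) r + r\<^sup>2 / 4 * (H y * \<eta> y) + r\<^sup>2 / 4 * \<delta> * \<eta> y)"
    proof (rule integral_mono)
      show "integrable lborel (\<lambda>y. \<eta> y * cmean (\<lambda>\<zeta>. g (y + \<zeta> *s (- w))) r + r\<^sup>2 / 4 * (H y * \<eta> y) + r\<^sup>2 / 4 * \<delta> * \<eta> y)"
        by (intro Bochner_Integration.integrable_add integrable_mult_right i2 H\<eta>int \<eta>int)
      fix y
      show "g y * \<eta> y \<le> \<eta> y * cmean (\<lambda>\<zeta>. g (y + \<zeta> *s (- w))) r + r\<^sup>2 / 4 * (H y * \<eta> y) + r\<^sup>2 / 4 * \<delta> * \<eta> y"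
      proof (cases "y \<in> S")
        case True
        then have "y \<in> W" using W by auto
        have "\<eta> y * G y \<le> \<eta> y * (cmean (\<lambda>\<zeta>. g (y + \<zeta> *s (- w))) r + r\<^sup>2 / 4 * (h y w + \<delta>))"
          using sub[OF True r(1,3)] \<eta>0 by (intro mult_left_mono) auto
        then show ?thesis using \<open>y \<in> W\<close> by (simp add: g_def[of y] H_def algebra_simps add_divide_distrib)
      qed (simp add: S)
    qed (rule i3)
    also have "\<dots> = (LINT y|lborel. \<eta> y * cmean (\<lambda>\<zeta>. g (y + \<zeta> *s (- w))) r) + r\<^sup>2 / 4 * (LINT y|lborel. H y * \<eta> y) + r\<^sup>2 / 4 * \<delta> * (LINT y|lborel. \<eta> y)"
      using i2 H\<eta>int \<eta>int by (simp add: Bochner_Integration.integral_add)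
    finally have "0 \<le> r\<^sup>2 / 4 * (LINT y|lborel. g y * dd y) + \<delta> * r\<^sup>2 * (LINT y|lborel. \<bar>g y\<bar>) + r\<^sup>2 / 4 * (LINT y|lborel. H y * \<eta> y) + r\<^sup>2 / 4 * \<delta> * (LINT y|lborel. \<eta> y)"
      using up by linarith
    also have "\<dots> = r\<^sup>2 / 4 * ((LINT x|lborel. H x * \<eta> x) + (LINT x|lborel. g x * dd x) + \<delta> * ((LINT x|lborel. \<eta> x) + 4 * (LINT x|lborel. \<bar>g x\<bar>)))"
      by (simp add: algebra_simps)
    finally show ?thesis using r(1) by (simp add: zero_le_mult_iff)
  qed
  have "0 \<le> (LINT x|lborel. H x * \<eta> x) + (LINT x|lborel. g x * dd x)"
  proof (rule field_le_epsilon)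
    fix e :: real assume e: "e > 0"
    define K where "K = (LINT x|lborel. \<eta> x) + 4 * (LINT x|lborel. \<bar>g x\<bar>)"
    have "K \<ge> 0" using \<eta>0 by (simp add: K_def integral_nonneg)
    then have "e / (K + 1) * K \<le> e" using e by (simp add: field_simps)
    then show "0 \<le> (LINT x|lborel. H x * \<eta> x) + (LINT x|lborel. g x * dd x) + e"
      using claim[of "e / (K + 1)"] e \<open>K \<ge> 0\<close> unfolding K_def[symmetric] by (simp add: add_nonneg_pos)
  qed
  also have "\<dots> = (LINT x|lborel. H x * \<eta> x + g x * dd x)"
    using H\<eta>int gddint by (simp add: Bochner_Integration.integral_add)
  also have "\<dots> = (LINT z:D|lborel. h z w * \<eta> z + G z * ddc \<eta> z w (\<i> *s w))"
    unfolding set_lebesgue_integral_def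
  proof (rule Bochner_Integration.integral_cong[OF refl])
    fix x
    show "H x * \<eta> x + g x * dd x = indicator D x *\<^sub>R (h x w * \<eta> x + G x * ddc \<eta> x w (\<i> *s w))"
    proof (cases "x \<in> S")
      case True
      then have "x \<in> W" "x \<in> D" using W by auto
      then show ?thesis by (simp add: H_def g_def dd_def)
    qed (simp add: S dd_def)
  qed
  finally show ?thesis .
qed

section \<open>Regularization of positive currents\<close>

lemma usc_on_add_continuous:
  fixes u :: "'a::topological_space \<Rightarrow> ereal"
  assumes "usc_on W u" "continuous_on W f" "\<And>x. x \<in> W \<Longrightarrow> u x < \<infinity>"
  shows "usc_on W (\<lambda>x. ereal (f x) + u x)"
  unfolding usc_on_def
proof (intro ballI allI impI)
  fix x c assume x: "x \<in> W" "ereal (f x) + u x < c"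
  show "\<forall>\<^sub>F y in at x within W. ereal (f y) + u y < c"
  proof (cases c)
    case (real c')
    have "u x < ereal (c' - f x)" using x assms(3)[OF x(1)] real by (cases "u x") auto
    then obtain t where t: "u x < ereal t" "ereal t < ereal (c' - f x)" using ereal_dense2 by blast
    have "\<forall>\<^sub>F y in at x within W. u y < ereal t" using assms(1) x(1) t(1) by (auto simp: usc_on_def)
    moreover have "(f \<longlongrightarrow> f x) (at x within W)" using assms(2) x(1) by (auto simp: continuous_on_def)
    then have "\<forall>\<^sub>F y in at x within W. f y < c' - t" using t(2) by (intro order_tendstoD) auto
    ultimately show ?thesis
    proof eventually_elim
      case (elim y)
      then show ?case by (cases "u y") (auto simp: real)
    qed
  next
    case PInf
    have "\<forall>\<^sub>F y in at x within W. y \<in> W" by (simp add: eventually_at_filter)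
    then show ?thesis
    proof eventually_elim
      case (elim y)
      then show ?case using assms(3)[of y] PInf by (cases "u y") auto
    qed
  qed (use x in auto)
qed

section \<open>Mollifiers\<close>

lemma flat_exp_bounds: "0 \<le> flat_exp 0 t" "flat_exp 0 t \<le> 1"
  by (auto simp: flat_exp_def)

lemma bump_integrable:
  "integrable lborel (\<lambda>x::complex^'n. flat_exp 0 (\<epsilon>\<^sup>2 - (norm (x - z))\<^sup>2))"
proof (rule integrable_bounded_support[of _ 1 "\<bar>\<epsilon>\<bar> + norm z"])
  have "continuous_on UNIV (\<lambda>x::complex^'n. flat_exp 0 (\<epsilon>\<^sup>2 - (norm (x - z))\<^sup>2))"
    by (intro continuous_on_compose2[OF flat_exp_continuous[of UNIV]] continuous_intros) auto
  then show "(\<lambda>x::complex^'n. flat_exp 0 (\<epsilon>\<^sup>2 - (norm (x - z))\<^sup>2)) \<in> borel_measurable borel"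
    by (rule borel_measurable_continuous_onI)
  show "\<bar>flat_exp 0 (\<epsilon>\<^sup>2 - (norm (x - z))\<^sup>2)\<bar> \<le> 1" for x :: "complex^'n"
    using flat_exp_bounds by (simp add: abs_le_iff order_trans[of _ 0])
  fix x :: "complex^'n" assume "\<bar>\<epsilon>\<bar> + norm z < norm x"
  then have "\<bar>\<epsilon>\<bar> \<le> norm (x - z)" using norm_triangle_ineq2[of x z] by linarith
  then have "\<bar>\<epsilon>\<bar>\<^sup>2 \<le> (norm (x - z))\<^sup>2" by (intro power_mono) auto
  then show "flat_exp 0 (\<epsilon>\<^sup>2 - (norm (x - z))\<^sup>2) = 0" by (simp add: flat_exp_def)
qed

text \<open>The argument of type \<open>itself\<close> carries the dimension, on which the integral
  depends and which \<open>\<epsilon>\<close> does not determine.\<close>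

definition bump_mass :: "'n::finite itself \<Rightarrow> real \<Rightarrow> real" where
  "bump_mass _ \<epsilon> = (LINT x|lborel. flat_exp 0 (\<epsilon>\<^sup>2 - (norm (x :: complex^'n))\<^sup>2))"

lemma bump_mass_pos:
  assumes "0 < \<epsilon>"
  shows "0 < bump_mass TYPE('n::finite) \<epsilon>"
proof -
  define c where "c = flat_exp 0 (\<epsilon>\<^sup>2 - (\<epsilon> / 2)\<^sup>2)"
  have c: "c > 0" using assms by (simp add: c_def flat_exp_def power2_eq_square)
  have "0 < c * measure lborel (ball (0::complex^'n) (\<epsilon> / 2))" using c assms by (simp add: content_ball_pos)
  also have "\<dots> = (LINT x|lborel. c * indicator (ball (0::complex^'n) (\<epsilon> / 2)) x)" by simp
  also have "\<dots> \<le> bump_mass TYPE('n) \<epsilon>" unfolding bump_mass_def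
  proof (rule integral_mono)
    show "integrable lborel (\<lambda>x. c * indicator (ball (0::complex^'n) (\<epsilon> / 2)) x)"
      by (intro integrable_mult_right integrable_real_indicator) (auto intro!: emeasure_bounded_finite[unfolded infinity_ennreal_def])
    show "integrable lborel (\<lambda>x::complex^'n. flat_exp 0 (\<epsilon>\<^sup>2 - (norm x)\<^sup>2))" using bump_integrable[of \<epsilon> 0] by simp
    fix x :: "complex^'n"
    show "c * indicator (ball 0 (\<epsilon> / 2)) x \<le> flat_exp 0 (\<epsilon>\<^sup>2 - (norm x)\<^sup>2)"
    proof (cases "norm x < \<epsilon> / 2")
      case True
      have "(norm x)\<^sup>2 \<le> (\<epsilon> / 2)\<^sup>2" using True by (intro power_mono) auto
      moreover have "(\<epsilon> / 2)\<^sup>2 < \<epsilon>\<^sup>2" using assms by (simp add: power2_eq_square)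
      ultimately have "c \<le> flat_exp 0 (\<epsilon>\<^sup>2 - (norm x)\<^sup>2)"
        by (auto simp: c_def flat_exp_def intro!: divide_left_mono)
      then show ?thesis using True by simp
    qed (simp add: flat_exp_bounds)
  qed
  finally show ?thesis .
qed

definition mollifier :: "real \<Rightarrow> complex^'n \<Rightarrow> complex^'n \<Rightarrow> real" where
  "mollifier \<epsilon> z y = (1 / bump_mass TYPE('n) \<epsilon>) * flat_exp 0 (\<epsilon>\<^sup>2 - (norm (y - z))\<^sup>2)"

lemma mollifier_nonneg: "0 < \<epsilon> \<Longrightarrow> 0 \<le> mollifier \<epsilon> z (y :: complex^'n)"
  using bump_mass_pos[of \<epsilon>, where 'n='n] by (simp add: mollifier_def flat_exp_bounds)

lemma mollifier_eq_0:
  assumes "0 < \<epsilon>" "\<epsilon> \<le> norm (y - z)"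
  shows "mollifier \<epsilon> z y = 0"
proof -
  have "\<epsilon>\<^sup>2 \<le> (norm (y - z))\<^sup>2" using assms by (intro power_mono) auto
  then show ?thesis by (simp add: mollifier_def flat_exp_def)
qed

lemma mollifier_smooth: "smooth_on W (mollifier \<epsilon> z)"
  unfolding mollifier_def[abs_def] by (rule smooth_on_bump)

lemma mollifier_integrable: "integrable lborel (mollifier \<epsilon> z)"
  unfolding mollifier_def[abs_def] by (intro integrable_mult_right bump_integrable)

lemma mollifier_continuous: "continuous_on UNIV (mollifier \<epsilon> z)"
  using mollifier_smooth by (rule smooth_on_imp_continuous_on)

lemma mollifier_measurable [measurable]: "mollifier \<epsilon> z \<in> borel_measurable borel"
  using mollifier_continuous by (rule borel_measurable_continuous_onI)

lemma mollifier_bounded: "0 < \<epsilon> \<Longrightarrow> \<bar>mollifier \<epsilon> z (y :: complex^'n)\<bar> \<le> 1 / bump_mass TYPE('n) \<epsilon>"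
  using bump_mass_pos[of \<epsilon>, where 'n='n] flat_exp_bounds[of "\<epsilon>\<^sup>2 - (norm (y - z))\<^sup>2"]
  by (simp add: mollifier_def abs_mult divide_right_mono)

lemma mollifier_integral: 
  assumes "0 < \<epsilon>"
  shows "(LINT y|lborel. mollifier \<epsilon> z (y :: complex^'n)) = 1"
proof -
  have "continuous_on UNIV (\<lambda>y::complex^'n. flat_exp 0 (\<epsilon>\<^sup>2 - (norm (y - z))\<^sup>2))"
    by (intro continuous_on_compose2[OF flat_exp_continuous[of UNIV]] continuous_intros) auto
  then have "(LINT y|lborel. flat_exp 0 (\<epsilon>\<^sup>2 - (norm (y - z))\<^sup>2)) = (LINT y|lborel. flat_exp 0 (\<epsilon>\<^sup>2 - (norm ((y + z) - z))\<^sup>2))"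
    by (intro integral_lborel_shift[symmetric] borel_measurable_continuous_onI)
  then have "(LINT y|lborel. flat_exp 0 (\<epsilon>\<^sup>2 - (norm (y - z))\<^sup>2)) = bump_mass TYPE('n) \<epsilon>"
    by (simp add: bump_mass_def)
  then show ?thesis using bump_mass_pos[OF assms, where 'n='n] by (simp add: mollifier_def)
qed

lemma mollifier_shift: "mollifier \<epsilon> (z + a) y = mollifier \<epsilon> z (y - a)"
  by (simp add: mollifier_def algebra_simps)

lemma mollifier_test_function:
  assumes "0 < \<epsilon>" "cball z \<epsilon> \<subseteq> D"
  shows "nonneg_test_function D (mollifier \<epsilon> z)"
proof -
  have "{y. mollifier \<epsilon> z y \<noteq> 0} \<subseteq> cball z \<epsilon>"
  proof
    fix y assume "y \<in> {y. mollifier \<epsilon> z y \<noteq> 0}"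
    then have "\<not> \<epsilon> \<le> norm (y - z)" using mollifier_eq_0[OF assms(1), of y z] by auto
    then show "y \<in> cball z \<epsilon>" by (simp add: dist_norm norm_minus_commute)
  qed
  then have c: "closure {y. mollifier \<epsilon> z y \<noteq> 0} \<subseteq> cball z \<epsilon>" by (rule closure_minimal) simp
  then have "compact (closure {y. mollifier \<epsilon> z y \<noteq> 0})"
    using compact_Int_closed[OF compact_cball closed_closure] by (metis inf.absorb2)
  then show ?thesis
    unfolding nonneg_test_function_def using mollifier_smooth mollifier_nonneg[OF assms(1)] c assms(2) by blast
qed

lemma convolution_continuous:
  fixes g :: "complex^'n \<Rightarrow> real"
  assumes g: "integrable lborel g" and \<epsilon>: "0 < \<epsilon>"
  shows "continuous_on UNIV (\<lambda>z. LINT y|lborel. g y * mollifier \<epsilon> z y)"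
  unfolding continuous_on_sequentially
proof (intro ballI allI impI)
  fix x :: "nat \<Rightarrow> complex^'n" and a assume "(\<forall>n. x n \<in> UNIV) \<and> x \<longlonglongrightarrow> a"
  then have x: "x \<longlonglongrightarrow> a" by simp
  have [measurable]: "g \<in> borel_measurable borel" using borel_measurable_integrable[OF g] by simp
  have "(\<lambda>n. LINT y|lborel. g y * mollifier \<epsilon> (x n) y) \<longlonglongrightarrow> (LINT y|lborel. g y * mollifier \<epsilon> a y)"
  proof (rule integral_dominated_convergence[where w = "\<lambda>y. \<bar>g y\<bar> * (1 / bump_mass TYPE('n) \<epsilon>)"])
    show "integrable lborel (\<lambda>y. \<bar>g y\<bar> * (1 / bump_mass TYPE('n) \<epsilon>))" using g by (intro integrable_mult_left) simp
    show "AE y in lborel. (\<lambda>n. g y * mollifier \<epsilon> (x n) y) \<longlonglongrightarrow> g y * mollifier \<epsilon> a y"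
    proof (rule AE_I2)
      fix y
      have "isCont (flat_exp 0) t" for t using flat_exp_continuous[of UNIV 0] by (simp add: continuous_on_eq_continuous_at)
      then show "(\<lambda>n. g y * mollifier \<epsilon> (x n) y) \<longlonglongrightarrow> g y * mollifier \<epsilon> a y"
        unfolding mollifier_def by (intro tendsto_intros isCont_tendsto_compose[of _ "flat_exp 0"] x)
    qed
    show "AE y in lborel. norm (g y * mollifier \<epsilon> (x n) y) \<le> \<bar>g y\<bar> * (1 / bump_mass TYPE('n) \<epsilon>)" for n
      unfolding real_norm_def abs_mult by (intro AE_I2 mult_left_mono mollifier_bounded[OF \<epsilon>]) auto
  qed measurable
  then show "((\<lambda>z. LINT y|lborel. g y * mollifier \<epsilon> z y) \<circ> x) \<longlonglongrightarrow> (LINT y|lborel. g y * mollifier \<epsilon> a y)"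
    by (simp add: o_def)
qed

lemma integrable_mult_bounded:
  fixes f g :: "complex^'n \<Rightarrow> real"
  assumes f: "integrable lborel f" and [measurable]: "g \<in> borel_measurable borel" and B: "\<And>x. \<bar>g x\<bar> \<le> B"
  shows "integrable lborel (\<lambda>x. f x * g x)"
proof (rule Bochner_Integration.integrable_bound)
  have [measurable]: "f \<in> borel_measurable borel" using borel_measurable_integrable[OF f] by simp
  show "integrable lborel (\<lambda>x. \<bar>f x\<bar> * B)" using f by (intro integrable_mult_left) simp
  show "(\<lambda>x. f x * g x) \<in> borel_measurable lborel" by simp
  show "AE x in lborel. norm (f x * g x) \<le> norm (\<bar>f x\<bar> * B)"
    using B by (intro AE_I2) (auto simp: abs_mult intro!: mult_left_mono intro: order_trans[OF _ abs_ge_self])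
qed

text \<open>Moving the centre of the mollifier by \<zeta>w shifts its argument by -\<zeta>w. The
  mean of the convolution along w is therefore g paired with the mean of the mollifier along -w, to
  which \<open>cmean_expansion\<close> applies.\<close>

lemma asub_convolution:
  fixes g :: "complex^'n \<Rightarrow> real"
  assumes g: "integrable lborel g" and \<epsilon>: "0 < \<epsilon>"
    and pos: "- q \<le> (LINT y|lborel. g y * ddc (mollifier \<epsilon> x) y (- w) (\<i> *s (- w)))"
  shows "asub (\<lambda>z. LINT y|lborel. g y * mollifier \<epsilon> z y) x w q"
proof (rule asub_linearI)
  fix e :: real assume e: "e > 0"
  have [measurable]: "g \<in> borel_measurable borel" using borel_measurable_integrable[OF g] by simp
  define \<eta> where "\<eta> = mollifier \<epsilon> x"
  have \<eta>m[measurable]: "\<eta> \<in> borel_measurable borel" by (simp add: \<eta>_def)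
  define C where "C = 1 / bump_mass TYPE('n) \<epsilon>"
  have \<eta>C: "\<bar>\<eta> y\<bar> \<le> C" for y using mollifier_bounded[OF \<epsilon>] by (simp add: \<eta>_def C_def)
  have supp: "\<eta> y = 0" if "norm x + \<epsilon> < norm y" for y
    using that norm_triangle_ineq2[of y x] unfolding \<eta>_def by (intro mollifier_eq_0[OF \<epsilon>]) linarith
  have sm: "smooth_on UNIV \<eta>" by (simp add: \<eta>_def mollifier_smooth)
  define dd where "dd y = ddc \<eta> y (- w) (\<i> *s (- w))" for y
  have ddc: "continuous_on UNIV dd" unfolding dd_def by (rule ddc_continuous[OF sm])
  have [measurable]: "dd \<in> borel_measurable borel" using ddc by (rule borel_measurable_continuous_onI)
  have dd0: "dd y = 0" if "norm x + \<epsilon> < norm y" for y unfolding dd_def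
    by (rule ddc_eq_0_outside[of "{y. norm x + \<epsilon> < norm y}"]) (use supp that in \<open>auto intro!: open_Collect_less continuous_intros\<close>)
  obtain C2 where C2: "\<And>y. \<bar>dd y\<bar> \<le> C2" using continuous_compact_support_bounded[OF ddc dd0] by blast
  define G where "G = (LINT y|lborel. \<bar>g y\<bar>)"
  have G0: "G \<ge> 0" by (simp add: G_def integral_nonneg)
  \<comment> \<open>Makes \<delta>r^2 times the L1 norm of g at most the available slack r^2
    e/4.\<close>
  define \<delta> where "\<delta> = e / (4 * (G + 1))"
  have \<delta>: "\<delta> > 0" "\<delta> * G \<le> e / 4" using e G0 by (auto simp: \<delta>_def field_simps)
  obtain r0 where r0: "0 < r0" "\<And>r y. 0 < r \<Longrightarrow> r < r0 \<Longrightarrow> \<bar>cmean (\<lambda>\<zeta>. \<eta> (y + \<zeta> *s (- w))) r - \<eta> y - r\<^sup>2 / 4 * dd y\<bar> \<le> \<delta> * r\<^sup>2"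
    using cmean_expansion[OF sm supp \<delta>(1), where w = "- w"] unfolding dd_def by blast
  show "\<forall>\<^sub>F r in at_right 0. (LINT y|lborel. g y * mollifier \<epsilon> x y) \<le>
      cmean (\<lambda>\<zeta>. LINT y|lborel. g y * mollifier \<epsilon> (x + \<zeta> *s w) y) r + r\<^sup>2 / 4 * (q + e)"
    using eventually_at_right_0_less[OF r0(1)]
  proof eventually_elim
    case (elim r)
    have i1: "integrable lborel (\<lambda>y. g y * \<eta> y)" by (rule integrable_mult_bounded[OF g \<eta>m \<eta>C])
    have i2: "integrable lborel (\<lambda>y. g y * dd y)" by (rule integrable_mult_bounded[OF g _ C2]) simp
    have i3: "integrable lborel (\<lambda>y. g y * cmean (\<lambda>\<zeta>. \<eta> (y + \<zeta> *s (- w))) r)"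
      by (rule integrable_mult_bounded[OF g cmean_measurable[OF \<eta>m] cmean_bounded]) (use \<eta>C elim in auto)
    have eq: "mollifier \<epsilon> (x + \<zeta> *s w) y = \<eta> (y + \<zeta> *s (- w))" for \<zeta> y
      by (simp add: mollifier_shift \<eta>_def)
    have "(LINT y|lborel. g y * \<eta> y + r\<^sup>2 / 4 * (g y * dd y) - \<delta> * r\<^sup>2 * \<bar>g y\<bar>) \<le> (LINT y|lborel. g y * cmean (\<lambda>\<zeta>. \<eta> (y + \<zeta> *s (- w))) r)"
    proof (rule integral_mono[OF _ i3])
      show "integrable lborel (\<lambda>y. g y * \<eta> y + r\<^sup>2 / 4 * (g y * dd y) - \<delta> * r\<^sup>2 * \<bar>g y\<bar>)"
        by (intro Bochner_Integration.integrable_diff Bochner_Integration.integrable_add i1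
            integrable_mult_right[OF i2] integrable_mult_right[OF integrable_abs[OF g]])
      fix y
      have "- (g y * (cmean (\<lambda>\<zeta>. \<eta> (y + \<zeta> *s (- w))) r - \<eta> y - r\<^sup>2 / 4 * dd y)) \<le> \<bar>g y\<bar> * (\<delta> * r\<^sup>2)"
        by (rule order_trans[OF abs_ge_minus_self], simp only: abs_mult) (rule mult_left_mono[OF r0(2) abs_ge_zero], use elim in auto)
      then show "g y * \<eta> y + r\<^sup>2 / 4 * (g y * dd y) - \<delta> * r\<^sup>2 * \<bar>g y\<bar> \<le> g y * cmean (\<lambda>\<zeta>. \<eta> (y + \<zeta> *s (- w))) r"
        by (simp add: algebra_simps)
    qed
    also have "(LINT y|lborel. g y * \<eta> y + r\<^sup>2 / 4 * (g y * dd y) - \<delta> * r\<^sup>2 * \<bar>g y\<bar>)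
        = (LINT y|lborel. g y * \<eta> y) + r\<^sup>2 / 4 * (LINT y|lborel. g y * dd y) - \<delta> * r\<^sup>2 * G"
      using i1 i2 g by (simp add: G_def)
    also have "(LINT y|lborel. g y * cmean (\<lambda>\<zeta>. \<eta> (y + \<zeta> *s (- w))) r) = cmean (\<lambda>\<zeta>. LINT y|lborel. g y * \<eta> (y + \<zeta> *s (- w))) r"
      by (rule cmean_integral_swap[symmetric, OF g \<eta>m \<eta>C])
    finally have "(LINT y|lborel. g y * \<eta> y) + r\<^sup>2 / 4 * (LINT y|lborel. g y * dd y) - \<delta> * r\<^sup>2 * G
        \<le> cmean (\<lambda>\<zeta>. LINT y|lborel. g y * mollifier \<epsilon> (x + \<zeta> *s w) y) r" by (simp only: eq)
    moreover have "r\<^sup>2 / 4 * (- q) \<le> r\<^sup>2 / 4 * (LINT y|lborel. g y * dd y)"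
      using pos by (intro mult_left_mono) (auto simp: dd_def \<eta>_def)
    moreover have "r\<^sup>2 * (\<delta> * G) \<le> r\<^sup>2 * (e / 4)" using \<delta>(2) by (intro mult_left_mono) auto
    moreover have "r\<^sup>2 / 4 * (q + e) = - (r\<^sup>2 / 4 * (- q)) + r\<^sup>2 * (e / 4)" "\<delta> * r\<^sup>2 * G = r\<^sup>2 * (\<delta> * G)"
      by (simp_all add: algebra_simps add_divide_distrib)
    ultimately show ?case unfolding \<eta>_def by linarith
  qed
qed

text \<open>A convolution G of v inherits dd^c G \<ge> -q near z0, so its positive part satisfies
  the sub-mean inequality on a disc of fixed radius. This passes to v from both ends: on the circle,
  G is at most the supremum of the positive part of v over small balls, and at the centre v \<le> G
  + \<delta>, since f is nearly constant and u is plurisubharmonic.\<close>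

lemma asub_pos_part_of_current:
  fixes v u :: "complex^'n \<Rightarrow> ereal"
  assumes D: "W \<subseteq> D" and W: "open W" "z0 \<in> W"
    and v: "\<And>z. z \<in> W \<Longrightarrow> v z = ereal (f z) + u z" and f: "continuous_on W f" and u: "psh_on W u"
    and h: "\<And>w. continuous_on D (\<lambda>z. h z w)" "\<And>z w. z \<in> D \<Longrightarrow> 0 \<le> h z w" "\<And>z w. z \<in> D \<Longrightarrow> h z (- w) = h z w"
    and cur: "\<And>w \<eta>. nonneg_test_function D \<eta> \<Longrightarrow>
        0 \<le> (LINT z:D|lborel. h z w * \<eta> z + real_of_ereal (v z) * ddc \<eta> z w (\<i> *s w))"
  shows "usc W (pos_part v)" "asub (pos_part v) z0 w (h z0 w)"
proof -
  have ufin: "u x < \<infinity>" if "x \<in> W" for x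
    using u that by (auto simp: psh_on_def)
  have us: "usc_on W u" using u by (simp add: psh_on_def)
  have vfin: "v x < \<infinity>" if "x \<in> W" for x using ufin[OF that] v[OF that] by (cases "u x") auto
  have vus: "usc_on W v"
  proof -
    have a: "usc_on W (\<lambda>x. ereal (f x) + u x)" by (rule usc_on_add_continuous[OF us f ufin])
    show ?thesis unfolding usc_on_def
    proof (intro ballI allI impI)
      fix x c assume "x \<in> W" "v x < c"
      then have "\<forall>\<^sub>F y in at x within W. ereal (f y) + u y < c" using a v by (simp add: usc_on_def)
      moreover have "\<forall>\<^sub>F y in at x within W. y \<in> W" by (simp add: eventually_at_filter)
      ultimately show "\<forall>\<^sub>F y in at x within W. v y < c" by eventually_elim (simp add: v)
    qed
  qed
  show pus: "usc W (pos_part v)" by (rule pos_part_usc[OF W(1) vus vfin])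
  have h0: "0 \<le> h z0 w" using h(2) D W by blast
  show "asub (pos_part v) z0 w (h z0 w)"
  proof (cases "v z0 \<le> 0")
    \<comment> \<open>Where v \<le> 0, the constant 0 touches the positive part from below.\<close>
    case True
    have "pos_part v z0 = 0" using True by (simp add: pos_part_def max_def)
    then show ?thesis
      by (intro asub_touch[OF asub_const[OF h0, of 0] W _ pus, where m = 0])
         (auto simp: pos_part_nonneg intro: continuous_imp_usc)
  next
    case False
    then have "u z0 \<noteq> - \<infinity>" using v[OF W(2)] by auto
    then obtain a where a: "u z0 = ereal a" using ufin[OF W(2)] by (cases "u z0") auto
    have p: "pos_part v z0 = f z0 + a" using False v[OF W(2)] by (simp add: a pos_part_def max_def)
    show ?thesis
    proof (rule asub_linearI)
      fix e :: real assume e: "e > 0"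
      define q where "q = h z0 w + e"
      have q: "q > 0" using h0 e by (simp add: q_def)
      have "usc W (\<lambda>z. h z w)" by (rule continuous_imp_usc[OF continuous_on_subset[OF h(1) D]])
      then have "\<forall>\<^sub>F y in nhds z0. y \<in> W \<and> h y w < q" using W e by (intro usc_openD) (auto simp: q_def)
      then obtain R' where R': "R' > 0" "\<And>y. dist y z0 < R' \<Longrightarrow> y \<in> W \<and> h y w < q"
        by (auto simp: eventually_nhds_metric)
      define R where "R = R' / 2"
      have R: "R > 0" "\<And>y. y \<in> cball z0 R \<Longrightarrow> y \<in> W" "\<And>y. y \<in> cball z0 R \<Longrightarrow> h y w \<le> q"
        using R' by (auto simp: R_def dist_commute less_imp_le)
      have RW: "cball z0 R \<subseteq> W" using R(2) by blast
      obtain M1 where M1: "\<And>y. y \<in> cball z0 R \<Longrightarrow> pos_part v y \<le> M1"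
        using usc_attains_max[OF usc_subset[OF pus RW]] R(1) by (metis cball_eq_empty compact_cball not_less_iff_gr_or_eq)
      have M10: "0 \<le> M1" using M1[of z0] pos_part_nonneg[of v z0] R(1) by auto
      have "compact (f ` cball z0 R)" using continuous_on_subset[OF f RW] by (rule compact_continuous_image) simp
      then obtain Bf where Bf: "\<And>y. y \<in> cball z0 R \<Longrightarrow> \<bar>f y\<bar> \<le> Bf"
        using compact_imp_bounded by (fastforce simp: bounded_iff)
      have Bf0: "0 \<le> Bf" using Bf[of z0] R(1) by auto
      have vM1: "v y \<le> ereal M1" if "y \<in> cball z0 R" for y
        using M1[OF that] ereal_pos_part[of v y] vfin R(2)[OF that] by (metis ereal_less_eq(3) max.bounded_iff)
      have evm[measurable]: "ext_infinity W v \<in> borel_measurable borel" by (rule ext_infinity_measurable[OF W(1) vus])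
      have eum[measurable]: "ext_infinity W u \<in> borel_measurable borel" by (rule ext_infinity_measurable[OF W(1) us])
      \<comment> \<open>v cut off outside a ball, as a function on the whole space that can be
        convolved.\<close>
      define g where "g y = indicator (cball z0 R) y * real_of_ereal (ext_infinity W v y)" for y
      have gm[measurable]: "g \<in> borel_measurable borel" unfolding g_def
        by (intro borel_measurable_times borel_measurable_indicator borel_measurable_real_of_ereal evm) auto
      have g_in: "g y = real_of_ereal (v y)" if "y \<in> cball z0 R" for y using that R(2) by (simp add: g_def ext_infinity_def)
      have g_le: "g y \<le> pos_part v y" if "y \<in> cball z0 R" for y
        using that by (cases "v y") (auto simp: g_in pos_part_def max_def)
      \<comment> \<open>Local integrability comes from the kernel bound with an indicator; its right
        side is finite because u z0 is.\<close>
      have gint: "integrable lborel g"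
      proof (rule integrableI_bounded)
        define M2 where "M2 = M1 + Bf"
        have uM2: "u y \<le> ereal M2" if "y \<in> cball z0 R" for y
          using vM1[OF that] Bf[OF that] v[OF R(2)[OF that]] by (cases "u y") (auto simp: M2_def)
        have "(\<integral>\<^sup>+y. indicator (cball 0 R) (y - z0) * e2ennreal (ereal M2 - ext_infinity W u y) \<partial>lborel)
           \<le> e2ennreal (ereal M2 - u z0) * (\<integral>\<^sup>+x. indicator (cball 0 R) (x :: complex^'n) \<partial>lborel)"
          by (rule psh_kernel_bound[OF u W(1) RW]) (use M10 Bf0 uM2 in \<open>auto simp: M2_def indicator_def norm_smult_cart\<close>)
        also have "\<dots> < \<infinity>"
          using emeasure_lborel_cball_finite[of "0::complex^'n" R] by (simp add: a ennreal_mult_less_top)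
        finally have fin1: "(\<integral>\<^sup>+y. indicator (cball 0 R) (y - z0) * e2ennreal (ereal M2 - ext_infinity W u y) \<partial>lborel) < \<infinity>" .
        have "(\<integral>\<^sup>+y. ennreal (norm (g y)) \<partial>lborel) \<le>
          (\<integral>\<^sup>+y. ennreal (Bf + M2) * indicator (cball z0 R) y + indicator (cball 0 R) (y - z0) * e2ennreal (ereal M2 - ext_infinity W u y) \<partial>lborel)"
        proof (rule nn_integral_mono)
          fix y
          show "ennreal (norm (g y)) \<le> ennreal (Bf + M2) * indicator (cball z0 R) y + indicator (cball 0 R) (y - z0) * e2ennreal (ereal M2 - ext_infinity W u y)"
          proof (cases "y \<in> cball z0 R")
            case True
            have yz: "y - z0 \<in> cball 0 R" using True by (simp add: dist_norm norm_minus_commute)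
            show ?thesis
            proof (cases "u y")
              case (real b)
              have "b \<le> M2" using uM2[OF True] real by simp
              then have "norm (g y) \<le> (Bf + M2) + (M2 - b)"
                using Bf[OF True] v[OF R(2)[OF True]] M10 Bf0 by (auto simp: g_in[OF True] real M2_def)
              then have "ennreal (norm (g y)) \<le> ennreal (Bf + M2) + ennreal (M2 - b)"
                using \<open>b \<le> M2\<close> M10 Bf0 by (simp add: ennreal_plus[symmetric] ennreal_leI M2_def del: ennreal_plus)
              then show ?thesis using True yz R(2)[OF True] by (simp add: ext_infinity_def real)
            next
              case MInf
              then show ?thesis using v[OF R(2)[OF True]] by (simp add: g_in[OF True])
            qed (use ufin[OF R(2)[OF True]] in auto)
          qed (simp add: g_def)
        qed
        also have "\<dots> = (\<integral>\<^sup>+y. ennreal (Bf + M2) * indicator (cball z0 R) y \<partial>lborel) + (\<integral>\<^sup>+y. indicator (cball 0 R) (y - z0) * e2ennreal (ereal M2 - ext_infinity W u y) \<partial>lborel)"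
        proof (rule nn_integral_add)
          have c: "cball c R \<in> sets borel" for c :: "complex^'n" by simp
          have "(indicator (cball z0 R) :: complex^'n \<Rightarrow> ennreal) \<in> borel_measurable borel"
            by (rule borel_measurable_indicator[OF c])
          then show "(\<lambda>y. ennreal (Bf + M2) * indicator (cball z0 R) y) \<in> borel_measurable lborel" by simp
          have "(\<lambda>y. y - z0) \<in> borel_measurable borel" by measurable
          from measurable_compose[OF this borel_measurable_indicator[OF c]]
          have "(\<lambda>y. indicator (cball 0 R) (y - z0) :: ennreal) \<in> borel_measurable borel" .
          moreover have "(\<lambda>y. e2ennreal (ereal M2 - ext_infinity W u y)) \<in> borel_measurable borel" by measurable
          ultimately show "(\<lambda>y. indicator (cball 0 R) (y - z0) * e2ennreal (ereal M2 - ext_infinity W u y)) \<in> borel_measurable lborel"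
            by simp
        qed
        also have "\<dots> < \<infinity>"
          using fin1 emeasure_lborel_cball_finite[of z0 R] by (simp add: nn_integral_cmult_indicator ennreal_mult_less_top)
        finally show "(\<integral>\<^sup>+y. ennreal (norm (g y)) \<partial>lborel) < \<infinity>" .
      qed simp
      define d where "d = R / 2 / (norm w + 1)"
      have nw: "norm w + 1 > 0" by (simp add: add_nonneg_pos)
      have d: "d > 0" using R(1) nw by (simp add: d_def)
      show "\<forall>\<^sub>F r in at_right 0. pos_part v z0 \<le> cmean (\<lambda>\<zeta>. pos_part v (z0 + \<zeta> *s w)) r + r\<^sup>2 / 4 * (h z0 w + e)"
        using eventually_at_right_0_less[OF d]
      proof eventually_elim
        case (elim s)
        have sw: "s * norm w < R / 2"
        proof -
          have "s * norm w \<le> s * (norm w + 1)" using elim by (intro mult_left_mono) auto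
          also have "\<dots> < R / 2" using elim nw pos_less_divide_eq[OF nw, of s "R / 2"] by (simp add: d_def)
          finally show ?thesis .
        qed
        have disc: "z0 + \<zeta> *s w \<in> ball z0 (R / 2)" if "cmod \<zeta> \<le> s" for \<zeta>
          by (rule disc_in_ball[OF _ that]) (use sw in auto)
        show ?case
        proof (rule field_le_epsilon)
          fix \<epsilon>0 :: real assume "\<epsilon>0 > 0"
          define \<delta> where "\<delta> = \<epsilon>0 / 2"
          have \<delta>: "\<delta> > 0" using \<open>\<epsilon>0 > 0\<close> by (simp add: \<delta>_def)
          have b2: "ball z0 (R / 2) \<subseteq> W" using RW R(1) by (auto simp: subset_iff)
          have pn: "0 \<le> pos_part v x" if "x \<in> W" for x by (rule pos_part_nonneg)
          have spos: "0 < s" using elim by simp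
          have dW: "z0 + \<zeta> *s w \<in> W" if "cmod \<zeta> = s" for \<zeta> using disc[of \<zeta>] b2 that by auto
          have lt: "cmean (\<lambda>\<zeta>. pos_part v (z0 + \<zeta> *s w)) s < cmean (\<lambda>\<zeta>. pos_part v (z0 + \<zeta> *s w)) s + \<delta>" using \<delta> by simp
          \<comment> \<open>Taking values within \<sigma> of the circle raises the mean of the
            positive part by less than \<delta>; the mollifier will have radius at most
            \<sigma>.\<close>
          obtain \<sigma> where \<sigma>: "\<sigma> > 0" and
            \<sigma>_mean: "\<forall>f. cint f s \<longrightarrow> (\<forall>\<zeta>. cmod \<zeta> = s \<longrightarrow> (\<exists>x. norm (x - (z0 + \<zeta> *s w)) \<le> \<sigma> \<and> f \<zeta> \<le> pos_part v x))
              \<longrightarrow> cmean f s < cmean (\<lambda>\<zeta>. pos_part v (z0 + \<zeta> *s w)) s + \<delta>"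
            using cmean_tube[OF W(1) pus pn spos dW lt] by blast
          have "isCont f z0" using f W by (simp add: continuous_on_eq_continuous_at)
          then obtain \<epsilon>1 where \<epsilon>1: "\<epsilon>1 > 0" "\<And>y. dist y z0 < \<epsilon>1 \<Longrightarrow> dist (f y) (f z0) < \<delta>"
            using \<delta> unfolding continuous_at_eps_delta by (metis dist_commute)
          define \<epsilon> where "\<epsilon> = min \<sigma> (min (\<epsilon>1 / 2) (R / 2))"
          have \<epsilon>: "\<epsilon> > 0" "\<epsilon> \<le> \<sigma>" "\<epsilon> < \<epsilon>1" "\<epsilon> \<le> R / 2" using \<sigma> \<epsilon>1 R(1) by (auto simp: \<epsilon>_def)
          define G where "G z = (LINT y|lborel. g y * mollifier \<epsilon> z y)" for z
          have cb: "cball x \<epsilon> \<subseteq> cball z0 R" if "x \<in> ball z0 (R / 2)" for x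
          proof
            fix y assume "y \<in> cball x \<epsilon>"
            then show "y \<in> cball z0 R" using that \<epsilon>(4) dist_triangle[of z0 y x] by auto
          qed
          have gmi: "integrable lborel (\<lambda>y. g y * mollifier \<epsilon> z y)" for z
            by (rule integrable_mult_bounded[OF gint mollifier_measurable mollifier_bounded[OF \<epsilon>(1)]])
          have Gc: "continuous_on UNIV G" unfolding G_def by (rule convolution_continuous[OF gint \<epsilon>(1)])
          \<comment> \<open>M' - g \<ge> 0 permits nonnegative integrals. Replacing f by f z0 costs
            \<delta>, that is M' - g \<le> M - u on the ball, and the kernel bound for M - u at z0
            gives M' - G z0 \<le> M - u z0.\<close>
          have 1: "pos_part v z0 \<le> G z0 + \<delta>"
          proof -
            define M' where "M' = M1 + \<bar>f z0\<bar>"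
            define M where "M = M' - f z0 + \<delta>"
            have zz: "z0 \<in> ball z0 (R / 2)" using R(1) by simp
            have M0: "0 \<le> M" using M10 \<delta> by (simp add: M_def M'_def)
            have fd: "\<bar>f y - f z0\<bar> \<le> \<delta>" if "y \<in> cball z0 \<epsilon>" for y
              using \<epsilon>1(2)[of y] that \<epsilon>(3) by (auto simp: dist_commute dist_real_def)
            have uM: "u y \<le> ereal M" if "y \<in> cball z0 \<epsilon>" for y
            proof -
              have yR: "y \<in> cball z0 R" using cb[OF zz] that by blast
              show ?thesis using vM1[OF yR] fd[OF that] v[OF R(2)[OF yR]] by (cases "u y") (auto simp: M_def M'_def)
            qed
            have gM': "g y \<le> M'" if "y \<in> cball z0 \<epsilon>" for y
            proof -
              have yR: "y \<in> cball z0 R" using cb[OF zz] that by blast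
              show ?thesis using g_le[OF yR] M1[OF yR] by (simp add: M'_def)
            qed
            have nonneg: "0 \<le> mollifier \<epsilon> z0 y * (M' - g y)" for y
              using gM'[of y] mollifier_nonneg[OF \<epsilon>(1), of z0 y] mollifier_eq_0[OF \<epsilon>(1), of y z0]
              by (cases "y \<in> cball z0 \<epsilon>") (auto simp: dist_norm norm_minus_commute)
            have eqf: "(\<lambda>y. mollifier \<epsilon> z0 y * (M' - g y)) = (\<lambda>y. M' * mollifier \<epsilon> z0 y - g y * mollifier \<epsilon> z0 y)"
              by (auto simp: algebra_simps)
            have int: "integrable lborel (\<lambda>y. mollifier \<epsilon> z0 y * (M' - g y))"
              unfolding eqf by (intro Bochner_Integration.integrable_diff integrable_mult_right mollifier_integrable gmi)
            have mm: "mollifier \<epsilon> z0 y = mollifier \<epsilon> 0 (y - z0)" for y using mollifier_shift[of \<epsilon> 0 z0 y] by simp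
            have "ennreal (LINT y|lborel. mollifier \<epsilon> z0 y * (M' - g y)) = (\<integral>\<^sup>+y. ennreal (mollifier \<epsilon> z0 y * (M' - g y)) \<partial>lborel)"
              using nn_integral_eq_integral[OF int] nonneg by simp
            also have "\<dots> \<le> (\<integral>\<^sup>+y. ennreal (mollifier \<epsilon> 0 (y - z0)) * e2ennreal (ereal M - ext_infinity W u y) \<partial>lborel)"
            proof (rule nn_integral_mono)
              fix y
              show "ennreal (mollifier \<epsilon> z0 y * (M' - g y)) \<le> ennreal (mollifier \<epsilon> 0 (y - z0)) * e2ennreal (ereal M - ext_infinity W u y)"
              proof (cases "y \<in> cball z0 \<epsilon>")
                case True
                have yR: "y \<in> cball z0 R" using cb[OF zz] True by blast
                have "ennreal (M' - g y) \<le> e2ennreal (ereal M - u y)"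
                proof (cases "u y")
                  case (real b)
                  then have "M' - g y \<le> M - b" using fd[OF True] v[OF R(2)[OF yR]] by (auto simp: M_def g_in[OF yR])
                  then show ?thesis by (simp add: real ennreal_leI)
                qed (use ufin[OF R(2)[OF yR]] in auto)
                then show ?thesis using R(2)[OF yR] mollifier_nonneg[OF \<epsilon>(1), of z0 y] gM'[OF True]
                  by (simp add: ext_infinity_def mm ennreal_mult mult_left_mono)
              next
                case False
                then have "mollifier \<epsilon> z0 y = 0" by (intro mollifier_eq_0 \<epsilon>) (simp add: dist_norm norm_minus_commute)
                then show ?thesis by simp
              qed
            qed
            also have "\<dots> \<le> e2ennreal (ereal M - u z0) * (\<integral>\<^sup>+x. ennreal (mollifier \<epsilon> 0 (x :: complex^'n)) \<partial>lborel)"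
            proof (rule psh_kernel_bound[OF u W(1) _ M0 uM])
              show "cball z0 \<epsilon> \<subseteq> W" using cb[OF zz] RW by blast
              show "ennreal (mollifier \<epsilon> 0 (cis t *s x)) = ennreal (mollifier \<epsilon> 0 x)" for t and x :: "complex^'n"
                by (simp add: mollifier_def norm_smult_cart)
              show "ennreal (mollifier \<epsilon> 0 x) = 0" if "\<epsilon> < norm x" for x :: "complex^'n"
                using that mollifier_eq_0[OF \<epsilon>(1), of x 0] by simp
            qed auto
            also have "(\<integral>\<^sup>+x. ennreal (mollifier \<epsilon> 0 (x :: complex^'n)) \<partial>lborel) = 1"
              by (subst nn_integral_eq_integral[OF mollifier_integrable]) (auto simp: mollifier_nonneg[OF \<epsilon>(1)] mollifier_integral[OF \<epsilon>(1)])
            finally have "ennreal (LINT y|lborel. mollifier \<epsilon> z0 y * (M' - g y)) \<le> ennreal (M - a)" by (simp add: a)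
            moreover have "0 \<le> M - a" using uM[of z0] \<epsilon>(1) a by simp
            ultimately have "(LINT y|lborel. mollifier \<epsilon> z0 y * (M' - g y)) \<le> M - a" by (simp add: ennreal_le_iff)
            moreover have "(LINT y|lborel. mollifier \<epsilon> z0 y * (M' - g y)) = M' - G z0"
              unfolding eqf using gmi[of z0] mollifier_integrable[of \<epsilon> z0] mollifier_integral[OF \<epsilon>(1), of z0]
              by (simp add: G_def)
            ultimately show ?thesis by (simp add: p M_def)
          qed
          \<comment> \<open>The current is tested on the mollifier centred at x, in direction -w.
            The term with h is at most q because h \<le> q on the ball and the mollifier has mass
            1.\<close>
          have 2: "asub G x w q" if x: "x \<in> ball z0 (R / 2)" for x
            unfolding G_def
          proof (rule asub_convolution[OF gint \<epsilon>(1)])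
            have cbx: "cball x \<epsilon> \<subseteq> cball z0 R" by (rule cb[OF x])
            define \<eta> where "\<eta> = mollifier \<epsilon> x"
            define dd where "dd y = ddc \<eta> y (- w) (\<i> *s (- w))" for y
            have t: "nonneg_test_function D \<eta>" unfolding \<eta>_def
              by (rule mollifier_test_function[OF \<epsilon>(1)]) (use cbx RW D in blast)
            have sm: "smooth_on UNIV \<eta>" by (simp add: \<eta>_def mollifier_smooth)
            have z1: "\<eta> y = 0" "dd y = 0" if "y \<notin> cball x \<epsilon>" for y
            proof -
              have o: "open (- cball x \<epsilon>)" by (simp add: open_Compl)
              have s0: "\<eta> y = 0" if "y \<in> - cball x \<epsilon>" for y
                using that unfolding \<eta>_def by (intro mollifier_eq_0 \<epsilon>) (auto simp: dist_norm norm_minus_commute)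
              show "\<eta> y = 0" using s0 that by simp
              show "dd y = 0" unfolding dd_def by (rule ddc_eq_0_outside[OF o s0]) (use that in auto)
            qed
            define H where "H y = (if y \<in> W then h y w else 0)" for y
            have [measurable]: "H \<in> borel_measurable borel" unfolding H_def
              by (rule borel_measurable_extend_zero[OF _ W(1)]) (rule continuous_imp_usc[OF continuous_on_subset[OF h(1) D]])
            have [measurable]: "\<eta> \<in> borel_measurable borel" by (simp add: \<eta>_def)
            have \<eta>0: "0 \<le> \<eta> y" for y unfolding \<eta>_def by (rule mollifier_nonneg[OF \<epsilon>(1)])
            have \<eta>i: "integrable lborel \<eta>" unfolding \<eta>_def by (rule mollifier_integrable)
            have Hle: "H y * \<eta> y \<le> q * \<eta> y" "0 \<le> H y * \<eta> y" for y
            proof -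
              have "H y * \<eta> y \<le> q * \<eta> y \<and> 0 \<le> H y * \<eta> y"
              proof (cases "y \<in> cball x \<epsilon>")
                case True
                then have yR: "y \<in> cball z0 R" using cbx by blast
                then have "H y = h y w" "h y w \<le> q" "0 \<le> h y w" using R(2,3)[OF yR] h(2) D by (auto simp: H_def)
                then show ?thesis using \<eta>0[of y] by (auto intro: mult_right_mono)
              qed (simp add: z1)
              then show "H y * \<eta> y \<le> q * \<eta> y" "0 \<le> H y * \<eta> y" by auto
            qed
            have H\<eta>i: "integrable lborel (\<lambda>y. H y * \<eta> y)"
              by (rule Bochner_Integration.integrable_bound[of _ "\<lambda>y. q * \<eta> y"]) (use \<eta>i Hle in \<open>auto intro!: AE_I2 intro: order_trans[OF _ abs_ge_self]\<close>)
            have ddc: "continuous_on UNIV dd" unfolding dd_def by (rule ddc_continuous[OF sm])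
            have ddm[measurable]: "dd \<in> borel_measurable borel" using ddc by (rule borel_measurable_continuous_onI)
            have "dd y = 0" if "norm x + \<epsilon> < norm y" for y
              using that norm_triangle_ineq2[of y x] by (intro z1) (auto simp: dist_norm norm_minus_commute)
            then obtain C2 where C2: "\<And>y. \<bar>dd y\<bar> \<le> C2" using continuous_compact_support_bounded[OF ddc, of "norm x + \<epsilon>"] by blast
            have gddi: "integrable lborel (\<lambda>y. g y * dd y)" by (rule integrable_mult_bounded[OF gint ddm C2])
            have "0 \<le> (LINT z:D|lborel. h z (- w) * \<eta> z + real_of_ereal (v z) * ddc \<eta> z (- w) (\<i> *s (- w)))"
              by (rule cur[OF t])
            also have "\<dots> = (LINT y|lborel. H y * \<eta> y + g y * dd y)"
              unfolding set_lebesgue_integral_def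
            proof (rule Bochner_Integration.integral_cong[OF refl])
              fix y
              show "indicator D y *\<^sub>R (h y (- w) * \<eta> y + real_of_ereal (v y) * ddc \<eta> y (- w) (\<i> *s (- w))) = H y * \<eta> y + g y * dd y"
              proof (cases "y \<in> cball x \<epsilon>")
                case True
                then have yR: "y \<in> cball z0 R" using cbx by blast
                then have "y \<in> W" "y \<in> D" using R(2) D by auto
                then show ?thesis using h(3)[of y w] by (simp only: H_def g_in[OF yR] dd_def) simp
              next
                case False
                then have "\<eta> y = 0" "ddc \<eta> y (- w) (\<i> *s (- w)) = 0" "dd y = 0" using z1[OF False] by (simp_all only: dd_def)
                then show ?thesis by (simp only:) simp
              qed
            qed
            also have "\<dots> = (LINT y|lborel. H y * \<eta> y) + (LINT y|lborel. g y * dd y)"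
              by (rule Bochner_Integration.integral_add[OF H\<eta>i gddi])
            also have "(LINT y|lborel. H y * \<eta> y) \<le> (LINT y|lborel. q * \<eta> y)"
              by (rule integral_mono[OF H\<eta>i]) (use \<eta>i Hle in auto)
            also have "\<dots> = q" using mollifier_integral[OF \<epsilon>(1), of x] by (simp add: \<eta>_def)
            finally show "- q \<le> (LINT y|lborel. g y * ddc (mollifier \<epsilon> x) y (- w) (\<i> *s (- w)))"
              unfolding dd_def \<eta>_def by linarith
          qed
          define G' where "G' z = max (G z) 0" for z
          have G'c: "continuous_on UNIV G'" unfolding G'_def by (intro continuous_intros Gc)
          have 3: "asub G' x w q" if x: "x \<in> ball z0 (R / 2)" for x
          proof (cases "0 \<le> G x")
            case True
            have "compact (G ` cball z0 R)" by (intro compact_continuous_image continuous_on_subset[OF Gc]) auto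
            then obtain m where m: "\<And>y. y \<in> cball z0 R \<Longrightarrow> \<bar>G y\<bar> \<le> m" using compact_imp_bounded by (fastforce simp: bounded_iff)
            show ?thesis
            proof (rule asub_touch[OF 2[OF x] open_ball x, where m = "- m"])
              show "- m \<le> G y" if "y \<in> ball z0 (R / 2)" for y using m[of y] that R(1) by auto
            qed (use True in \<open>auto simp: G'_def[abs_def] intro!: continuous_imp_usc continuous_on_subset[OF G'c[unfolded G'_def[abs_def]]] continuous_on_subset[OF Gc]\<close>)
          next
            case False
            show ?thesis
              by (rule asub_touch[OF asub_const[of q 0] open_UNIV, where m = 0])
                 (use q False in \<open>auto simp: G'_def intro: continuous_imp_usc continuous_imp_usc[OF G'c]\<close>)
          qed
          have "G' z0 \<le> cmean (\<lambda>\<zeta>. G' (z0 + \<zeta> *s w)) s + s\<^sup>2 / 4 * q"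
          proof (rule disc_submean[where W = "ball z0 (R / 2)" and m = 0, OF open_ball _ _ _ 3])
            show "usc (ball z0 (R / 2)) G'" by (rule continuous_imp_usc[OF continuous_on_subset[OF G'c]]) simp
            show "0 \<le> G' x" for x by (simp add: G'_def)
          qed (use q elim disc in auto)
          \<comment> \<open>On the circle, G' is at most a value of \<open>pos_part v\<close> within
            \<epsilon> \<le> \<sigma>, namely its maximum over the closed ball.\<close>
          also have "cmean (\<lambda>\<zeta>. G' (z0 + \<zeta> *s w)) s < cmean (\<lambda>\<zeta>. pos_part v (z0 + \<zeta> *s w)) s + \<delta>"
          proof (rule \<sigma>_mean[rule_format])
            show "cint (\<lambda>\<zeta>. G' (z0 + \<zeta> *s w)) s"
              using elim by (intro continuous_cint continuous_on_compose2[OF G'c] continuous_intros) auto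
            fix \<zeta> :: complex assume \<zeta>: "cmod \<zeta> = s"
            define x where "x = z0 + \<zeta> *s w"
            have x: "x \<in> ball z0 (R / 2)" using disc[of \<zeta>] \<zeta> by (simp add: x_def)
            have cbx: "cball x \<epsilon> \<subseteq> cball z0 R" by (rule cb[OF x])
            obtain y where y: "y \<in> cball x \<epsilon>" "\<And>y'. y' \<in> cball x \<epsilon> \<Longrightarrow> pos_part v y' \<le> pos_part v y"
              using usc_attains_max[OF usc_subset[OF pus, of "cball x \<epsilon>"] compact_cball] cbx RW \<epsilon>(1)
              by force
            have "G x \<le> (LINT y'|lborel. pos_part v y * mollifier \<epsilon> x y')"
              unfolding G_def
            proof (rule integral_mono[OF gmi])
              show "integrable lborel (\<lambda>y'. pos_part v y * mollifier \<epsilon> x y')" using mollifier_integrable by (rule integrable_mult_right)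
              fix y'
              show "g y' * mollifier \<epsilon> x y' \<le> pos_part v y * mollifier \<epsilon> x y'"
              proof (cases "y' \<in> cball x \<epsilon>")
                case True
                then have "g y' \<le> pos_part v y" using g_le[of y'] y(2)[OF True] cbx by force
                then show ?thesis by (intro mult_right_mono mollifier_nonneg[OF \<epsilon>(1)])
              next
                case False
                then have "mollifier \<epsilon> x y' = 0" by (intro mollifier_eq_0 \<epsilon>) (simp add: dist_norm norm_minus_commute)
                then show ?thesis by simp
              qed
            qed
            also have "\<dots> = pos_part v y" using mollifier_integral[OF \<epsilon>(1), of x] by simp
            finally have "G' x \<le> pos_part v y" using pos_part_nonneg[of v y] by (simp add: G'_def)
            moreover have "norm (y - x) \<le> \<sigma>" using y(1) \<epsilon>(2) by (simp add: dist_norm norm_minus_commute)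
            ultimately show "\<exists>x. norm (x - (z0 + \<zeta> *s w)) \<le> \<sigma> \<and> G' (z0 + \<zeta> *s w) \<le> pos_part v x"
              unfolding x_def by blast
          qed
          finally show "pos_part v z0 \<le> cmean (\<lambda>\<zeta>. pos_part v (z0 + \<zeta> *s w)) s + s\<^sup>2 / 4 * (h z0 w + e) + \<epsilon>0"
            using 1 by (simp add: G'_def q_def \<delta>_def)
        qed
      qed
    qed
  qed
qed

section \<open>Hermitian forms in coordinates\<close>

lemma bilinear_bound_Basis:
  fixes D :: "'v::euclidean_space \<Rightarrow> 'v \<Rightarrow> real"
  assumes "bilinear D"
  shows "\<bar>D u w\<bar> \<le> (\<Sum>(i,j)\<in>Basis \<times> Basis. \<bar>D i j\<bar>) * (norm u * norm w)"
proof -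
  have "D u w = D (\<Sum>i\<in>Basis. (u \<bullet> i) *\<^sub>R i) (\<Sum>j\<in>Basis. (w \<bullet> j) *\<^sub>R j)" by (simp add: euclidean_representation)
  also have "\<dots> = (\<Sum>(i,j)\<in>Basis \<times> Basis. D ((u \<bullet> i) *\<^sub>R i) ((w \<bullet> j) *\<^sub>R j))"
    by (rule bilinear_sum[OF assms])
  also have "\<dots> = (\<Sum>(i,j)\<in>Basis \<times> Basis. (u \<bullet> i) * (w \<bullet> j) * D i j)"
    by (intro sum.cong refl) (auto simp: bilinear_lmul[OF assms] bilinear_rmul[OF assms])
  finally have "\<bar>D u w\<bar> \<le> (\<Sum>(i,j)\<in>Basis \<times> Basis. \<bar>(u \<bullet> i) * (w \<bullet> j) * D i j\<bar>)"
    using sum_abs[of "\<lambda>(i,j). (u \<bullet> i) * (w \<bullet> j) * D i j" "Basis \<times> Basis"] by (simp add: case_prod_unfold)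
  also have "\<dots> \<le> (\<Sum>(i,j)\<in>Basis \<times> Basis. \<bar>D i j\<bar> * (norm u * norm w))"
  proof (intro sum_mono, clarify)
    fix i j :: 'v assume "i \<in> Basis" "j \<in> Basis"
    then have "\<bar>u \<bullet> i\<bar> * \<bar>w \<bullet> j\<bar> \<le> norm u * norm w" by (intro mult_mono Basis_le_norm) auto
    then have "\<bar>D i j\<bar> * (\<bar>u \<bullet> i\<bar> * \<bar>w \<bullet> j\<bar>) \<le> \<bar>D i j\<bar> * (norm u * norm w)" by (intro mult_left_mono) auto
    then show "\<bar>(u \<bullet> i) * (w \<bullet> j) * D i j\<bar> \<le> \<bar>D i j\<bar> * (norm u * norm w)" by (simp add: abs_mult mult_ac)
  qed
  also have "\<dots> = (\<Sum>(i,j)\<in>Basis \<times> Basis. \<bar>D i j\<bar>) * (norm u * norm w)"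
    by (simp add: sum_distrib_right case_prod_unfold)
  finally show ?thesis .
qed

text \<open>Continuity is given for each fixed pair u, w; expansion in a basis reduces uniformity in
  w to finitely many pairs.\<close>

lemma hermitian_form_near:
  fixes \<omega> :: "complex^'n \<Rightarrow> complex^'n \<Rightarrow> complex^'n \<Rightarrow> real"
  assumes W: "open W" "z0 \<in> W" and bil: "\<And>z. z \<in> W \<Longrightarrow> bilinear (\<omega> z)"
    and cont: "\<And>u w. continuous_on W (\<lambda>z. \<omega> z u w)" and e: "0 < e"
  shows "\<exists>\<rho>>0. \<forall>z w. dist z z0 < \<rho> \<longrightarrow> z \<in> W \<and> \<bar>\<omega> z w (\<i> *s w) - \<omega> z0 w (\<i> *s w)\<bar> \<le> e * (norm w)\<^sup>2"
proof -
  define S where "S z = (\<Sum>(i,j)\<in>(Basis::(complex^'n) set) \<times> Basis. \<bar>\<omega> z i j - \<omega> z0 i j\<bar>)" for z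
  have "continuous_on W S" unfolding S_def case_prod_unfold by (intro continuous_intros cont)
  moreover have "S z0 = 0" by (simp add: S_def case_prod_unfold)
  ultimately have "\<forall>\<^sub>F z in nhds z0. z \<in> W \<and> S z < e" using W e by (intro usc_openD continuous_imp_usc) auto
  then obtain \<rho> where \<rho>: "\<rho> > 0" "\<And>z. dist z z0 < \<rho> \<Longrightarrow> z \<in> W \<and> S z < e" by (auto simp: eventually_nhds_metric)
  show ?thesis
  proof (intro exI[of _ \<rho>] conjI[OF \<rho>(1)] allI impI)
    fix z w assume d: "dist z z0 < \<rho>"
    then have z: "z \<in> W" "S z < e" using \<rho>(2) by auto
    define D where "D u w = \<omega> z u w - \<omega> z0 u w" for u w
    have "bilinear D"
      using bil[OF z(1)] bil[OF W(2)] unfolding bilinear_def D_def by (auto intro!: linear_compose_sub)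
    from bilinear_bound_Basis[OF this, of w "\<i> *s w"]
    have "\<bar>\<omega> z w (\<i> *s w) - \<omega> z0 w (\<i> *s w)\<bar> \<le> S z * (norm w)\<^sup>2"
      by (simp add: D_def S_def norm_smult_cart power2_eq_square)
    also have "\<dots> \<le> e * (norm w)\<^sup>2" using z by (intro mult_right_mono) auto
    finally show "z \<in> W \<and> \<bar>\<omega> z w (\<i> *s w) - \<omega> z0 w (\<i> *s w)\<bar> \<le> e * (norm w)\<^sup>2" using z by simp
  qed
qed

lemma hermitian_form_bounds:
  fixes \<omega> :: "complex^'n \<Rightarrow> complex^'n \<Rightarrow> real"
  assumes bil: "bilinear \<omega>" and pos: "\<And>w. w \<noteq> 0 \<Longrightarrow> 0 < \<omega> w (\<i> *s w)"
  shows "\<exists>c C. 0 < c \<and> 0 < C \<and> (\<forall>w. c * (norm w)\<^sup>2 \<le> \<omega> w (\<i> *s w) \<and> \<omega> w (\<i> *s w) \<le> C * (norm w)\<^sup>2)"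
proof -
  have bb: "bounded_bilinear \<omega>" using bil bilinear_conv_bounded_bilinear by blast
  have "continuous_on (sphere 0 1) (\<lambda>w. \<omega> w (\<i> *s w))"
    by (intro bounded_bilinear.continuous_on[OF bb] continuous_intros)
  then obtain w0 where w0: "w0 \<in> sphere (0::complex^'n) 1" "\<And>w. w \<in> sphere 0 1 \<Longrightarrow> \<omega> w0 (\<i> *s w0) \<le> \<omega> w (\<i> *s w)"
    using continuous_attains_inf[of "sphere (0::complex^'n) 1" "\<lambda>w. \<omega> w (\<i> *s w)"] by (auto simp: sphere_eq_empty)
  have c: "0 < \<omega> w0 (\<i> *s w0)" using w0 by (intro pos) auto
  define S where "S = (\<Sum>(i,j)\<in>(Basis::(complex^'n) set) \<times> Basis. \<bar>\<omega> i j\<bar>)"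
  have S0: "0 \<le> S" unfolding S_def case_prod_unfold by (intro sum_nonneg) auto
  show ?thesis
  proof (rule exI[of _ "\<omega> w0 (\<i> *s w0)"], rule exI[of _ "S + 1"], intro conjI allI)
    show "0 < S + 1" using S0 by simp
    show "\<omega> w (\<i> *s w) \<le> (S + 1) * (norm w)\<^sup>2" for w
    proof -
      have "\<omega> w (\<i> *s w) \<le> S * (norm w)\<^sup>2"
        using bilinear_bound_Basis[OF bil, of w "\<i> *s w"] by (simp add: S_def norm_smult_cart power2_eq_square)
      also have "\<dots> \<le> (S + 1) * (norm w)\<^sup>2" by (intro mult_right_mono) auto
      finally show ?thesis .
    qed
    show "\<omega> w0 (\<i> *s w0) * (norm w)\<^sup>2 \<le> \<omega> w (\<i> *s w)" for w
    proof (cases "w = 0")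
      case True
      then show ?thesis by (simp add: bilinear_lzero[OF bil])
    next
      case False
      define v where "v = (1 / norm w) *\<^sub>R w"
      have "v \<in> sphere 0 1" using False by (simp add: v_def)
      then have "\<omega> w0 (\<i> *s w0) \<le> \<omega> v (\<i> *s v)" by (rule w0(2))
      moreover have wv: "w = norm w *\<^sub>R v" using False by (simp add: v_def)
      have iv: "\<i> *s (norm w *\<^sub>R v) = norm w *\<^sub>R (\<i> *s v)" by (simp add: vec_eq_iff)
      have "\<omega> w (\<i> *s w) = (norm w)\<^sup>2 * \<omega> v (\<i> *s v)"
        by (subst (1 2) wv) (simp add: iv bilinear_lmul[OF bil] bilinear_rmul[OF bil] power2_eq_square)
      ultimately show ?thesis using mult_right_mono[of "\<omega> w0 (\<i> *s w0)" "\<omega> v (\<i> *s v)" "(norm w)\<^sup>2"] by (simp add: mult.commute)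
    qed
  qed (rule c)
qed

text \<open>\<open>holomorphic_map_on\<close> asserts complex derivatives but not their continuity.
  Cauchy's inequality on the discs \<zeta> \<mapsto> F(z + \<zeta>w) bounds them locally uniformly
  by the size of F.\<close>

lemma holomorphic_map_derivative_bound:
  fixes F :: "complex^'n \<Rightarrow> complex^'m"
  assumes F: "holomorphic_map_on A F" and A: "open A" "z0 \<in> A"
  shows "\<exists>\<rho>>0. \<exists>L>0. \<forall>z. dist z z0 < \<rho> \<longrightarrow> z \<in> A \<and> (\<forall>f' w. (F has_derivative f') (at z) \<longrightarrow> norm (f' w) \<le> L * norm w)"
proof -
  have "isCont F z" if z: "z \<in> A" for z
  proof -
    obtain f' where "(F has_derivative f') (at z)" using F z by (auto simp: holomorphic_map_on_def)
    then show ?thesis by (rule has_derivative_continuous)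
  qed
  then have Fc: "continuous_on A F" by (simp add: continuous_at_imp_continuous_on)
  obtain e where e: "e > 0" "cball z0 e \<subseteq> A" using A open_contains_cball by blast
  define \<rho> where "\<rho> = e / 2"
  have \<rho>: "\<rho> > 0" using e by (simp add: \<rho>_def)
  have "compact (F ` cball z0 e)" by (rule compact_continuous_image[OF continuous_on_subset[OF Fc e(2)] compact_cball])
  then obtain B where B: "\<And>x. x \<in> cball z0 e \<Longrightarrow> norm (F x) \<le> B" using compact_imp_bounded by (fastforce simp: bounded_iff)
  have B0: "0 \<le> B" using B[of z0] e norm_ge_zero order_trans by (metis centre_in_cball less_imp_le)
  \<comment> \<open>Cauchy's bound for one component, summed over all components.\<close>
  define L where "L = real CARD('m) * ((B + 1) / \<rho>)"
  have L: "L > 0" using B0 \<rho> by (simp add: L_def)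
  have main: "norm (f' w) \<le> L * norm w" if z: "dist z z0 < \<rho>" and f': "(F has_derivative f') (at z)" for z f' w
  proof (cases "w = 0")
    case True
    then show ?thesis using has_derivative_linear[OF f'] by (simp add: linear_0)
  next
    case False
    \<comment> \<open>In direction w the disc of this parameter radius has Euclidean radius \<rho>,
      which makes the bound proportional to |w|.\<close>
    define s where "s = \<rho> / norm w"
    have s: "s > 0" using False \<rho> by (simp add: s_def)
    have sw: "s * norm w = \<rho>" using False by (simp add: s_def)
    have inA: "z + \<zeta> *s w \<in> cball z0 e" if "cmod \<zeta> \<le> s" for \<zeta>
    proof -
      have "z + \<zeta> *s w \<in> ball z0 e" by (rule disc_in_ball[OF _ that]) (use z sw in \<open>auto simp: \<rho>_def\<close>)
      then show ?thesis by simp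
    qed
    have line: "((\<lambda>\<zeta>. z + \<zeta> *s w) has_derivative (\<lambda>h. h *s w)) (at \<zeta>)" for \<zeta>
      using has_derivative_add[OF has_derivative_const bounded_linear.has_derivative[OF bounded_linear_smult_left has_derivative_ident]] by simp
    have der: "\<exists>d. ((\<lambda>\<zeta>. F (z + \<zeta> *s w)) has_derivative (\<lambda>h. h *s d)) (at \<zeta>)" if \<zeta>: "cmod \<zeta> \<le> s" for \<zeta>
    proof -
      have "z + \<zeta> *s w \<in> A" using inA[OF \<zeta>] e by auto
      then obtain g' where g': "(F has_derivative g') (at (z + \<zeta> *s w))" "\<forall>c w. g' (c *s w) = c *s g' w"
        using F by (auto simp: holomorphic_map_on_def)
      have "((\<lambda>\<zeta>. F (z + \<zeta> *s w)) has_derivative (\<lambda>h. g' (h *s w))) (at \<zeta>)"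
        by (rule has_derivative_compose[OF line g'(1)])
      then show ?thesis using g'(2) by auto
    qed
    have zA: "z \<in> A" using inA[of 0] s e by auto
    have lin: "f' (c *s y) = c *s f' y" for c y
    proof -
      obtain g' where "(F has_derivative g') (at z)" "\<forall>c w. g' (c *s w) = c *s g' w"
        using F zA by (auto simp: holomorphic_map_on_def)
      then show ?thesis using has_derivative_unique[OF f'] by blast
    qed
    have d0: "((\<lambda>\<zeta>. F (z + \<zeta> *s w)) has_derivative (\<lambda>h. h *s f' w)) (at 0)"
      using has_derivative_compose[OF line[of 0], of F f'] f' by (simp add: lin)
    have "cmod (f' w $ i) \<le> (B + 1) / \<rho> * norm w" for i
    proof -
      define k where "k \<zeta> = F (z + \<zeta> *s w) $ i" for \<zeta>
      have kd: "k field_differentiable (at \<zeta>)" if "cmod \<zeta> \<le> s" for \<zeta>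
        using der[OF that] disc_component_derivative[of "\<lambda>\<zeta>. F (z + \<zeta> *s w)"] unfolding k_def field_differentiable_def by blast
      have hol: "k holomorphic_on ball 0 s" unfolding holomorphic_on_def
        by (intro ballI field_differentiable_at_within[OF kd]) auto
      have con: "continuous_on (cball 0 s) k"
        by (intro continuous_at_imp_continuous_on ballI field_differentiable_imp_continuous_at[OF kd]) auto
      have "deriv k 0 = f' w $ i"
        using disc_component_derivative[OF d0, of i] DERIV_imp_deriv unfolding k_def by blast
      moreover have "cmod ((deriv ^^ 1) k 0) \<le> fact 1 * (B + 1) / s ^ 1"
      proof (rule Cauchy_inequality[OF hol con s])
        fix x assume "cmod (0 - x) = s"
        then have "cmod x \<le> s" by simp
        from B[OF inA[OF this]] have "norm (F (z + x *s w)) \<le> B" .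
        moreover have "cmod (k x) \<le> norm (F (z + x *s w))" unfolding k_def by (rule Finite_Cartesian_Product.norm_nth_le)
        ultimately show "cmod (k x) \<le> B + 1" by simp
      qed
      ultimately show ?thesis by (simp add: s_def)
    qed
    then have "(\<Sum>i\<in>UNIV. cmod (f' w $ i)) \<le> (\<Sum>i\<in>(UNIV::'m set). (B + 1) / \<rho> * norm w)" by (intro sum_mono)
    moreover have "norm (f' w) \<le> (\<Sum>i\<in>UNIV. cmod (f' w $ i))" unfolding norm_vec_def by (rule L2_set_le_sum) auto
    ultimately show ?thesis by (simp add: L_def)
  qed
  have "z \<in> A" if "dist z z0 < \<rho>" for z using that e by (auto simp: \<rho>_def dist_commute subset_iff)
  then show ?thesis using \<rho> L main by blast
qed

section \<open>Charts\<close>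

lemma topological_chartD:
  assumes "topological_chart (U, \<phi>)"
  shows "open U" "open (\<phi> ` U)" "continuous_on U \<phi>" "continuous_on (\<phi> ` U) (inv_into U \<phi>)"
    "\<And>x. x \<in> U \<Longrightarrow> inv_into U \<phi> (\<phi> x) = x" "\<And>z. z \<in> \<phi> ` U \<Longrightarrow> \<phi> (inv_into U \<phi> z) = z"
    "\<And>z. z \<in> \<phi> ` U \<Longrightarrow> inv_into U \<phi> z \<in> U" "inj_on \<phi> U"
  using assms unfolding topological_chart_def homeomorphism_def
  by (auto simp: inv_into_into inj_on_def) (metis)+

lemma chart_image_open:
  assumes c: "topological_chart (U, \<phi>)" and V: "open V"
  shows "open (\<phi> ` (U \<inter> V))"
proof -
  note t = topological_chartD[OF c]
  have "\<phi> ` (U \<inter> V) = \<phi> ` U \<inter> inv_into U \<phi> -` V" using t(5) by force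
  moreover have "openin (top_of_set (\<phi> ` U)) (\<phi> ` U \<inter> inv_into U \<phi> -` V)"
    using t(4) V continuous_openin_preimage_gen by blast
  ultimately show ?thesis using t(2) by (simp add: openin_open_eq)
qed

lemma chart_inv_image_open:
  assumes c: "topological_chart (U, \<phi>)" and B: "open B" "B \<subseteq> \<phi> ` U"
  shows "open (inv_into U \<phi> ` B)"
proof -
  note t = topological_chartD[OF c]
  have "inv_into U \<phi> ` B = U \<inter> \<phi> -` B"
  proof
    show "inv_into U \<phi> ` B \<subseteq> U \<inter> \<phi> -` B" using t(6,7) B(2) by auto
    show "U \<inter> \<phi> -` B \<subseteq> inv_into U \<phi> ` B" using t(5) by force
  qed
  moreover have "openin (top_of_set U) (U \<inter> \<phi> -` B)" using t(3) B(1) continuous_openin_preimage_gen by blast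
  ultimately show ?thesis using t(1) by (simp add: openin_open_eq)
qed

lemma chart_usc:
  assumes c: "topological_chart (U, \<phi>)" and v: "usc UNIV v"
  shows "usc (\<phi> ` U) (\<lambda>z. v (inv_into U \<phi> z))"
  by (rule usc_compose[OF v topological_chartD(4)[OF c]]) simp

text \<open>The two derivatives are kept together as mutual inverses, so every direction in one
  chart is the image of a direction in the other.\<close>

lemma chart_change:
  assumes c: "topological_chart (U, \<phi>)" "topological_chart (V, \<psi>)" and comp: "holomorphically_compatible (U, \<phi>) (V, \<psi>)"
    and x: "x \<in> U" "x \<in> V"
  shows "\<exists>f' g'. ((\<psi> \<circ> inv_into U \<phi>) has_derivative f') (at (\<phi> x)) \<and> ((\<phi> \<circ> inv_into V \<psi>) has_derivative g') (at (\<psi> x)) \<and>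
    (\<forall>w. f' (g' w) = w) \<and> (\<forall>w. g' (f' w) = w) \<and> (\<forall>c w. f' (c *s w) = c *s f' w) \<and> (\<forall>c w. g' (c *s w) = c *s g' w) \<and>
    (\<forall>v w q. asub (\<lambda>z. v (inv_into U \<phi> z)) (\<phi> x) w q \<longrightarrow> asub (\<lambda>z. v (inv_into V \<psi> z)) (\<psi> x) (f' w) q) \<and>
    (\<forall>v w q. asub (\<lambda>z. v (inv_into V \<psi> z)) (\<psi> x) w q \<longrightarrow> asub (\<lambda>z. v (inv_into U \<phi> z)) (\<phi> x) (g' w) q)"
proof -
  note t = topological_chartD[OF c(1)] and t' = topological_chartD[OF c(2)]
  define F where "F = \<psi> \<circ> inv_into U \<phi>"
  define G where "G = \<phi> \<circ> inv_into V \<psi>"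
  define A where "A = \<phi> ` (U \<inter> V)"
  define B where "B = \<psi> ` (U \<inter> V)"
  have A: "open A" "\<phi> x \<in> A" using chart_image_open[OF c(1) t'(1)] x by (auto simp: A_def)
  have B: "open B" "\<psi> x \<in> B" using chart_image_open[OF c(2) t(1)] x by (auto simp: B_def Int_commute)
  have FA: "holomorphic_map_on A F" and GB: "holomorphic_map_on B G"
    using comp by (auto simp: holomorphically_compatible_def A_def B_def F_def G_def)
  obtain f' where f': "(F has_derivative f') (at (\<phi> x))" "\<forall>c w. f' (c *s w) = c *s f' w"
    using FA A(2) by (auto simp: holomorphic_map_on_def)
  obtain g' where g': "(G has_derivative g') (at (\<psi> x))" "\<forall>c w. g' (c *s w) = c *s g' w"
    using GB B(2) by (auto simp: holomorphic_map_on_def)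
  have GF: "G (F z) = z" if "z \<in> A" for z using that t t' by (auto simp: A_def F_def G_def)
  have FG: "F (G z) = z" if "z \<in> B" for z using that t t' by (auto simp: B_def F_def G_def)
  have Fx: "F (\<phi> x) = \<psi> x" "G (\<psi> x) = \<phi> x" using t(5) t'(5) x by (auto simp: F_def G_def)
  have "((\<lambda>z. G (F z)) has_derivative (\<lambda>w. g' (f' w))) (at (\<phi> x))"
    by (rule has_derivative_compose[OF f'(1)]) (simp add: Fx g'(1))
  then have "((\<lambda>z. z) has_derivative (\<lambda>w. g' (f' w))) (at (\<phi> x))"
    by (rule has_derivative_transform_within_open[OF _ A]) (simp add: GF)
  then have gf: "g' (f' w) = w" for w using has_derivative_unique[OF _ has_derivative_ident] by metis
  have "((\<lambda>z. F (G z)) has_derivative (\<lambda>w. f' (g' w))) (at (\<psi> x))"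
    by (rule has_derivative_compose[OF g'(1)]) (simp add: Fx f'(1))
  then have "((\<lambda>z. z) has_derivative (\<lambda>w. f' (g' w))) (at (\<psi> x))"
    by (rule has_derivative_transform_within_open[OF _ B]) (simp add: FG)
  then have fg: "f' (g' w) = w" for w using has_derivative_unique[OF _ has_derivative_ident] by metis
  have "asub (\<lambda>z. v (inv_into V \<psi> z)) (\<psi> x) (f' w) q" if "asub (\<lambda>z. v (inv_into U \<phi> z)) (\<phi> x) w q" for v w q
  proof -
    have "asub (\<lambda>z. v (inv_into V \<psi> z)) (F (\<phi> x)) (f' w) q"
      by (rule asub_transport[OF that A FA f'(1)]) (auto simp: A_def F_def t(5) t'(5))
    then show ?thesis by (simp only: Fx)
  qed
  moreover have "asub (\<lambda>z. v (inv_into U \<phi> z)) (\<phi> x) (g' w) q" if "asub (\<lambda>z. v (inv_into V \<psi> z)) (\<psi> x) w q" for v w q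
  proof -
    have "asub (\<lambda>z. v (inv_into U \<phi> z)) (G (\<psi> x)) (g' w) q"
      by (rule asub_transport[OF that B GB g'(1)]) (auto simp: B_def G_def t(5) t'(5))
    then show ?thesis by (simp only: Fx)
  qed
  ultimately show ?thesis using f' g' fg gf unfolding F_def G_def by blast
qed

section \<open>Semicontinuous regularization\<close>

text \<open>For bounded u this is the least upper semicontinuous majorant; the lemmas below assume
  the bounds under which the infimum is meaningful. The filter \<open>nhds x\<close> includes x
  itself, whence u \<le> \<open>usc_reg u\<close>.\<close>

definition usc_reg :: "('a::topological_space \<Rightarrow> real) \<Rightarrow> 'a \<Rightarrow> real" where
  "usc_reg u x = Inf {c. \<forall>\<^sub>F y in nhds x. u y < c}"

lemma usc_reg_le:
  assumes m: "\<And>y. m \<le> u y" and c: "\<forall>\<^sub>F y in nhds x. u y \<le> c"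
  shows "usc_reg u x \<le> c"
proof (rule field_le_epsilon)
  fix e :: real assume "0 < e"
  then have "\<forall>\<^sub>F y in nhds x. u y < c + e" using c by (auto elim: eventually_mono)
  moreover have "bdd_below {c. \<forall>\<^sub>F y in nhds x. u y < c}"
    by (rule bdd_belowI[of _ m]) (use m in \<open>auto dest!: eventually_nhds_x_imp_x intro: less_imp_le le_less_trans\<close>)
  ultimately show "usc_reg u x \<le> c + e" unfolding usc_reg_def by (intro cInf_lower) auto
qed

lemma usc_reg_less:
  assumes M: "\<And>y. u y \<le> M" and c: "usc_reg u x < c"
  shows "\<forall>\<^sub>F y in nhds x. u y < c"
proof -
  have "M + 1 \<in> {c. \<forall>\<^sub>F y in nhds x. u y < c}" using M by (auto intro!: always_eventually simp: le_less_trans[OF M])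
  then obtain b where "\<forall>\<^sub>F y in nhds x. u y < b" "b < c"
    using cInf_lessD[OF _ c[unfolded usc_reg_def]] by blast
  then show ?thesis by (auto elim: eventually_mono)
qed

lemma usc_reg_ge:
  assumes M: "\<And>y. u y \<le> M"
  shows "u x \<le> usc_reg u x"
  using eventually_nhds_x_imp_x[OF usc_reg_less[where u = u and x = x and c = "u x", OF M]] by (meson less_irrefl not_le)

lemma usc_usc_reg:
  assumes m: "\<And>y. m \<le> u y" and M: "\<And>y. u y \<le> M"
  shows "usc UNIV (usc_reg u)"
proof (rule usc_openI[OF open_UNIV])
  fix x c assume "usc_reg u x < c"
  then obtain b where b: "usc_reg u x < b" "b < c" using dense by blast
  from usc_reg_less[OF M b(1)] have "\<forall>\<^sub>F z in nhds x. \<forall>\<^sub>F y in nhds z. u y < b" by (simp add: eventually_eventually)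
  then show "\<forall>\<^sub>F z in nhds x. usc_reg u z < c"
  proof (rule eventually_mono)
    fix z assume "\<forall>\<^sub>F y in nhds z. u y < b"
    then have "usc_reg u z \<le> b" by (intro usc_reg_le[OF m]) (auto elim: eventually_mono)
    then show "usc_reg u z < c" using b(2) by simp
  qed
qed

lemma usc_add:
  assumes f: "usc S f" and g: "usc S g" and S: "open S"
  shows "usc S (\<lambda>x. f x + g x)"
proof (rule usc_openI[OF S])
  fix x c assume x: "x \<in> S" "f x + g x < c"
  define e where "e = (c - (f x + g x)) / 2"
  have "e > 0" using x by (simp add: e_def)
  then have "\<forall>\<^sub>F y in nhds x. f y < f x + e" "\<forall>\<^sub>F y in nhds x. g y < g x + e"
    using usc_openD[OF f S x(1), of "f x + e"] usc_openD[OF g S x(1), of "g x + e"] by (auto elim: eventually_mono)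
  then show "\<forall>\<^sub>F y in nhds x. f y + g y < c"
    by eventually_elim (simp add: e_def field_simps)
qed

section \<open>Plurisubharmonic functions on a compact Hermitian manifold\<close>

locale compact_hermitian =
  fixes \<A> :: "('a::{t2_space,second_countable_topology}, 'n::finite) chart set"
    and \<omega> :: "('a, 'n) two_form"
  assumes atlas: "complex_atlas \<A>" and cpt: "compact (UNIV :: 'a set)" and herm: "hermitian_metric \<A> \<omega>"
begin

definition herm_quad :: "('a, 'n) chart \<Rightarrow> complex^'n \<Rightarrow> complex^'n \<Rightarrow> real" where
  "herm_quad c z w = \<omega> c z w (\<i> *s w)"

lemma chart_at: "\<exists>U \<phi>. (U, \<phi>) \<in> \<A> \<and> x \<in> U"
proof -
  have "x \<in> (\<Union>(U, \<phi>)\<in>\<A>. U)" using atlas by (simp add: complex_atlas_def)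
  then show ?thesis by auto
qed

lemma chart_top: "(U, \<phi>) \<in> \<A> \<Longrightarrow> topological_chart (U, \<phi>)"
  using atlas unfolding complex_atlas_def by blast

lemma chart_compat: "c \<in> \<A> \<Longrightarrow> c' \<in> \<A> \<Longrightarrow> holomorphically_compatible c c'"
  using atlas by (auto simp: complex_atlas_def)

lemma form_props:
  assumes "(U, \<phi>) \<in> \<A>"
  shows "\<And>z. z \<in> \<phi> ` U \<Longrightarrow> bilinear (\<omega> (U, \<phi>) z)"
    "\<And>z w. z \<in> \<phi> ` U \<Longrightarrow> w \<noteq> 0 \<Longrightarrow> 0 < \<omega> (U, \<phi>) z w (\<i> *s w)"
    "\<And>u w. continuous_on (\<phi> ` U) (\<lambda>z. \<omega> (U, \<phi>) z u w)"
proof -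
  have h: "(\<forall>z\<in>\<phi> ` U. bilinear (\<omega> (U, \<phi>) z) \<and>
           (\<forall>u w. \<omega> (U, \<phi>) z w u = - \<omega> (U, \<phi>) z u w) \<and>
           (\<forall>u w. \<omega> (U, \<phi>) z (\<i> *s u) (\<i> *s w) = \<omega> (U, \<phi>) z u w) \<and>
           (\<forall>w. w \<noteq> 0 \<longrightarrow> 0 < \<omega> (U, \<phi>) z w (\<i> *s w))) \<and>
        (\<forall>u w. smooth_on (\<phi> ` U) (\<lambda>z. \<omega> (U, \<phi>) z u w))"
    using herm assms unfolding hermitian_metric_def by blast
  then show "\<And>z. z \<in> \<phi> ` U \<Longrightarrow> bilinear (\<omega> (U, \<phi>) z)"
    "\<And>z w. z \<in> \<phi> ` U \<Longrightarrow> w \<noteq> 0 \<Longrightarrow> 0 < \<omega> (U, \<phi>) z w (\<i> *s w)"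
    "\<And>u w. continuous_on (\<phi> ` U) (\<lambda>z. \<omega> (U, \<phi>) z u w)"
    using smooth_on_imp_continuous_on by blast+
qed

lemma herm_quad_continuous: "(U, \<phi>) \<in> \<A> \<Longrightarrow> continuous_on (\<phi> ` U) (\<lambda>z. herm_quad (U, \<phi>) z w)"
  unfolding herm_quad_def by (rule form_props(3))

lemma herm_quad_nonneg: "(U, \<phi>) \<in> \<A> \<Longrightarrow> z \<in> \<phi> ` U \<Longrightarrow> 0 \<le> herm_quad (U, \<phi>) z w"
  unfolding herm_quad_def using form_props(1,2)[of U \<phi> z] by (cases "w = 0") (auto simp: bilinear_lzero less_imp_le)

lemma herm_quad_uminus: "(U, \<phi>) \<in> \<A> \<Longrightarrow> z \<in> \<phi> ` U \<Longrightarrow> herm_quad (U, \<phi>) z (- w) = herm_quad (U, \<phi>) z w"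
  unfolding herm_quad_def using form_props(1)[of U \<phi> z] by (simp add: bilinear_lneg bilinear_rneg)

text \<open>The two-sided bounds compare with the Euclidean form; the factor t compares the form at
  two nearby points and serves for translating functions inside a chart.\<close>

lemma herm_quad_near:
  assumes c: "(U, \<phi>) \<in> \<A>" and z0: "z0 \<in> \<phi> ` U" and t: "1 < t"
  shows "\<exists>\<rho>>0. \<exists>c0>0. \<exists>C0>0. \<forall>z. dist z z0 < \<rho> \<longrightarrow> z \<in> \<phi> ` U \<and>
    (\<forall>w. c0 * (norm w)\<^sup>2 \<le> herm_quad (U, \<phi>) z w \<and> herm_quad (U, \<phi>) z w \<le> C0 * (norm w)\<^sup>2) \<and>
    (\<forall>z' w. dist z' z0 < \<rho> \<longrightarrow> herm_quad (U, \<phi>) z' w \<le> t * herm_quad (U, \<phi>) z w)"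
proof -
  note top = topological_chartD[OF chart_top[OF c]]
  obtain k K where k: "0 < k" "0 < K" "\<And>w. k * (norm w)\<^sup>2 \<le> herm_quad (U, \<phi>) z0 w" "\<And>w. herm_quad (U, \<phi>) z0 w \<le> K * (norm w)\<^sup>2"
    using hermitian_form_bounds[OF form_props(1)[OF c z0] form_props(2)[OF c z0]] unfolding herm_quad_def by blast
  \<comment> \<open>k/2 keeps the lower bound positive. The other entry gives 2e|w|^2 \<le> (t - 1)
    k/2 |w|^2, so the variation between two points is absorbed by the factor t.\<close>
  define e where "e = min (k / 2) ((t - 1) * k / 4)"
  have e: "e > 0" "e \<le> k / 2" "4 * e \<le> (t - 1) * k" using k t by (auto simp: e_def)
  obtain \<rho> where \<rho>: "\<rho> > 0" "\<And>z w. dist z z0 < \<rho> \<Longrightarrow> z \<in> \<phi> ` U \<and> \<bar>herm_quad (U, \<phi>) z w - herm_quad (U, \<phi>) z0 w\<bar> \<le> e * (norm w)\<^sup>2"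
    using hermitian_form_near[OF top(2) z0 form_props(1)[OF c] form_props(3)[OF c] e(1)] unfolding herm_quad_def by blast
  have low: "k / 2 * (norm w)\<^sup>2 \<le> herm_quad (U, \<phi>) z w" if "dist z z0 < \<rho>" for z w
  proof -
    have "e * (norm w)\<^sup>2 \<le> k / 2 * (norm w)\<^sup>2" using e by (intro mult_right_mono) auto
    moreover have "k / 2 * (norm w)\<^sup>2 + k / 2 * (norm w)\<^sup>2 = k * (norm w)\<^sup>2" by simp
    ultimately show ?thesis using \<rho>(2)[OF that, of w] k(3)[of w] by linarith
  qed
  show ?thesis
  proof (rule exI[of _ \<rho>], rule conjI[OF \<rho>(1)], rule exI[of _ "k / 2"], rule conjI[OF half_gt_zero[OF k(1)]],
      rule exI[of _ "K + e"], rule conjI[OF add_pos_pos[OF k(2) e(1)]], intro conjI allI impI)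
    fix z assume z: "dist z z0 < \<rho>"
    show "z \<in> \<phi> ` U" using \<rho>(2)[OF z] by blast
    show "k / 2 * (norm w)\<^sup>2 \<le> herm_quad (U, \<phi>) z w" for w by (rule low[OF z])
    show "herm_quad (U, \<phi>) z w \<le> (K + e) * (norm w)\<^sup>2" for w using \<rho>(2)[OF z, of w] k(4)[of w] unfolding distrib_right by linarith
    fix z' w assume z': "dist z' z0 < \<rho>"
    have "herm_quad (U, \<phi>) z' w \<le> herm_quad (U, \<phi>) z w + 2 * (e * (norm w)\<^sup>2)" using \<rho>(2)[OF z, of w] \<rho>(2)[OF z', of w] by linarith
    also have "4 * e * (norm w)\<^sup>2 \<le> (t - 1) * k * (norm w)\<^sup>2" using e(3) by (intro mult_right_mono) auto
    then have "2 * (e * (norm w)\<^sup>2) \<le> (t - 1) * (k / 2 * (norm w)\<^sup>2)" by (simp add: algebra_simps)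
    also have "(t - 1) * (k / 2 * (norm w)\<^sup>2) \<le> (t - 1) * herm_quad (U, \<phi>) z w" using low[OF z] t by (intro mult_left_mono) auto
    finally show "herm_quad (U, \<phi>) z' w \<le> t * herm_quad (U, \<phi>) z w" by (simp add: algebra_simps)
  qed
qed

text \<open>One chart is enough to establish the condition; \<open>asubX_chart\<close> yields it in
  all others.\<close>

definition asubX :: "('a \<Rightarrow> real) \<Rightarrow> 'a \<Rightarrow> bool" where
  "asubX v x \<longleftrightarrow> (\<exists>(U, \<phi>)\<in>\<A>. x \<in> U \<and> (\<forall>w. asub (\<lambda>z. v (inv_into U \<phi> z)) (\<phi> x) w (herm_quad (U, \<phi>) (\<phi> x) w)))"

text \<open>The discs are transported by the derivative of the coordinate change, and \<omega>
  transforms by the same derivative, whose complex linearity carries iw along.\<close>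

lemma asubX_chart:
  assumes "asubX v x" "(V, \<psi>) \<in> \<A>" "x \<in> V"
  shows "asub (\<lambda>z. v (inv_into V \<psi> z)) (\<psi> x) w (herm_quad (V, \<psi>) (\<psi> x) w)"
proof -
  obtain U \<phi> where U: "(U, \<phi>) \<in> \<A>" "x \<in> U" "\<And>w. asub (\<lambda>z. v (inv_into U \<phi> z)) (\<phi> x) w (herm_quad (U, \<phi>) (\<phi> x) w)"
    using assms(1) by (auto simp: asubX_def)
  obtain f' g' where f: "((\<psi> \<circ> inv_into U \<phi>) has_derivative f') (at (\<phi> x))" "\<forall>w. f' (g' w) = w" "\<forall>c w. f' (c *s w) = c *s f' w"
    and tr: "\<forall>v w q. asub (\<lambda>z. v (inv_into U \<phi> z)) (\<phi> x) w q \<longrightarrow> asub (\<lambda>z. v (inv_into V \<psi> z)) (\<psi> x) (f' w) q"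
    using chart_change[OF chart_top[OF U(1)] chart_top[OF assms(2)] chart_compat[OF U(1) assms(2)] U(2) assms(3)] by blast
  have "frechet_derivative (\<psi> \<circ> inv_into U \<phi>) (at (\<phi> x)) = f'" using frechet_derivative_at[OF f(1)] by simp
  then have "\<omega> (U, \<phi>) (\<phi> x) u w = \<omega> (V, \<psi>) (\<psi> x) (f' u) (f' w)" for u w
  proof -
    have "\<forall>(U, \<phi>)\<in>\<A>. \<forall>(V, \<psi>)\<in>\<A>. \<forall>x\<in>U \<inter> V. \<forall>u w.
        \<omega> (U, \<phi>) (\<phi> x) u w =
        \<omega> (V, \<psi>) (\<psi> x) (frechet_derivative (\<psi> \<circ> inv_into U \<phi>) (at (\<phi> x)) u)
                       (frechet_derivative (\<psi> \<circ> inv_into U \<phi>) (at (\<phi> x)) w)"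
      using herm unfolding hermitian_metric_def by (rule conjunct2)
    from bspec[OF bspec[OF this U(1), unfolded prod.case] assms(2), unfolded prod.case]
    show ?thesis using \<open>frechet_derivative (\<psi> \<circ> inv_into U \<phi>) (at (\<phi> x)) = f'\<close> U(2) assms(3) by simp
  qed
  then have "herm_quad (U, \<phi>) (\<phi> x) (g' w) = herm_quad (V, \<psi>) (\<psi> x) w" by (simp add: herm_quad_def f)
  then show ?thesis using tr[rule_format, OF U(3)[of "g' w"]] by (simp add: f)
qed

lemma asubX_I:
  assumes "(U, \<phi>) \<in> \<A>" "x \<in> U" "\<And>w. asub (\<lambda>z. v (inv_into U \<phi> z)) (\<phi> x) w (herm_quad (U, \<phi>) (\<phi> x) w)"
  shows "asubX v x"
  using assms unfolding asubX_def by blast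

lemma asubX_touch:
  assumes u: "asubX u x" and A: "open A" "x \<in> A" "usc A u" "usc A v"
    and uv: "\<And>y. y \<in> A \<Longrightarrow> m \<le> u y" "\<And>y. y \<in> A \<Longrightarrow> u y \<le> v y" "v x \<le> u x"
  shows "asubX v x"
proof -
  obtain U \<phi> where U: "(U, \<phi>) \<in> \<A>" "x \<in> U" using chart_at by blast
  note t = topological_chartD[OF chart_top[OF U(1)]]
  have o: "open (\<phi> ` (U \<inter> A))" by (rule chart_image_open[OF chart_top[OF U(1)] A(1)])
  have img: "inv_into U \<phi> ` (\<phi> ` (U \<inter> A)) \<subseteq> A" using t(5) by auto
  have cont: "continuous_on (\<phi> ` (U \<inter> A)) (inv_into U \<phi>)" by (rule continuous_on_subset[OF t(4)]) auto
  show ?thesis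
  proof (rule asubX_I[OF U])
    fix w
    show "asub (\<lambda>z. v (inv_into U \<phi> z)) (\<phi> x) w (herm_quad (U, \<phi>) (\<phi> x) w)"
    proof (rule asub_touch[OF asubX_chart[OF u U] o, where m = m])
      show "\<phi> x \<in> \<phi> ` (U \<inter> A)" using U(2) A(2) by blast
      show "usc (\<phi> ` (U \<inter> A)) (\<lambda>z. u (inv_into U \<phi> z))" "usc (\<phi> ` (U \<inter> A)) (\<lambda>z. v (inv_into U \<phi> z))"
        by (rule usc_compose[OF A(3) cont img] usc_compose[OF A(4) cont img])+
      show "m \<le> u (inv_into U \<phi> z)" "u (inv_into U \<phi> z) \<le> v (inv_into U \<phi> z)" if "z \<in> \<phi> ` (U \<inter> A)" for z
        using uv(1,2) img that by blast+
      show "v (inv_into U \<phi> (\<phi> x)) \<le> u (inv_into U \<phi> (\<phi> x))" using uv(3) t(5)[OF U(2)] by simp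
    qed
  qed
qed

lemma asubX_const: "asubX (\<lambda>_. c) x"
proof -
  obtain U \<phi> where U: "(U, \<phi>) \<in> \<A>" "x \<in> U" using chart_at by blast
  then show ?thesis by (intro asubX_I[OF U] asub_const herm_quad_nonneg) auto
qed

text \<open>The working class: values are real and bounded below, so that circle means exist. An
  upper bound follows from compactness of the manifold.\<close>

definition bdd_omega_psh :: "('a \<Rightarrow> real) \<Rightarrow> bool" where
  "bdd_omega_psh v \<longleftrightarrow> usc UNIV v \<and> (\<exists>m. \<forall>x. m \<le> v x) \<and> (\<forall>x. asubX v x)"

lemma bdd_omega_psh_in_chart:
  assumes "bdd_omega_psh v" "(U, \<phi>) \<in> \<A>"
  shows "usc (\<phi> ` U) (\<lambda>z. v (inv_into U \<phi> z))"
    "\<And>z w. z \<in> \<phi> ` U \<Longrightarrow> asub (\<lambda>z. v (inv_into U \<phi> z)) z w (herm_quad (U, \<phi>) z w)"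
proof -
  show "usc (\<phi> ` U) (\<lambda>z. v (inv_into U \<phi> z))" using chart_usc[OF chart_top[OF assms(2)]] assms(1) by (simp add: bdd_omega_psh_def)
  fix z w assume "z \<in> \<phi> ` U"
  then obtain x where "x \<in> U" "z = \<phi> x" by blast
  then show "asub (\<lambda>z. v (inv_into U \<phi> z)) z w (herm_quad (U, \<phi>) z w)"
    using asubX_chart[OF _ assms(2)] assms(1) by (simp add: bdd_omega_psh_def)
qed

lemma bdd_omega_psh_bounded_above: "bdd_omega_psh v \<Longrightarrow> \<exists>M. \<forall>x. v x \<le> M"
  using usc_attains_max[of UNIV v] cpt by (auto simp: bdd_omega_psh_def)

text \<open>In a small ball, adding C|z|^2 with 4C = C0 compensates \<omega> and leaves a
  plurisubharmonic function; minus this quadratic, plus the constant m, is the smooth part required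
  by \<open>quasi_psh\<close>. Positivity of the current is \<open>current_positive\<close>.\<close>

lemma bdd_omega_psh_imp_omega_psh:
  assumes v: "bdd_omega_psh v"
  shows "(\<lambda>x. ereal (v x)) \<in> omega_psh \<A> \<omega>"
proof -
  obtain m M where mM: "\<And>x. m \<le> v x" "\<And>x. v x \<le> M" using v bdd_omega_psh_bounded_above[OF v] by (auto simp: bdd_omega_psh_def)
  have "quasi_psh \<A> (\<lambda>x. ereal (v x))"
    unfolding quasi_psh_def
  proof (intro conjI allI)
    show "\<exists>x. ereal (v x) \<noteq> - \<infinity>" by simp
    fix x
    obtain U \<phi> where U: "(U, \<phi>) \<in> \<A>" "x \<in> U" using chart_at by blast
    then have z0: "\<phi> x \<in> \<phi> ` U" by blast
    obtain \<rho> c0 C0 where \<rho>: "0 < \<rho>" "0 < C0" "\<And>z. dist z (\<phi> x) < \<rho> \<Longrightarrow> z \<in> \<phi> ` U"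
      "\<And>z w. dist z (\<phi> x) < \<rho> \<Longrightarrow> herm_quad (U, \<phi>) z w \<le> C0 * (norm w)\<^sup>2"
      using herm_quad_near[OF U(1) z0, of 2] by auto
    define W where "W = ball (\<phi> x) \<rho>"
    define C where "C = C0 / 4"
    define f where "f z = m + (- C) * (norm (z - \<phi> x))\<^sup>2" for z
    define u where "u z = 1 * v (inv_into U \<phi> z) + (- m) + C * (norm (z - \<phi> x))\<^sup>2" for z
    have WU: "W \<subseteq> \<phi> ` U" using \<rho>(3) by (auto simp: W_def dist_commute)
    have usW: "usc W (\<lambda>z. v (inv_into U \<phi> z))" by (rule usc_subset[OF bdd_omega_psh_in_chart(1)[OF v U(1)] WU])
    have asW: "asub (\<lambda>z. v (inv_into U \<phi> z)) z w (C0 * (norm w)\<^sup>2)" if "z \<in> W" for z w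
      using that WU \<rho>(4) by (intro asub_mono[OF bdd_omega_psh_in_chart(2)[OF v U(1)]]) (auto simp: W_def dist_commute)
    have "psh_on W (\<lambda>z. ereal (u z))"
    proof (rule psh_on_ereal)
      show "open W" by (simp add: W_def)
      have "usc W (\<lambda>z. v (inv_into U \<phi> z) + (- m + C * (norm (z - \<phi> x))\<^sup>2))"
        by (intro usc_add_continuous usW continuous_intros) (simp add: W_def)
      then show "usc W u" by (rule usc_cong) (simp add: u_def)
      show "0 \<le> u z" for z using mM(1)[of "inv_into U \<phi> z"] \<rho>(2) by (simp add: u_def C_def add_nonneg_nonneg)
      show "asub u z w 0" if "z \<in> W" for z w
      proof -
        have "asub u z w (1 * (C0 * (norm w)\<^sup>2) - 4 * C * (norm w)\<^sup>2)" unfolding u_def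
          by (rule asub_affine_quadratic[OF _ usW mM(1) that asW]) (use \<rho>(2) in \<open>auto simp: W_def\<close>)
        then show ?thesis by (simp add: C_def)
      qed
    qed
    moreover have "smooth_on W f" unfolding f_def smooth_on_def
      by (intro allI Ck_on_add Ck_on_mult Ck_on_const Ck_on_norm_power2)
    moreover have "ereal (v (inv_into U \<phi> z)) = ereal (f z) + ereal (u z)" for z by (simp add: f_def u_def)
    moreover have "open W" "\<phi> x \<in> W" using \<rho>(1) by (auto simp: W_def)
    ultimately show "\<exists>(U, \<phi>)\<in>\<A>. x \<in> U \<and> (\<exists>W f u. open W \<and> \<phi> x \<in> W \<and> W \<subseteq> \<phi> ` U \<and> smooth_on W f \<and> psh_on W u \<and>
                 (\<forall>z\<in>W. ereal (v (inv_into U \<phi> z)) = ereal (f z) + u z))"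
      using U WU by blast
  qed
  moreover have "0 \<le> (LINT z:\<phi> ` U|lborel. \<omega> (U, \<phi>) z w (\<i> *s w) * \<eta> z
                 + real_of_ereal (ereal (v (inv_into U \<phi> z))) * ddc \<eta> z w (\<i> *s w))"
    if U: "(U, \<phi>) \<in> \<A>" and \<eta>: "nonneg_test_function (\<phi> ` U) \<eta>" for U \<phi> w \<eta>
    using current_positive[OF topological_chartD(2)[OF chart_top[OF U]] bdd_omega_psh_in_chart(1)[OF v U] mM bdd_omega_psh_in_chart(2)[OF v U]
        herm_quad_continuous[OF U] herm_quad_nonneg[OF U] herm_quad_uminus[OF U] \<eta>, of w]
    by (simp add: herm_quad_def)
  ultimately show ?thesis unfolding omega_psh_def by blast
qed

lemma omega_psh_imp_bdd:
  assumes v: "v \<in> omega_psh \<A> \<omega>"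
  shows "bdd_omega_psh (pos_part v)" "\<And>x. v x < \<infinity>"
proof -
  have loc: "v x < \<infinity> \<and> asubX (pos_part v) x \<and> (\<exists>A. open A \<and> x \<in> A \<and> usc A (pos_part v))" for x
  proof -
    have "quasi_psh \<A> v" using v by (simp add: omega_psh_def)
    then obtain U \<phi> W f u where U: "(U, \<phi>) \<in> \<A>" "x \<in> U" and W: "open W" "\<phi> x \<in> W" "W \<subseteq> \<phi> ` U" "smooth_on W f" "psh_on W u"
      "\<And>z. z \<in> W \<Longrightarrow> v (inv_into U \<phi> z) = ereal (f z) + u z" unfolding quasi_psh_def by blast
    note t = topological_chartD[OF chart_top[OF U(1)]]
    have cur: "0 \<le> (LINT z:\<phi> ` U|lborel. herm_quad (U, \<phi>) z w * \<eta> z + real_of_ereal (v (inv_into U \<phi> z)) * ddc \<eta> z w (\<i> *s w))"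
      if "nonneg_test_function (\<phi> ` U) \<eta>" for w \<eta>
      using v U(1) that unfolding omega_psh_def herm_quad_def by blast
    note a = asub_pos_part_of_current[OF W(3,1,2,6) smooth_on_imp_continuous_on[OF W(4)] W(5) herm_quad_continuous[OF U(1)]
        herm_quad_nonneg[OF U(1)] herm_quad_uminus[OF U(1)] cur]
    have pp: "pos_part (\<lambda>z. v (inv_into U \<phi> z)) = (\<lambda>z. pos_part v (inv_into U \<phi> z))" by (simp add: fun_eq_iff pos_part_def)
    have "asubX (pos_part v) x" by (rule asubX_I[OF U]) (use a(2) pp in simp)
    moreover have "v x < \<infinity>"
    proof -
      have "u (\<phi> x) < \<infinity>" using W by (simp add: psh_on_def)
      then show ?thesis using W(6)[OF W(2)] t(5)[OF U(2)] by (cases "u (\<phi> x)") auto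
    qed
    moreover have "\<exists>A. open A \<and> x \<in> A \<and> usc A (pos_part v)"
    proof (intro exI conjI)
      show "open (inv_into U \<phi> ` W)" by (rule chart_inv_image_open[OF chart_top[OF U(1)] W(1,3)])
      show "x \<in> inv_into U \<phi> ` W" using t(5)[OF U(2)] W(2) by force
      have "inv_into U \<phi> ` W \<subseteq> U" using W(3) t(7) by blast
      then have "usc (inv_into U \<phi> ` W) (\<lambda>y. pos_part v (inv_into U \<phi> (\<phi> y)))"
        by (intro usc_compose[OF a(1)[unfolded pp]] continuous_on_subset[OF t(3)]) (use W(3) t in auto)
      then show "usc (inv_into U \<phi> ` W) (pos_part v)" by (rule usc_cong) (use W(3) t in auto)
    qed
    ultimately show ?thesis by blast
  qed
  show "\<And>x. v x < \<infinity>" using loc by blast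
  have "usc UNIV (pos_part v)"
  proof (rule usc_openI)
    fix x c assume "pos_part v x < c"
    moreover obtain A where "open A" "x \<in> A" "usc A (pos_part v)" using loc by blast
    ultimately show "\<forall>\<^sub>F y in nhds x. pos_part v y < c" using usc_openD[of A "pos_part v" x c] by (simp add: eventually_conj_iff)
  qed simp
  then show "bdd_omega_psh (pos_part v)" unfolding bdd_omega_psh_def using loc pos_part_nonneg by (intro conjI exI[of _ 0] allI) simp_all
qed

text \<open>The positive part of a competitor belongs to the working class, is at least as large,
  and vanishes on E.\<close>

lemma V_extremal_alt:
  "V_extremal \<A> \<omega> E x = (SUP v\<in>{v. bdd_omega_psh v \<and> (\<forall>y. 0 \<le> v y) \<and> (\<forall>y\<in>E. v y \<le> 0)}. ereal (v x))"
proof (rule antisym)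
  show "V_extremal \<A> \<omega> E x \<le> (SUP v\<in>{v. bdd_omega_psh v \<and> (\<forall>y. 0 \<le> v y) \<and> (\<forall>y\<in>E. v y \<le> 0)}. ereal (v x))"
    unfolding V_extremal_def
  proof (rule SUP_least)
    fix v assume v: "v \<in> {v\<in>omega_psh \<A> \<omega>. \<forall>y\<in>E. v y \<le> 0}"
    have e: "ereal (pos_part v y) = max (v y) 0" for y using v by (intro ereal_pos_part omega_psh_imp_bdd(2)) auto
    have "pos_part v y \<le> 0" if "y \<in> E" for y using v that by (simp add: pos_part_def max_def)
    then have "pos_part v \<in> {v. bdd_omega_psh v \<and> (\<forall>y. 0 \<le> v y) \<and> (\<forall>y\<in>E. v y \<le> 0)}"
      using v omega_psh_imp_bdd(1) pos_part_nonneg by auto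
    moreover have "v x \<le> ereal (pos_part v x)" by (simp add: e)
    ultimately show "v x \<le> (SUP v\<in>{v. bdd_omega_psh v \<and> (\<forall>y. 0 \<le> v y) \<and> (\<forall>y\<in>E. v y \<le> 0)}. ereal (v x))"
      by (intro SUP_upper2[of "pos_part v"]) auto
  qed
  show "(SUP v\<in>{v. bdd_omega_psh v \<and> (\<forall>y. 0 \<le> v y) \<and> (\<forall>y\<in>E. v y \<le> 0)}. ereal (v x)) \<le> V_extremal \<A> \<omega> E x"
  proof (rule SUP_least)
    fix v assume "v \<in> {v. bdd_omega_psh v \<and> (\<forall>y. 0 \<le> v y) \<and> (\<forall>y\<in>E. v y \<le> 0)}"
    then show "ereal (v x) \<le> V_extremal \<A> \<omega> E x"
      unfolding V_extremal_def by (intro SUP_upper2[of "\<lambda>x. ereal (v x)"]) (auto intro: bdd_omega_psh_imp_omega_psh)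
  qed
qed

lemma bdd_omega_psh_le_V_extremal: "bdd_omega_psh v \<Longrightarrow> (\<And>y. y \<in> E \<Longrightarrow> v y \<le> 0) \<Longrightarrow> ereal (v x) \<le> V_extremal \<A> \<omega> E x"
  unfolding V_extremal_def by (intro SUP_upper2[of "\<lambda>x. ereal (v x)"]) (auto intro: bdd_omega_psh_imp_omega_psh)

lemma bdd_omega_psh_const: "bdd_omega_psh (\<lambda>_. c)"
  unfolding bdd_omega_psh_def by (auto intro: asubX_const continuous_imp_usc)

lemma V_extremal_nonneg: "0 \<le> V_extremal \<A> \<omega> E x"
  using bdd_omega_psh_le_V_extremal[OF bdd_omega_psh_const[of 0], of E x] by (simp add: zero_ereal_def)

lemma V_extremal_zero: "x \<in> E \<Longrightarrow> V_extremal \<A> \<omega> E x = 0"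
  by (rule antisym[OF _ V_extremal_nonneg]) (auto simp: V_extremal_def intro!: SUP_least)

section \<open>Comparison with Euclidean metrics in holomorphic coordinates\<close>

text \<open>\<tau> need not belong to the atlas, and \<omega> is given only in charts of the atlas.
  Both comparisons with the Euclidean form are therefore pulled back from an atlas chart at
  a.\<close>

lemma coordinate_comparison:
  assumes top: "topological_chart (\<Omega>, \<tau>)" and comp: "\<And>c. c \<in> \<A> \<Longrightarrow> holomorphically_compatible c (\<Omega>, \<tau>)" and a: "a \<in> \<Omega>"
  shows "\<exists>r0>0. \<exists>c0>0. \<exists>C0>0. ball (\<tau> a) r0 \<subseteq> \<tau> ` \<Omega> \<and>
    (\<forall>v x w. x \<in> \<Omega> \<and> dist (\<tau> x) (\<tau> a) < r0 \<and> asubX v x \<longrightarrow> asub (\<lambda>z. v (inv_into \<Omega> \<tau> z)) (\<tau> x) w (C0 * (norm w)\<^sup>2)) \<and>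
    (\<forall>v x. x \<in> \<Omega> \<and> dist (\<tau> x) (\<tau> a) < r0 \<and> (\<forall>w. asub (\<lambda>z. v (inv_into \<Omega> \<tau> z)) (\<tau> x) w (c0 * (norm w)\<^sup>2)) \<longrightarrow> asubX v x)"
proof -
  obtain U \<phi> where U: "(U, \<phi>) \<in> \<A>" "a \<in> U" using chart_at by blast
  note topU = chart_top[OF U(1)]
  note t = topological_chartD[OF topU] and t' = topological_chartD[OF top]
  have cc: "holomorphically_compatible (U, \<phi>) (\<Omega>, \<tau>)" by (rule comp[OF U(1)])
  have F: "holomorphic_map_on (\<phi> ` (U \<inter> \<Omega>)) (\<tau> \<circ> inv_into U \<phi>)" and G: "holomorphic_map_on (\<tau> ` (U \<inter> \<Omega>)) (\<phi> \<circ> inv_into \<Omega> \<tau>)"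
    using cc by (auto simp: holomorphically_compatible_def)
  have oA: "open (\<phi> ` (U \<inter> \<Omega>))" by (rule chart_image_open[OF topU t'(1)])
  have oB: "open (\<tau> ` (U \<inter> \<Omega>))" using chart_image_open[OF top t(1)] by (simp add: Int_commute)
  have aA: "\<phi> a \<in> \<phi> ` (U \<inter> \<Omega>)" and aB: "\<tau> a \<in> \<tau> ` (U \<inter> \<Omega>)" and aU: "\<phi> a \<in> \<phi> ` U" using a U(2) by auto
  obtain \<rho>1 L1 where 1: "\<rho>1 > 0" "L1 > 0" "\<forall>z. dist z (\<phi> a) < \<rho>1 \<longrightarrow> z \<in> \<phi> ` (U \<inter> \<Omega>) \<and>
      (\<forall>f' w. ((\<tau> \<circ> inv_into U \<phi>) has_derivative f') (at z) \<longrightarrow> norm (f' w) \<le> L1 * norm w)"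
    using holomorphic_map_derivative_bound[OF F oA aA] by blast
  obtain \<rho>2 L2 where 2: "\<rho>2 > 0" "L2 > 0" "\<forall>z. dist z (\<tau> a) < \<rho>2 \<longrightarrow> z \<in> \<tau> ` (U \<inter> \<Omega>) \<and>
      (\<forall>f' w. ((\<phi> \<circ> inv_into \<Omega> \<tau>) has_derivative f') (at z) \<longrightarrow> norm (f' w) \<le> L2 * norm w)"
    using holomorphic_map_derivative_bound[OF G oB aB] by blast
  obtain \<rho>3 c C where 3: "\<rho>3 > 0" "c > 0" "C > 0" "\<forall>z. dist z (\<phi> a) < \<rho>3 \<longrightarrow> z \<in> \<phi> ` U \<and>
      (\<forall>w. c * (norm w)\<^sup>2 \<le> herm_quad (U, \<phi>) z w \<and> herm_quad (U, \<phi>) z w \<le> C * (norm w)\<^sup>2)"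
    using herm_quad_near[OF U(1) aU, of 2] by auto
  define B where "B = ball (\<phi> a) (min \<rho>1 \<rho>3)"
  have B: "open B" "B \<subseteq> \<phi> ` U" "\<phi> a \<in> B" using 1(1) 3(1,4) by (auto simp: B_def dist_commute)
  define N where "N = inv_into U \<phi> ` B"
  have oN: "open N" unfolding N_def by (rule chart_inv_image_open[OF topU B(1,2)])
  have aN: "a \<in> N" unfolding N_def by (rule image_eqI[of _ _ "\<phi> a"]) (simp_all add: t(5)[OF U(2)] B(3))
  have N\<phi>: "x \<in> U \<and> \<phi> x \<in> B" if "x \<in> N" for x using that B(2) t(6,7) by (auto simp: N_def)
  have "open (\<tau> ` (\<Omega> \<inter> N))" by (rule chart_image_open[OF top oN])
  moreover have "\<tau> a \<in> \<tau> ` (\<Omega> \<inter> N)" using a aN by blast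
  ultimately obtain r1 where r1: "r1 > 0" "ball (\<tau> a) r1 \<subseteq> \<tau> ` (\<Omega> \<inter> N)" using open_contains_ball by blast
  define r0 where "r0 = min r1 \<rho>2"
  have r0: "r0 > 0" using r1 2 by (simp add: r0_def)
  have inN: "x \<in> N" if "x \<in> \<Omega>" "dist (\<tau> x) (\<tau> a) < r0" for x
  proof -
    have "\<tau> x \<in> ball (\<tau> a) r1" using that(2) by (simp add: r0_def dist_commute)
    then have "\<tau> x \<in> \<tau> ` (\<Omega> \<inter> N)" using r1(2) by blast
    then show ?thesis using t'(8) that(1) by (auto dest: inj_onD)
  qed
  show ?thesis
  \<comment> \<open>The derivatives of the two coordinate changes are bounded by L1 and L2; squared,
    they turn the bounds c and C in the atlas chart into c/L1^2 and C L2^2 in \<tau>.\<close>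
  proof (rule exI[of _ r0], rule conjI[OF r0], rule exI[of _ "c / L1\<^sup>2"], rule conjI, use 3 1 in simp,
      rule exI[of _ "C * L2\<^sup>2"], rule conjI, use 3 2 in simp, intro conjI allI impI)
    show "ball (\<tau> a) r0 \<subseteq> \<tau> ` \<Omega>" using r1(2) by (auto simp: r0_def)
  next
    fix v x w assume x: "x \<in> \<Omega> \<and> dist (\<tau> x) (\<tau> a) < r0 \<and> asubX v x"
    then have xU: "x \<in> U" "\<phi> x \<in> B" using inN N\<phi> by blast+
    obtain f' g' where fg: "((\<phi> \<circ> inv_into \<Omega> \<tau>) has_derivative g') (at (\<tau> x))" "\<forall>w. f' (g' w) = w"
      and tr: "\<forall>v w q. asub (\<lambda>z. v (inv_into U \<phi> z)) (\<phi> x) w q \<longrightarrow> asub (\<lambda>z. v (inv_into \<Omega> \<tau> z)) (\<tau> x) (f' w) q"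
      using chart_change[OF topU top cc xU(1), of] x by blast
    have ng: "norm (g' w) \<le> L2 * norm w" 
    proof -
      have "dist (\<tau> x) (\<tau> a) < \<rho>2" using x by (simp add: r0_def)
      then show ?thesis using 2(3) fg(1) by blast
    qed
    have "herm_quad (U, \<phi>) (\<phi> x) (g' w) \<le> C * (norm (g' w))\<^sup>2" using 3(4) xU(2) by (simp add: B_def dist_commute)
    also have "\<dots> \<le> C * (L2 * norm w)\<^sup>2" using ng 3(3) by (intro mult_left_mono power_mono) auto
    finally have "herm_quad (U, \<phi>) (\<phi> x) (g' w) \<le> C * L2\<^sup>2 * (norm w)\<^sup>2" by (simp add: power_mult_distrib mult.assoc)
    moreover have "asub (\<lambda>z. v (inv_into \<Omega> \<tau> z)) (\<tau> x) (f' (g' w)) (herm_quad (U, \<phi>) (\<phi> x) (g' w))"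
      using tr asubX_chart[OF _ U(1) xU(1), of v "g' w"] x by blast
    ultimately show "asub (\<lambda>z. v (inv_into \<Omega> \<tau> z)) (\<tau> x) w (C * L2\<^sup>2 * (norm w)\<^sup>2)"
      using asub_mono fg(2) by metis
  next
    fix v x assume x: "x \<in> \<Omega> \<and> dist (\<tau> x) (\<tau> a) < r0 \<and> (\<forall>w. asub (\<lambda>z. v (inv_into \<Omega> \<tau> z)) (\<tau> x) w (c / L1\<^sup>2 * (norm w)\<^sup>2))"
    then have xU: "x \<in> U" "\<phi> x \<in> B" using inN N\<phi> by blast+
    obtain f' g' where fg: "((\<tau> \<circ> inv_into U \<phi>) has_derivative f') (at (\<phi> x))" "\<forall>w. g' (f' w) = w"
      and tr: "\<forall>v w q. asub (\<lambda>z. v (inv_into \<Omega> \<tau> z)) (\<tau> x) w q \<longrightarrow> asub (\<lambda>z. v (inv_into U \<phi> z)) (\<phi> x) (g' w) q"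
      using chart_change[OF topU top cc xU(1), of] x by blast
    show "asubX v x"
    proof (rule asubX_I[OF U(1) xU(1)])
      fix w
      have nf: "norm (f' w) \<le> L1 * norm w" 
      proof -
        have "dist (\<phi> x) (\<phi> a) < \<rho>1" using xU(2) by (simp add: B_def dist_commute)
        then show ?thesis using 1(3) fg(1) by blast
      qed
      have "c / L1\<^sup>2 * (norm (f' w))\<^sup>2 \<le> c / L1\<^sup>2 * (L1 * norm w)\<^sup>2" using nf 3(2) by (intro mult_left_mono power_mono) auto
      also have "\<dots> = c * (norm w)\<^sup>2" using 1(2) by (simp add: power_mult_distrib)
      also have "\<dots> \<le> herm_quad (U, \<phi>) (\<phi> x) w" using 3(4) xU(2) by (simp add: B_def dist_commute)
      finally have "c / L1\<^sup>2 * (norm (f' w))\<^sup>2 \<le> herm_quad (U, \<phi>) (\<phi> x) w" .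
      moreover have "asub (\<lambda>z. v (inv_into U \<phi> z)) (\<phi> x) (g' (f' w)) (c / L1\<^sup>2 * (norm (f' w))\<^sup>2)" using tr x by blast
      ultimately show "asub (\<lambda>z. v (inv_into U \<phi> z)) (\<phi> x) w (herm_quad (U, \<phi>) (\<phi> x) w)" using asub_mono fg(2) by metis
    qed
  qed
qed

section \<open>A Harnack type estimate\<close>

lemma chart_ball_in_component:
  assumes top: "topological_chart (U, \<phi>)" and x: "x \<in> U" and B: "ball (\<phi> x) \<rho> \<subseteq> \<phi> ` U" "0 < \<rho>"
  shows "inv_into U \<phi> ` ball (\<phi> x) \<rho> \<subseteq> connected_component_set UNIV x"
proof (rule connected_component_maximal)
  note t = topological_chartD[OF top]
  show "x \<in> inv_into U \<phi> ` ball (\<phi> x) \<rho>" by (rule image_eqI[of _ _ "\<phi> x"]) (simp_all add: t(5)[OF x] B(2))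
  show "connected (inv_into U \<phi> ` ball (\<phi> x) \<rho>)"
    by (rule connected_continuous_image[OF continuous_on_subset[OF t(4) B(1)]]) simp
qed simp

lemma component_open: "open (connected_component_set UNIV (a::'a))"
  unfolding open_subopen[of "connected_component_set UNIV a"]
proof
  fix p assume p: "p \<in> connected_component_set UNIV a"
  obtain U \<phi> where U: "(U, \<phi>) \<in> \<A>" "p \<in> U" using chart_at by blast
  note top = chart_top[OF U(1)]
  obtain \<rho> where \<rho>: "\<rho> > 0" "ball (\<phi> p) \<rho> \<subseteq> \<phi> ` U"
    using topological_chartD(2)[OF top] U(2) open_contains_ball by blast
  have "open (inv_into U \<phi> ` ball (\<phi> p) \<rho>)" by (rule chart_inv_image_open[OF top _ \<rho>(2)]) simp
  moreover have "p \<in> inv_into U \<phi> ` ball (\<phi> p) \<rho>" by (rule image_eqI[of _ _ "\<phi> p"]) (simp_all add: topological_chartD(5)[OF top U(2)] \<rho>(1))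
  moreover have "inv_into U \<phi> ` ball (\<phi> p) \<rho> \<subseteq> connected_component_set UNIV a"
    using chart_ball_in_component[OF top U(2) \<rho>(2,1)] connected_component_eq[OF p] by simp
  ultimately show "\<exists>T. open T \<and> p \<in> T \<and> T \<subseteq> connected_component_set UNIV a" by blast
qed

text \<open>M bounds v on X and b bounds it on S. On N a fraction \<kappa> of the gap M - b is
  gained, up to an additive C caused by the metric. Both constants are independent of v, M and b,
  and estimates of this form can be chained.\<close>

definition harnack_on :: "'a set \<Rightarrow> 'a set \<Rightarrow> 'a set \<Rightarrow> bool" where
  "harnack_on X S N \<longleftrightarrow> (\<exists>\<kappa> C. 0 < \<kappa> \<and> \<kappa> \<le> 1 \<and> 0 \<le> C \<and> (\<forall>v M b. bdd_omega_psh v \<longrightarrow> (\<forall>x. 0 \<le> v x) \<longrightarrow> (\<forall>x\<in>X. v x \<le> M) \<longrightarrow>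
     (\<forall>x\<in>S. v x \<le> b) \<longrightarrow> b \<le> M \<longrightarrow> (\<forall>x\<in>N. v x \<le> M - \<kappa> * (M - b) + C)))"

text \<open>Three circles about a point of S \<inter> N: in the chart a small sphere lies in S, the
  bound M holds on the large one, and N stays well inside. The quadratic term that compensates
  \<omega> is the source of C.\<close>

lemma harnack_local:
  assumes X: "X = connected_component_set UNIV p"
  shows "\<exists>N. open N \<and> p \<in> N \<and> N \<subseteq> X \<and> (\<forall>S. open S \<longrightarrow> S \<inter> N \<noteq> {} \<longrightarrow> harnack_on X S N)"
proof -
  obtain U \<phi> where U: "(U, \<phi>) \<in> \<A>" "p \<in> U" using chart_at by blast
  note top = chart_top[OF U(1)]
  note t = topological_chartD[OF top]
  have pU: "\<phi> p \<in> \<phi> ` U" using U by blast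
  obtain \<rho>' c0 C0 where \<rho>': "\<rho>' > 0" "C0 > 0" "\<forall>z. dist z (\<phi> p) < \<rho>' \<longrightarrow> z \<in> \<phi> ` U \<and> (\<forall>w. herm_quad (U, \<phi>) z w \<le> C0 * (norm w)\<^sup>2)"
    using herm_quad_near[OF U(1) pU, of 2] by auto
  \<comment> \<open>The centre c lies within \<rho> of \<phi> p, so N lies within 2\<rho> of c and
    the ball of radius 3\<rho> about c within 4\<rho> of \<phi> p.\<close>
  define \<rho> where "\<rho> = \<rho>' / 6"
  have \<rho>: "\<rho> > 0" using \<rho>' by (simp add: \<rho>_def)
  define W where "W = ball (\<phi> p) (5 * \<rho>)"
  have bU: "ball (\<phi> p) \<rho>' \<subseteq> \<phi> ` U" using \<rho>'(3) by (auto simp: dist_commute)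
  have WB: "W \<subseteq> ball (\<phi> p) \<rho>'" using \<rho> by (auto simp: W_def \<rho>_def)
  have BX: "inv_into U \<phi> z \<in> X" if "z \<in> W" for z
    using chart_ball_in_component[OF top U(2) bU \<rho>'(1)] WB that unfolding X by blast
  have N1: "ball (\<phi> p) \<rho> \<subseteq> W" using \<rho> by (auto simp: W_def)
  define N where "N = inv_into U \<phi> ` ball (\<phi> p) \<rho>"
  have "open N" unfolding N_def by (rule chart_inv_image_open[OF top]) (use N1 WB bU in auto)
  moreover have "p \<in> N" unfolding N_def by (rule image_eqI[of _ _ "\<phi> p"]) (simp_all add: t(5)[OF U(2)] \<rho>)
  moreover have "N \<subseteq> X" unfolding N_def using N1 BX by blast
  moreover have "harnack_on X S N" if S: "open S" "S \<inter> N \<noteq> {}" for S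
  proof -
    obtain q where q: "q \<in> S" "q \<in> N" using S by blast
    define c where "c = \<phi> q"
    have c: "c \<in> ball (\<phi> p) \<rho>" "q \<in> U" 
    proof -
      obtain z where z: "z \<in> ball (\<phi> p) \<rho>" "q = inv_into U \<phi> z" using q(2) by (auto simp: N_def)
      then have "z \<in> \<phi> ` U" using N1 WB bU by blast
      then show "c \<in> ball (\<phi> p) \<rho>" "q \<in> U" using z t(6,7) by (simp_all add: c_def)
    qed
    have "open (\<phi> ` (U \<inter> S))" by (rule chart_image_open[OF top S(1)])
    moreover have "c \<in> \<phi> ` (U \<inter> S)" using c(2) q(1) by (auto simp: c_def)
    ultimately obtain s0 where s0: "s0 > 0" "ball c s0 \<subseteq> \<phi> ` (U \<inter> S)" using open_contains_ball by blast
    define s where "s = min (s0 / 2) \<rho>"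
    have s: "0 < s" "s < s0" "s \<le> \<rho>" using s0 \<rho> by (auto simp: s_def)
    \<comment> \<open>The weight of the outer bound at distance 2\<rho>; it is below 1, whence
      \<kappa> = 1 - \<theta>.\<close>
    define \<theta> where "\<theta> = ln (2 * \<rho> / s) / ln (3 * \<rho> / s)"
    have l23: "0 < ln (2 * \<rho> / s)" "ln (2 * \<rho> / s) < ln (3 * \<rho> / s)" using s \<rho> by (auto simp: field_simps)
    have \<theta>: "0 < \<theta>" "\<theta> < 1" using l23 by (auto simp: \<theta>_def)
    define C1 where "C1 = C0 / 4"
    define C where "C = C1 * (3 * \<rho>)\<^sup>2"
    have C0: "0 \<le> C" "0 \<le> C1" using \<rho>' by (auto simp: C_def C1_def)
    have cW: "cball c (3 * \<rho>) \<subseteq> W"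
    proof
      fix z assume "z \<in> cball c (3 * \<rho>)"
      then show "z \<in> W" using c(1) dist_triangle[of "\<phi> p" z c] \<rho> by (auto simp: W_def)
    qed
    have "\<forall>x\<in>N. v x \<le> M - (1 - \<theta>) * (M - b) + C"
      if v: "bdd_omega_psh v" "\<forall>x. 0 \<le> v x" "\<forall>x\<in>X. v x \<le> M" "\<forall>x\<in>S. v x \<le> b" "b \<le> M" for v M b
    proof
      fix x assume "x \<in> N"
      then obtain z where z: "z \<in> ball (\<phi> p) \<rho>" "x = inv_into U \<phi> z" by (auto simp: N_def)
      have zc: "norm (z - c) < 2 * \<rho>"
        using z(1) c(1) dist_triangle[of z c "\<phi> p"] by (simp add: dist_norm[symmetric] dist_commute)
      have vS: "v (inv_into U \<phi> y) \<le> b" if "norm (y - c) < s0" for y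
      proof -
        have "y \<in> \<phi> ` (U \<inter> S)" using s0(2) that by (auto simp: dist_norm norm_minus_commute)
        then show ?thesis using v(4) t(5) by auto
      qed
      have Mb: "(1 - \<theta>) * (M - b) \<le> M - b" using \<theta> v(5) by (intro mult_left_le_one_le) auto
      show "v x \<le> M - (1 - \<theta>) * (M - b) + C"
      proof (cases "norm (z - c) < s")
        case True
        then have "v x \<le> b" using vS[of z] s z by auto
        then show ?thesis using Mb C0 by linarith
      next
        case False
        define u where "u y = 1 * v (inv_into U \<phi> y) + 0 + C1 * (norm (y - c))\<^sup>2" for y
        have WU: "W \<subseteq> \<phi> ` U" using WB bU by auto
        have usW: "usc W (\<lambda>y. v (inv_into U \<phi> y))" by (rule usc_subset[OF bdd_omega_psh_in_chart(1)[OF v(1) U(1)] WU])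
        have asW: "asub (\<lambda>y. v (inv_into U \<phi> y)) y w (C0 * (norm w)\<^sup>2)" if "y \<in> W" for y w
          using that WU WB \<rho>'(3) by (intro asub_mono[OF bdd_omega_psh_in_chart(2)[OF v(1) U(1)]]) (auto simp: dist_commute subset_iff)
        have v0: "0 \<le> v (inv_into U \<phi> y)" for y using v(2) by simp
        have "usc W (\<lambda>y. v (inv_into U \<phi> y) + C1 * (norm (y - c))\<^sup>2)"
          by (intro usc_add_continuous usW continuous_intros) (simp add: W_def)
        then have usu: "usc W u" by (rule usc_cong) (simp add: u_def)
        have asu: "asub u y w 0" if "y \<in> W" for y w
        proof -
          have "asub u y w (1 * (C0 * (norm w)\<^sup>2) - 4 * C1 * (norm w)\<^sup>2)" unfolding u_def
            by (rule asub_affine_quadratic[OF _ usW v0 that asW]) (use \<rho>' in \<open>auto simp: W_def\<close>)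
          then show ?thesis by (simp add: C1_def)
        qed
        have quad: "C1 * (norm (y - c))\<^sup>2 \<le> C" if "norm (y - c) \<le> 3 * \<rho>" for y
          unfolding C_def using that C0 by (intro mult_left_mono power_mono) auto
        have "u z \<le> (b + C) + ((M + C) - (b + C)) * (ln (norm (z - c) / s) / ln (3 * \<rho> / s))"
        proof (rule three_circles[OF _ usu _ asu s(1) _ cW])
          show "0 \<le> u y" for y using v0[of y] C0 by (simp add: u_def add_nonneg_nonneg)
          show "u y \<le> b + C" if "norm (y - c) = s" for y
            using vS[of y] quad[of y] that s \<rho> by (simp add: u_def)
          show "u y \<le> M + C" if "norm (y - c) = 3 * \<rho>" for y
          proof -
            have "y \<in> W" using cW that by (auto simp: dist_norm norm_minus_commute subset_iff)
            then show ?thesis using v(3) BX[of y] quad[of y] that by (simp add: u_def add_mono)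
          qed
        qed (use s \<rho> False zc in \<open>auto simp: W_def\<close>)
        also have "\<dots> \<le> (b + C) + (M - b) * \<theta>"
        proof -
          have "0 < norm (z - c)" using False s by linarith
          then have "ln (norm (z - c) / s) \<le> ln (2 * \<rho> / s)"
            using zc s by (intro ln_mono divide_pos_pos divide_right_mono) auto
          then have "ln (norm (z - c) / s) / ln (3 * \<rho> / s) \<le> \<theta>" unfolding \<theta>_def using l23 by (intro divide_right_mono) auto
          then have "(M - b) * (ln (norm (z - c) / s) / ln (3 * \<rho> / s)) \<le> (M - b) * \<theta>" using v(5) by (intro mult_left_mono) auto
          then show ?thesis by simp
        qed
        finally have "u z \<le> M - (1 - \<theta>) * (M - b) + C" by (simp add: algebra_simps)
        moreover have "v x \<le> u z" using C0 by (simp add: u_def z(2))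
        ultimately show ?thesis by simp
      qed
    qed
    then show ?thesis unfolding harnack_on_def using \<theta> C0 by (intro exI[of _ "1 - \<theta>"] exI[of _ C]) auto
  qed
  ultimately show ?thesis by blast
qed

lemma harnack_trans:
  assumes "harnack_on X S T" "harnack_on X T N" "T \<subseteq> X" "N \<subseteq> X"
  shows "harnack_on X S N"
proof -
  obtain k1 C1 where 1: "0 < k1" "k1 \<le> 1" "0 \<le> C1" "\<And>v M b. bdd_omega_psh v \<Longrightarrow> (\<forall>x. 0 \<le> v x) \<Longrightarrow> (\<forall>x\<in>X. v x \<le> M) \<Longrightarrow>
     (\<forall>x\<in>S. v x \<le> b) \<Longrightarrow> b \<le> M \<Longrightarrow> (\<forall>x\<in>T. v x \<le> M - k1 * (M - b) + C1)"
    using assms(1) unfolding harnack_on_def by auto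
  obtain k2 C2 where 2: "0 < k2" "k2 \<le> 1" "0 \<le> C2" "\<And>v M b. bdd_omega_psh v \<Longrightarrow> (\<forall>x. 0 \<le> v x) \<Longrightarrow> (\<forall>x\<in>X. v x \<le> M) \<Longrightarrow>
     (\<forall>x\<in>T. v x \<le> b) \<Longrightarrow> b \<le> M \<Longrightarrow> (\<forall>x\<in>N. v x \<le> M - k2 * (M - b) + C2)"
    using assms(2) unfolding harnack_on_def by auto
  have "\<forall>x\<in>N. v x \<le> M - (k2 * k1) * (M - b) + (k2 * C1 + C2)"
    if v: "bdd_omega_psh v" "\<forall>x. 0 \<le> v x" "\<forall>x\<in>X. v x \<le> M" "\<forall>x\<in>S. v x \<le> b" "b \<le> M" for v M b
  proof
    fix x assume x: "x \<in> N"
    \<comment> \<open>The bound gained on T becomes the bound b for the second estimate. If it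
      exceeds M, the claimed right side is at least M and the inequality is trivial.\<close>
    define b' where "b' = M - k1 * (M - b) + C1"
    have T: "\<forall>x\<in>T. v x \<le> b'" using 1(4)[OF v] by (simp add: b'_def)
    have eq: "k2 * (M - b') = k2 * k1 * (M - b) - k2 * C1" by (simp add: b'_def algebra_simps)
    show "v x \<le> M - (k2 * k1) * (M - b) + (k2 * C1 + C2)"
    proof (cases "b' \<le> M")
      case True
      then show ?thesis using 2(4)[OF v(1-3) T True] x eq by fastforce
    next
      case False
      then have "k2 * (M - b') \<le> 0" using 2(1) by (simp add: mult_le_0_iff)
      moreover have "v x \<le> M" using v(3) x assms(4) by blast
      ultimately show ?thesis using eq 2(3) by linarith
    qed
  qed
  moreover have "0 < k2 * k1" "k2 * k1 \<le> 1" "0 \<le> k2 * C1 + C2" using 1 2 by (auto intro: mult_le_one)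
  ultimately show ?thesis unfolding harnack_on_def by (intro exI[of _ "k2 * k1"] exI[of _ "k2 * C1 + C2"]) auto
qed

text \<open>The points reached by chains starting from S form an open and closed set, hence all of
  X. At a maximum point of v the estimate reads M \<le> M - \<kappa>(M - b) + C, that is M - b \<le>
  C/\<kappa>; compactness of X makes the constant uniform.\<close>

lemma harnack_component:
  assumes X: "X = connected_component_set UNIV a" and S: "open S" "S \<noteq> {}" "S \<subseteq> X"
  shows "\<exists>C\<ge>0. \<forall>v b. bdd_omega_psh v \<longrightarrow> (\<forall>x. 0 \<le> v x) \<longrightarrow> (\<forall>x\<in>S. v x \<le> b) \<longrightarrow> (\<forall>x\<in>X. v x \<le> b + C)"
proof -
  have Xp: "X = connected_component_set UNIV p" if "p \<in> X" for p using that connected_component_eq unfolding X by blast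
  define G where "G = {p\<in>X. \<exists>N. open N \<and> p \<in> N \<and> N \<subseteq> X \<and> harnack_on X S N}"
  have SS: "harnack_on X S S" unfolding harnack_on_def by (intro exI[of _ 1] exI[of _ 0]) auto
  have oX: "open X" unfolding X by (rule component_open)
  have "open G" unfolding G_def
  proof (subst open_subopen, intro ballI)
    fix p assume "p \<in> {p\<in>X. \<exists>N. open N \<and> p \<in> N \<and> N \<subseteq> X \<and> harnack_on X S N}"
    then obtain N where "open N" "p \<in> N" "N \<subseteq> X" "harnack_on X S N" by blast
    then show "\<exists>T. open T \<and> p \<in> T \<and> T \<subseteq> {p\<in>X. \<exists>N. open N \<and> p \<in> N \<and> N \<subseteq> X \<and> harnack_on X S N}"
      by (intro exI[of _ N]) blast
  qed
  moreover have "open (X - G)"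
  proof (subst open_subopen, intro ballI)
    fix p assume p: "p \<in> X - G"
    obtain N where N: "open N" "p \<in> N" "N \<subseteq> X" "\<forall>S. open S \<longrightarrow> S \<inter> N \<noteq> {} \<longrightarrow> harnack_on X S N"
      using harnack_local[OF Xp] p by blast
    have "N \<inter> G = {}"
    proof (rule ccontr)
      assume "N \<inter> G \<noteq> {}"
      then obtain q T where q: "q \<in> N" "open T" "q \<in> T" "T \<subseteq> X" "harnack_on X S T" by (auto simp: G_def)
      then have "harnack_on X T N" using N(4) by blast
      then have "harnack_on X S N" using harnack_trans[OF q(5) _ q(4) N(3)] by blast
      then have "p \<in> G" using N p by (auto simp: G_def)
      then show False using p by blast
    qed
    then show "\<exists>T. open T \<and> p \<in> T \<and> T \<subseteq> X - G" using N by blast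
  qed
  moreover have "connected X" unfolding X by simp
  moreover have "S \<subseteq> G" using S SS by (auto simp: G_def)
  then have "G \<inter> X \<noteq> {}" using S by (auto simp: G_def)
  ultimately have "(X - G) \<inter> X = {}" using connectedD[of X G "X - G"] by (auto simp: G_def)
  then have XG: "\<forall>p\<in>X. \<exists>N. open N \<and> p \<in> N \<and> harnack_on X S N" by (auto simp: G_def)
  define Q where "Q N C \<longleftrightarrow> (\<forall>v M b. bdd_omega_psh v \<longrightarrow> (\<forall>x. 0 \<le> v x) \<longrightarrow> (\<forall>x\<in>X. v x \<le> M) \<longrightarrow>
     (\<forall>x\<in>S. v x \<le> b) \<longrightarrow> (\<forall>x\<in>N. v x = M \<longrightarrow> M \<le> b + C))" for N C
  have "\<forall>p\<in>X. \<exists>N C. open N \<and> p \<in> N \<and> 0 \<le> C \<and> Q N C"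
  proof
    fix p assume "p \<in> X"
    then obtain N where N: "open N" "p \<in> N" and har: "harnack_on X S N" using XG by blast
    from har obtain k C where k: "0 < k" "0 \<le> C" "\<And>v M b. bdd_omega_psh v \<Longrightarrow> (\<forall>x. 0 \<le> v x) \<Longrightarrow> (\<forall>x\<in>X. v x \<le> M) \<Longrightarrow>
     (\<forall>x\<in>S. v x \<le> b) \<Longrightarrow> b \<le> M \<Longrightarrow> (\<forall>x\<in>N. v x \<le> M - k * (M - b) + C)"
      unfolding harnack_on_def by auto
    have "M \<le> b + C / k" if v: "bdd_omega_psh v" "\<forall>x. 0 \<le> v x" "\<forall>x\<in>X. v x \<le> M" "\<forall>x\<in>S. v x \<le> b" "x \<in> N" "v x = M" for v M b x
    proof (cases "b \<le> M")
      case True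
      then have "M \<le> M - k * (M - b) + C" using k(3)[OF v(1-4) True] v(5,6) by auto
      then have "(M - b) * k \<le> C" by (simp add: mult.commute)
      then have "M - b \<le> C / k" using k(1) by (simp add: pos_le_divide_eq)
      then show ?thesis by simp
    next
      case False
      moreover have "0 \<le> C / k" using k by simp
      ultimately show ?thesis by linarith
    qed
    then have "Q N (C / k)" unfolding Q_def by blast
    moreover have "0 \<le> C / k" using k by simp
    ultimately show "\<exists>N C. open N \<and> p \<in> N \<and> 0 \<le> C \<and> Q N C" using N by blast
  qed
  from bchoice[OF this] obtain N where "\<forall>p\<in>X. \<exists>C. open (N p) \<and> p \<in> N p \<and> 0 \<le> C \<and> Q (N p) C" by blast
  from bchoice[OF this] obtain C where NC': "\<forall>p\<in>X. open (N p) \<and> p \<in> N p \<and> 0 \<le> C p \<and> Q (N p) (C p)" by blast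
  then have N: "\<And>p. p \<in> X \<Longrightarrow> open (N p)" "\<And>p. p \<in> X \<Longrightarrow> p \<in> N p" "\<And>p. p \<in> X \<Longrightarrow> 0 \<le> C p"
    and Q: "\<And>p. p \<in> X \<Longrightarrow> Q (N p) (C p)" by simp_all
  have NC: "M \<le> b + C p" if "p \<in> X" "bdd_omega_psh v" "\<forall>x. 0 \<le> v x" "\<forall>x\<in>X. v x \<le> M" "\<forall>x\<in>S. v x \<le> b" "x \<in> N p" "v x = M" for p v M b x
    using Q[OF that(1)] that(2-) unfolding Q_def by blast
  have "closed X" unfolding X by (rule closed_connected_component) simp
  then have cX: "compact X" using cpt compact_Int_closed[of UNIV X] by simp
  obtain F where F: "F \<subseteq> X" "finite F" "X \<subseteq> (\<Union>p\<in>F. N p)"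
    using compactE_image[OF cX, of X N] N(1,2) by blast
  define C' where "C' = (\<Sum>p\<in>F. C p)"
  have C': "C p \<le> C'" if "p \<in> F" for p unfolding C'_def using F N(3) that by (intro member_le_sum) auto
  have C'0: "0 \<le> C'" unfolding C'_def using F N(3) by (intro sum_nonneg) auto
  have "\<forall>x\<in>X. v x \<le> b + C'" if v: "bdd_omega_psh v" "\<forall>x. 0 \<le> v x" "\<forall>x\<in>S. v x \<le> b" for v b
  proof -
    have "usc X v" using usc_subset[of UNIV v X] v(1) by (simp add: bdd_omega_psh_def)
    then obtain xm where xm: "xm \<in> X" "\<forall>y\<in>X. v y \<le> v xm" using usc_attains_max[OF _ cX] S by blast
    obtain p where p: "p \<in> F" "xm \<in> N p" using F xm by blast
    then have "v xm \<le> b + C p" using NC[OF _ v(1,2) xm(2) v(3) p(2) refl] F by blast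
    then show ?thesis using C'[OF p(1)] xm(2) by force
  qed
  then show ?thesis using C'0 by blast
qed

section \<open>Continuity at a point and local regularity\<close>

text \<open>V is nonnegative and vanishes at a, so continuity at a amounts to smallness from
  above.\<close>

lemma isCont_V_extremal_iff:
  assumes "a \<in> K"
  shows "isCont (V_extremal \<A> \<omega> K) a \<longleftrightarrow>
    (\<forall>e>0. \<exists>N. open N \<and> a \<in> N \<and> (\<forall>x\<in>N. V_extremal \<A> \<omega> K x \<le> ereal e))"
proof
  assume "isCont (V_extremal \<A> \<omega> K) a"
  then have lim: "(V_extremal \<A> \<omega> K \<longlongrightarrow> 0) (at a)" using V_extremal_zero[OF assms] by (simp add: isCont_def)
  show "\<forall>e>0. \<exists>N. open N \<and> a \<in> N \<and> (\<forall>x\<in>N. V_extremal \<A> \<omega> K x \<le> ereal e)"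
  proof (intro allI impI)
    fix e :: real assume e: "0 < e"
    have "\<forall>\<^sub>F x in at a. V_extremal \<A> \<omega> K x < ereal e" using lim e by (intro order_tendstoD) (auto simp: zero_ereal_def)
    then have "\<forall>\<^sub>F x in nhds a. V_extremal \<A> \<omega> K x < ereal e"
      using e by (simp add: eventually_nhds_conv_at V_extremal_zero[OF assms] zero_ereal_def)
    then show "\<exists>N. open N \<and> a \<in> N \<and> (\<forall>x\<in>N. V_extremal \<A> \<omega> K x \<le> ereal e)"
      unfolding eventually_nhds using less_imp_le by blast
  qed
next
  assume h: "\<forall>e>0. \<exists>N. open N \<and> a \<in> N \<and> (\<forall>x\<in>N. V_extremal \<A> \<omega> K x \<le> ereal e)"
  have "(V_extremal \<A> \<omega> K \<longlongrightarrow> 0) (at a)"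
  proof (rule order_tendstoI)
    fix c :: ereal assume "c < 0"
    then show "\<forall>\<^sub>F x in at a. c < V_extremal \<A> \<omega> K x"
      using V_extremal_nonneg by (intro always_eventually allI) (rule less_le_trans)
  next
    fix c :: ereal assume "0 < c"
    then obtain e where e: "0 < ereal e" "ereal e < c" using ereal_dense2 by blast
    then obtain N where "open N" "a \<in> N" "\<forall>x\<in>N. V_extremal \<A> \<omega> K x \<le> ereal e" using h by (auto simp: zero_ereal_def)
    then show "\<forall>\<^sub>F x in at a. V_extremal \<A> \<omega> K x < c"
      unfolding eventually_at_topological using e by (meson le_less_trans)
  qed
  then show "isCont (V_extremal \<A> \<omega> K) a" using V_extremal_zero[OF assms] by (simp add: isCont_def)
qed

lemma ext_ball_ereal: "ext_ball b (ereal r) = ball b r"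
  by (auto simp: ext_ball_def)

lemma isCont_L_extremal_zeroD:
  assumes "isCont (L_extremal E) 0" "0 \<in> E" "0 < e"
  shows "\<exists>s>0. \<forall>z. norm z < s \<longrightarrow> L_extremal E z < ereal e"
proof -
  have lim: "(L_extremal E \<longlongrightarrow> 0) (at 0)" using assms(1) L_extremal_zero[OF assms(2)] by (simp add: isCont_def)
  have "\<forall>\<^sub>F x in at 0. L_extremal E x < ereal e" using lim assms(3) by (intro order_tendstoD) (auto simp: zero_ereal_def)
  then have "\<forall>\<^sub>F x in nhds 0. L_extremal E x < ereal e"
    using assms(3) by (simp add: eventually_nhds_conv_at L_extremal_zero[OF assms(2)] zero_ereal_def)
  then show ?thesis by (auto simp: eventually_nhds_metric)
qed

lemma isCont_L_extremal_zeroI: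
  assumes "0 \<in> E" "\<And>e. 0 < e \<Longrightarrow> \<exists>s>0. \<forall>z. norm z < s \<longrightarrow> L_extremal E z \<le> ereal e"
  shows "isCont (L_extremal (E :: (complex^'m) set)) 0"
proof -
  have "(L_extremal E \<longlongrightarrow> 0) (at 0)"
  proof (rule order_tendstoI)
    fix c :: ereal assume "c < 0"
    then show "\<forall>\<^sub>F x in at 0. c < L_extremal E x"
      using L_extremal_nonneg by (intro always_eventually allI) (rule less_le_trans)
  next
    fix c :: ereal assume "0 < c"
    then obtain e where e: "0 < ereal e" "ereal e < c" using ereal_dense2 by blast
    then obtain s where s: "s > 0" "\<forall>z. norm z < s \<longrightarrow> L_extremal E z \<le> ereal e" using assms(2)[of e] by (auto simp: zero_ereal_def)
    have "\<forall>\<^sub>F x in at 0. norm x < s" using s(1) eventually_at_ball[of s 0 UNIV] by (auto elim: eventually_mono)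
    then show "\<forall>\<^sub>F x in at 0. L_extremal E x < c" by eventually_elim (use s e in \<open>auto intro: le_less_trans\<close>)
  qed
  then show ?thesis using L_extremal_zero[OF assms(1)] by (simp add: isCont_def)
qed

text \<open>The maximum M of v on the component enters the multiple of L linearly. On a ball where L
  < ln 2 / 2 this gives v \<le> const + M/2; the Harnack estimate extends the bound to the maximum
  point, and M absorbs its half.\<close>

lemma weak_regular_imp_isCont:
  assumes aK: "a \<in> K" and cb: "coordinate_ball \<A> a R \<Omega> \<tau>" and reg: "locally_L_regular_Cn_at (\<tau> ` (K \<inter> \<Omega>)) 0"
  shows "isCont (V_extremal \<A> \<omega> K) a"
proof -
  have top: "topological_chart (\<Omega>, \<tau>)" and comp: "\<And>c. c \<in> \<A> \<Longrightarrow> holomorphically_compatible c (\<Omega>, \<tau>)"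
    and a: "a \<in> \<Omega>" "\<tau> a = 0" using cb by (auto simp: coordinate_ball_def)
  note t = topological_chartD[OF top]
  obtain r0 C0 where r0: "r0 > 0" "C0 > 0" "ball 0 r0 \<subseteq> \<tau> ` \<Omega>"
    and as: "\<forall>v x w. x \<in> \<Omega> \<and> dist (\<tau> x) 0 < r0 \<and> asubX v x \<longrightarrow> asub (\<lambda>z. v (inv_into \<Omega> \<tau> z)) (\<tau> x) w (C0 * (norm w)\<^sup>2)"
    using coordinate_comparison[OF top comp a(1)] unfolding a(2) by blast
  define E where "E r = \<tau> ` (K \<inter> \<Omega>) \<inter> cball 0 r" for r
  have regr: "isCont (L_extremal (E r)) 0" if "0 < r" for r
  proof -
    have "isCont (L_extremal (\<tau> ` (K \<inter> \<Omega>) \<inter> closure (ext_ball 0 (ereal r)))) 0"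
      using reg that unfolding locally_L_regular_Cn_at_def by (simp add: zero_ereal_def)
    then show ?thesis using that by (simp add: E_def ext_ball_ereal)
  qed
  have zE: "0 \<in> E r" if "0 < r" for r
    unfolding E_def using aK a that by (metis IntI centre_in_cball image_eqI less_imp_le)
  define X where "X = connected_component_set UNIV a"
  have BX: "inv_into \<Omega> \<tau> z \<in> X" if "norm z < r0" for z
    using chart_ball_in_component[OF top a(1), of r0] r0 that unfolding X_def a(2) by (auto simp: image_subset_iff)
  define C1 where "C1 = C0 / 4"
  define K1 where "K1 = C1 * r0\<^sup>2 + 1"
  \<comment> \<open>The gluing radii are r0/4, r0/2 and r0; the ratio of the first two is the source
    of ln 2.\<close>
  define r1 where "r1 = r0 / 4"
  have C1: "C1 > 0" and K1: "K1 > 0" and r1: "0 < r1" "r1 < r0" using r0 by (auto simp: C1_def K1_def r1_def add_nonneg_pos)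
  have ln2: "ln (2::real) > 0" by simp
  have key: "ereal (v (inv_into \<Omega> \<tau> z)) \<le> ereal (C1 * r\<^sup>2) + ereal ((M + K1) / ln 2) * L_extremal (E r) z"
    if v: "bdd_omega_psh v" "\<forall>x. 0 \<le> v x" "\<forall>x\<in>K. v x \<le> 0" "\<forall>x\<in>X. v x \<le> M" and r: "0 < r" "r \<le> r1" and z: "norm z \<le> r1" for v M r z
  proof -
    \<comment> \<open>Nonpositive at the points of K with |y| \<le> r, and plurisubharmonic because
      4 C1 = C0.\<close>
    define u where "u y = 1 * v (inv_into \<Omega> \<tau> y) + (- (C1 * r\<^sup>2)) + C1 * (norm (y - 0))\<^sup>2" for y
    define u' where "u' y = max (u y) 0" for y
    have usv: "usc (ball 0 r0) (\<lambda>y. v (inv_into \<Omega> \<tau> y))"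
      using usc_subset[OF chart_usc[OF top] r0(3)] v(1) by (simp add: bdd_omega_psh_def)
    have asv: "asub (\<lambda>y. v (inv_into \<Omega> \<tau> y)) y w (C0 * (norm w)\<^sup>2)" if y: "y \<in> ball 0 r0" for y w
    proof -
      have y': "inv_into \<Omega> \<tau> y \<in> \<Omega>" "\<tau> (inv_into \<Omega> \<tau> y) = y" using y r0(3) t(6,7) by auto
      moreover have "dist (\<tau> (inv_into \<Omega> \<tau> y)) 0 < r0" unfolding y' using y by simp
      moreover have "asubX v (inv_into \<Omega> \<tau> y)" using v(1) by (simp add: bdd_omega_psh_def)
      ultimately have "asub (\<lambda>z. v (inv_into \<Omega> \<tau> z)) (\<tau> (inv_into \<Omega> \<tau> y)) w (C0 * (norm w)\<^sup>2)"
        using as by blast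
      then show ?thesis by (simp add: y')
    qed
    have v0: "0 \<le> v (inv_into \<Omega> \<tau> y)" for y using v(2) by simp
    have "usc (ball 0 r0) (\<lambda>y. v (inv_into \<Omega> \<tau> y) + (- (C1 * r\<^sup>2) + C1 * (norm y)\<^sup>2))"
      by (intro usc_add_continuous usv continuous_intros) simp
    then have usu: "usc (ball 0 r0) u" by (rule usc_cong) (simp add: u_def)
    have usu': "usc (ball 0 r0) u'" unfolding u'_def by (intro usc_max usu continuous_imp_usc continuous_intros)
    have asu: "asub u y w 0" if "y \<in> ball 0 r0" for y w
    proof -
      have "asub u y w (1 * (C0 * (norm w)\<^sup>2) - 4 * C1 * (norm w)\<^sup>2)" unfolding u_def
        by (rule asub_affine_quadratic[OF _ usv v0 that asv]) (use r0 in auto)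
      then show ?thesis by (simp add: C1_def)
    qed
    have ulow: "- (C1 * r\<^sup>2) \<le> u y" for y using v0[of y] C1 by (simp add: u_def add_nonneg_nonneg)
    have asu': "asub u' y w 0" if "norm y < r0" for y w
    proof (cases "0 \<le> u y")
      case True
      show ?thesis
        by (rule asub_touch[OF asu open_ball _ usu usu', where m = "- (C1 * r\<^sup>2)"]) (use that True ulow in \<open>auto simp: u'_def\<close>)
    next
      case False
      show ?thesis
        by (rule asub_touch[OF asub_const[of 0 0] open_ball _ _ usu', where m = 0]) (use that False in \<open>auto simp: u'_def intro: continuous_imp_usc\<close>)
    qed
    have u'M: "u' y \<le> M + C1 * r0\<^sup>2" if "norm y < r0" for y
    proof -
      have "v (inv_into \<Omega> \<tau> y) \<le> M" using v(4) BX[OF that] by blast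
      moreover have "C1 * (norm y)\<^sup>2 \<le> C1 * r0\<^sup>2" using that C1 by (intro mult_left_mono power_mono) auto
      moreover have "0 \<le> C1 * r\<^sup>2" using C1 by simp
      moreover have "0 \<le> M" using calculation(1) v0[of y] by linarith
      moreover have "0 \<le> C1 * r0\<^sup>2" using C1 by simp
      ultimately show ?thesis by (simp add: u'_def u_def)
    qed
    have uE: "norm x \<le> r1 \<and> u' x \<le> 0" if "x \<in> E r" for x
    proof -
      obtain k where k: "k \<in> K" "k \<in> \<Omega>" "x = \<tau> k" "norm x \<le> r" using \<open>x \<in> E r\<close> by (auto simp: E_def)
      have "v (inv_into \<Omega> \<tau> x) \<le> 0" using k v(3) t(5) by simp
      moreover have "C1 * (norm x)\<^sup>2 \<le> C1 * r\<^sup>2" using k C1 by (intro mult_left_mono power_mono) auto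
      ultimately show ?thesis using k r by (simp add: u'_def u_def)
    qed
    have "ereal (u' z) \<le> ereal ((M + C1 * r0\<^sup>2 + 1) / ln ((r0 / 2) / r1)) * L_extremal (E r) z"
      by (rule le_L_extremal_by_gluing[OF r1(1) _ _ usu' _ u'M asu' uE z]) (use r0 in \<open>auto simp: r1_def u'_def\<close>)
    moreover have "(r0 / 2) / r1 = 2" "M + C1 * r0\<^sup>2 + 1 = M + K1" using r0 by (auto simp: r1_def K1_def)
    ultimately have "ereal (u' z) \<le> ereal ((M + K1) / ln 2) * L_extremal (E r) z" by simp
    moreover have "v (inv_into \<Omega> \<tau> z) \<le> C1 * r\<^sup>2 + u' z"
    proof -
      have "0 \<le> C1 * (norm z)\<^sup>2" using C1 by simp
      then show ?thesis by (simp add: u'_def u_def)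
    qed
    then have "ereal (v (inv_into \<Omega> \<tau> z)) \<le> ereal (C1 * r\<^sup>2) + ereal (u' z)" by simp
    ultimately show ?thesis using add_left_mono order_trans by blast
  qed
  \<comment> \<open>With this bound for L the coefficient of M in \<open>key\<close> becomes
    1/2.\<close>
  obtain s where s: "s > 0" "\<And>z. norm z < s \<Longrightarrow> L_extremal (E r1) z < ereal (ln 2 / 2)"
    using isCont_L_extremal_zeroD[OF regr[OF r1(1)] zE[OF r1(1)], of "ln 2 / 2"] ln2 by auto
  define S where "S = inv_into \<Omega> \<tau> ` ball 0 (min s r1)"
  have bs: "ball 0 (min s r1) \<subseteq> \<tau> ` \<Omega>" using r0(3) r1 by auto
  have oS: "open S" unfolding S_def by (rule chart_inv_image_open[OF top _ bs]) simp
  have "S \<noteq> {}" unfolding S_def using s r1 by simp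
  moreover have "S \<subseteq> X" unfolding S_def using BX r1 by auto
  ultimately obtain C2 where C2: "C2 \<ge> 0" "\<forall>v b. bdd_omega_psh v \<longrightarrow> (\<forall>x. 0 \<le> v x) \<longrightarrow> (\<forall>x\<in>S. v x \<le> b) \<longrightarrow> (\<forall>x\<in>X. v x \<le> b + C2)"
    using harnack_component[OF X_def oS] by blast
  \<comment> \<open>The solution of M = C1 r1^2 + (M + K1)/2 + C2.\<close>
  define Mb where "Mb = 2 * (C1 * r1\<^sup>2 + C2) + K1"
  have Mb0: "Mb > 0" using C1 C2 K1 by (simp add: Mb_def add_nonneg_pos)
  have cX: "compact X"
  proof -
    have "closed X" unfolding X_def by (rule closed_connected_component) simp
    then show ?thesis using cpt compact_Int_closed[of UNIV X] by simp
  qed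
  have aX: "a \<in> X" by (simp add: X_def)
  have bound: "\<forall>x\<in>X. v x \<le> Mb" if v: "bdd_omega_psh v" "\<forall>x. 0 \<le> v x" "\<forall>x\<in>K. v x \<le> 0" for v
  proof -
    have "usc X v" using usc_subset[of UNIV v X] v(1) by (simp add: bdd_omega_psh_def)
    then obtain xm where xm: "xm \<in> X" "\<forall>y\<in>X. v y \<le> v xm" using usc_attains_max[OF _ cX] aX by blast
    define M where "M = v xm"
    have M: "\<forall>x\<in>X. v x \<le> M" "0 \<le> M" using xm v(2) by (auto simp: M_def)
    have "v x \<le> C1 * r1\<^sup>2 + (M + K1) / 2" if "x \<in> S" for x
    proof -
      obtain z where z: "norm z < s" "norm z < r1" "x = inv_into \<Omega> \<tau> z" using \<open>x \<in> S\<close> by (auto simp: S_def)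
      have "ereal (v x) \<le> ereal (C1 * r1\<^sup>2) + ereal ((M + K1) / ln 2) * L_extremal (E r1) z"
        unfolding z(3) by (rule key[OF v M(1) r1(1) order_refl]) (use z in simp)
      also have "\<dots> \<le> ereal (C1 * r1\<^sup>2) + ereal ((M + K1) / ln 2) * ereal (ln 2 / 2)"
        using s(2)[OF z(1)] M(2) K1 ln2 by (intro add_left_mono ereal_mult_left_mono) auto
      finally show ?thesis using ln2 by simp
    qed
    then have "v xm \<le> C1 * r1\<^sup>2 + (M + K1) / 2 + C2" using C2(2) v xm(1) by blast
    then have "M \<le> Mb" by (simp add: M_def Mb_def field_simps)
    then show ?thesis using M(1) by auto
  qed
  show ?thesis unfolding isCont_V_extremal_iff[OF aK]
  proof (intro allI impI)
    fix e :: real assume e: "e > 0"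
    \<comment> \<open>C1 r^2 \<le> e/2 leaves e/2 for the term with L.\<close>
    define r where "r = min r1 (sqrt (e / (2 * C1)))"
    have r: "0 < r" "r \<le> r1" using r1 e C1 by (auto simp: r_def)
    have "r\<^sup>2 \<le> (sqrt (e / (2 * C1)))\<^sup>2" using r(1) by (intro power_mono) (auto simp: r_def)
    also have "\<dots> = e / (2 * C1)" using e C1 by simp
    finally have "C1 * r\<^sup>2 \<le> C1 * (e / (2 * C1))" using C1 by (intro mult_left_mono) auto
    then have Cr: "C1 * r\<^sup>2 \<le> e / 2" using C1 by simp
    define A where "A = (Mb + K1) / ln 2"
    have A: "A > 0" using Mb0 K1 ln2 by (simp add: A_def)
    obtain s' where s': "s' > 0" "\<And>z. norm z < s' \<Longrightarrow> L_extremal (E r) z < ereal (e / (2 * A))"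
      using isCont_L_extremal_zeroD[OF regr[OF r(1)] zE[OF r(1)], of "e / (2 * A)"] e A by auto
    define N where "N = inv_into \<Omega> \<tau> ` ball 0 (min s' r1)"
    have bs': "ball 0 (min s' r1) \<subseteq> \<tau> ` \<Omega>" using r0(3) r1 by auto
    show "\<exists>N. open N \<and> a \<in> N \<and> (\<forall>x\<in>N. V_extremal \<A> \<omega> K x \<le> ereal e)"
    proof (intro exI conjI ballI)
      show "open N" unfolding N_def by (rule chart_inv_image_open[OF top _ bs']) simp
      show "a \<in> N" unfolding N_def by (rule image_eqI[of _ _ 0]) (use t(5)[OF a(1)] a(2) s' r1 in auto)
      fix x assume "x \<in> N"
      then obtain z where z: "norm z < s'" "norm z < r1" "x = inv_into \<Omega> \<tau> z" by (auto simp: N_def)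
      show "V_extremal \<A> \<omega> K x \<le> ereal e"
        unfolding V_extremal_alt
      proof (rule SUP_least)
        fix v assume "v \<in> {v. bdd_omega_psh v \<and> (\<forall>y. 0 \<le> v y) \<and> (\<forall>y\<in>K. v y \<le> 0)}"
        then have v: "bdd_omega_psh v" "\<forall>x. 0 \<le> v x" "\<forall>x\<in>K. v x \<le> 0" by auto
        have "ereal (v x) \<le> ereal (C1 * r\<^sup>2) + ereal ((Mb + K1) / ln 2) * L_extremal (E r) z"
          unfolding z(3) by (rule key[OF v bound[OF v] r]) (use z in simp)
        also have "\<dots> \<le> ereal (C1 * r\<^sup>2) + ereal A * ereal (e / (2 * A))"
          using s'(2)[OF z(1)] A unfolding A_def[symmetric] by (intro add_left_mono ereal_mult_left_mono) auto
        also have "\<dots> \<le> ereal e" using Cr A by simp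
        finally show "ereal (v x) \<le> ereal e" .
      qed
    qed
  qed
qed

text \<open>The multiple of u^+ has to shrink with its maximum M on the ball, so
  \<open>small\<close> still contains M. With \<theta> = 1/2, and with logarithmic growth from
  radius s1 to r, it gives M \<le> (M + 1)/2 + ln (r/s1) and hence a bound common to all u; a second
  use of \<open>small\<close> then makes L small near 0.\<close>

lemma isCont_imp_regular:
  assumes aK: "a \<in> K" and cont: "isCont (V_extremal \<A> \<omega> K) a" and cb: "coordinate_ball \<A> a R \<Omega> \<tau>"
  shows "locally_L_regular_Cn_at (\<tau> ` (K \<inter> \<Omega>)) 0"
  unfolding locally_L_regular_Cn_at_def
proof (intro allI impI)
  fix \<rho> :: ereal assume \<rho>: "0 < \<rho>"
  have top: "topological_chart (\<Omega>, \<tau>)" and comp: "\<And>c. c \<in> \<A> \<Longrightarrow> holomorphically_compatible c (\<Omega>, \<tau>)"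
    and a: "a \<in> \<Omega>" "\<tau> a = 0" using cb by (auto simp: coordinate_ball_def)
  note t = topological_chartD[OF top]
  obtain r0 c0 where r0: "r0 > 0" "c0 > 0" "ball 0 r0 \<subseteq> \<tau> ` \<Omega>"
    and as: "\<forall>v x. x \<in> \<Omega> \<and> dist (\<tau> x) 0 < r0 \<and> (\<forall>w. asub (\<lambda>z. v (inv_into \<Omega> \<tau> z)) (\<tau> x) w (c0 * (norm w)\<^sup>2)) \<longrightarrow> asubX v x"
    using coordinate_comparison[OF top comp a(1)] unfolding a(2) by blast
  \<comment> \<open>\<rho> may be infinite; a smaller finite radius is enough, since L decreases
    when the set grows.\<close>
  obtain r where r: "0 < r" "r < r0" "ereal r < \<rho>"
  proof -
    obtain x where x: "0 < ereal x" "ereal x < min \<rho> (ereal r0)" using ereal_dense2[of 0 "min \<rho> (ereal r0)"] \<rho> r0(1) by auto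
    then show ?thesis using that[of x] by (auto simp: zero_ereal_def)
  qed
  define E' where "E' = \<tau> ` (K \<inter> \<Omega>) \<inter> cball 0 r"
  define E where "E = \<tau> ` (K \<inter> \<Omega>) \<inter> closure (ext_ball 0 \<rho>)"
  have "ball (0::complex^'n) r \<subseteq> ext_ball 0 \<rho>" 
    using less_trans[OF _ r(3)] by (auto simp: ext_ball_def)
  then have "cball (0::complex^'n) r \<subseteq> closure (ext_ball 0 \<rho>)" using closure_mono r(1) by (metis closure_ball)
  then have EE: "E' \<subseteq> E" by (auto simp: E_def E'_def)
  have zE': "0 \<in> E'" unfolding E'_def using aK a r(1) by (metis IntI centre_in_cball image_eqI less_imp_le)
  have br: "ball 0 r \<subseteq> \<tau> ` \<Omega>" "cball 0 (3 * r / 4) \<subseteq> \<tau> ` \<Omega>" using r r0(3) by auto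
  \<comment> \<open>4 \<epsilon>1 = c0, so subtracting \<epsilon>1|z|^2 uses just the positivity
    that \<omega> is known to have.\<close>
  define \<epsilon>1 where "\<epsilon>1 = c0 / 4"
  \<comment> \<open>From radius 3r/4 on, \<epsilon>1|z|^2 \<ge> 2k while the multiple of u^+ is at
    most k, so the competitor drops to -k before the ball ends.\<close>
  define k where "k = \<epsilon>1 * r\<^sup>2 / 8"
  have k: "0 < \<epsilon>1" "0 < k" using r0 r by (auto simp: \<epsilon>1_def k_def)
  define P where "P = inv_into \<Omega> \<tau> ` ball 0 r"
  define Q where "Q = inv_into \<Omega> \<tau> ` cball 0 (3 * r / 4)"
  have oP: "open P" unfolding P_def by (rule chart_inv_image_open[OF top _ br(1)]) simp
  have "compact Q" unfolding Q_def by (rule compact_continuous_image[OF continuous_on_subset[OF t(4) br(2)] compact_cball])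
  then have oQ: "open (- Q)" using compact_imp_closed by blast
  have P_iff: "x \<in> P \<longleftrightarrow> x \<in> \<Omega> \<and> norm (\<tau> x) < r" for x
  proof
    assume "x \<in> P"
    then obtain z where "norm z < r" "x = inv_into \<Omega> \<tau> z" "z \<in> \<tau> ` \<Omega>" using br(1) by (auto simp: P_def)
    then show "x \<in> \<Omega> \<and> norm (\<tau> x) < r" using t(6,7) by simp
  next
    assume "x \<in> \<Omega> \<and> norm (\<tau> x) < r"
    then show "x \<in> P" unfolding P_def by (intro image_eqI[of _ _ "\<tau> x"]) (auto simp: t(5))
  qed
  have Q_I: "x \<in> Q" if "x \<in> \<Omega>" "norm (\<tau> x) \<le> 3 * r / 4" for x
    unfolding Q_def using that by (intro image_eqI[of _ _ "\<tau> x"]) (auto simp: t(5))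
  have QP: "Q \<subseteq> P" unfolding Q_def P_def using r(1) by (intro image_mono) auto
  have claim: "ereal (k / (M + 1) * pos_part u z - \<epsilon>1 * (norm z)\<^sup>2) \<le> V_extremal \<A> \<omega> K (inv_into \<Omega> \<tau> z)"
    if u: "u \<in> lelong_class" "\<And>x. x \<in> E' \<Longrightarrow> u x \<le> 0" and M: "0 \<le> M" "\<And>x. norm x \<le> r \<Longrightarrow> pos_part u x \<le> M" and z: "norm z < r" for u M z
  proof -
    have pu: "psh_on UNIV u" using u(1) by (simp add: lelong_class_def)
    have up: "usc UNIV (pos_part u)" "\<And>z w. asub (pos_part u) z w 0" using psh_on_pos_part[OF pu] by auto
    define tt where "tt = k / (M + 1)"
    have tt: "0 < tt" using k M by (simp add: tt_def)
    have ttM: "tt * M \<le> k" using k M by (simp add: tt_def field_simps)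
    define g where "g y = tt * pos_part u y + 0 + (- \<epsilon>1) * (norm (y - 0))\<^sup>2" for y
    have usg: "usc UNIV g"
    proof -
      have "usc UNIV (\<lambda>y. tt * pos_part u y + (- \<epsilon>1) * (norm y)\<^sup>2)"
        by (intro usc_add_continuous usc_cmult up tt continuous_intros) simp
      then show ?thesis by (rule usc_cong) (simp add: g_def)
    qed
    have asg: "asub g y w (c0 * (norm w)\<^sup>2)" for y w
    proof -
      have "asub g y w (tt * 0 - 4 * (- \<epsilon>1) * (norm w)\<^sup>2)" unfolding g_def
        by (rule asub_affine_quadratic[OF open_UNIV up(1) pos_part_nonneg _ up(2)]) (use tt in auto)
      then show ?thesis by (simp add: \<epsilon>1_def)
    qed
    \<comment> \<open>Gluing with the constant -k instead of 0 leaves room for the quadratic term,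
      and v \<le> 0 still holds on K because u \<le> 0 there inside the ball.\<close>
    define v where "v x = (if x \<in> P then max (g (\<tau> x)) (- k) else - k)" for x
    have vk: "- k \<le> v x" for x by (simp add: v_def)
    have cP: "continuous_on P \<tau>" by (rule continuous_on_subset[OF t(3)]) (auto simp: P_iff)
    have us1: "usc P v"
    proof -
      have "usc P (\<lambda>x. max (g (\<tau> x)) (- k))"
        by (intro usc_max usc_compose[OF usg cP] continuous_imp_usc continuous_intros) auto
      then show ?thesis by (rule usc_cong) (simp add: v_def)
    qed
    have vQ: "v x = - k" if "x \<in> - Q" for x
    proof (cases "x \<in> P")
      case True
      then have x: "x \<in> \<Omega>" "norm (\<tau> x) < r" "3 * r / 4 < norm (\<tau> x)" using P_iff Q_I that by force+
      have "tt * pos_part u (\<tau> x) \<le> tt * M" using M(2)[of "\<tau> x"] x tt by (intro mult_left_mono) auto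
      moreover have "\<epsilon>1 * (3 * r / 4)\<^sup>2 \<le> \<epsilon>1 * (norm (\<tau> x))\<^sup>2" using x k r by (intro mult_left_mono power_mono) auto
      moreover have "\<epsilon>1 * (3 * r / 4)\<^sup>2 \<ge> 2 * k" using k(1) by (simp add: k_def power2_eq_square)
      ultimately show ?thesis using True ttM by (simp add: v_def g_def)
    qed (simp add: v_def)
    have us2: "usc (- Q) v" by (rule usc_cong[OF continuous_imp_usc[OF continuous_on_const[of _ "- k"]]]) (simp add: vQ)
    have us: "usc UNIV v"
    proof (rule usc_openI)
      fix x c assume "v x < c"
      consider "x \<in> P" | "x \<in> - Q" using QP by blast
      then show "\<forall>\<^sub>F y in nhds x. v y < c"
      proof cases
        case 1 then show ?thesis using usc_openD[OF us1 oP _ \<open>v x < c\<close>] by (simp add: eventually_conj_iff)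
      next
        case 2 then show ?thesis using usc_openD[OF us2 oQ _ \<open>v x < c\<close>] by (simp add: eventually_conj_iff)
      qed
    qed simp
    have asX: "asubX v x" for x
    proof (cases "x \<in> P \<and> - k \<le> g (\<tau> x)")
      case True
      then have x: "x \<in> \<Omega>" "norm (\<tau> x) < r" by (auto simp: P_iff)
      have vinv: "v (inv_into \<Omega> \<tau> y) = max (g y) (- k)" if "y \<in> ball 0 r" for y
      proof -
        have "inv_into \<Omega> \<tau> y \<in> P" unfolding P_def using that by blast
        moreover have "\<tau> (inv_into \<Omega> \<tau> y) = y" using t(6) br(1) that by blast
        ultimately show ?thesis by (simp add: v_def)
      qed
      have "asub (\<lambda>z. v (inv_into \<Omega> \<tau> z)) (\<tau> x) w (c0 * (norm w)\<^sup>2)" for w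
      proof (rule asub_touch[OF asg open_ball, where m = "- \<epsilon>1 * r\<^sup>2"])
        show "\<tau> x \<in> ball 0 r" using x by simp
        show "usc (ball 0 r) g" by (rule usc_subset[OF usg]) simp
        show "usc (ball 0 r) (\<lambda>z. v (inv_into \<Omega> \<tau> z))" by (rule usc_subset[OF chart_usc[OF top us] br(1)])
        show "- \<epsilon>1 * r\<^sup>2 \<le> g y" if "y \<in> ball 0 r" for y
        proof -
          have "\<epsilon>1 * (norm y)\<^sup>2 \<le> \<epsilon>1 * r\<^sup>2" using that k by (intro mult_left_mono power_mono) auto
          moreover have "0 \<le> tt * pos_part u y" using tt pos_part_nonneg[of u y] by simp
          ultimately show ?thesis by (simp add: g_def)
        qed
        show "g y \<le> v (inv_into \<Omega> \<tau> y)" if "y \<in> ball 0 r" for y using vinv[OF that] by simp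
        show "v (inv_into \<Omega> \<tau> (\<tau> x)) \<le> g (\<tau> x)" using vinv[of "\<tau> x"] x True by simp
      qed
      then show ?thesis using as x r(2) by auto
    next
      case False
      then have "v x \<le> - k" by (auto simp: v_def)
      then show ?thesis
        by (intro asubX_touch[OF asubX_const[of "- k"] open_UNIV UNIV_I continuous_imp_usc[OF continuous_on_const] us, where m = "- k"])
           (auto simp: vk)
    qed
    have "bdd_omega_psh v" unfolding bdd_omega_psh_def using us vk asX by blast
    moreover have "v y \<le> 0" if "y \<in> K" for y
    proof (cases "y \<in> P")
      case True
      then have "\<tau> y \<in> E'" using that by (auto simp: E'_def P_iff)
      then have "u (\<tau> y) \<le> 0" by (rule u(2))
      then have "pos_part u (\<tau> y) = 0" by (simp add: pos_part_def max_def)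
      then show ?thesis using True k by (simp add: v_def g_def)
    qed (use k in \<open>simp add: v_def\<close>)
    ultimately have "ereal (v (inv_into \<Omega> \<tau> z)) \<le> V_extremal \<A> \<omega> K (inv_into \<Omega> \<tau> z)" by (rule bdd_omega_psh_le_V_extremal)
    moreover have "g z \<le> v (inv_into \<Omega> \<tau> z)"
    proof -
      have zb: "z \<in> ball 0 r" using z by simp
      then have "inv_into \<Omega> \<tau> z \<in> P" unfolding P_def by blast
      moreover have "\<tau> (inv_into \<Omega> \<tau> z) = z" using t(6) br(1) zb by blast
      ultimately show ?thesis by (simp add: v_def)
    qed
    ultimately have "ereal (g z) \<le> V_extremal \<A> \<omega> K (inv_into \<Omega> \<tau> z)" by (meson ereal_less_eq(3) order_trans)
    then show ?thesis by (simp add: g_def tt_def)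
  qed
  \<comment> \<open>Near a the extremal function is at most k\<theta>/2, and on the ball of radius s
    the quadratic term costs another k\<theta>/2.\<close>
  have small: "\<exists>s>0. s < r \<and> (\<forall>u M z. u \<in> lelong_class \<longrightarrow> (\<forall>x\<in>E'. u x \<le> 0) \<longrightarrow> 0 \<le> M \<longrightarrow> (\<forall>x. norm x \<le> r \<longrightarrow> pos_part u x \<le> M) \<longrightarrow>
      norm z \<le> s \<longrightarrow> pos_part u z \<le> (M + 1) * \<theta>)" if \<theta>: "\<theta> > 0" for \<theta>
  proof -
    have "k * \<theta> / 2 > 0" using k \<theta> by simp
    then obtain N where N: "open N" "a \<in> N" "\<forall>x\<in>N. V_extremal \<A> \<omega> K x \<le> ereal (k * \<theta> / 2)"
      using cont unfolding isCont_V_extremal_iff[OF aK] by blast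
    have "open (\<tau> ` (\<Omega> \<inter> N))" by (rule chart_image_open[OF top N(1)])
    moreover have "0 \<in> \<tau> ` (\<Omega> \<inter> N)" using a N(2) by (metis IntI image_eqI)
    ultimately obtain s1 where s1: "s1 > 0" "ball 0 s1 \<subseteq> \<tau> ` (\<Omega> \<inter> N)" using open_contains_ball by blast
    define s where "s = min (s1 / 2) (min (r / 2) (sqrt (k * \<theta> / (2 * \<epsilon>1))))"
    have s: "s > 0" "s < s1" "s < r" using s1 r k \<theta> by (auto simp: s_def)
    have "s\<^sup>2 \<le> (sqrt (k * \<theta> / (2 * \<epsilon>1)))\<^sup>2" using s(1) by (intro power_mono) (auto simp: s_def)
    also have "\<dots> = k * \<theta> / (2 * \<epsilon>1)" using k \<theta> by simp
    finally have "\<epsilon>1 * s\<^sup>2 \<le> \<epsilon>1 * (k * \<theta> / (2 * \<epsilon>1))" using k by (intro mult_left_mono) auto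
    then have \<epsilon>s: "\<epsilon>1 * s\<^sup>2 \<le> k * \<theta> / 2" using k by simp
    show ?thesis
    proof (rule exI[of _ s], intro conjI s allI impI)
      fix u :: "complex^'n \<Rightarrow> ereal" and M :: real and z :: "complex^'n"
      assume u: "u \<in> lelong_class" "\<forall>x\<in>E'. u x \<le> 0" "0 \<le> M" "\<forall>x. norm x \<le> r \<longrightarrow> pos_part u x \<le> M" "norm z \<le> s"
      have "z \<in> \<tau> ` (\<Omega> \<inter> N)" using s1(2) u(5) s(2) by auto
      then have "inv_into \<Omega> \<tau> z \<in> N" using t(5) by auto
      then have "V_extremal \<A> \<omega> K (inv_into \<Omega> \<tau> z) \<le> ereal (k * \<theta> / 2)" using N(3) by blast
      moreover have "ereal (k / (M + 1) * pos_part u z - \<epsilon>1 * (norm z)\<^sup>2) \<le> V_extremal \<A> \<omega> K (inv_into \<Omega> \<tau> z)"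
        by (rule claim[OF u(1)]) (use u s in auto)
      ultimately have "ereal (k / (M + 1) * pos_part u z - \<epsilon>1 * (norm z)\<^sup>2) \<le> ereal (k * \<theta> / 2)" by (rule order_trans[rotated])
      then have "k / (M + 1) * pos_part u z \<le> k * \<theta> / 2 + \<epsilon>1 * (norm z)\<^sup>2" unfolding ereal_less_eq by linarith
      also have "\<epsilon>1 * (norm z)\<^sup>2 \<le> \<epsilon>1 * s\<^sup>2" using u(5) k by (intro mult_left_mono power_mono) auto
      finally have "k / (M + 1) * pos_part u z \<le> k * \<theta>" using \<epsilon>s by simp
      then have "k * (pos_part u z / (M + 1)) \<le> k * \<theta>" by simp
      then have "pos_part u z / (M + 1) \<le> \<theta>" using mult_le_cancel_left_pos[OF k(2)] by blast
      then show "pos_part u z \<le> (M + 1) * \<theta>" using u(3) by (simp add: field_simps)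
    qed
  qed
  obtain s1 where s1: "s1 > 0" "s1 < r" "\<And>u M z. u \<in> lelong_class \<Longrightarrow> (\<forall>x\<in>E'. u x \<le> 0) \<Longrightarrow> 0 \<le> M \<Longrightarrow> (\<forall>x. norm x \<le> r \<longrightarrow> pos_part u x \<le> M) \<Longrightarrow>
      norm z \<le> s1 \<Longrightarrow> pos_part u z \<le> (M + 1) * (1 / 2)" using small[of "1 / 2"] by auto
  \<comment> \<open>The solution of M = (M + 1)/2 + ln (r/s1).\<close>
  define Mb where "Mb = 1 + 2 * ln (r / s1)"
  have Mb: "Mb > 0" using s1 r by (simp add: Mb_def add_pos_pos)
  have bound: "\<forall>x. norm x \<le> r \<longrightarrow> pos_part u x \<le> Mb" if u: "u \<in> lelong_class" "\<forall>x\<in>E'. u x \<le> 0" for u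
  proof -
    have pu: "psh_on UNIV u" using u(1) by (simp add: lelong_class_def)
    have "usc (cball 0 r) (pos_part u)" by (rule usc_subset[OF psh_on_pos_part(1)[OF pu]]) auto
    then obtain xm where xm: "xm \<in> cball 0 r" "\<forall>y\<in>cball 0 r. pos_part u y \<le> pos_part u xm"
      using usc_attains_max[of "cball 0 r" "pos_part u"] r(1) by force
    define M where "M = pos_part u xm"
    have M: "\<forall>x. norm x \<le> r \<longrightarrow> pos_part u x \<le> M" "0 \<le> M" using xm by (auto simp: M_def pos_part_nonneg)
    have h: "pos_part u z \<le> (M + 1) / 2" if "norm z \<le> s1" for z using s1(3)[OF u M(2,1) that] by simp
    have l: "0 < ln (r / s1)" using s1 r by simp
    have "M \<le> (M + 1) / 2 + ln (r / s1)"
    proof (cases "norm xm \<le> s1")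
      case True
      then show ?thesis using h[OF True] l unfolding M_def[symmetric] by linarith
    next
      case False
      have "pos_part u xm \<le> (M + 1) / 2 + ln (norm xm / s1)"
        by (rule lelong_class_growth[OF u(1) s1(1)]) (use h False in auto)
      also have "ln (norm xm / s1) \<le> ln (r / s1)" using xm(1) False s1(1) by (intro ln_mono divide_pos_pos divide_right_mono) auto
      finally show ?thesis by (simp add: M_def)
    qed
    then have "M \<le> Mb" by (simp add: Mb_def field_simps)
    then show ?thesis using M(1) by auto
  qed
  show "isCont (L_extremal (\<tau> ` (K \<inter> \<Omega>) \<inter> closure (ext_ball 0 \<rho>))) 0"
    unfolding E_def[symmetric]
  proof (rule isCont_L_extremal_zeroI)
    show "0 \<in> E" using zE' EE by blast
    fix e :: real assume e: "0 < e"
    have "e / (Mb + 1) > 0" using e Mb by simp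
    from small[OF this] obtain s where s: "s > 0" "\<And>u M z. u \<in> lelong_class \<Longrightarrow> (\<forall>x\<in>E'. u x \<le> 0) \<Longrightarrow> 0 \<le> M \<Longrightarrow> (\<forall>x. norm x \<le> r \<longrightarrow> pos_part u x \<le> M) \<Longrightarrow>
      norm z \<le> s \<Longrightarrow> pos_part u z \<le> (M + 1) * (e / (Mb + 1))" by auto
    show "\<exists>s>0. \<forall>z. norm z < s \<longrightarrow> L_extremal E z \<le> ereal e"
    proof (intro exI conjI allI impI)
      show "0 < s" by (rule s)
      fix z :: "complex^'n" assume z: "norm z < s"
      have "L_extremal E z \<le> L_extremal E' z" by (rule L_extremal_antimono[OF EE])
      also have "\<dots> \<le> ereal e" unfolding L_extremal_def
      proof (rule SUP_least)
        fix u assume "u \<in> {u \<in> lelong_class. \<forall>x\<in>E'. u x \<le> 0}"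
        then have u: "u \<in> lelong_class" "\<forall>x\<in>E'. u x \<le> 0" by auto
        have "pos_part u z \<le> (Mb + 1) * (e / (Mb + 1))" by (rule s(2)[OF u _ bound[OF u]]) (use Mb z in auto)
        then have "pos_part u z \<le> e" using Mb by simp
        moreover have "u z < \<infinity>" using u(1) by (auto simp: lelong_class_def psh_on_def)
        then have "u z \<le> ereal (pos_part u z)" using ereal_pos_part[of u z] by simp
        ultimately show "u z \<le> ereal e" by (meson ereal_less_eq(3) order_trans)
      qed
      finally show "L_extremal E z \<le> ereal e" .
    qed
  qed
qed

section \<open>Existence of coordinate balls\<close>

lemma exists_coordinate_ball: "\<exists>R \<Omega> \<tau>. coordinate_ball \<A> a R \<Omega> \<tau>"
proof -
  obtain U \<phi> where U: "(U, \<phi>) \<in> \<A>" "a \<in> U" using chart_at by blast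
  note top = chart_top[OF U(1)]
  note t = topological_chartD[OF top]
  obtain r where r: "r > 0" "ball (\<phi> a) r \<subseteq> \<phi> ` U" using t(2) U(2) open_contains_ball by blast
  define \<Omega> where "\<Omega> = inv_into U \<phi> ` ball (\<phi> a) r"
  define \<tau> where "\<tau> x = \<phi> x - \<phi> a" for x
  have \<Omega>U: "\<Omega> \<subseteq> U" unfolding \<Omega>_def using t(7) r(2) by blast
  have o\<Omega>: "open \<Omega>" unfolding \<Omega>_def by (rule chart_inv_image_open[OF top _ r(2)]) simp
  have shift: "z + \<phi> a \<in> ball (\<phi> a) r" if "z \<in> ball 0 r" for z using that by (simp add: dist_norm)
  have \<phi>\<Omega>: "\<phi> x \<in> ball (\<phi> a) r" if "x \<in> \<Omega>" for x using that t(6) r(2) by (auto simp: \<Omega>_def subset_iff)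
  have inj: "inj_on \<tau> \<Omega>" using inj_on_subset[OF t(8) \<Omega>U] by (auto simp: inj_on_def \<tau>_def)
  have im: "\<tau> ` \<Omega> = ball 0 r"
  proof
    show "\<tau> ` \<Omega> \<subseteq> ball 0 r" using \<phi>\<Omega> by (auto simp: \<tau>_def dist_norm norm_minus_commute)
    show "ball 0 r \<subseteq> \<tau> ` \<Omega>"
    proof
      fix z assume z: "z \<in> ball (0::complex^'n) r"
      have "z = \<tau> (inv_into U \<phi> (z + \<phi> a))" using t(6) shift[OF z] r(2) by (simp add: \<tau>_def subset_iff)
      moreover have "inv_into U \<phi> (z + \<phi> a) \<in> \<Omega>" unfolding \<Omega>_def using shift[OF z] by blast
      ultimately show "z \<in> \<tau> ` \<Omega>" by blast
    qed
  qed
  have inv: "inv_into \<Omega> \<tau> z = inv_into U \<phi> (z + \<phi> a)" if z: "z \<in> ball 0 r" for z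
  proof -
    have m: "inv_into U \<phi> (z + \<phi> a) \<in> \<Omega>" unfolding \<Omega>_def using shift[OF z] by blast
    have "\<tau> (inv_into U \<phi> (z + \<phi> a)) = z" using t(6) shift[OF z] r(2) by (simp add: \<tau>_def subset_iff)
    then show ?thesis using inv_into_f_f[OF inj m] by simp
  qed
  have "topological_chart (\<Omega>, \<tau>)"
    unfolding topological_chart_def homeomorphism_def prod.case
  proof (intro conjI ballI)
    show "open \<Omega>" "open (\<tau> ` \<Omega>)" using o\<Omega> im by auto
    show "inv_into \<Omega> \<tau> (\<tau> x) = x" if "x \<in> \<Omega>" for x using inv_into_f_f[OF inj that] .
    show "\<tau> (inv_into \<Omega> \<tau> y) = y" if "y \<in> \<tau> ` \<Omega>" for y using f_inv_into_f[OF that] .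
    show "inv_into \<Omega> \<tau> ` \<tau> ` \<Omega> = \<Omega>" by (simp add: inj inv_into_image_cancel)
    show "continuous_on \<Omega> \<tau>" unfolding \<tau>_def by (intro continuous_intros continuous_on_subset[OF t(3) \<Omega>U])
    have "continuous_on (ball 0 r) (\<lambda>z. inv_into U \<phi> (z + \<phi> a))"
      by (rule continuous_on_compose2[OF t(4)]) (use shift r(2) in \<open>auto intro!: continuous_intros\<close>)
    then show "continuous_on (\<tau> ` \<Omega>) (inv_into \<Omega> \<tau>)" unfolding im by (rule continuous_on_eq) (simp add: inv)
  qed simp_all
  moreover have "holomorphically_compatible c (\<Omega>, \<tau>)" if c: "c \<in> \<A>" for c
  proof -
    obtain V \<psi> where V: "c = (V, \<psi>)" by (cases c)
    have cc: "holomorphic_map_on (\<psi> ` (V \<inter> U)) (\<phi> \<circ> inv_into V \<psi>)" "holomorphic_map_on (\<phi> ` (V \<inter> U)) (\<psi> \<circ> inv_into U \<phi>)"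
      using chart_compat[OF c U(1)] by (auto simp: V holomorphically_compatible_def)
    have "holomorphic_map_on (\<psi> ` (V \<inter> \<Omega>)) (\<tau> \<circ> inv_into V \<psi>)"
      unfolding holomorphic_map_on_def
    proof
      fix z assume "z \<in> \<psi> ` (V \<inter> \<Omega>)"
      then have "z \<in> \<psi> ` (V \<inter> U)" using \<Omega>U by blast
      then obtain f' where f': "((\<phi> \<circ> inv_into V \<psi>) has_derivative f') (at z)" "\<forall>c w. f' (c *s w) = c *s f' w"
        using bspec[OF cc(1)[unfolded holomorphic_map_on_def]] by blast
      have "((\<lambda>y. (\<phi> \<circ> inv_into V \<psi>) y - \<phi> a) has_derivative (\<lambda>h. f' h - 0)) (at z)"
        by (intro has_derivative_diff f' has_derivative_const)
      then show "\<exists>f'. ((\<tau> \<circ> inv_into V \<psi>) has_derivative f') (at z) \<and> (\<forall>c w. f' (c *s w) = c *s f' w)"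
        using f'(2) by (intro exI[of _ f']) (simp add: \<tau>_def o_def)
    qed
    moreover have "holomorphic_map_on (\<tau> ` (V \<inter> \<Omega>)) (\<psi> \<circ> inv_into \<Omega> \<tau>)"
      unfolding holomorphic_map_on_def
    proof
      fix z assume z: "z \<in> \<tau> ` (V \<inter> \<Omega>)"
      then have zb: "z \<in> ball 0 r" using im by blast
      have "z + \<phi> a \<in> \<phi> ` (V \<inter> U)" using z \<Omega>U by (auto simp: \<tau>_def)
      then obtain f' where f': "((\<psi> \<circ> inv_into U \<phi>) has_derivative f') (at (z + \<phi> a))" "\<forall>c w. f' (c *s w) = c *s f' w"
        using bspec[OF cc(2)[unfolded holomorphic_map_on_def]] by blast
      have "((\<lambda>y. y + \<phi> a) has_derivative (\<lambda>h. h)) (at z)" by (auto intro!: derivative_eq_intros)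
      from has_derivative_compose[OF this f'(1)]
      have "((\<lambda>y. (\<psi> \<circ> inv_into U \<phi>) (y + \<phi> a)) has_derivative f') (at z)" .
      then have "((\<psi> \<circ> inv_into \<Omega> \<tau>) has_derivative f') (at z)"
        by (rule has_derivative_transform_within_open[OF _ open_ball zb]) (simp add: inv)
      then show "\<exists>f'. ((\<psi> \<circ> inv_into \<Omega> \<tau>) has_derivative f') (at z) \<and> (\<forall>c w. f' (c *s w) = c *s f' w)" using f'(2) by blast
    qed
    ultimately show ?thesis by (simp add: V holomorphically_compatible_def)
  qed
  moreover have "a \<in> \<Omega>" unfolding \<Omega>_def by (rule image_eqI[of _ _ "\<phi> a"]) (simp_all add: t(5)[OF U(2)] r)
  ultimately have "coordinate_ball \<A> a (ereal r) \<Omega> \<tau>"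
    unfolding coordinate_ball_def using r(1) im by (simp add: ext_ball_ereal \<tau>_def zero_ereal_def)
  then show ?thesis by blast
qed

section \<open>Continuity of the extremal function away from the set\<close>

definition candidate :: "'a set \<Rightarrow> ('a \<Rightarrow> real) \<Rightarrow> bool" where
  "candidate E v \<longleftrightarrow> bdd_omega_psh v \<and> (\<forall>x. 0 \<le> v x) \<and> (\<forall>x\<in>E. v x \<le> 0)"

lemma V_extremal_candidate: "V_extremal \<A> \<omega> E x = (SUP v\<in>{v. candidate E v}. ereal (v x))"
  unfolding V_extremal_alt candidate_def ..

lemma candidate_le_V_extremal: "candidate E v \<Longrightarrow> ereal (v x) \<le> V_extremal \<A> \<omega> E x"
  unfolding V_extremal_candidate by (rule SUP_upper2[of v]) auto

text \<open>If the sub-mean inequality failed for the regularization on some circle, a strict bound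
  c for its mean would persist on nearby circles for all v in F at once, as v \<le> h. All v, hence
  their supremum and its regularization at z, would then be at most c + s^2/4 q, a contradiction.
  That the radius s works for every v is \<open>disc_submean_uniform\<close>.\<close>

lemma bdd_omega_psh_usc_reg_SUP:
  assumes F: "F \<noteq> {}" "\<And>v. v \<in> F \<Longrightarrow> bdd_omega_psh v" "\<And>v x. v \<in> F \<Longrightarrow> 0 \<le> v x" "\<And>v x. v \<in> F \<Longrightarrow> v x \<le> M"
  shows "bdd_omega_psh (usc_reg (\<lambda>x. SUP v\<in>F. v x))"
proof -
  define S where "S x = (SUP v\<in>F. v x)" for x
  define G where "G = usc_reg S"
  have bdd: "bdd_above ((\<lambda>v. v x) ` F)" for x using F(4) by (auto intro!: bdd_aboveI[of _ M])
  have S1: "v x \<le> S x" if "v \<in> F" for v x unfolding S_def by (rule cSUP_upper[OF that bdd])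
  have S2: "S x \<le> c" if "\<And>v. v \<in> F \<Longrightarrow> v x \<le> c" for x c unfolding S_def by (rule cSUP_least[OF F(1) that])
  have S0: "0 \<le> S x" for x using F(1,3) S1 by (meson all_not_in_conv order_trans)
  have SM: "S x \<le> M" for x using S2 F(4) by blast
  have SG: "S x \<le> G x" for x unfolding G_def by (rule usc_reg_ge[OF SM])
  have G0: "0 \<le> G x" for x using S0 SG order_trans by blast
  have Gu: "usc UNIV G" unfolding G_def by (rule usc_usc_reg[OF S0 SM])
  have "asubX G x" for x
  proof -
    obtain U \<phi> where U: "(U, \<phi>) \<in> \<A>" "x \<in> U" using chart_at by blast
    note top = chart_top[OF U(1)]
    note t = topological_chartD[OF top]
    define W where "W = \<phi> ` U"
    define z where "z = \<phi> x"
    have W: "open W" "z \<in> W" using t(2) U(2) by (auto simp: W_def z_def)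
    define h where "h y = G (inv_into U \<phi> y)" for y
    have hu: "usc W h" unfolding h_def W_def by (rule chart_usc[OF top Gu])
    have h0: "0 \<le> h y" for y using G0 by (simp add: h_def)
    have hz: "h z = G x" by (simp add: h_def z_def t(5)[OF U(2)])
    have "asub h z w (herm_quad (U, \<phi>) z w)" for w
    proof (rule asub_linearI)
      fix e :: real assume e: "0 < e"
      define q where "q = herm_quad (U, \<phi>) z w + e"
      obtain \<rho> where \<rho>: "\<rho> > 0" "ball z (2 * \<rho>) \<subseteq> W"
        and sub: "\<And>u m y s. usc W u \<Longrightarrow> (\<And>x. x \<in> W \<Longrightarrow> m \<le> u x) \<Longrightarrow> (\<And>x. x \<in> W \<Longrightarrow> asub u x w (herm_quad (U, \<phi>) x w)) \<Longrightarrow>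
          dist y z < \<rho> \<Longrightarrow> 0 < s \<Longrightarrow> s * norm w < \<rho> \<Longrightarrow> u y \<le> cmean (\<lambda>\<zeta>. u (y + \<zeta> *s w)) s + s\<^sup>2 / 4 * q"
        unfolding q_def
        by (rule disc_submean_uniform[OF W herm_quad_continuous[OF U(1), of w, folded W_def] herm_quad_nonneg[OF U(1), folded W_def] e]) blast+
      have disc: "y + \<zeta> *s w \<in> W" if "dist y z < \<rho>" "s * norm w < \<rho>" "cmod \<zeta> \<le> s" for y s \<zeta>
        using disc_in_ball[of y z s w "2 * \<rho>" \<zeta>] that \<rho>(2) by auto
      have main: "h z \<le> cmean (\<lambda>\<zeta>. h (z + \<zeta> *s w)) s + s\<^sup>2 / 4 * q" if s: "0 < s" "s * norm w < \<rho>" for s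
      proof (rule ccontr)
        assume "\<not> ?thesis"
        then have "cmean (\<lambda>\<zeta>. h (z + \<zeta> *s w)) s < h z - s\<^sup>2 / 4 * q" by simp
        then obtain c where c: "cmean (\<lambda>\<zeta>. h (z + \<zeta> *s w)) s < c" "c < h z - s\<^sup>2 / 4 * q" using dense by blast
        have dW: "z + \<zeta> *s w \<in> W" if "cmod \<zeta> = s" for \<zeta> using disc[of z s \<zeta>] that s \<rho>(1) by simp
        obtain \<sigma> where \<sigma>: "\<sigma> > 0"
          and tube: "\<forall>f. cint f s \<longrightarrow> (\<forall>\<zeta>. cmod \<zeta> = s \<longrightarrow> (\<exists>x. norm (x - (z + \<zeta> *s w)) \<le> \<sigma> \<and> f \<zeta> \<le> h x)) \<longrightarrow> cmean f s < c"
          using cmean_tube[OF W(1) hu h0 s(1) dW c(1)] by blast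
        have near: "S (inv_into U \<phi> y) \<le> c + s\<^sup>2 / 4 * q" if y: "dist y z < \<rho>" "dist y z \<le> \<sigma>" for y
        proof (rule S2)
          fix v assume v: "v \<in> F"
          define u where "u y = v (inv_into U \<phi> y)" for y
          have u: "usc W u" "\<And>x. x \<in> W \<Longrightarrow> asub u x w (herm_quad (U, \<phi>) x w)" "\<And>x. x \<in> W \<Longrightarrow> 0 \<le> u x"
            unfolding u_def W_def using bdd_omega_psh_in_chart[OF F(2)[OF v] U(1)] F(3)[OF v] by auto
          have uh: "u y \<le> h y" for y unfolding u_def h_def using S1[OF v] SG order_trans by blast
          have "cint (\<lambda>\<zeta>. u (y + \<zeta> *s w)) s"
            by (rule cint_disc[OF u(1,3)]) (use s disc[OF y(1) s(2)] in \<open>auto intro!: continuous_intros\<close>)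
          moreover have "\<exists>x. norm (x - (z + \<zeta> *s w)) \<le> \<sigma> \<and> u (y + \<zeta> *s w) \<le> h x" for \<zeta>
            using y(2) uh by (intro exI[of _ "y + \<zeta> *s w"]) (simp add: dist_norm)
          ultimately have "cmean (\<lambda>\<zeta>. u (y + \<zeta> *s w)) s < c" using tube by blast
          then show "v (inv_into U \<phi> y) \<le> c + s\<^sup>2 / 4 * q"
            using sub[OF u(1,3,2) y(1) s] unfolding u_def by simp
        qed
        define B where "B = ball z (min \<rho> \<sigma>)"
        have "open (inv_into U \<phi> ` B)"
          by (rule chart_inv_image_open[OF top]) (use \<rho> in \<open>auto simp: B_def W_def[symmetric] subset_iff\<close>)
        moreover have "x \<in> inv_into U \<phi> ` B"
          using \<rho>(1) \<sigma> t(5)[OF U(2)] by (intro image_eqI[of _ _ z]) (auto simp: B_def z_def)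
        moreover have "\<forall>y\<in>inv_into U \<phi> ` B. S y \<le> c + s\<^sup>2 / 4 * q" using near by (auto simp: B_def dist_commute)
        ultimately have "\<forall>\<^sub>F y in nhds x. S y \<le> c + s\<^sup>2 / 4 * q" unfolding eventually_nhds by blast
        then have "h z \<le> c + s\<^sup>2 / 4 * q" unfolding hz G_def by (rule usc_reg_le[OF S0])
        then show False using c(2) by simp
      qed
      have "\<rho> / (norm w + 1) > 0" using \<rho>(1) by (simp add: add_nonneg_pos)
      from eventually_at_right_0_less[OF this]
      show "\<forall>\<^sub>F r in at_right 0. h z \<le> cmean (\<lambda>\<zeta>. h (z + \<zeta> *s w)) r + r\<^sup>2 / 4 * (herm_quad (U, \<phi>) z w + e)"
      proof (rule eventually_mono)
        fix r assume r: "0 < r \<and> r < \<rho> / (norm w + 1)"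
        then have "r * (norm w + 1) < \<rho>" by (simp add: pos_less_divide_eq add_nonneg_pos)
        then have "r * norm w < \<rho>" using r by (simp add: algebra_simps)
        then show "h z \<le> cmean (\<lambda>\<zeta>. h (z + \<zeta> *s w)) r + r\<^sup>2 / 4 * (herm_quad (U, \<phi>) z w + e)"
          using main[of r] r by (simp add: q_def)
      qed
    qed
    then show ?thesis by (intro asubX_I[OF U]) (simp add: h_def[abs_def] z_def)
  qed
  then show ?thesis using Gu G0 unfolding bdd_omega_psh_def G_def S_def by blast
qed

text \<open>By \<open>eq\<close> the supremum of the candidates tends to 0 at E, so its
  regularization vanishes on E and is itself the largest candidate.\<close>

lemma max_candidate_exists:
  assumes M: "\<And>v x. candidate E v \<Longrightarrow> v x \<le> M"
    and eq: "\<And>a e. a \<in> E \<Longrightarrow> 0 < e \<Longrightarrow> \<exists>N. open N \<and> a \<in> N \<and> (\<forall>v x. candidate E v \<longrightarrow> x \<in> N \<longrightarrow> v x \<le> e)"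
  shows "\<exists>g. candidate E g \<and> (\<forall>v x. candidate E v \<longrightarrow> v x \<le> g x)"
proof -
  define F where "F = {v. candidate E v}"
  have F: "F \<noteq> {}" "\<And>v. v \<in> F \<Longrightarrow> bdd_omega_psh v" "\<And>v x. v \<in> F \<Longrightarrow> 0 \<le> v x" "\<And>v x. v \<in> F \<Longrightarrow> v x \<le> M"
    using bdd_omega_psh_const[of 0] M by (auto simp: F_def candidate_def)
  define S where "S x = (SUP v\<in>F. v x)" for x
  have bdd: "bdd_above ((\<lambda>v. v x) ` F)" for x using F(4) by (auto intro!: bdd_aboveI[of _ M])
  have S1: "v x \<le> S x" if "v \<in> F" for v x unfolding S_def by (rule cSUP_upper[OF that bdd])
  have S2: "S x \<le> c" if "\<And>v. v \<in> F \<Longrightarrow> v x \<le> c" for x c unfolding S_def by (rule cSUP_least[OF F(1) that])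
  have S0: "0 \<le> S x" for x using F(1,3) S1 by (meson all_not_in_conv order_trans)
  have SG: "S x \<le> usc_reg S x" for x by (rule usc_reg_ge) (rule S2, rule F(4))
  have "usc_reg S a \<le> 0" if a: "a \<in> E" for a
  proof (rule field_le_epsilon)
    fix e :: real assume "0 < e"
    then obtain N where "open N" "a \<in> N" "\<forall>v x. candidate E v \<longrightarrow> x \<in> N \<longrightarrow> v x \<le> e" using eq[OF a] by blast
    then have "open N" "a \<in> N" "\<forall>x\<in>N. S x \<le> e" using S2 by (auto simp: F_def)
    then have "\<forall>\<^sub>F x in nhds a. S x \<le> e" unfolding eventually_nhds by blast
    then show "usc_reg S a \<le> 0 + e" using usc_reg_le[OF S0] by simp
  qed
  moreover have "bdd_omega_psh (usc_reg S)" using bdd_omega_psh_usc_reg_SUP[of F M, folded S_def] F by blast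
  moreover have "0 \<le> usc_reg S x" for x using S0 SG order_trans by blast
  ultimately have "candidate E (usc_reg S)" by (simp add: candidate_def)
  moreover have "v x \<le> usc_reg S x" if "candidate E v" for v x
    using S1[of v x] SG[of x] that by (simp add: F_def)
  ultimately show ?thesis by blast
qed

text \<open>This is Walsh's argument: a maximal candidate dominates its translates in a chart, after these have
  been multiplied by \<open>1 / (1 + \<tau>)\<close> to compensate the variation of the metric and made small near the
  boundary of a ball. The ball is centred at a maximum of \<open>g - (1 + \<tau>) g\<^sub>*\<close>, so that the translates
  exceed \<open>g\<^sub>*\<close> only by an arbitrarily small amount.\<close>

lemma max_candidate_lsc:
  assumes g: "candidate E g" and mx: "\<And>v x. candidate E v \<Longrightarrow> v x \<le> g x" and E: "closed E"
  shows "usc UNIV (\<lambda>x. - g x)"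
proof -
  have gn: "bdd_omega_psh g" "\<And>x. 0 \<le> g x" "\<And>x. x \<in> E \<Longrightarrow> g x \<le> 0" and gu: "usc UNIV g"
    using g by (auto simp: candidate_def bdd_omega_psh_def)
  obtain M where M: "\<And>x. g x \<le> M" using bdd_omega_psh_bounded_above[OF gn(1)] by blast
  \<comment> \<open>\<open>L\<close> is minus the lower regularization of g; the claim is g =
    -L.\<close>
  define L where "L = usc_reg (\<lambda>x. - g x)"
  have Lu: "usc UNIV L" unfolding L_def by (rule usc_usc_reg[of "- M" _ 0]) (simp_all add: M gn(2))
  have Lg: "- g x \<le> L x" for x unfolding L_def by (rule usc_reg_ge[of _ 0]) (simp add: gn(2))
  have L0: "L x \<le> 0" for x unfolding L_def by (rule usc_reg_le[of "- M"]) (simp_all add: M gn(2))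
  have "g y = - L y" for y
  proof (rule ccontr)
    assume "g y \<noteq> - L y"
    then have gap: "0 < g y + L y" using Lg[of y] by linarith
    \<comment> \<open>Small enough for the gap g y + L y to stay positive after the factor 1 +
      \<tau>; the denominator 1 - L y is at least 1.\<close>
    define \<tau> where "\<tau> = (g y + L y) / 2 / (1 - L y)"
    have \<tau>: "0 < \<tau>" using gap L0[of y] by (simp add: \<tau>_def)
    have "\<tau> * (1 - L y) = (g y + L y) / 2" 
    proof -
      have "1 - L y \<noteq> 0" using L0[of y] by linarith
      then show ?thesis by (metis \<tau>_def nonzero_divide_eq_eq)
    qed
    then have yD: "0 < g y + (1 + \<tau>) * L y" using gap \<tau> by (simp add: algebra_simps)
    define D where "D x = g x + (1 + \<tau>) * L x" for x
    have "usc UNIV D" unfolding D_def by (intro usc_add gu usc_cmult Lu) (use \<tau> in auto)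
    then obtain p where p: "\<And>x. D x \<le> D p" using usc_attains_max[OF _ cpt] by auto
    define m where "m = D p"
    have m: "0 < m" using yD p[of y] by (simp add: m_def D_def)
    have "p \<notin> E"
    proof
      assume "p \<in> E"
      then have "g p \<le> 0" by (rule gn)
      moreover have "(1 + \<tau>) * L p \<le> 0" using \<tau> L0[of p] by (intro mult_nonneg_nonpos) auto
      ultimately show False using m by (simp add: m_def D_def)
    qed
    obtain U \<phi> where U: "(U, \<phi>) \<in> \<A>" "p \<in> U" using chart_at by blast
    note top = chart_top[OF U(1)]
    note t = topological_chartD[OF top]
    define z0 where "z0 = \<phi> p"
    have z0: "z0 \<in> \<phi> ` U" using U(2) by (simp add: z0_def)
    obtain \<rho> c0 C0 where \<rho>: "\<rho> > 0" "c0 > 0"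
      and herm_quad: "\<forall>z. dist z z0 < \<rho> \<longrightarrow> z \<in> \<phi> ` U \<and>
        (\<forall>w. c0 * (norm w)\<^sup>2 \<le> herm_quad (U, \<phi>) z w \<and> herm_quad (U, \<phi>) z w \<le> C0 * (norm w)\<^sup>2) \<and>
        (\<forall>z' w. dist z' z0 < \<rho> \<longrightarrow> herm_quad (U, \<phi>) z' w \<le> (1 + \<tau> / 2) * herm_quad (U, \<phi>) z w)"
      using herm_quad_near[OF U(1) z0, of "1 + \<tau> / 2"] \<tau> by auto
    have "open (\<phi> ` (U \<inter> - E))" by (rule chart_image_open[OF top]) (use E in auto)
    moreover have "z0 \<in> \<phi> ` (U \<inter> - E)" using U(2) \<open>p \<notin> E\<close> by (simp add: z0_def)
    ultimately obtain r where r: "r > 0" "ball z0 r \<subseteq> \<phi> ` (U \<inter> - E)" using open_contains_ball by blast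
    define s where "s = min r \<rho> / 2"
    have s: "0 < s" "2 * s \<le> \<rho>" "2 * s \<le> r" using r \<rho> by (auto simp: s_def)
    define B where "B = ball z0 (3 * s / 2)"
    have B2: "ball z0 (2 * s) \<subseteq> \<phi> ` U" using r s(3) by force
    have B: "B \<subseteq> ball z0 (2 * s)" using s by (auto simp: B_def)
    have BE: "inv_into U \<phi> z \<notin> E" if "z \<in> B" for z
    proof -
      have "z \<in> \<phi> ` (U \<inter> - E)" using that B r(2) s(3) by (force simp: subset_iff)
      then show ?thesis using t(5) by auto
    qed
    define b where "b = c0 * ((\<tau> / 2) / (1 + \<tau>))"
    have b: "0 < b" using \<rho> \<tau> by (simp add: b_def)
    \<comment> \<open>The quadratic term of P costs 8\<kappa>/s^2 |w|^2. By \<open>ks\<close> this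
      is c0|w|^2 times the slack (\<tau>/2)/(1 + \<tau>) that the factor 1 + \<tau>/2 leaves below 1
      + \<tau>.\<close>
    define \<kappa> where "\<kappa> = s\<^sup>2 * b / 8"
    \<comment> \<open>\<epsilon>/(1 + \<tau>) = \<kappa>/4, half of the gain \<kappa>/2 that the
      translates keep near the centre.\<close>
    define \<epsilon> where "\<epsilon> = (1 + \<tau>) * (\<kappa> / 4)"
    have k: "0 < \<kappa>" "0 < \<epsilon>" using s b \<tau> by (auto simp: \<kappa>_def \<epsilon>_def)
    have ks: "8 * \<kappa> / s\<^sup>2 = c0 * ((\<tau> / 2) / (1 + \<tau>))" unfolding b_def[symmetric] using s by (simp add: \<kappa>_def)
    define G where "G z = g (inv_into U \<phi> z)" for z
    define H where "H z = L (inv_into U \<phi> z)" for z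
    have GH: "usc (ball z0 (2 * s)) G" "usc (ball z0 (2 * s)) H"
      unfolding G_def H_def by (rule usc_subset[OF chart_usc[OF top] B2], fact gu Lu)+
    \<comment> \<open>A Lebesgue number turns the bound G + (1 + \<tau>)H \<le> m at one point into
      the bound m + \<epsilon> when the two arguments differ by a small h.\<close>
    obtain \<delta>1 where \<delta>1: "\<delta>1 > 0" "\<forall>z\<in>cball z0 (3 * s / 2). \<exists>S\<in>{S. open S \<and> (\<forall>y\<in>S. \<forall>z\<in>S. G y + (1 + \<tau>) * H z < m + \<epsilon>)}. ball z \<delta>1 \<subseteq> S"
    proof (rule Heine_Borel_lemma[of "cball z0 (3 * s / 2)" "{S. open S \<and> (\<forall>y\<in>S. \<forall>z\<in>S. G y + (1 + \<tau>) * H z < m + \<epsilon>)}"])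
      show "cball z0 (3 * s / 2) \<subseteq> \<Union>{S. open S \<and> (\<forall>y\<in>S. \<forall>z\<in>S. G y + (1 + \<tau>) * H z < m + \<epsilon>)}"
      proof
        fix z assume "z \<in> cball z0 (3 * s / 2)"
        then have z: "z \<in> ball z0 (2 * s)" using s by auto
        have "\<forall>\<^sub>F y in nhds z. G y < G z + \<epsilon> / 2" "\<forall>\<^sub>F y in nhds z. H y < H z + \<epsilon> / (2 * (1 + \<tau>))"
          using usc_openD[OF GH(1) _ z, of "G z + \<epsilon> / 2"] usc_openD[OF GH(2) _ z, of "H z + \<epsilon> / (2 * (1 + \<tau>))"] k \<tau>
          by (auto elim: eventually_mono)
        then have "\<forall>\<^sub>F y in nhds z. G y < G z + \<epsilon> / 2 \<and> H y < H z + \<epsilon> / (2 * (1 + \<tau>))" by eventually_elim simp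
        then obtain S where S: "open S" "z \<in> S" "\<And>y. y \<in> S \<Longrightarrow> G y < G z + \<epsilon> / 2 \<and> H y < H z + \<epsilon> / (2 * (1 + \<tau>))"
          unfolding eventually_nhds by blast
        have "G y + (1 + \<tau>) * H x < m + \<epsilon>" if "y \<in> S" "x \<in> S" for x y
        proof -
          have "(1 + \<tau>) * H x < (1 + \<tau>) * (H z + \<epsilon> / (2 * (1 + \<tau>)))" using S(3)[OF that(2)] \<tau> by (intro mult_strict_left_mono) auto
          also have "\<dots> = (1 + \<tau>) * H z + \<epsilon> / 2" using \<tau> by (simp add: field_simps)
          finally have "(1 + \<tau>) * H x < (1 + \<tau>) * H z + \<epsilon> / 2" .
          moreover have "G z + (1 + \<tau>) * H z \<le> m" using p[of "inv_into U \<phi> z"] by (simp add: G_def H_def m_def D_def)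
          ultimately show ?thesis using S(3)[OF that(1)] by linarith
        qed
        then show "z \<in> \<Union>{S. open S \<and> (\<forall>y\<in>S. \<forall>z\<in>S. G y + (1 + \<tau>) * H z < m + \<epsilon>)}" using S(1,2) by blast
      qed
    qed auto
    define \<delta> where "\<delta> = min (\<delta>1 / 2) (s / 2)"
    have \<delta>: "0 < \<delta>" "\<delta> < \<delta>1" "\<delta> \<le> s / 2" using \<delta>1(1) s by (auto simp: \<delta>_def)
    have GHb: "G (z + h) + (1 + \<tau>) * H z < m + \<epsilon>" if zh: "z \<in> B" "norm h \<le> \<delta>" for z h
    proof -
      have "z \<in> cball z0 (3 * s / 2)" using zh(1) by (auto simp: B_def)
      then obtain S where S: "\<forall>y\<in>S. \<forall>z\<in>S. G y + (1 + \<tau>) * H z < m + \<epsilon>" "ball z \<delta>1 \<subseteq> S" using \<delta>1(2) by blast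
      have "z \<in> S" "z + h \<in> S" using S(2) zh(2) \<delta> \<delta>1(1) by (auto simp: subset_iff dist_norm)
      then show ?thesis using S(1) by blast
    qed
    have key: "(G (z0) - m - \<epsilon>) / (1 + \<tau>) + \<kappa> / 2 \<le> G (z0 - h)" if h: "norm h \<le> \<delta>" for h
    proof -
      \<comment> \<open>Without \<kappa> and the quadratic term, \<open>GHb\<close> places the
        scaled translate below -H \<le> G. The term \<kappa> lifts it near the centre, and the
        quadratic term pushes it below G again for |z - z0| \<ge> s.\<close>
      define P where "P z = (1 / (1 + \<tau>)) * G (z + h) + (- (m + \<epsilon>) / (1 + \<tau>) + \<kappa>) + (- (2 * \<kappa> / s\<^sup>2)) * (norm (z - z0))\<^sup>2" for z
      have zh: "z + h \<in> ball z0 (2 * s)" if "z \<in> B" for z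
      proof -
        have "dist z0 (z + h) \<le> dist z0 z + norm h" using dist_triangle[of z0 "z + h" z] by (simp add: dist_norm)
        then show ?thesis using that h \<delta>(3) by (simp add: B_def)
      qed
      have uG: "usc B (\<lambda>z. G (z + h))" by (rule usc_compose[OF GH(1)]) (use zh in \<open>auto intro!: continuous_intros\<close>)
      have oB: "open B" by (simp add: B_def)
      have G0: "0 \<le> G z" for z using gn(2) by (simp add: G_def)
      have uP: "usc B P"
      proof -
        have "usc B (\<lambda>z. (1 / (1 + \<tau>)) * G (z + h) + ((- (m + \<epsilon>) / (1 + \<tau>) + \<kappa>) + (- (2 * \<kappa> / s\<^sup>2)) * (norm (z - z0))\<^sup>2))"
          by (intro usc_add_continuous usc_cmult uG continuous_intros oB) (use \<tau> in auto)
        then show ?thesis by (rule usc_cong) (simp add: P_def)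
      qed
      have asP: "asub P z w (herm_quad (U, \<phi>) z w)" if z: "z \<in> B" for z w
      proof -
        have hz: "dist y z0 < \<rho>" if "y \<in> ball z0 (2 * s)" for y using that s(2) by (simp add: dist_commute)
        have a1: "asub (\<lambda>z. G (z + h)) y w ((1 + \<tau> / 2) * herm_quad (U, \<phi>) z w)" if y: "y \<in> B" for y
        proof -
          have "y + h \<in> \<phi> ` U" using zh[OF y] B2 by blast
          then have "asub G (y + h) w (herm_quad (U, \<phi>) (y + h) w)" unfolding G_def by (rule bdd_omega_psh_in_chart(2)[OF gn(1) U(1)])
          then have "asub (\<lambda>z. G (z + h)) ((y + h) - h) w (herm_quad (U, \<phi>) (y + h) w)"
            by (rule asub_transport[where A = UNIV and f' = "\<lambda>w. w"])
              (auto simp: holomorphic_map_on_def intro!: derivative_eq_intros exI[of _ "\<lambda>w. w"])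
          moreover have "herm_quad (U, \<phi>) (y + h) w \<le> (1 + \<tau> / 2) * herm_quad (U, \<phi>) z w"
            using herm_quad hz[of "y + h"] hz[of z] zh[OF y] z B by blast
          ultimately show ?thesis using asub_mono by simp
        qed
        have zU: "z \<in> \<phi> ` U" using z B B2 by blast
        have q0: "0 \<le> herm_quad (U, \<phi>) z w" by (rule herm_quad_nonneg[OF U(1) zU])
        have "asub P z w ((1 / (1 + \<tau>)) * ((1 + \<tau> / 2) * herm_quad (U, \<phi>) z w) - 4 * (- (2 * \<kappa> / s\<^sup>2)) * (norm w)\<^sup>2)"
          unfolding P_def by (rule asub_affine_quadratic[OF oB uG G0 z a1]) (use \<tau> q0 in auto)
        moreover have "(1 / (1 + \<tau>)) * ((1 + \<tau> / 2) * herm_quad (U, \<phi>) z w) - 4 * (- (2 * \<kappa> / s\<^sup>2)) * (norm w)\<^sup>2 \<le> herm_quad (U, \<phi>) z w"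
        proof -
          have "c0 * (norm w)\<^sup>2 \<le> herm_quad (U, \<phi>) z w" using herm_quad hz[of z] z B by blast
          then have "((\<tau> / 2) / (1 + \<tau>)) * (c0 * (norm w)\<^sup>2) \<le> ((\<tau> / 2) / (1 + \<tau>)) * herm_quad (U, \<phi>) z w"
            using \<tau> by (intro mult_left_mono) auto
          moreover have "4 * (2 * \<kappa> / s\<^sup>2) * (norm w)\<^sup>2 = ((\<tau> / 2) / (1 + \<tau>)) * (c0 * (norm w)\<^sup>2)"
            using arg_cong[OF ks, of "\<lambda>x. x * (norm w)\<^sup>2"] by (simp add: ac_simps)
          moreover have "(1 / (1 + \<tau>)) * ((1 + \<tau> / 2) * herm_quad (U, \<phi>) z w) + ((\<tau> / 2) / (1 + \<tau>)) * herm_quad (U, \<phi>) z w = herm_quad (U, \<phi>) z w"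
          proof -
            have "1 / (1 + \<tau>) * (1 + \<tau> / 2) + (\<tau> / 2) / (1 + \<tau>) = 1" using \<tau> by (simp add: divide_simps) (simp add: algebra_simps)
            then show ?thesis unfolding mult.assoc[symmetric] distrib_right[symmetric] by simp
          qed
          ultimately show ?thesis by linarith
        qed
        ultimately show ?thesis by (rule asub_mono)
      qed
      have PG: "P z < G z" if z: "z \<in> B" "s \<le> norm (z - z0)" for z
      proof -
        have "(1 / (1 + \<tau>)) * (G (z + h) - (m + \<epsilon>)) \<le> (1 / (1 + \<tau>)) * ((1 + \<tau>) * (- H z))"
          using GHb[OF z(1) h] \<tau> by (intro mult_left_mono) auto
        also have "\<dots> = - H z" using \<tau> by simp
        also have "\<dots> \<le> G z" using Lg[of "inv_into U \<phi> z"] by (simp add: G_def H_def)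
        finally have 1: "(1 / (1 + \<tau>)) * (G (z + h) - (m + \<epsilon>)) \<le> G z" .
        have "(2 * \<kappa> / s\<^sup>2) * s\<^sup>2 \<le> (2 * \<kappa> / s\<^sup>2) * (norm (z - z0))\<^sup>2"
          using z(2) s k by (intro mult_left_mono power_mono) auto
        then have 2: "2 * \<kappa> \<le> (2 * \<kappa> / s\<^sup>2) * (norm (z - z0))\<^sup>2" using s by simp
        have "P z = (1 / (1 + \<tau>)) * (G (z + h) - (m + \<epsilon>)) + \<kappa> - (2 * \<kappa> / s\<^sup>2) * (norm (z - z0))\<^sup>2"
          by (simp add: P_def right_diff_distrib divide_inverse algebra_simps)
        then show ?thesis using 1 2 k by linarith
      qed
      have Pl: "- (m + \<epsilon>) / (1 + \<tau>) - 8 * \<kappa> \<le> P z" if z: "z \<in> B" for z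
      proof -
        have "(norm (z - z0))\<^sup>2 \<le> (2 * s)\<^sup>2" using z s by (intro power_mono) (auto simp: B_def dist_norm norm_minus_commute)
        then have "(2 * \<kappa> / s\<^sup>2) * (norm (z - z0))\<^sup>2 \<le> (2 * \<kappa> / s\<^sup>2) * (2 * s)\<^sup>2" using s k by (intro mult_left_mono) auto
        also have "\<dots> = 8 * \<kappa>" using s by (simp add: power_mult_distrib)
        finally have "(2 * \<kappa> / s\<^sup>2) * (norm (z - z0))\<^sup>2 \<le> 8 * \<kappa>" .
        moreover have "0 \<le> (1 / (1 + \<tau>)) * G (z + h)" using G0 \<tau> by simp
        ultimately show ?thesis using k unfolding P_def by linarith
      qed
      define N where "N = inv_into U \<phi> ` B"
      define N1 where "N1 = inv_into U \<phi> ` cball z0 s"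
      have BU: "B \<subseteq> \<phi> ` U" using B B2 by blast
      have cB: "cball z0 s \<subseteq> B" using s by (auto simp: B_def)
      have oN: "open N" unfolding N_def by (rule chart_inv_image_open[OF top oB BU])
      have "compact N1" unfolding N1_def by (rule compact_continuous_image[OF continuous_on_subset[OF t(4)]]) (use cB BU in auto)
      then have oN1: "open (- N1)" using compact_imp_closed by auto
      have N1N: "N1 \<subseteq> N" unfolding N_def N1_def using cB by (rule image_mono)
      have NU: "x \<in> U" "\<phi> x \<in> B" "inv_into U \<phi> (\<phi> x) = x" if "x \<in> N" for x
        using that BU t(5,6,7) by (auto simp: N_def subset_iff)
      have PN: "P (\<phi> x) < g x" if "x \<in> N" "x \<notin> N1" for x
      proof -
        have "\<phi> x \<notin> cball z0 s" using that(2) NU(3)[OF that(1)] unfolding N1_def by force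
        then have "s \<le> norm (\<phi> x - z0)" by (simp add: dist_norm norm_minus_commute)
        then show ?thesis using PG[OF NU(2)[OF that(1)]] NU(3)[OF that(1)] by (simp add: G_def)
      qed
      \<comment> \<open>Maximality of g, applied to this glued candidate, gives P \<le> G at z0 -
        h.\<close>
      define c where "c x = (if x \<in> N then max (g x) (P (\<phi> x)) else g x)" for x
      have gc: "g x \<le> c x" for x by (simp add: c_def)
      have c1: "c x = g x" if "x \<notin> N1" for x using PN[of x] that by (auto simp: c_def)
      have cN: "usc N c"
      proof -
        have "usc N (\<lambda>x. P (\<phi> x))" by (rule usc_compose[OF uP]) (use NU in \<open>auto intro!: continuous_on_subset[OF t(3)]\<close>)
        then have "usc N (\<lambda>x. max (g x) (P (\<phi> x)))" using usc_subset[OF gu] by (intro usc_max) auto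
        then show ?thesis by (rule usc_cong) (simp add: c_def)
      qed
      have cN1: "usc (- N1) c" by (rule usc_cong[OF usc_subset[OF gu subset_UNIV]]) (simp add: c1)
      have cu: "usc UNIV c"
      proof (rule usc_openI[OF open_UNIV])
        fix x a assume "c x < a"
        moreover have "x \<in> N \<or> x \<in> - N1" using N1N by blast
        ultimately consider "x \<in> N" "c x < a" | "x \<in> - N1" "c x < a" by blast
        then show "\<forall>\<^sub>F y in nhds x. c y < a"
        proof cases
          case 1
          show ?thesis by (rule eventually_mono[OF usc_openD[OF cN oN 1]]) simp
        next
          case 2
          show ?thesis by (rule eventually_mono[OF usc_openD[OF cN1 oN1 2]]) simp
        qed
      qed
      have ca: "asubX c x" for x
      proof (cases "c x \<le> g x")
        case True
        show ?thesis
          by (rule asubX_touch[OF _ open_UNIV _ gu cu gn(2)]) (use gn(1) gc True in \<open>auto simp: bdd_omega_psh_def\<close>)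
      next
        case False
        then have x: "x \<in> N" "c x = P (\<phi> x)" by (auto simp: c_def split: if_splits)
        note xN = NU[OF x(1)]
        have cB': "usc B (\<lambda>z. c (inv_into U \<phi> z))" by (rule usc_subset[OF chart_usc[OF top cu] BU])
        have "P z \<le> c (inv_into U \<phi> z)" if "z \<in> B" for z
        proof -
          have "inv_into U \<phi> z \<in> N" "\<phi> (inv_into U \<phi> z) = z" using that BU t(6) by (auto simp: N_def subset_iff)
          then show ?thesis by (simp add: c_def)
        qed
        then have "asub (\<lambda>z. c (inv_into U \<phi> z)) (\<phi> x) w (herm_quad (U, \<phi>) (\<phi> x) w)" for w
          by (intro asub_touch[OF asP[OF xN(2)] oB xN(2) uP cB' Pl]) (simp_all add: xN(3) x(2))
        then show ?thesis by (rule asubX_I[OF U(1) xN(1)])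
      qed
      have cE: "c x \<le> 0" if "x \<in> E" for x
      proof -
        have "x \<notin> N" using that BE by (auto simp: N_def)
        then show ?thesis using gn(3)[OF that] by (simp add: c_def)
      qed
      have c0': "0 \<le> c x" for x using gn(2) gc order_trans by blast
      then have "candidate E c" using cu ca cE unfolding candidate_def bdd_omega_psh_def by blast
      then have "c (inv_into U \<phi> (z0 - h)) \<le> g (inv_into U \<phi> (z0 - h))" by (rule mx)
      moreover have hB: "z0 - h \<in> B" using h \<delta>(3) s(1) by (simp add: B_def dist_norm)
      then have "inv_into U \<phi> (z0 - h) \<in> N" "\<phi> (inv_into U \<phi> (z0 - h)) = z0 - h" using BU t(6) by (auto simp: N_def subset_iff)
      ultimately have "P (z0 - h) \<le> G (z0 - h)" by (simp add: c_def G_def)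
      moreover have "(2 * \<kappa> / s\<^sup>2) * (norm h)\<^sup>2 \<le> \<kappa> / 2"
      proof -
        have "(2 * \<kappa> / s\<^sup>2) * (norm h)\<^sup>2 \<le> (2 * \<kappa> / s\<^sup>2) * (s / 2)\<^sup>2" using h \<delta>(3) k by (intro mult_left_mono power_mono) auto
        also have "\<dots> = \<kappa> / 2" using s by (simp add: power2_eq_square)
        finally show ?thesis .
      qed
      moreover have "P (z0 - h) = (G z0 - m - \<epsilon>) / (1 + \<tau>) + \<kappa> - (2 * \<kappa> / s\<^sup>2) * (norm h)\<^sup>2"
        by (simp add: P_def diff_divide_distrib add_divide_distrib)
      ultimately show ?thesis by linarith
    qed
    have "open (inv_into U \<phi> ` ball z0 \<delta>)"
      by (rule chart_inv_image_open[OF top]) (use B2 \<delta> s in \<open>auto simp: subset_iff\<close>)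
    moreover have "p \<in> inv_into U \<phi> ` ball z0 \<delta>"
      using \<delta>(1) t(5)[OF U(2)] by (intro image_eqI[of _ _ z0]) (auto simp: z0_def)
    moreover have "- g x \<le> - ((G z0 - m - \<epsilon>) / (1 + \<tau>) + \<kappa> / 2)" if x: "x \<in> inv_into U \<phi> ` ball z0 \<delta>" for x
    proof -
      obtain z where z: "z \<in> ball z0 \<delta>" "x = inv_into U \<phi> z" using x by blast
      then show ?thesis using key[of "z0 - z"] by (simp add: G_def dist_norm)
    qed
    \<comment> \<open>The bound holds on a whole neighbourhood of p and so passes to the lower
      regularization at p, which would have to exceed itself by \<kappa>/4.\<close>
    ultimately have "\<forall>\<^sub>F x in nhds p. - g x \<le> - ((G z0 - m - \<epsilon>) / (1 + \<tau>) + \<kappa> / 2)" unfolding eventually_nhds by blast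
    then have "L p \<le> - ((G z0 - m - \<epsilon>) / (1 + \<tau>) + \<kappa> / 2)" unfolding L_def
      by (rule usc_reg_le[of "- M" "\<lambda>x. - g x", rotated]) (simp add: M)
    moreover have "G z0 = g p" by (simp add: G_def z0_def t(5)[OF U(2)])
    then have "G z0 - m = - ((1 + \<tau>) * L p)" by (simp add: m_def D_def)
    then have "(G z0 - m - \<epsilon>) / (1 + \<tau>) = - L p - \<epsilon> / (1 + \<tau>)" using \<tau> by (simp add: diff_divide_distrib)
    moreover have "\<epsilon> / (1 + \<tau>) = \<kappa> / 4" unfolding \<epsilon>_def
      by (rule nonzero_mult_div_cancel_left) (use \<tau> in simp)
    ultimately show False using k by linarith
  qed
  then have "(\<lambda>x. - g x) = L" by auto
  then show ?thesis using Lu by simp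
qed

text \<open>The largest candidate attains the supremum; it is upper semicontinuous as a candidate
  and lower semicontinuous by \<open>max_candidate_lsc\<close>.\<close>

lemma V_extremal_continuous:
  assumes E: "closed E" and M: "\<And>v x. candidate E v \<Longrightarrow> v x \<le> M"
    and eq: "\<And>a e. a \<in> E \<Longrightarrow> 0 < e \<Longrightarrow> \<exists>N. open N \<and> a \<in> N \<and> (\<forall>v x. candidate E v \<longrightarrow> x \<in> N \<longrightarrow> v x \<le> e)"
  shows "continuous_on UNIV (V_extremal \<A> \<omega> E)"
proof -
  have "\<exists>g. candidate E g \<and> (\<forall>v x. candidate E v \<longrightarrow> v x \<le> g x)"
    by (rule max_candidate_exists[where E = E and M = M], erule M, erule (1) eq)
  then obtain g where g: "candidate E g" "\<And>v x. candidate E v \<Longrightarrow> v x \<le> g x" by blast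
  have u: "usc UNIV g" using g(1) by (simp add: candidate_def bdd_omega_psh_def)
  have l: "usc UNIV (\<lambda>x. - g x)" by (rule max_candidate_lsc[OF g(1) _ E]) (rule g(2))
  have "isCont g x" for x
    unfolding isCont_def
  proof (rule order_tendstoI)
    fix c assume "c < g x"
    then have "\<forall>\<^sub>F y in nhds x. - g y < - c" using usc_openD[OF l open_UNIV, of x "- c"] by (auto elim: eventually_mono)
    then show "\<forall>\<^sub>F y in at x. c < g y" by (simp add: eventually_nhds_conv_at)
  next
    fix c assume "g x < c"
    then have "\<forall>\<^sub>F y in nhds x. g y < c" using usc_openD[OF u open_UNIV, of x c] by (auto elim: eventually_mono)
    then show "\<forall>\<^sub>F y in at x. g y < c" by (simp add: eventually_nhds_conv_at)
  qed
  then have "continuous_on UNIV (\<lambda>x. ereal (g x))"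
    by (intro continuous_on_ereal) (simp add: continuous_at_imp_continuous_on)
  moreover have "V_extremal \<A> \<omega> E x = ereal (g x)" for x
    by (rule antisym[OF _ candidate_le_V_extremal[OF g(1)]])
      (auto simp: V_extremal_candidate g(2) intro!: SUP_least)
  ultimately show ?thesis by (metis (no_types, lifting) continuous_on_cong)
qed

section \<open>Reduction to one connected component\<close>

text \<open>X is open and closed, so v on X and 0 elsewhere fit together without any comparison at a
  boundary.\<close>

lemma candidate_restrict:
  assumes v: "candidate (K \<inter> X) v" and X: "open X" "open (- X)"
  shows "candidate (K \<union> - X) (\<lambda>x. if x \<in> X then v x else 0)"
proof -
  define u where "u x = (if x \<in> X then v x else 0)" for x
  have v': "bdd_omega_psh v" "\<And>x. 0 \<le> v x" "\<And>x. x \<in> K \<inter> X \<Longrightarrow> v x \<le> 0" "usc UNIV v" using v by (auto simp: candidate_def bdd_omega_psh_def)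
  have u1: "usc X u" by (rule usc_cong[OF usc_subset[OF v'(4) subset_UNIV]]) (simp add: u_def)
  have c0: "usc (- X) (\<lambda>_. 0)" by (intro continuous_imp_usc continuous_intros)
  then have u2: "usc (- X) u" by (rule usc_cong) (simp add: u_def)
  have "usc UNIV u"
  proof (rule usc_openI[OF open_UNIV])
    fix x c assume "u x < c"
    then show "\<forall>\<^sub>F y in nhds x. u y < c"
      using usc_openD[OF u1 X(1), of x c] usc_openD[OF u2 X(2), of x c] by (cases "x \<in> X") (auto elim: eventually_mono)
  qed
  moreover have "asubX u x" for x
  proof (cases "x \<in> X")
    case True
    show ?thesis
      by (rule asubX_touch[OF _ X(1) True usc_subset[OF v'(4)] u1 v'(2)]) (use True v'(1) in \<open>auto simp: u_def bdd_omega_psh_def\<close>)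
  next
    case False
    show ?thesis
      by (rule asubX_touch[OF asubX_const[of 0] X(2) _ c0 u2, of _ 0]) (use False in \<open>auto simp: u_def\<close>)
  qed
  moreover have "0 \<le> u x" for x using v'(2) by (simp add: u_def)
  moreover have "u x \<le> 0" if "x \<in> K \<union> - X" for x using that v'(3) by (auto simp: u_def)
  ultimately have "candidate (K \<union> - X) u" unfolding candidate_def bdd_omega_psh_def by blast
  then show ?thesis by (simp add: u_def[abs_def])
qed

text \<open>Candidates for K may be arbitrarily large on components that miss K, so the uniform
  bound in \<open>V_extremal_continuous\<close> can fail for K itself. Adding the complement of X to
  the set forces the value 0 there and leaves the extremal function unchanged on X.\<close>

lemma isCont_V_extremal:
  assumes K: "closed K" and cont: "\<And>a. a \<in> K \<Longrightarrow> isCont (V_extremal \<A> \<omega> K) a"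
  shows "isCont (V_extremal \<A> \<omega> K) x0"
proof -
  define X where "X = connected_component_set UNIV x0"
  have X: "open X" "open (- X)" "x0 \<in> X"
    using component_open closed_connected_component[OF closed_UNIV, of x0] by (auto simp: X_def open_closed)
  show ?thesis
  proof (cases "K \<inter> X = {}")
    case True
    have "V_extremal \<A> \<omega> K x = \<infinity>" if x: "x \<in> X" for x
    proof (rule ereal_top)
      fix B :: real
      have "candidate (K \<inter> X) (\<lambda>_. max B 0)" using bdd_omega_psh_const True by (simp add: candidate_def)
      from candidate_le_V_extremal[OF candidate_restrict[OF this X(1,2)], of x] x
      have "ereal (max B 0) \<le> V_extremal \<A> \<omega> (K \<union> - X) x" by simp
      also have "\<dots> \<le> V_extremal \<A> \<omega> K x"
        unfolding V_extremal_candidate by (rule SUP_subset_mono) (auto simp: candidate_def)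
      finally show "ereal B \<le> V_extremal \<A> \<omega> K x" by (rule order_trans[rotated]) simp
    qed
    then have "continuous_on X (V_extremal \<A> \<omega> K)" by (simp cong: continuous_on_cong_simp)
    then show ?thesis using X continuous_on_eq_continuous_at by blast
  next
    case False
    then obtain a where a: "a \<in> K" "a \<in> X" by blast
    have Xa: "X = connected_component_set UNIV a" using connected_component_eq[of a UNIV x0] a(2) by (simp add: X_def)
    have near: "\<exists>N. open N \<and> b \<in> N \<and> (\<forall>v x. candidate K v \<longrightarrow> x \<in> N \<longrightarrow> v x \<le> e)" if b: "b \<in> K" "0 < e" for b and e :: real
    proof -
      obtain N where N: "open N" "b \<in> N" "\<forall>x\<in>N. V_extremal \<A> \<omega> K x \<le> ereal e"
        using isCont_V_extremal_iff[OF b(1)] cont[OF b(1)] b(2) by blast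
      have "v x \<le> e" if "candidate K v" "x \<in> N" for v x
      proof -
        have "ereal (v x) \<le> ereal e" by (rule order_trans[OF candidate_le_V_extremal[OF that(1)]]) (use N(3) that(2) in blast)
        then show ?thesis by simp
      qed
      then show ?thesis using N(1,2) by blast
    qed
    obtain N where N: "open N" "a \<in> N" "\<forall>v x. candidate K v \<longrightarrow> x \<in> N \<longrightarrow> v x \<le> 1" using near[OF a(1), of 1] by auto
    obtain C where C: "\<forall>v b. bdd_omega_psh v \<longrightarrow> (\<forall>x. 0 \<le> v x) \<longrightarrow> (\<forall>x\<in>N \<inter> X. v x \<le> b) \<longrightarrow> (\<forall>x\<in>X. v x \<le> b + C)" "0 \<le> C"
      using harnack_component[OF Xa, of "N \<inter> X"] N(1,2) X(1) a(2) by blast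
    define E where "E = K \<union> - X"
    have KE: "candidate K v" if "candidate E v" for v using that by (simp add: candidate_def E_def)
    have "v x \<le> 1 + C" if v: "candidate E v" for v x
    proof (cases "x \<in> X")
      case True
      have "\<forall>x\<in>N \<inter> X. v x \<le> 1" using N(3) KE[OF v] by blast
      then show ?thesis using C(1) v True unfolding candidate_def by blast
    next
      case False
      then have "v x \<le> 0" using v by (simp add: candidate_def E_def)
      then show ?thesis using C(2) by simp
    qed
    moreover have "\<exists>N. open N \<and> b \<in> N \<and> (\<forall>v x. candidate E v \<longrightarrow> x \<in> N \<longrightarrow> v x \<le> e)" if b: "b \<in> E" "0 < e" for b and e :: real
    proof (cases "b \<in> K")
      case True
      then show ?thesis using near[OF True b(2)] KE by blast
    next
      case False
      then have "b \<in> - X" using b(1) by (simp add: E_def)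
      moreover have "v x \<le> e" if "candidate E v" "x \<in> - X" for v x
        using that b(2) by (auto simp: candidate_def E_def intro: order_trans)
      ultimately show ?thesis using X(2) by blast
    qed
    moreover have "closed E" using K X(1) by (simp add: E_def closed_Un closed_Compl)
    ultimately have "continuous_on X (V_extremal \<A> \<omega> E)" by (intro continuous_on_subset[OF V_extremal_continuous subset_UNIV])
    moreover have "V_extremal \<A> \<omega> E x = V_extremal \<A> \<omega> K x" if x: "x \<in> X" for x
    proof (rule antisym)
      show "V_extremal \<A> \<omega> E x \<le> V_extremal \<A> \<omega> K x"
        unfolding V_extremal_candidate by (rule SUP_subset_mono) (auto simp: KE)
      show "V_extremal \<A> \<omega> K x \<le> V_extremal \<A> \<omega> E x"
        unfolding V_extremal_candidate[of K]
      proof (rule SUP_least)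
        fix v assume "v \<in> {v. candidate K v}"
        then have "candidate (K \<inter> X) v" by (simp add: candidate_def)
        from candidate_le_V_extremal[OF candidate_restrict[OF this X(1,2)], of x] x
        show "ereal (v x) \<le> V_extremal \<A> \<omega> E x" by (simp add: E_def)
      qed
    qed
    ultimately have "continuous_on X (V_extremal \<A> \<omega> K)" by (metis (no_types, lifting) continuous_on_cong)
    then show ?thesis using X continuous_on_eq_continuous_at by blast
  qed
qed

end

theorem theorem1p5:
  fixes \<A> :: "('a::{t2_space,second_countable_topology}, 'n::finite) chart set"
    and \<omega> :: "('a, 'n) two_form"
    and K :: "'a set"
  assumes "complex_atlas \<A>"
    and "compact (UNIV :: 'a set)"
    and "hermitian_metric \<A> \<omega>"
    and "compact K"
  shows "(\<forall>a\<in>K.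
            (isCont (V_extremal \<A> \<omega> K) a \<longleftrightarrow> locally_L_regular_at \<A> K a) \<and>
            (locally_L_regular_at \<A> K a \<longleftrightarrow> weakly_locally_L_regular_at \<A> K a)) \<and>
         (continuous_on UNIV (V_extremal \<A> \<omega> K) \<longleftrightarrow> locally_L_regular \<A> K) \<and>
         (locally_L_regular \<A> K \<longleftrightarrow> weakly_locally_L_regular \<A> K)"
proof -
  interpret compact_hermitian \<A> \<omega> using assms(1-3) by unfold_locales
  have K: "closed K" using assms(4) by (rule compact_imp_closed)
  have 1: "locally_L_regular_at \<A> K a" if "a \<in> K" "isCont (V_extremal \<A> \<omega> K) a" for a
    using isCont_imp_regular[OF that] unfolding locally_L_regular_at_def by blast
  have 2: "weakly_locally_L_regular_at \<A> K a" if "locally_L_regular_at \<A> K a" for a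
    using exists_coordinate_ball[of a] that unfolding locally_L_regular_at_def weakly_locally_L_regular_at_def by blast
  have 3: "isCont (V_extremal \<A> \<omega> K) a" if "a \<in> K" "weakly_locally_L_regular_at \<A> K a" for a
    using weak_regular_imp_isCont[OF that(1)] that(2) unfolding weakly_locally_L_regular_at_def by blast
  have "continuous_on UNIV (V_extremal \<A> \<omega> K) \<longleftrightarrow> (\<forall>a\<in>K. isCont (V_extremal \<A> \<omega> K) a)"
    using isCont_V_extremal[OF K] continuous_on_eq_continuous_at[OF open_UNIV] by blast
  then show ?thesis
    using 1 2 3 K unfolding locally_L_regular_def weakly_locally_L_regular_def by (simp only: closure_closed) blast
qed

end
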